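(* For every integer $r\ge 4$, $$\lim_{n\to\infty}\frac{f^{(r)}(n;8r-14,8)}{n^2}=\frac{1}{r^2-r}.$$
   Context: An $r$-graph $H$ has a vertex set $V(H)$ and an edge set $E(H)\subseteq\binom{V(H)}{r}$. For integers $r,s,k$, $f^{(r)}(n;s,k)$ denotes the maximum number of edges in an $n$-vertex $r$-graph that contains no $k$ edges whose union has at most $s$ vertices. Note $8r-14=rk-2k+2$ for $k=8$. *)

theory Defs
  imports Complex_Main
begin

definition uniform_hypergraph :: "nat \<Rightarrow> 'a set \<Rightarrow> 'a set set \<Rightarrow> bool" where
  "uniform_hypergraph r V E \<longleftrightarrow> finite V \<and> E \<subseteq> {e. e \<subseteq> V \<and> card e = r}"

definition sparse_free :: "nat \<Rightarrow> nat \<Rightarrow> 'a set set \<Rightarrow> bool" where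
  "sparse_free s k E \<longleftrightarrow> \<not> (\<exists>F. F \<subseteq> E \<and> finite F \<and> card F = k \<and> card (\<Union>F) \<le> s)"

text \<open>
  Vertices are taken to be natural numbers; every finite hypergraph is isomorphic to one of these.
  For \<open>k \<ge> 1\<close> the set below is nonempty (take \<open>E = {}\<close>), and it is
  finite since a member is at most \<open>n choose r\<close>, so \<open>Max\<close> is a genuine maximum.
\<close>

definition turan_f :: "nat \<Rightarrow> nat \<Rightarrow> nat \<Rightarrow> nat \<Rightarrow> nat" where
  "turan_f r n s k =
     Max {card E | (V :: nat set) E. uniform_hypergraph r V E \<and> card V = n \<and> sparse_free s k E}"

end

theory Submission
  imports Defs
begin

text \<open>
  Call a set of 2 to 8 edges bad if it spans at most \<open>(r - 2) m + 2\<close> vertices, where \<open>m\<close>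
  is its number of edges.

  Lower bound: a hypergraph without bad sets is grown in boundedly many random rounds. In each round
  every edge is offered independently, with probability a small constant times \<open>n\<close> to the power
  \<open>2 - r\<close>, and an offered edge that completes a minimal bad set is discarded. The probability
  that a given conflict-free set of bounded size is contained in the random hypergraph factorises in
  the limit, as truncated inclusion-exclusion over the minimal bad sets shows: only those of excess
  exactly 2 attached along a single edge matter, and any two of these meet only inside the given set. The
  normalised density \<open>y\<close> increases in each round by at least a constant times a power of
  \<open>1 - y\<close>, hence tends to 1, which is an approximate decomposition of all pairs into edges.

  Upper bound: up to linearly many edges one may assume that no dense set of at most 7 edges is denser
  than necessary. The edges then fall into classes generated by sharing two vertices; a class of
  \<open>m\<close> edges has \<open>m \<le> 7\<close> and covers at least \<open>m (r choose 2) - (m - 1)\<close> pairs.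
  The deficit \<open>m - 1\<close> is made up by uncovered pairs: a class has at least \<open>4 (m - 1)\<close>
  pairs across two adjacent edges not covered by itself, few of them are covered by other edges, and
  a pair is claimed by at most 3 classes, for otherwise 8 edges of excess at most 2 would appear.
  Discharging uncovered pairs to classes shows that \<open>(r choose 2)\<close> times the number of edges is
  at most the number of all pairs.
\<close>

section \<open>Excess, and gluing minimal configurations\<close>

text \<open>A nibble would normally need concentration of the degrees into every forbidden
  configuration. Here the only quantity carried from round to round is, for each conflict-free set
  of bounded size, the probability of being contained. A round spends size: its estimate for sets of
  K edges uses sets of some larger size L before the round. So the number of rounds is fixed first,
  sizes and errors are chosen backwards from the last round, and only then is n taken large. In the
  upper bound the number 8 acts in two ways. Disjoint dense sets that share a vertex pair have a
  dense union, so pieces chained along pairs with 8 edges in total are impossible; the discharging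
  lemmas are decompositions such as 3 + 3 + 2 or 2 + 2 + 2 + 2. For unions of j at most 7 edges, the
  division 8 = f * j + s tells what can be cleaned away, namely what would yield f copies and s
  further edges glued at one vertex. This is why residues \<open>8 mod j\<close> and dense subsets
  of that size recur.\<close>

text \<open>
  A singleton has excess 2 and excess drops by one for each shared vertex, so 8 edges span at most
  \<open>8 * r - 14\<close> vertices iff their excess is at most 2. For \<open>r < 2\<close> the subtraction truncates.
\<close>

definition exc :: "nat \<Rightarrow> 'a set set \<Rightarrow> int" where
  "exc r W = int (card (\<Union>W)) - int (r - 2) * int (card W)"

definition unif :: "nat \<Rightarrow> 'a set set \<Rightarrow> bool" where
  "unif r W \<longleftrightarrow> finite W \<and> (\<forall>e\<in>W. finite e \<and> card e = r)"

text \<open>Forbidding sizes 2 to 7 along with 8 is stronger than the problem asks. In return every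
  proper part with at least two edges of a minimal bad set has excess at least 3, and two edges of a
  conflict-free set share at most one vertex.\<close>

definition bad :: "nat \<Rightarrow> 'a set set \<Rightarrow> bool" where
  "bad r Z \<longleftrightarrow> 2 \<le> card Z \<and> card Z \<le> 8 \<and> exc r Z \<le> 2"

definition minbad :: "nat \<Rightarrow> 'a set set \<Rightarrow> bool" where
  "minbad r Z \<longleftrightarrow> bad r Z \<and> (\<forall>Y. Y \<subset> Z \<longrightarrow> \<not> bad r Y)"

definition conflict_free :: "nat \<Rightarrow> 'a set set \<Rightarrow> bool" where
  "conflict_free r E \<longleftrightarrow> (\<forall>Z\<subseteq>E. \<not> bad r Z)"

lemma unif_subset: "unif r W \<Longrightarrow> Y \<subseteq> W \<Longrightarrow> unif r Y"
  by (auto simp: unif_def intro: finite_subset)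

lemma unif_Un: "unif r W \<Longrightarrow> unif r Y \<Longrightarrow> unif r (W \<union> Y)"
  by (auto simp: unif_def)

lemma unif_finite [simp]: "unif r W \<Longrightarrow> finite W"
  and unif_finite_Union [simp]: "unif r W \<Longrightarrow> finite (\<Union>W)"
  by (auto simp: unif_def)

lemma exc_empty [simp]: "exc r {} = 0"
  by (simp add: exc_def)

lemma exc_singleton: "r \<ge> 2 \<Longrightarrow> card b = r \<Longrightarrow> exc r {b} = 2"
  by (simp add: exc_def)

text \<open>Counting vertices is modular and counting edges additive, so gluing costs exactly the
  number of shared vertices. All later arithmetic with excess goes back to this identity.\<close>

lemma exc_Un:
  assumes "unif r W" "unif r Y" "W \<inter> Y = {}"
  shows "exc r (W \<union> Y) = exc r W + exc r Y - int (card (\<Union>W \<inter> \<Union>Y))"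
proof -
  have "card (W \<union> Y) = card W + card Y"
    using assms by (simp add: card_Un_disjoint)
  moreover have "card (\<Union>W \<union> \<Union>Y) + card (\<Union>W \<inter> \<Union>Y) = card (\<Union>W) + card (\<Union>Y)"
    using assms by (intro card_Un_Int[symmetric]) auto
  ultimately show ?thesis
    by (simp add: exc_def algebra_simps flip: of_nat_add of_nat_mult)
qed

lemma bad_finite: "bad r Z \<Longrightarrow> finite Z"
  unfolding bad_def by (metis card.infinite not_numeral_le_zero)

lemma bad_contains_minbad:
  assumes "bad r Z"
  obtains Y where "Y \<subseteq> Z" "minbad r Y"
proof -
  have "finite {Y. Y \<subseteq> Z \<and> bad r Y}"
    using bad_finite[OF assms] by simp
  moreover have "Z \<in> {Y. Y \<subseteq> Z \<and> bad r Y}" using assms by simp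
  ultimately obtain Y where Y: "Y \<in> {Y. Y \<subseteq> Z \<and> bad r Y}"
      "\<And>X. X \<in> {Y. Y \<subseteq> Z \<and> bad r Y} \<Longrightarrow> X \<subseteq> Y \<Longrightarrow> Y = X"
    using finite_has_minimal2 by (metis (no_types, lifting))
  have "minbad r Y"
    unfolding minbad_def using Y by blast
  thus ?thesis using that Y by blast
qed

lemma cf_iff_no_minbad: "conflict_free r E \<longleftrightarrow> (\<forall>Z\<subseteq>E. \<not> minbad r Z)"
  unfolding conflict_free_def
  by (meson bad_contains_minbad minbad_def subset_trans)

lemma cf_subset: "conflict_free r E \<Longrightarrow> F \<subseteq> E \<Longrightarrow> conflict_free r F"
  unfolding conflict_free_def by blast

lemma cf_exc_ge3: "conflict_free r E \<Longrightarrow> T \<subseteq> E \<Longrightarrow> 2 \<le> card T \<Longrightarrow> card T \<le> 8 \<Longrightarrow> exc r T \<ge> 3"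
  by (rule ccontr) (auto simp: conflict_free_def bad_def)

lemma minbad_card: "minbad r Z \<Longrightarrow> 2 \<le> card Z" "minbad r Z \<Longrightarrow> card Z \<le> 8"
  "minbad r Z \<Longrightarrow> exc r Z \<le> 2" "minbad r Z \<Longrightarrow> finite Z"
  by (simp_all add: minbad_def bad_def card_ge_0_finite)

lemma minbad_proper_exc_ge3:
  assumes "minbad r Z" "T \<subset> Z" "2 \<le> card T"
  shows "exc r T \<ge> 3"
proof -
  have "card T \<le> 8"
    using assms minbad_card[OF assms(1)] by (meson card_mono le_trans psubset_imp_subset)
  moreover have "\<not> bad r T" using assms(1,2) unfolding minbad_def by blast
  ultimately show ?thesis using assms(3) unfolding bad_def by linarith
qed

lemma minbad_proper_exc_ge2:
  assumes "minbad r Z" "unif r Z" "T \<subset> Z" "T \<noteq> {}" "r \<ge> 2"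
  shows "exc r T \<ge> 2"
proof (cases "card T \<ge> 2")
  case True
  thus ?thesis using minbad_proper_exc_ge3[OF assms(1,3)] by simp
next
  case False
  have "finite T" using assms by (meson finite_subset minbad_card(4) psubset_imp_subset)
  then have "card T = 1" using False assms(4) by (metis One_nat_def Suc_leI card_gt_0_iff le_antisym not_less_eq_eq numeral_2_eq_2)
  then obtain b where "T = {b}" by (auto simp: card_1_singleton_iff)
  hence "b \<in> Z" using assms(3) by blast
  hence "card b = r" using assms(2) unfolding unif_def by blast
  from exc_singleton[OF assms(5) this] show ?thesis using \<open>T = {b}\<close> by simp
qed

text \<open>Two edges with two common vertices have excess at most 2 + 2 - 2, so they are bad
  already.\<close>

lemma cf_linear:
  assumes "conflict_free r E" "unif r E" "b \<in> E" "b' \<in> E" "b \<noteq> b'" "r \<ge> 2"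
  shows "card (b \<inter> b') \<le> 1"
proof -
  have "exc r {b,b'} \<ge> 3"
    using cf_exc_ge3[OF assms(1), of "{b,b'}"] assms by auto
  moreover have "exc r ({b} \<union> {b'}) = exc r {b} + exc r {b'} - int (card (\<Union>{b} \<inter> \<Union>{b'}))"
    using assms by (intro exc_Un) (auto simp: unif_def)
  moreover have "exc r {b} = 2" "exc r {b'} = 2"
    using assms by (auto intro!: exc_singleton simp: unif_def)
  ultimately show ?thesis by (simp add: insert_commute)
qed

lemma unif_card_gt1_cases:
  assumes "finite T" "T \<noteq> {}" "\<not> 2 \<le> card T"
  obtains b where "T = {b}"
  using assms
  by (metis card_0_eq card_1_singleton_iff less_2_cases linorder_not_le One_nat_def)

text \<open>
  The counting heart of the gluing argument: a proper part of a minimal configuration attached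
  along \<open>b\<close> has excess at least the number of vertices of \<open>b\<close> it touches, with equality
  only for the full complement of \<open>b\<close>.
\<close>

lemma piece_excess:
  assumes r: "r \<ge> 2" and Z: "minbad r Z" "unif r Z" and b: "b \<in> Z" "\<Union>Z \<inter> V0 = b"
    and Y: "Y \<subseteq> Z - {b}" "Y \<noteq> {}" and Z2: "exc r Z = 2"
  shows "exc r Y \<ge> int (card (\<Union>Y \<inter> V0))" "exc r Y \<ge> 2"
    "2 \<le> card Y \<Longrightarrow> exc r Y \<ge> 3"
    "exc r Y = int (card (\<Union>Y \<inter> V0)) \<Longrightarrow> insert b Y = Z"
    "exc r (insert b Y) = exc r Y + 2 - int (card (\<Union>Y \<inter> V0))"
proof -
  have uY: "unif r Y" and ub: "unif r {b}" using unif_subset[OF Z(2)] Y b by blast+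
  have eq: "\<Union>Y \<inter> V0 = \<Union>{b} \<inter> \<Union>Y" using b Y by auto
  have "exc r ({b} \<union> Y) = exc r {b} + exc r Y - int (card (\<Union>{b} \<inter> \<Union>Y))"
    using Y by (intro exc_Un ub uY) auto
  moreover have "exc r {b} = 2"
    using ub r by (intro exc_singleton) (auto simp: unif_def)
  ultimately show ins: "exc r (insert b Y) = exc r Y + 2 - int (card (\<Union>Y \<inter> V0))"
    using eq by simp
  have psub: "Y \<subset> Z" using Y b by blast
  show "exc r Y \<ge> 2" by (rule minbad_proper_exc_ge2[OF Z psub Y(2) r])
  show "2 \<le> card Y \<Longrightarrow> exc r Y \<ge> 3" by (rule minbad_proper_exc_ge3[OF Z(1) psub])
  have fin: "finite Y" using uY by simp
  have "b \<notin> Y" using Y by blast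
  hence c2: "2 \<le> card (insert b Y)" using Y(2) fin by (simp add: card_gt_0_iff Suc_le_eq)
  \<comment> \<open>Adding \<open>b\<close> changes the excess by 2 minus the contact. If the result
    is still a proper part of \<open>Z\<close>, its excess is at least 3, which is the strict
    inequality.\<close>
  have *: "exc r Y \<ge> int (card (\<Union>Y \<inter> V0)) + 1" if "insert b Y \<noteq> Z"
  proof -
    have "insert b Y \<subset> Z" using that Y b by blast
    from minbad_proper_exc_ge3[OF Z(1) this c2] show ?thesis using ins by simp
  qed
  show "exc r Y = int (card (\<Union>Y \<inter> V0)) \<Longrightarrow> insert b Y = Z" using * by force
  show "exc r Y \<ge> int (card (\<Union>Y \<inter> V0))"
    using * ins Z2 by (cases "insert b Y = Z") auto
qed

text \<open>
  Configurations that each hang on \<open>E\<close> along a single edge of \<open>B\<close> and meet each other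
  only inside the vertex set of \<open>E\<close>; these dominate the inclusion-exclusion sums.
\<close>

definition nice :: "nat \<Rightarrow> 'a set set \<Rightarrow> 'a set set \<Rightarrow> 'a set set set \<Rightarrow> bool" where
  "nice r E B \<Z> \<longleftrightarrow>
     (\<forall>Z\<in>\<Z>. unif r Z \<and> minbad r Z \<and> exc r Z = 2 \<and> (\<exists>b\<in>B. b \<in> Z \<and> \<Union>Z \<inter> \<Union>E = b)) \<and>
     (\<forall>Z\<in>\<Z>. \<forall>Z'\<in>\<Z>. Z \<noteq> Z' \<longrightarrow> \<Union>Z \<inter> \<Union>Z' \<subseteq> \<Union>E)"

lemma niceD:
  assumes "nice r E B \<Z>" "Z \<in> \<Z>"
  shows "unif r Z" "minbad r Z" "exc r Z = 2" "\<exists>b\<in>B. b \<in> Z \<and> \<Union>Z \<inter> \<Union>E = b"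
  using assms unfolding nice_def by blast+

text \<open>By uniformity an edge contained in \<open>b\<close> is \<open>b\<close> itself, so the
  vertex contact already determines the common edges.\<close>

lemma nice_Int:
  assumes "unif r E" "unif r Z" "r \<ge> 2" "b \<in> E" "b \<in> Z" "\<Union>Z \<inter> \<Union>E = b"
  shows "Z \<inter> E = {b}"
proof -
  have "g = b" if "g \<in> Z" "g \<in> E" for g
  proof -
    have "g \<subseteq> b" using that assms(6) by blast
    moreover have "card g = r" "card b = r" "finite b" using that assms by (auto simp: unif_def)
    ultimately show ?thesis by (simp add: card_subset_eq)
  qed
  thus ?thesis using assms by blast
qed

text \<open>Outside the vertices of \<open>E\<close> the members of a nice family are disjoint, so
  new vertices and new edges of \<open>W\<close> can be counted member by member. Each member
  contributes the excess of its new edges minus their contact with \<open>E\<close>.\<close>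

lemma exc_decompose:
  assumes E: "unif r E" and fin: "finite \<Z>" and n: "nice r E B \<Z>" "B \<subseteq> E" and r: "r \<ge> 2"
    and W: "W \<subseteq> E \<union> \<Union>\<Z>"
  shows "exc r W = int (card (\<Union>W \<inter> \<Union>E)) - int (r - 2) * int (card (W \<inter> E))
           + (\<Sum>Z\<in>\<Z>. exc r (W \<inter> Z - E) - int (card (\<Union>(W \<inter> Z - E) \<inter> \<Union>E)))"
proof -
  define V where "V = \<Union>E"
  define Y where "Y Z = W \<inter> Z - E" for Z
  have finZ: "finite Z" if "Z \<in> \<Z>" for Z using niceD[OF n(1) that] by simp
  have uY: "unif r (Y Z)" if "Z \<in> \<Z>" for Z
    by (rule unif_subset[OF niceD(1)[OF n(1) that]]) (auto simp: Y_def)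
  have uW: "unif r W"
  proof -
    have "unif r (E \<union> \<Union>\<Z>)" using E fin niceD(1)[OF n(1)] by (auto simp: unif_def)
    thus ?thesis using W unif_subset by blast
  qed
  have disjV: "(\<Union>(Y Z) - V) \<inter> (\<Union>(Y Z') - V) = {}" if "Z \<in> \<Z>" "Z' \<in> \<Z>" "Z \<noteq> Z'" for Z Z'
    using n(1) that unfolding nice_def Y_def V_def by blast
  \<comment> \<open>An edge of \<open>Z\<close> inside the vertices of \<open>E\<close> lies in the
    attaching edge, hence equals it and belongs to \<open>E\<close>. So each new edge has an outside
    vertex, and this separates different members.\<close>
  have outside: "\<not> g \<subseteq> V" if Zg: "Z \<in> \<Z>" "g \<in> Y Z" for Z g
  proof
    assume "g \<subseteq> V"
    obtain b where b: "b \<in> B" "b \<in> Z" "\<Union>Z \<inter> V = b" using niceD(4)[OF n(1) Zg(1)] V_def by blast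
    have "g \<subseteq> b" using \<open>g \<subseteq> V\<close> b Zg unfolding Y_def by blast
    moreover have "card g = r" "card b = r" "finite b"
      using Zg b E n(2) uY[OF Zg(1)] by (auto simp: unif_def)
    ultimately have "g = b" by (simp add: card_subset_eq)
    thus False using Zg b n(2) unfolding Y_def by blast
  qed
  have disjY: "Y Z \<inter> Y Z' = {}" if ZZ: "Z \<in> \<Z>" "Z' \<in> \<Z>" "Z \<noteq> Z'" for Z Z'
  proof (rule ccontr)
    assume "Y Z \<inter> Y Z' \<noteq> {}"
    then obtain g where "g \<in> Y Z" "g \<in> Y Z'" by blast
    moreover from this obtain a where "a \<in> g" "a \<notin> V" using outside[OF ZZ(1)] by blast
    ultimately show False using disjV[OF ZZ] by blast
  qed
  have Wun: "W = (W \<inter> E) \<union> (\<Union>Z\<in>\<Z>. Y Z)" using W unfolding Y_def by blast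
  have cW: "card W = card (W \<inter> E) + (\<Sum>Z\<in>\<Z>. card (Y Z))"
  proof -
    have "card W = card ((W \<inter> E) \<union> (\<Union>Z\<in>\<Z>. Y Z))" by (rule arg_cong[OF Wun])
    also have "\<dots> = card (W \<inter> E) + card (\<Union>Z\<in>\<Z>. Y Z)"
    proof (rule card_Un_disjoint)
      show "finite (W \<inter> E)" using unif_finite[OF E(1)] by simp
      show "finite (\<Union>Z\<in>\<Z>. Y Z)" using fin unif_finite[OF uY] by blast
      show "(W \<inter> E) \<inter> (\<Union>Z\<in>\<Z>. Y Z) = {}" unfolding Y_def by blast
    qed
    also have "card (\<Union>Z\<in>\<Z>. Y Z) = (\<Sum>Z\<in>\<Z>. card (Y Z))"
      using fin unif_finite[OF uY] disjY by (intro card_UN_disjoint) blast+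
    finally show ?thesis .
  qed
  have Vun: "\<Union>W = (\<Union>W \<inter> V) \<union> (\<Union>Z\<in>\<Z>. \<Union>(Y Z) - V)"
  proof -
    have "\<Union>W - V \<subseteq> (\<Union>Z\<in>\<Z>. \<Union>(Y Z) - V)"
    proof
      fix x assume "x \<in> \<Union>W - V"
      then obtain g where "g \<in> W" "x \<in> g" "x \<notin> V" by blast
      hence "g \<notin> E" unfolding V_def by blast
      thus "x \<in> (\<Union>Z\<in>\<Z>. \<Union>(Y Z) - V)" using \<open>g \<in> W\<close> \<open>x \<in> g\<close> \<open>x \<notin> V\<close> Wun by blast
    qed
    moreover have "(\<Union>Z\<in>\<Z>. \<Union>(Y Z) - V) \<subseteq> \<Union>W" unfolding Y_def by blast
    ultimately show ?thesis by blast
  qed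
  have cV: "card (\<Union>W) = card (\<Union>W \<inter> V) + (\<Sum>Z\<in>\<Z>. card (\<Union>(Y Z) - V))"
  proof -
    have "card (\<Union>W) = card ((\<Union>W \<inter> V) \<union> (\<Union>Z\<in>\<Z>. \<Union>(Y Z) - V))" by (rule arg_cong[OF Vun])
    also have "\<dots> = card (\<Union>W \<inter> V) + card (\<Union>Z\<in>\<Z>. \<Union>(Y Z) - V)"
    proof (rule card_Un_disjoint)
      show "finite (\<Union>W \<inter> V)" using unif_finite_Union[OF uW] by simp
      show "finite (\<Union>Z\<in>\<Z>. \<Union>(Y Z) - V)" using fin unif_finite_Union[OF uY] by simp
      show "(\<Union>W \<inter> V) \<inter> (\<Union>Z\<in>\<Z>. \<Union>(Y Z) - V) = {}" by blast
    qed
    also have "card (\<Union>Z\<in>\<Z>. \<Union>(Y Z) - V) = (\<Sum>Z\<in>\<Z>. card (\<Union>(Y Z) - V))"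
      using fin unif_finite_Union[OF uY] disjV by (intro card_UN_disjoint) simp_all
    finally show ?thesis .
  qed
  have trm: "int (card (\<Union>(Y Z) - V)) - int (r - 2) * int (card (Y Z))
       = exc r (Y Z) - int (card (\<Union>(Y Z) \<inter> V))" if "Z \<in> \<Z>" for Z
  proof -
    have "finite (\<Union>(Y Z))" using uY[OF that] by simp
    hence "card (\<Union>(Y Z)) = card (\<Union>(Y Z) - V) + card (\<Union>(Y Z) \<inter> V)"
      by (metis add.commute card_Int_Diff)
    thus ?thesis by (simp add: exc_def)
  qed
  have "exc r W = int (card (\<Union>W \<inter> V)) - int (r - 2) * int (card (W \<inter> E))
     + (\<Sum>Z\<in>\<Z>. int (card (\<Union>(Y Z) - V)) - int (r - 2) * int (card (Y Z)))"
    unfolding exc_def[of r W] cW cV by (simp add: sum_subtractf sum_distrib_left algebra_simps)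
  also have "(\<Sum>Z\<in>\<Z>. int (card (\<Union>(Y Z) - V)) - int (r - 2) * int (card (Y Z)))
      = (\<Sum>Z\<in>\<Z>. exc r (Y Z) - int (card (\<Union>(Y Z) \<inter> V)))"
    by (intro sum.cong refl trm)
  finally show ?thesis unfolding V_def Y_def .
qed

text \<open>A member whose new edges meet \<open>W\<close> contributes at least 0 to the excess of
  \<open>W\<close>, and 0 only if \<open>W\<close> contains all of them. The number of edges of
  \<open>E\<close> in \<open>W\<close> decides: two or more give excess at least 3, one forces
  equality throughout and makes \<open>W\<close> a member, none leaves only two outer edges through
  the same vertex pair. That last case does occur, and the model of a round has to account for
  it.\<close>

lemma nice_glue:
  assumes E: "unif r E" "conflict_free r E" and fin: "finite \<Z>" and n: "nice r E B \<Z>" "B \<subseteq> E" and r: "r \<ge> 2"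
    and W: "W \<subseteq> E \<union> \<Union>\<Z>" "minbad r W"
  shows "W \<in> \<Z> \<or> (W \<inter> E = {} \<and> (\<exists>Z1\<in>\<Z>. \<exists>Z2\<in>\<Z>. Z1 \<noteq> Z2 \<and> card Z1 = 2 \<and> card Z2 = 2 \<and>
            \<Inter>Z1 = \<Inter>Z2 \<and> (Z1 \<union> Z2) - E \<subseteq> W))"
proof -
  define V where "V = \<Union>E"
  define Y where "Y Z = W \<inter> Z - E" for Z
  define x where "x Z = int (card (\<Union>(Y Z) \<inter> V))" for Z
  have finV: "finite V" using E by (simp add: V_def)
  have uW: "unif r W"
  proof -
    have "unif r (E \<union> \<Union>\<Z>)" using E fin niceD(1)[OF n(1)] by (auto simp: unif_def)
    thus ?thesis using W unif_subset by blast
  qed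
  have dec: "exc r W = int (card (\<Union>W \<inter> V)) - int (r - 2) * int (card (W \<inter> E)) + (\<Sum>Z\<in>\<Z>. exc r (Y Z) - x Z)"
    unfolding V_def x_def Y_def by (rule exc_decompose[OF E(1) fin n r W(1)])
  define \<beta> where "\<beta> Z = \<Union>Z \<inter> V" for Z
  have \<beta>: "\<beta> Z \<in> B" "\<beta> Z \<in> Z" if "Z \<in> \<Z>" for Z
    using niceD(4)[OF n(1) that] unfolding \<beta>_def V_def by auto
  have ZE: "Z \<inter> E = {\<beta> Z}" if "Z \<in> \<Z>" for Z
    using nice_Int[OF E(1) niceD(1)[OF n(1) that] r _ \<beta>(2)[OF that]] \<beta>(1)[OF that] n(2)
    unfolding \<beta>_def V_def by auto
  have Ysub: "Y Z \<subseteq> Z - {\<beta> Z}" if "Z \<in> \<Z>" for Z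
    using ZE[OF that] unfolding Y_def by blast
  have pc: "exc r (Y Z) \<ge> x Z" "exc r (Y Z) \<ge> 2" "2 \<le> card (Y Z) \<Longrightarrow> exc r (Y Z) \<ge> 3"
     "exc r (Y Z) = x Z \<Longrightarrow> insert (\<beta> Z) (Y Z) = Z" if "Z \<in> \<Z>" "Y Z \<noteq> {}" for Z
    using piece_excess[OF r niceD(2,1)[OF n(1) that(1)] \<beta>(2)[OF that(1)] \<beta>_def[symmetric] Ysub[OF that(1)] that(2)
        niceD(3)[OF n(1) that(1)]] unfolding x_def by simp_all
  have nonneg: "exc r (Y Z) - x Z \<ge> 0" if "Z \<in> \<Z>" for Z
    using pc(1)[OF that] by (cases "Y Z = {}") (auto simp: x_def)
  have le2: "exc r W \<le> 2" and cW: "card W \<le> 8" "card W \<ge> 2" using minbad_card[OF W(2)] by auto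
  have finW: "finite W" using uW by simp
  consider "card (W \<inter> E) \<ge> 2" | g where "W \<inter> E = {g}" | "W \<inter> E = {}"
    using unif_card_gt1_cases[of "W \<inter> E"] finW by blast
  thus ?thesis
  proof cases
    case 1
    \<comment> \<open>These edges alone have excess at least 3, and the remaining contributions
      cannot lower it.\<close>
    have "card (W \<inter> E) \<le> 8" using cW finW by (meson card_mono inf_le1 le_trans)
    hence "exc r (W \<inter> E) \<ge> 3" using cf_exc_ge3[OF E(2) _ 1] by simp
    moreover have "card (\<Union>(W \<inter> E)) \<le> card (\<Union>W \<inter> V)"
      using finV by (intro card_mono) (auto simp: V_def)
    ultimately have "exc r W \<ge> 3"
      using dec sum_nonneg[of \<Z> "\<lambda>Z. exc r (Y Z) - x Z"] nonneg
      unfolding exc_def[of r "W \<inter> E"] by auto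
    thus ?thesis using le2 by simp
  next
    case 2
    have g: "card g = r" "finite g" "g \<in> E" "g \<in> W" using 2 uW by (auto simp: unif_def)
    have gsub: "g \<subseteq> \<Union>W \<inter> V" using g V_def by blast
    \<comment> \<open>The vertices of \<open>g\<close> alone give r - (r - 2) = 2, the most that
      \<open>W\<close> may have. So every contribution is 0 and \<open>W\<close> touches
      \<open>E\<close> only in \<open>g\<close>.\<close>
    have "card g \<le> card (\<Union>W \<inter> V)" using gsub finV by (intro card_mono) auto
    moreover have S0: "(\<Sum>Z\<in>\<Z>. exc r (Y Z) - x Z) \<ge> 0" by (intro sum_nonneg nonneg)
    moreover have "int r - int (r-2) = 2" using r by simp
    ultimately have eqs: "card (\<Union>W \<inter> V) = card g" "(\<Sum>Z\<in>\<Z>. exc r (Y Z) - x Z) = 0"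
      using dec le2 2 g by auto
    have Vg: "\<Union>W \<inter> V = g" using eqs(1) gsub finV by (metis card_subset_eq finite_Int)
    have zero: "exc r (Y Z) = x Z" if "Z \<in> \<Z>" for Z
      using eqs(2) sum_nonneg_eq_0_iff[OF fin, of "\<lambda>Z. exc r (Y Z) - x Z"] nonneg that by auto
    have "\<exists>h. h \<in> W \<and> h \<noteq> g" using cW(2) finW g(4)
      by (metis card_1_singleton_iff card_le_Suc0_iff_eq not_less_eq_eq numeral_2_eq_2)
    then obtain h where h: "h \<in> W" "h \<noteq> g" by blast
    hence "h \<notin> E" using 2 by blast
    then obtain Z where Z: "Z \<in> \<Z>" "h \<in> Y Z" using W(1) h unfolding Y_def by blast
    define b where "b = \<beta> Z"
    have "Y Z \<noteq> {}" using Z(2) by blast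
    note pZ = pc[OF Z(1) this] 
    have b: "b \<in> B" "b \<in> Z" "\<Union>Z \<inter> V = b" "exc r (Y Z) \<ge> 2" "insert b (Y Z) = Z"
      using \<beta>[OF Z(1)] pZ zero[OF Z(1)] by (auto simp: b_def \<beta>_def)
    \<comment> \<open>A piece with contribution 0 and excess at least 2 touches two vertices of
      \<open>E\<close>; they lie in both \<open>g\<close> and \<open>b\<close>, so linearity gives g
      = b.\<close>
    have "x Z \<ge> 2" using b zero[OF Z(1)] by simp
    moreover have "\<Union>(Y Z) \<inter> V \<subseteq> g \<inter> b" using Vg b(3) unfolding Y_def by blast
    hence "card (\<Union>(Y Z) \<inter> V) \<le> card (g \<inter> b)" using g(2) by (intro card_mono) auto
    ultimately have "card (g \<inter> b) \<ge> 2" unfolding x_def by simp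
    hence "g = b" using cf_linear[OF E(2,1) g(3) _ _ r, of b] b(1) n(2) by force
    moreover have "Y Z \<subseteq> W" unfolding Y_def by blast
    ultimately have "insert b (Y Z) \<subseteq> W" using g(4) by simp
    hence "Z \<subseteq> W" using b(5) by simp
    hence "Z = W" using W(2) niceD(2)[OF n(1) Z(1)] unfolding minbad_def by blast
    thus ?thesis using Z(1) by simp
  next
    case 3
    have "W \<noteq> {}" using cW by auto
    then obtain h1 where "h1 \<in> W" by blast
    then obtain Z1 where Z1: "Z1 \<in> \<Z>" "h1 \<in> Y Z1" using W(1) 3 unfolding Y_def by blast
    define b1 where "b1 = \<beta> Z1"
    have Y1: "Y Z1 \<noteq> {}" using Z1(2) by blast
    have b1: "b1 \<in> B" "b1 \<in> Z1" "\<Union>Z1 \<inter> V = b1" "exc r (Y Z1) \<ge> x Z1" "exc r (Y Z1) \<ge> 2"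
      using \<beta>[OF Z1(1)] pc(1,2)[OF Z1(1) Y1] by (auto simp: b1_def \<beta>_def)
    \<comment> \<open>Otherwise \<open>W\<close>, which misses the attaching edge, would be a proper
      bad part of the minimal \<open>Z1\<close>.\<close>
    have "\<not> W \<subseteq> Z1"
    proof
      assume "W \<subseteq> Z1"
      moreover have "b1 \<notin> W" using 3 b1 n(2) by blast
      ultimately have "W \<subset> Z1" using b1 by blast
      thus False using niceD(2)[OF n(1) Z1(1)] W(2) unfolding minbad_def by blast
    qed
    then obtain h2 where h2: "h2 \<in> W" "h2 \<notin> Z1" by blast
    then obtain Z2 where Z2: "Z2 \<in> \<Z>" "h2 \<in> Y Z2" using W(1) 3 unfolding Y_def by blast
    have ne: "Z1 \<noteq> Z2" using h2 Z2 unfolding Y_def by blast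
    define b2 where "b2 = \<beta> Z2"
    have Y2: "Y Z2 \<noteq> {}" using Z2(2) by blast
    have b2: "b2 \<in> B" "b2 \<in> Z2" "\<Union>Z2 \<inter> V = b2" "exc r (Y Z2) \<ge> x Z2" "exc r (Y Z2) \<ge> 2"
      using \<beta>[OF Z2(1)] pc(1,2)[OF Z2(1) Y2] by (auto simp: b2_def \<beta>_def)
    define C1 where "C1 = \<Union>(Y Z1) \<inter> V"
    define C2 where "C2 = \<Union>(Y Z2) \<inter> V"
    have finC: "finite C1" "finite C2" using finV by (auto simp: C1_def C2_def)
    have "(\<Sum>Z\<in>\<Z>. exc r (Y Z) - x Z) \<ge> (\<Sum>Z\<in>{Z1,Z2}. exc r (Y Z) - x Z)"
      using fin Z1 Z2 nonneg by (intro sum_mono2) auto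
    moreover have "C1 \<union> C2 \<subseteq> \<Union>W \<inter> V" unfolding C1_def C2_def Y_def by blast
    hence "card (C1 \<union> C2) \<le> card (\<Union>W \<inter> V)" using finV by (intro card_mono) auto
    ultimately have "2 \<ge> int (card (C1 \<union> C2)) + (exc r (Y Z1) - x Z1) + (exc r (Y Z2) - x Z2)"
      using dec le2 ne 3 by simp
    moreover have "int (card (C1 \<union> C2)) = x Z1 + x Z2 - int (card (C1 \<inter> C2))"
      using card_Un_Int[OF finC] unfolding x_def C1_def[symmetric] C2_def[symmetric] by simp
    \<comment> \<open>The common contact of the two pieces is at least the sum of their excesses
      minus 2 and at most either contact. As each excess is at least 2 and at least the contact, all
      these numbers equal 2.\<close>
    ultimately have I: "int (card (C1 \<inter> C2)) \<ge> exc r (Y Z1) + exc r (Y Z2) - 2" by simp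
    have I1: "int (card (C1 \<inter> C2)) \<le> x Z1" "int (card (C1 \<inter> C2)) \<le> x Z2"
      using finC by (auto simp: x_def C1_def[symmetric] C2_def[symmetric] intro!: card_mono)
    have vals: "exc r (Y Z1) = 2" "exc r (Y Z2) = 2" "x Z1 = 2" "x Z2 = 2" "card (C1 \<inter> C2) = 2"
      using I I1 b1(4,5) b2(4,5) by linarith+
    have "card C1 = 2" "card C2 = 2" using vals(3,4) unfolding x_def C1_def C2_def by simp_all
    hence Ceq: "C1 \<inter> C2 = C1" "C1 \<inter> C2 = C2"
      using vals(5) finC card_subset_eq[of C1 "C1 \<inter> C2"] card_subset_eq[of C2 "C1 \<inter> C2"] by auto
    have single: "\<exists>f. Y Z = {f} \<and> Z = {\<beta> Z,f} \<and> \<beta> Z \<noteq> f \<and> \<Inter>Z = \<Union>(Y Z) \<inter> V"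
      if Z: "Z \<in> \<Z>" "Y Z \<noteq> {}" "exc r (Y Z) = 2" "x Z = 2" for Z
    proof -
      have "finite (Y Z)" using finW unfolding Y_def by blast
      moreover have "\<not> 2 \<le> card (Y Z)" using pc(3)[OF Z(1,2)] Z(3) by auto
      ultimately obtain f where f: "Y Z = {f}" using Z(2) unif_card_gt1_cases[of "Y Z"] by blast
      have ins: "insert (\<beta> Z) (Y Z) = Z" using pc(4)[OF Z(1,2)] Z(3,4) by simp
      hence eq: "{\<beta> Z, f} = Z" by (simp only: f)
      have ne: "\<beta> Z \<noteq> f" using f Ysub[OF Z(1)] by blast
      have "\<Inter>{\<beta> Z, f} = \<beta> Z \<inter> f" by simp
      moreover have "f \<in> Z" using f unfolding Y_def by blast
      hence "\<beta> Z \<inter> f = f \<inter> V" unfolding \<beta>_def by blast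
      ultimately have "\<Inter>Z = \<Union>(Y Z) \<inter> V" by (simp only: eq f cSup_singleton)
      thus ?thesis using f eq[symmetric] ne by (intro exI[of _ f] conjI)
    qed
    obtain f1 where f1: "Y Z1 = {f1}" "Z1 = {b1,f1}" "b1 \<noteq> f1" "\<Inter>Z1 = C1"
      using single[OF Z1(1) Y1 vals(1,3)] C1_def b1_def by blast
    obtain f2 where f2: "Y Z2 = {f2}" "Z2 = {b2,f2}" "b2 \<noteq> f2" "\<Inter>Z2 = C2"
      using single[OF Z2(1) Y2 vals(2,4)] C2_def b2_def by blast
    have "f1 \<in> W" "f2 \<in> W" using f1(1) f2(1) unfolding Y_def by blast+
    moreover have "b1 \<in> E" "b2 \<in> E" using b1(1) b2(1) n(2) by blast+
    ultimately have "(Z1 \<union> Z2) - E \<subseteq> W" unfolding f1(2) f2(2) by blast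
    moreover have "card Z1 = 2" "card Z2 = 2"
      using f1(3) f2(3) by (simp_all only: f1(2) f2(2) card_2_iff) blast+
    moreover have "\<Inter>Z1 = \<Inter>Z2" using f1(4) f2(4) Ceq by simp
    ultimately show ?thesis using 3 Z1 Z2 ne by blast
  qed
qed

section \<open>Counting minimal configurations\<close>

definition edges :: "nat \<Rightarrow> nat \<Rightarrow> nat set set" where
  "edges r n = {e. e \<subseteq> {..<n} \<and> card e = r}"

definition min_bad_sets :: "nat \<Rightarrow> nat \<Rightarrow> nat set set set" where
  "min_bad_sets r n = {Z. Z \<subseteq> edges r n \<and> minbad r Z}"

definition min_bad_meeting :: "nat \<Rightarrow> nat \<Rightarrow> nat set set \<Rightarrow> nat set set set" where
  "min_bad_meeting r n B = {Z \<in> min_bad_sets r n. Z \<inter> B \<noteq> {}}"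

text \<open>
  The number of edges meeting a fixed edge in exactly a given pair; edge probabilities are
  measured in units of its inverse.
\<close>

definition scale :: "nat \<Rightarrow> nat \<Rightarrow> real" where
  "scale r n = real ((n - r) choose (r - 2))"

lemma finite_edges [simp]: "finite (edges r n)"
  unfolding edges_def by (rule finite_subset[of _ "Pow {..<n}"]) auto

lemma unif_edges: "E \<subseteq> edges r n \<Longrightarrow> unif r E"
  unfolding unif_def
proof (intro conjI ballI)
  assume E: "E \<subseteq> edges r n"
  thus "finite E" by (rule finite_subset) simp
  fix e assume "e \<in> E"
  hence "e \<subseteq> {..<n}" "card e = r" using E unfolding edges_def by auto
  thus "finite e" "card e = r" using finite_subset by blast+
qed

lemma finite_MB [simp]: "finite (min_bad_sets r n)"
  unfolding min_bad_sets_def by (rule finite_subset[of _ "Pow (edges r n)"]) auto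

lemma finite_MBB [simp]: "finite (min_bad_meeting r n B)"
  unfolding min_bad_meeting_def by simp

lemma scale_lower:
  assumes "r \<ge> 2" "n \<ge> 2 * r"
  shows "scale r n \<ge> (real n / (2 * real r)) ^ (r - 2)" "scale r n \<ge> 1"
proof -
  have le: "r - 2 \<le> n - r" using assms by simp
  have "n - r choose (r - 2) > 0" using le by simp
  thus "scale r n \<ge> 1" unfolding scale_def by linarith
  have "(real n / (2 * real r)) ^ (r - 2) \<le> (real (n - r) / real (r - 2)) ^ (r - 2)"
  proof (cases "r = 2")
    case False
    hence r3: "r > 2" using assms by simp
    have "real n / (2 * real r) \<le> real (n - r) / real r"
      using assms r3 by (simp add: field_simps of_nat_diff)
    also have "\<dots> \<le> real (n - r) / real (r - 2)"
      using r3 by (intro divide_left_mono) auto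
    finally show ?thesis by (intro power_mono) auto
  qed simp
  also have "\<dots> \<le> scale r n"
    unfolding scale_def by (rule binomial_ge_n_over_k_pow_k[OF le])
  finally show "scale r n \<ge> (real n / (2 * real r)) ^ (r - 2)" .
qed

text \<open>\<open>scale\<close> is of order n^(r - 2), so the weight of m edges pays for up to (r -
  2) m vertices. The constant is uniform over m at most 8.\<close>

lemma inverse_scale_power:
  assumes "r \<ge> 2" "n \<ge> 2 * r" "m \<le> 8" "k \<le> (r - 2) * m"
  shows "(1 / scale r n) ^ m \<le> (2 * real r) ^ (8 * r) / real n ^ k"
proof -
  have n1: "real n \<ge> 1" using assms by simp
  have pos: "0 < (real n / (2 * real r)) ^ (r - 2)" using assms by simp
  have "1 / scale r n \<le> 1 / (real n / (2 * real r)) ^ (r - 2)"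
    using scale_lower(1)[OF assms(1,2)] pos by (intro divide_left_mono mult_pos_pos) auto
  hence "(1 / scale r n) ^ m \<le> (1 / (real n / (2 * real r)) ^ (r - 2)) ^ m"
    using scale_lower(2)[OF assms(1,2)] by (intro power_mono) auto
  also have "\<dots> = (2 * real r) ^ ((r - 2) * m) / real n ^ ((r - 2) * m)"
    by (simp add: power_divide power_mult)
  also have "\<dots> \<le> (2 * real r) ^ (8 * r) / real n ^ k"
  proof (rule frac_le)
    have "(r - 2) * m \<le> r * 8" using assms by (intro mult_le_mono) auto
    thus "(2 * real r) ^ ((r - 2) * m) \<le> (2 * real r) ^ (8 * r)"
      using assms by (intro power_increasing) (auto simp: mult.commute)
    show "real n ^ k \<le> real n ^ ((r - 2) * m)" using n1 assms by (intro power_increasing) auto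
  qed (use n1 in auto)
  finally show ?thesis .
qed

text \<open>The part of \<open>Z\<close> in \<open>H\<close> has excess at least 2 and
  \<open>Z\<close> at most 2, so new edges bring on average at most r - 2 new vertices each. A new
  edge has weight of order n^(2 - r); hence the ways to attach \<open>Z\<close> have bounded total
  weight, and O(1/n) as soon as one vertex is missing. Tightness forces the old part to be a single
  edge and \<open>Z\<close> to meet \<open>V0\<close> only there.\<close>

lemma new_vertices_bound:
  assumes r: "r \<ge> 2" and Z: "unif r Z" "minbad r Z" and H: "Z \<inter> H \<noteq> {}" "\<Union>H \<subseteq> V0"
  shows "card (\<Union>Z - V0) \<le> (r - 2) * card (Z - H)"
    "\<not> Z \<subseteq> H \<Longrightarrow> \<not> (\<exists>b\<in>H. b \<in> Z \<and> \<Union>Z \<inter> V0 = b \<and> exc r Z = 2) \<Longrightarrow>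
      card (\<Union>Z - V0) + 1 \<le> (r - 2) * card (Z - H)"
proof -
  define T where "T = Z \<inter> H"
  have fin: "finite Z" "finite (\<Union>Z)" using Z by auto
  have A: "card (\<Union>Z - V0) \<le> (r - 2) * card (Z - H) \<and> 
     (card (\<Union>Z - V0) = (r - 2) * card (Z - H) \<longrightarrow> (\<exists>b\<in>H. b \<in> Z \<and> \<Union>Z \<inter> V0 = b \<and> exc r Z = 2))"
    if nsub: "\<not> Z \<subseteq> H"
  proof -
    have TZ: "T \<subset> Z" "T \<noteq> {}" using nsub H unfolding T_def by auto
    have uT: "unif r T" using unif_subset[OF Z(1)] TZ by blast
    have e2: "exc r T \<ge> 2" by (rule minbad_proper_exc_ge2[OF Z(2,1) TZ r])
    have c1: "card (\<Union>Z) = card (\<Union>Z - V0) + card (\<Union>Z \<inter> V0)"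
      using fin(2) by (metis add.commute card_Int_Diff)
    have sub: "\<Union>T \<subseteq> \<Union>Z \<inter> V0" using H unfolding T_def by blast
    have c2: "card (\<Union>T) \<le> card (\<Union>Z \<inter> V0)" using sub fin by (intro card_mono) auto
    have c3: "card Z = card T + card (Z - H)"
      unfolding T_def using fin(1) by (metis card_Int_Diff)
    have z: "exc r Z \<le> 2" using minbad_card(3)[OF Z(2)] .
    have main: "int (card (\<Union>Z - V0)) = exc r Z - exc r T + int (r - 2) * int (card (Z - H))
        - (int (card (\<Union>Z \<inter> V0)) - int (card (\<Union>T)))"
      unfolding exc_def using c1 c3 by (simp add: algebra_simps)
    have le: "int (card (\<Union>Z - V0)) \<le> int ((r - 2) * card (Z - H))" using main z e2 c2 by simp
    moreover have "\<exists>b\<in>H. b \<in> Z \<and> \<Union>Z \<inter> V0 = b \<and> exc r Z = 2"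
      if eq: "card (\<Union>Z - V0) = (r - 2) * card (Z - H)"
    proof -
      have "int (card (\<Union>Z - V0)) = int (r - 2) * int (card (Z - H))" using eq by simp
      hence eqs: "exc r T = 2" "exc r Z = 2" "card (\<Union>T) = card (\<Union>Z \<inter> V0)"
        using main z e2 c2 by linarith+
      have "\<not> 2 \<le> card T" using minbad_proper_exc_ge3[OF Z(2) TZ(1)] eqs by auto
      from unif_card_gt1_cases[OF unif_finite[OF uT] TZ(2) this] obtain b where b: "T = {b}" .
      have "\<Union>Z \<inter> V0 = \<Union>T" using card_subset_eq[OF _ sub eqs(3)] fin by simp
      hence "\<Union>Z \<inter> V0 = b" using b by simp
      moreover have "b \<in> Z \<inter> H" using b unfolding T_def by simp
      ultimately show ?thesis using eqs(2) by (intro bexI[of _ b]) simp_all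
    qed
    ultimately show ?thesis by (metis of_nat_le_iff)
  qed
  show "card (\<Union>Z - V0) \<le> (r - 2) * card (Z - H)"
  proof (cases "Z \<subseteq> H")
    case True
    hence "\<Union>Z - V0 = {}" using H by blast
    hence "card (\<Union>Z - V0) = 0" by (simp only: card.empty)
    thus ?thesis by simp
  next
    case False thus ?thesis using A by blast
  qed
  show "\<not> Z \<subseteq> H \<Longrightarrow> \<not> (\<exists>b\<in>H. b \<in> Z \<and> \<Union>Z \<inter> V0 = b \<and> exc r Z = 2) \<Longrightarrow>
      card (\<Union>Z - V0) + 1 \<le> (r - 2) * card (Z - H)"
  proof -
    assume a: "\<not> Z \<subseteq> H" "\<not> (\<exists>b\<in>H. b \<in> Z \<and> \<Union>Z \<inter> V0 = b \<and> exc r Z = 2)"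
    from A[OF a(1)] a(2) have "card (\<Union>Z - V0) \<le> (r - 2) * card (Z - H)"
      "card (\<Union>Z - V0) \<noteq> (r - 2) * card (Z - H)" by blast+
    thus ?thesis by simp
  qed
qed

lemma card_Union_MB:
  assumes "Z \<in> min_bad_sets r n" "r \<ge> 2"
  shows "card (\<Union>Z) \<le> 8 * r"
proof -
  have "int (card (\<Union>Z)) \<le> 2 + int (r - 2) * int (card Z)" "card Z \<le> 8"
    using assms minbad_card[of r Z] by (auto simp: min_bad_sets_def exc_def)
  moreover have "int (r - 2) * int (card Z) \<le> int (r - 2) * 8"
    using \<open>card Z \<le> 8\<close> by (intro mult_left_mono) auto
  ultimately show ?thesis using assms(2) by (simp add: of_nat_diff)
qed

text \<open>The vertex set is given by its trace on \<open>V0\<close> and \<open>w\<close> new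
  vertices, and on at most 8r vertices there are at most 2^(2^(8r)) set systems.\<close>

lemma card_MB_by_new_vertices:
  assumes "finite V0" "card V0 \<le> K" "r \<ge> 2"
  shows "card {Z \<in> min_bad_sets r n. card (\<Union>Z - V0) = w} \<le> 2 ^ K * n ^ w * 2 ^ (2 ^ (8 * r))"
proof -
  define U where "U = {U. U \<subseteq> {..<n} \<and> card (U - V0) = w \<and> card U \<le> 8 * r}"
  have finU: "finite U" unfolding U_def by (rule finite_subset[of _ "Pow {..<n}"]) auto
  have sub: "{Z \<in> min_bad_sets r n. card (\<Union>Z - V0) = w} \<subseteq> (\<Union>X\<in>U. Pow (Pow X))"
  proof
    fix Z assume "Z \<in> {Z \<in> min_bad_sets r n. card (\<Union>Z - V0) = w}"
    hence Z: "Z \<in> min_bad_sets r n" "card (\<Union>Z - V0) = w" by auto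
    have "\<Union>Z \<subseteq> {..<n}" using Z(1) unfolding min_bad_sets_def edges_def by blast
    hence "\<Union>Z \<in> U" using Z card_Union_MB[OF Z(1) assms(3)] unfolding U_def by simp
    thus "Z \<in> (\<Union>X\<in>U. Pow (Pow X))" by blast
  qed
  have finX: "finite X" if "X \<in> U" for X using that finite_subset unfolding U_def by blast
  have "card U \<le> card (Pow V0 \<times> {N. N \<subseteq> {..<n} \<and> card N = w})"
  proof (rule card_inj_on_le[of "\<lambda>X. (X \<inter> V0, X - V0)"])
    show "inj_on (\<lambda>X. (X \<inter> V0, X - V0)) U" by (auto simp: inj_on_def)
    show "(\<lambda>X. (X \<inter> V0, X - V0)) ` U \<subseteq> Pow V0 \<times> {N. N \<subseteq> {..<n} \<and> card N = w}"
      unfolding U_def by blast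
    show "finite (Pow V0 \<times> {N. N \<subseteq> {..<n} \<and> card N = w})"
      using assms(1) by (intro finite_cartesian_product) (auto intro: finite_subset[of _ "Pow {..<n}"])
  qed
  also have "\<dots> = 2 ^ card V0 * (n choose w)"
    using assms(1) n_subsets[of "{..<n}" w] by (simp add: card_cartesian_product card_Pow)
  also have "\<dots> \<le> 2 ^ K * n ^ w"
  proof (intro mult_le_mono)
    show "2 ^ card V0 \<le> (2::nat) ^ K" using assms by (intro power_increasing) auto
    show "n choose w \<le> n ^ w" by (cases "w \<le> n") (auto intro: binomial_le_pow simp: binomial_eq_0)
  qed
  finally have cU: "card U \<le> 2 ^ K * n ^ w" .
  have "card {Z \<in> min_bad_sets r n. card (\<Union>Z - V0) = w} \<le> card (\<Union>X\<in>U. Pow (Pow X))"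
    using sub finU finX by (intro card_mono) auto
  also have "\<dots> \<le> (\<Sum>X\<in>U. card (Pow (Pow X)))" by (rule card_UN_le[OF finU])
  also have "\<dots> \<le> (\<Sum>X\<in>U. 2 ^ (2 ^ (8 * r)))"
  proof (rule sum_mono)
    fix X assume X: "X \<in> U"
    have "card (Pow (Pow X)) = 2 ^ (2 ^ card X)" using finX[OF X] by (simp add: card_Pow)
    also have "\<dots> \<le> 2 ^ (2 ^ (8 * r))" using X unfolding U_def by (intro power_increasing) auto
    finally show "card (Pow (Pow X)) \<le> 2 ^ (2 ^ (8 * r))" .
  qed
  also have "\<dots> = card U * 2 ^ (2 ^ (8 * r))" by simp
  also have "\<dots> \<le> 2 ^ K * n ^ w * 2 ^ (2 ^ (8 * r))" using cU by (intro mult_le_mono) auto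
  finally show ?thesis .
qed

text \<open>The constant of \<open>inverse_scale_power\<close>, times the 8r + 1 possible numbers of
  new vertices, times the constant of \<open>card_MB_by_new_vertices\<close>.\<close>

definition attach_const :: "nat \<Rightarrow> nat \<Rightarrow> real" where
  "attach_const r K = (2 * real r) ^ (8 * r) * (real (8 * r + 1) * (2 ^ K * 2 ^ (2 ^ (8 * r))))"

lemma attach_const_nonneg [simp]: "attach_const r K \<ge> 0"
  by (simp add: attach_const_def)

text \<open>With w new vertices there are O(n^w) configurations, each of weight O(n^-(w +
  \<delta>)). It is applied with \<delta> = 0 in general and \<delta> = 1 in the non-tight case of
  \<open>new_vertices_bound\<close>.\<close>

lemma attach_sum_bound:
  assumes r: "r \<ge> 2" and n: "n \<ge> 2 * r" and V0: "finite V0" "card V0 \<le> K"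
    and N: "N \<subseteq> min_bad_sets r n" "\<And>Z. Z \<in> N \<Longrightarrow> card (\<Union>Z - V0) + \<delta> \<le> (r - 2) * card (Z - H)"
  shows "(\<Sum>Z\<in>N. (1 / scale r n) ^ card (Z - H)) \<le> attach_const r K / real n ^ \<delta>"
proof -
  have n1: "real n > 0" using n r by simp
  have finN: "finite N" using N(1) finite_MB finite_subset by blast
  define A where "A = (2 * real r) ^ (8 * r)"
  have "(\<Sum>Z\<in>N. (1 / scale r n) ^ card (Z - H)) \<le> (\<Sum>Z\<in>N. A / real n ^ (card (\<Union>Z - V0) + \<delta>))"
  proof (rule sum_mono)
    fix Z assume Z: "Z \<in> N"
    have "minbad r Z" using Z N(1) by (auto simp: min_bad_sets_def)
    hence "card (Z - H) \<le> 8" using minbad_card(2,4)[of r Z] by (meson Diff_subset card_mono le_trans)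
    thus "(1 / scale r n) ^ card (Z - H) \<le> A / real n ^ (card (\<Union>Z - V0) + \<delta>)"
      unfolding A_def by (rule inverse_scale_power[OF r n _ N(2)[OF Z]])
  qed
  also have "\<dots> = A / real n ^ \<delta> * (\<Sum>Z\<in>N. 1 / real n ^ card (\<Union>Z - V0))"
    by (simp add: sum_distrib_left power_add mult.commute)
  finally have first: "(\<Sum>Z\<in>N. (1 / scale r n) ^ card (Z - H)) \<le> A / real n ^ \<delta> * (\<Sum>Z\<in>N. 1 / real n ^ card (\<Union>Z - V0))" .
  have "(\<Sum>Z\<in>N. 1 / real n ^ card (\<Union>Z - V0))
       = (\<Sum>w\<in>{..8*r}. \<Sum>Z\<in>{Z\<in>N. card (\<Union>Z - V0) = w}. 1 / real n ^ card (\<Union>Z - V0))"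
  proof (rule sum.group[symmetric])
    show "(\<lambda>Z. card (\<Union>Z - V0)) ` N \<subseteq> {..8 * r}"
    proof (rule image_subsetI)
      fix Z assume "Z \<in> N"
      hence Z: "Z \<in> min_bad_sets r n" using N by auto
      hence "finite (\<Union>Z)" using unif_edges[of Z r n] by (auto simp: min_bad_sets_def)
      hence "card (\<Union>Z - V0) \<le> card (\<Union>Z)" by (intro card_mono) auto
      thus "card (\<Union>Z - V0) \<in> {..8 * r}" using card_Union_MB[OF Z r] by simp
    qed
  qed (use finN in auto)
  also have "\<dots> \<le> (\<Sum>w\<in>{..8*r}. 2 ^ K * 2 ^ (2 ^ (8 * r)))"
  proof (rule sum_mono)
    fix w assume "w \<in> {..8 * r}"
    have "(\<Sum>Z\<in>{Z\<in>N. card (\<Union>Z - V0) = w}. 1 / real n ^ card (\<Union>Z - V0))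
        = real (card {Z\<in>N. card (\<Union>Z - V0) = w}) / real n ^ w" by simp
    also have "\<dots> \<le> real (2 ^ K * n ^ w * 2 ^ (2 ^ (8 * r))) / real n ^ w"
    proof (intro divide_right_mono)
      have "card {Z\<in>N. card (\<Union>Z - V0) = w} \<le> card {Z \<in> min_bad_sets r n. card (\<Union>Z - V0) = w}"
        using N(1) by (intro card_mono) auto
      also have "\<dots> \<le> 2 ^ K * n ^ w * 2 ^ (2 ^ (8 * r))"
        by (rule card_MB_by_new_vertices[OF V0 r])
      finally show "real (card {Z\<in>N. card (\<Union>Z - V0) = w}) \<le> real (2 ^ K * n ^ w * 2 ^ (2 ^ (8 * r)))"
        using of_nat_le_iff by blast
    qed simp
    also have "\<dots> = 2 ^ K * 2 ^ (2 ^ (8 * r))" using n1 by simp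
    finally show "(\<Sum>Z\<in>{Z\<in>N. card (\<Union>Z - V0) = w}. 1 / real n ^ card (\<Union>Z - V0)) \<le> 2 ^ K * 2 ^ (2 ^ (8 * r))" .
  qed
  also have "\<dots> = real (8 * r + 1) * (2 ^ K * 2 ^ (2 ^ (8 * r)))" by simp
  finally have "(\<Sum>Z\<in>N. 1 / real n ^ card (\<Union>Z - V0)) \<le> real (8 * r + 1) * (2 ^ K * 2 ^ (2 ^ (8 * r)))" .
  hence "A / real n ^ \<delta> * (\<Sum>Z\<in>N. 1 / real n ^ card (\<Union>Z - V0)) \<le> A / real n ^ \<delta> * (real (8 * r + 1) * (2 ^ K * 2 ^ (2 ^ (8 * r))))"
    by (intro mult_left_mono) (simp_all add: A_def)
  with first have "(\<Sum>Z\<in>N. (1 / scale r n) ^ card (Z - H)) \<le> A / real n ^ \<delta> * (real (8 * r + 1) * (2 ^ K * 2 ^ (2 ^ (8 * r))))"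
    by linarith
  thus ?thesis unfolding attach_const_def A_def by simp
qed

text \<open>A set of size j + 1 arises from sets of size j in j + 1 ways, so the right side only
  overcounts.\<close>

lemma sum_subsets_Suc_le:
  fixes f :: "'a set \<Rightarrow> real"
  assumes "finite A" "\<And>T. f T \<ge> 0"
  shows "(\<Sum>T | T \<subseteq> A \<and> card T = Suc j \<and> P T. f T)
     \<le> (\<Sum>T0 | T0 \<subseteq> A \<and> card T0 = j. \<Sum>z | z \<in> A - T0 \<and> P (insert z T0). f (insert z T0))"
proof -
  define S where "S = Sigma {T0. T0 \<subseteq> A \<and> card T0 = j} (\<lambda>T0. {z. z \<in> A - T0 \<and> P (insert z T0)})"
  have fin: "finite {T0. T0 \<subseteq> A \<and> card T0 = j}"
    by (rule finite_subset[of _ "Pow A"]) (use assms(1) in auto)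
  have finS: "finite S" unfolding S_def using fin assms(1) by (intro finite_SigmaI) auto
  have img: "{T. T \<subseteq> A \<and> card T = Suc j \<and> P T} \<subseteq> (\<lambda>(T0,z). insert z T0) ` S"
  proof
    fix T assume "T \<in> {T. T \<subseteq> A \<and> card T = Suc j \<and> P T}"
    hence T: "T \<subseteq> A" "card T = Suc j" "P T" by auto
    then obtain z T0 where "T = insert z T0" "z \<notin> T0" "card T0 = j" by (metis card_eq_SucD)
    hence "(T0, z) \<in> S" "T = (\<lambda>(T0,z). insert z T0) (T0, z)" using T unfolding S_def by auto
    thus "T \<in> (\<lambda>(T0,z). insert z T0) ` S" by blast
  qed
  have "(\<Sum>T | T \<subseteq> A \<and> card T = Suc j \<and> P T. f T) \<le> sum f ((\<lambda>(T0,z). insert z T0) ` S)"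
    using img finS assms(2) by (intro sum_mono2) auto
  also have "\<dots> \<le> sum (f \<circ> (\<lambda>(T0,z). insert z T0)) S"
    using finS assms(2) by (intro sum_image_le) auto
  also have "\<dots> = (\<Sum>T0 | T0 \<subseteq> A \<and> card T0 = j. \<Sum>z | z \<in> A - T0 \<and> P (insert z T0). f (insert z T0))"
    unfolding S_def using fin assms(1) by (subst sum.Sigma) (auto simp: case_prod_unfold)
  finally show ?thesis .
qed

text \<open>The tight case of \<open>new_vertices_bound\<close>. The edge of \<open>B\<close> in
  \<open>Z\<close> lies inside the contact \<open>b\<close> and therefore equals it, and beyond
  \<open>b\<close> the new member shares no vertex with the family.\<close>

lemma nice_insert:
  assumes r: "r \<ge> 2" and E: "unif r E" "B \<subseteq> E" and n: "nice r E B \<Z>" 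
    and Z: "unif r Z" "minbad r Z" "Z \<inter> B \<noteq> {}"
    and b: "b \<in> Z" "\<Union>Z \<inter> \<Union>(E \<union> \<Union>\<Z>) = b" "exc r Z = 2"
  shows "nice r E B (insert Z \<Z>)"
proof -
  obtain b' where b': "b' \<in> Z" "b' \<in> B" using Z(3) by blast
  have "b' \<subseteq> b" using b' b E(2) by blast
  moreover have "card b' = r" "card b = r" "finite b" using b(1) b'(1) Z(1) unfolding unif_def by blast+
  ultimately have bb: "b' = b" by (simp add: card_subset_eq)
  have V: "\<Union>Z \<inter> \<Union>E = b" using b b' bb E(2) by blast
  have out: "\<Union>Z \<inter> \<Union>Z' \<subseteq> \<Union>E" if "Z' \<in> \<Z>" for Z'
    using b(2) V that by blast
  show ?thesis unfolding nice_def
  proof (intro conjI ballI impI)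
    fix Z1 assume "Z1 \<in> insert Z \<Z>"
    then consider "Z1 = Z" | "Z1 \<in> \<Z>" by blast
    thus "unif r Z1" "minbad r Z1" "exc r Z1 = 2" "\<exists>b\<in>B. b \<in> Z1 \<and> \<Union>Z1 \<inter> \<Union>E = b"
      by (cases; use niceD[OF n] Z b V b' bb in blast)+
  next
    fix Z1 Z2 assume "Z1 \<in> insert Z \<Z>" "Z2 \<in> insert Z \<Z>" "Z1 \<noteq> Z2"
    moreover have "\<Union>Z1 \<inter> \<Union>Z2 \<subseteq> \<Union>E" if "Z1 \<in> \<Z>" "Z2 \<in> \<Z>" "Z1 \<noteq> Z2"
      using n that unfolding nice_def by simp
    ultimately show "\<Union>Z1 \<inter> \<Union>Z2 \<subseteq> \<Union>E"
      using out by (metis Int_commute insert_iff)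
  qed
qed

text \<open>After j members at most K + 8j edges, hence r (K + 8j) vertices, are present. The factor
  2 covers the two ways to obtain a family that is not nice: niceness is lost at the last member or
  was lost before.\<close>

fun fam_const :: "nat \<Rightarrow> nat \<Rightarrow> nat \<Rightarrow> real" where
  "fam_const r K 0 = 1"
| "fam_const r K (Suc j) = 2 * fam_const r K j * attach_const r (r * (K + 8 * j))"

lemma fam_const_nonneg [simp]: "fam_const r K j \<ge> 0"
  by (induction j) auto

text \<open>Configurations are added one at a time, each at total cost O(1), and at cost O(1/n) if
  niceness is lost in that step. So families that are not nice are negligible.\<close>

lemma family_sums:
  assumes r: "r \<ge> 2" and n: "n \<ge> 2 * r"
    and E: "E \<subseteq> edges r n" "conflict_free r E" "card E \<le> K" "B \<subseteq> E"
  shows "(\<Sum>\<Z> | \<Z> \<subseteq> min_bad_meeting r n B \<and> card \<Z> = j. (1 / scale r n) ^ card (\<Union>\<Z> - E)) \<le> fam_const r K j"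
    (is "?A j \<le> _")
    "(\<Sum>\<Z> | \<Z> \<subseteq> min_bad_meeting r n B \<and> card \<Z> = j \<and> \<not> nice r E B \<Z>. (1 / scale r n) ^ card (\<Union>\<Z> - E))
       \<le> fam_const r K j / real n" (is "?N j \<le> _")
proof -
  define D where "D = 1 / scale r n"
  have D0: "D \<ge> 0" "D \<le> 1" unfolding D_def using scale_lower(2)[OF r n] by auto
  have n1: "real n \<ge> 1" using r n by simp
  have uE: "unif r E" by (rule unif_edges[OF E(1)])
  define f where "f \<Z> = D ^ card (\<Union>\<Z> - E)" for \<Z> :: "nat set set set"
  have f0: "f T \<ge> 0" for T unfolding f_def using D0 by simp
  define M where "M = min_bad_meeting r n B"
  have finM: "finite M" unfolding M_def by simp
  have "(\<Sum>\<Z> | \<Z> \<subseteq> M \<and> card \<Z> = j \<and> True. f \<Z>) \<le> fam_const r K j \<and>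
     (\<Sum>\<Z> | \<Z> \<subseteq> M \<and> card \<Z> = j \<and> \<not> nice r E B \<Z>. f \<Z>) \<le> fam_const r K j / real n"
  proof (induction j)
    case 0
    have "{\<Z>. \<Z> \<subseteq> M \<and> card \<Z> = 0 \<and> True} = {{}}" using finM by (auto dest: finite_subset)
    moreover have "{\<Z>. \<Z> \<subseteq> M \<and> card \<Z> = 0 \<and> \<not> nice r E B \<Z>} = {}"
      using finM by (auto dest: finite_subset simp: nice_def)
    ultimately show ?case by (simp only:) (simp add: f_def)
  next
    case (Suc j)
    define C where "C = attach_const r (r * (K + 8 * j))"
    have C0: "C \<ge> 0" unfolding C_def by simp
    have fins: "finite {\<Z>. \<Z> \<subseteq> M \<and> card \<Z> = j}" by (rule finite_subset[of _ "Pow M"]) (use finM in auto)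
    have cnt: "(\<Sum>Z\<in>M - \<Z>0. D ^ card (Z - (E \<union> \<Union>\<Z>0))) \<le> C \<and>
       (nice r E B \<Z>0 \<longrightarrow> (\<Sum>Z | Z \<in> M - \<Z>0 \<and> \<not> nice r E B (insert Z \<Z>0). D ^ card (Z - (E \<union> \<Union>\<Z>0))) \<le> C / real n)"
      if Z0: "\<Z>0 \<subseteq> M" "card \<Z>0 = j" for \<Z>0
    proof -
      define H where "H = E \<union> \<Union>\<Z>0"
      have finZ0: "finite \<Z>0" using Z0 finM finite_subset by blast
      have Hsub: "H \<subseteq> edges r n" using E Z0 unfolding H_def M_def min_bad_meeting_def min_bad_sets_def by blast
      have uH: "unif r H" by (rule unif_edges[OF Hsub])
      have "card (\<Union>\<Z>0) \<le> (\<Sum>Z\<in>\<Z>0. card Z)" using card_Union_le_sum_card by blast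
      also have "\<dots> \<le> (\<Sum>Z\<in>\<Z>0. 8)"
        using Z0 by (intro sum_mono) (auto simp: M_def min_bad_meeting_def min_bad_sets_def minbad_card)
      finally have "card (\<Union>\<Z>0) \<le> 8 * j" using Z0 by simp
      hence cH: "card H \<le> K + 8 * j" using card_Un_le[of E "\<Union>\<Z>0"] E(3) unfolding H_def by linarith
      have "card (\<Union>H) \<le> (\<Sum>e\<in>H. card e)" using card_Union_le_sum_card by blast
      also have "\<dots> = card H * r" using uH by (simp add: unif_def)
      also have "\<dots> \<le> r * (K + 8 * j)" using cH by (simp add: mult.commute)
      finally have cVH: "card (\<Union>H) \<le> r * (K + 8 * j)" .
      have finVH: "finite (\<Union>H)" using uH by simp
      have in_M: "Z \<in> min_bad_sets r n" "unif r Z" "minbad r Z" "Z \<inter> H \<noteq> {}" "Z \<inter> B \<noteq> {}" if "Z \<in> M" for Z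
        using that E(4) unif_edges[of Z r n] unfolding M_def min_bad_meeting_def min_bad_sets_def H_def by auto
      have "(\<Sum>Z\<in>M - \<Z>0. D ^ card (Z - H)) \<le> attach_const r (r * (K + 8 * j)) / real n ^ 0"
        unfolding D_def
      proof (rule attach_sum_bound[OF r n finVH cVH])
        fix Z assume "Z \<in> M - \<Z>0"
        hence Z: "Z \<in> M" by simp
        show "card (\<Union>Z - \<Union>H) + 0 \<le> (r - 2) * card (Z - H)"
          using new_vertices_bound(1)[OF r in_M(2,3,4)[OF Z] order_refl] by simp
      qed (use in_M in auto)
      moreover have "(\<Sum>Z | Z \<in> M - \<Z>0 \<and> \<not> nice r E B (insert Z \<Z>0). D ^ card (Z - H)) \<le> 
          attach_const r (r * (K + 8 * j)) / real n ^ 1" if nc: "nice r E B \<Z>0"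
        unfolding D_def
      proof (rule attach_sum_bound[OF r n finVH cVH])
        show "{Z. Z \<in> M - \<Z>0 \<and> \<not> nice r E B (insert Z \<Z>0)} \<subseteq> min_bad_sets r n" using in_M by auto
        fix Z assume "Z \<in> {Z. Z \<in> M - \<Z>0 \<and> \<not> nice r E B (insert Z \<Z>0)}"
        hence Z: "Z \<in> M" "Z \<notin> \<Z>0" "\<not> nice r E B (insert Z \<Z>0)" by auto
        \<comment> \<open>By \<open>nice_glue\<close> such a \<open>Z\<close> would be an old member
          or disjoint from \<open>E\<close>, but it is new and meets \<open>B\<close>.\<close>
        have nsub: "\<not> Z \<subseteq> H"
        proof
          assume "Z \<subseteq> H"
          hence "Z \<in> \<Z>0 \<or> Z \<inter> E = {}"
            using nice_glue[OF uE E(2) finZ0 nc E(4) r _ in_M(3)[OF Z(1)]] unfolding H_def by blast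
          thus False using Z(2) in_M(5)[OF Z(1)] E(4) by blast
        qed
        show "card (\<Union>Z - \<Union>H) + 1 \<le> (r - 2) * card (Z - H)"
        proof (rule new_vertices_bound(2)[OF r in_M(2,3,4)[OF Z(1)] order_refl nsub], rule notI)
          assume "\<exists>b\<in>H. b \<in> Z \<and> \<Union>Z \<inter> \<Union>H = b \<and> exc r Z = 2"
          then obtain b where "b \<in> Z" "\<Union>Z \<inter> \<Union>H = b" "exc r Z = 2" by blast
          hence "nice r E B (insert Z \<Z>0)"
            using nice_insert[OF r uE E(4) nc in_M(2,3,5)[OF Z(1)], of b] unfolding H_def by blast
          thus False using Z(3) by blast
        qed
      qed
      ultimately show ?thesis unfolding H_def C_def by simp
    qed
    have fins': "f (insert Z \<Z>0) = f \<Z>0 * D ^ card (Z - (E \<union> \<Union>\<Z>0))" if "\<Z>0 \<subseteq> M" "Z \<in> M" for Z \<Z>0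
    proof -
      have eq: "\<Union>(insert Z \<Z>0) - E = (\<Union>\<Z>0 - E) \<union> (Z - (E \<union> \<Union>\<Z>0))" by blast
      have "finite (edges r n)" by simp
      moreover have "\<Union>\<Z>0 \<subseteq> edges r n" "Z \<subseteq> edges r n" using that unfolding M_def min_bad_meeting_def min_bad_sets_def by blast+
      ultimately have "finite (\<Union>\<Z>0)" "finite Z" using finite_subset by blast+
      hence "card (\<Union>(insert Z \<Z>0) - E) = card (\<Union>\<Z>0 - E) + card (Z - (E \<union> \<Union>\<Z>0))"
        unfolding eq by (intro card_Un_disjoint) auto
      thus ?thesis unfolding f_def by (simp add: power_add)
    qed
    have IH: "(\<Sum>\<Z> | \<Z> \<subseteq> M \<and> card \<Z> = j. f \<Z>) \<le> fam_const r K j"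
      "(\<Sum>\<Z> | \<Z> \<subseteq> M \<and> card \<Z> = j \<and> \<not> nice r E B \<Z>. f \<Z>) \<le> fam_const r K j / real n" using Suc by auto
    have "(\<Sum>\<Z> | \<Z> \<subseteq> M \<and> card \<Z> = Suc j \<and> True. f \<Z>)
       \<le> (\<Sum>\<Z>0 | \<Z>0 \<subseteq> M \<and> card \<Z>0 = j. \<Sum>Z | Z \<in> M - \<Z>0 \<and> True. f (insert Z \<Z>0))"
      by (rule sum_subsets_Suc_le[OF finM f0])
    also have "\<dots> = (\<Sum>\<Z>0 | \<Z>0 \<subseteq> M \<and> card \<Z>0 = j. f \<Z>0 * (\<Sum>Z\<in>M - \<Z>0. D ^ card (Z - (E \<union> \<Union>\<Z>0))))"
      by (intro sum.cong) (auto simp: sum_distrib_left fins' set_diff_eq)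
    also have "\<dots> \<le> (\<Sum>\<Z>0 | \<Z>0 \<subseteq> M \<and> card \<Z>0 = j. f \<Z>0 * C)"
      using cnt f0 by (intro sum_mono mult_left_mono) auto
    also have "\<dots> = (\<Sum>\<Z>0 | \<Z>0 \<subseteq> M \<and> card \<Z>0 = j. f \<Z>0) * C" by (simp add: sum_distrib_right)
    also have "\<dots> \<le> fam_const r K j * C" using IH C0 by (intro mult_right_mono)
    also have "\<dots> \<le> fam_const r K (Suc j)" using C0 by (simp add: C_def)
    finally have one: "(\<Sum>\<Z> | \<Z> \<subseteq> M \<and> card \<Z> = Suc j \<and> True. f \<Z>) \<le> fam_const r K (Suc j)" .
    have "(\<Sum>\<Z> | \<Z> \<subseteq> M \<and> card \<Z> = Suc j \<and> \<not> nice r E B \<Z>. f \<Z>)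
       \<le> (\<Sum>\<Z>0 | \<Z>0 \<subseteq> M \<and> card \<Z>0 = j. \<Sum>Z | Z \<in> M - \<Z>0 \<and> \<not> nice r E B (insert Z \<Z>0). f (insert Z \<Z>0))"
      by (rule sum_subsets_Suc_le[OF finM f0])
    also have "\<dots> = (\<Sum>\<Z>0 | \<Z>0 \<subseteq> M \<and> card \<Z>0 = j. f \<Z>0 *
         (\<Sum>Z | Z \<in> M - \<Z>0 \<and> \<not> nice r E B (insert Z \<Z>0). D ^ card (Z - (E \<union> \<Union>\<Z>0))))"
      by (intro sum.cong) (auto simp: sum_distrib_left fins')
    \<comment> \<open>A nice family pays only C/n for losing niceness; a family that is not nice
      pays C, but its own weight is already O(1/n).\<close>
    also have "\<dots> \<le> (\<Sum>\<Z>0 | \<Z>0 \<subseteq> M \<and> card \<Z>0 = j. f \<Z>0 * (C / real n) + (if \<not> nice r E B \<Z>0 then f \<Z>0 * C else 0))"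
    proof (rule sum_mono)
      fix \<Z>0 assume "\<Z>0 \<in> {\<Z>0. \<Z>0 \<subseteq> M \<and> card \<Z>0 = j}"
      hence Z0: "\<Z>0 \<subseteq> M" "card \<Z>0 = j" by auto
      let ?s = "(\<Sum>Z | Z \<in> M - \<Z>0 \<and> \<not> nice r E B (insert Z \<Z>0). D ^ card (Z - (E \<union> \<Union>\<Z>0)))"
      have "?s \<le> (\<Sum>Z\<in>M - \<Z>0. D ^ card (Z - (E \<union> \<Union>\<Z>0)))"
        using finM D0 by (intro sum_mono2) auto
      hence sC: "?s \<le> C" using cnt[OF Z0] by linarith
      have Cn: "C / real n \<ge> 0" using C0 by simp
      show "f \<Z>0 * ?s \<le> f \<Z>0 * (C / real n) + (if \<not> nice r E B \<Z>0 then f \<Z>0 * C else 0)"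
      proof (cases "nice r E B \<Z>0")
        case True
        hence "?s \<le> C / real n" using cnt[OF Z0] by blast
        hence "f \<Z>0 * ?s \<le> f \<Z>0 * (C / real n)" using f0 by (rule mult_left_mono)
        thus ?thesis using True by (simp only: not_True_eq_False if_False add_0_right)
      next
        case False
        have "f \<Z>0 * ?s \<le> f \<Z>0 * C" using sC f0 by (intro mult_left_mono)
        moreover have "f \<Z>0 * (C / real n) \<ge> 0" using Cn f0 by (intro mult_nonneg_nonneg)
        ultimately show ?thesis using False by simp
      qed
    qed
    also have "\<dots> = (\<Sum>\<Z>0 | \<Z>0 \<subseteq> M \<and> card \<Z>0 = j. f \<Z>0) * (C / real n)
       + (\<Sum>\<Z>0 | \<Z>0 \<subseteq> M \<and> card \<Z>0 = j \<and> \<not> nice r E B \<Z>0. f \<Z>0) * C"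
    proof -
      have "(\<Sum>\<Z>0 | \<Z>0 \<subseteq> M \<and> card \<Z>0 = j. (if \<not> nice r E B \<Z>0 then f \<Z>0 * C else 0))
          = (\<Sum>\<Z>0 | \<Z>0 \<subseteq> M \<and> card \<Z>0 = j \<and> \<not> nice r E B \<Z>0. f \<Z>0 * C)"
        by (rule sum.mono_neutral_cong_right[OF fins]) auto
      thus ?thesis by (simp only: sum.distrib sum_distrib_right)
    qed
    also have "\<dots> \<le> fam_const r K j * (C / real n) + fam_const r K j / real n * C"
      using IH C0 by (intro add_mono mult_right_mono) auto
    also have "\<dots> = fam_const r K (Suc j) / real n" by (simp add: C_def)
    finally show ?case using one by simp
  qed
  thus "?A j \<le> fam_const r K j" "?N j \<le> fam_const r K j / real n"
    unfolding f_def D_def M_def by simp_all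
qed

section \<open>One round of the random process\<close>

definition incl_prob :: "nat \<Rightarrow> nat \<Rightarrow> (nat set set \<Rightarrow> real) \<Rightarrow> nat set set \<Rightarrow> real" where
  "incl_prob r n \<mu> E = (\<Sum>S\<in>Pow (edges r n). \<mu> S * of_bool (E \<subseteq> S))"

text \<open>
  Random conflict-free hypergraphs are represented by weight functions on
  \<open>Pow (edges r n)\<close>; sums over that finite set replace a probability space.
\<close>

definition state :: "nat \<Rightarrow> nat \<Rightarrow> (nat set set \<Rightarrow> real) \<Rightarrow> bool" where
  "state r n \<mu> \<longleftrightarrow> (\<forall>S. \<mu> S \<ge> 0) \<and> (\<Sum>S\<in>Pow (edges r n). \<mu> S) = 1 \<and> (\<forall>S. \<mu> S \<noteq> 0 \<longrightarrow> conflict_free r S)"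

definition bernoulli_weight :: "nat \<Rightarrow> nat \<Rightarrow> real \<Rightarrow> nat set set \<Rightarrow> real" where
  "bernoulli_weight r n p X = p ^ card X * (1 - p) ^ card (edges r n - X)"

text \<open>
  One round: a random edge set \<open>X\<close> is offered to \<open>S\<close>, and an offered edge is
  discarded as soon as it completes a minimal configuration with \<open>S \<union> X\<close>.
\<close>

definition accept :: "nat \<Rightarrow> nat set set \<Rightarrow> nat set set \<Rightarrow> nat set set" where
  "accept r S X = {e \<in> X - S. \<forall>Z. minbad r Z \<longrightarrow> e \<in> Z \<longrightarrow> \<not> Z \<subseteq> S \<union> X}"

definition round_expectation :: "nat \<Rightarrow> nat \<Rightarrow> real \<Rightarrow> (nat set set \<Rightarrow> real) \<Rightarrow> (nat set set \<Rightarrow> nat set set \<Rightarrow> real) \<Rightarrow> real" where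
  "round_expectation r n p \<mu> f = (\<Sum>S\<in>Pow (edges r n). \<Sum>X\<in>Pow (edges r n). \<mu> S * bernoulli_weight r n p X * f S X)"

text \<open>The law of the hypergraph after the round: the image of the product law of
  \<open>S\<close> and \<open>X\<close>.\<close>

definition step :: "nat \<Rightarrow> nat \<Rightarrow> real \<Rightarrow> (nat set set \<Rightarrow> real) \<Rightarrow> nat set set \<Rightarrow> real" where
  "step r n p \<mu> S' = round_expectation r n p \<mu> (\<lambda>S X. of_bool (S \<union> accept r S X = S'))"

lemma bern_nonneg: "0 \<le> p \<Longrightarrow> p \<le> 1 \<Longrightarrow> bernoulli_weight r n p X \<ge> 0"
  by (simp add: bernoulli_weight_def)

text \<open>Expand the product over all edges of p plus a second term that is 0 on \<open>G\<close>
  and 1 - p elsewhere.\<close>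

lemma sum_bern_superset:
  assumes "G \<subseteq> edges r n"
  shows "(\<Sum>X\<in>Pow (edges r n). bernoulli_weight r n p X * of_bool (G \<subseteq> X)) = p ^ card G"
proof -
  have finG: "finite G" using assms finite_edges finite_subset by blast
  have "(\<Sum>X\<in>Pow (edges r n). bernoulli_weight r n p X * of_bool (G \<subseteq> X))
      = (\<Sum>X\<in>Pow (edges r n). (\<Prod>x\<in>X. p) * (\<Prod>x\<in>edges r n - X. if x \<in> G then 0 else 1 - p))"
  proof (rule sum.cong[OF refl])
    fix X assume X: "X \<in> Pow (edges r n)"
    show "bernoulli_weight r n p X * of_bool (G \<subseteq> X) = (\<Prod>x\<in>X. p) * (\<Prod>x\<in>edges r n - X. if x \<in> G then 0 else 1 - p)"
    proof (cases "G \<subseteq> X")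
      case True
      have "(\<Prod>x\<in>edges r n - X. if x \<in> G then 0 else 1 - p) = (\<Prod>x\<in>edges r n - X. 1 - p)"
        by (rule prod.cong) (use True in auto)
      thus ?thesis using True by (simp add: bernoulli_weight_def)
    next
      case False
      then obtain x where "x \<in> G" "x \<notin> X" by blast
      hence "(\<Prod>x\<in>edges r n - X. if x \<in> G then 0 else 1 - p) = 0"
        using assms by (intro prod_zero) auto
      thus ?thesis using False by simp
    qed
  qed
  also have "\<dots> = (\<Prod>x\<in>edges r n. p + (if x \<in> G then 0 else 1 - p))"
    by (rule prod_add[symmetric]) simp
  also have "\<dots> = (\<Prod>x\<in>edges r n. if x \<in> G then p else 1)"
    by (rule prod.cong) auto
  also have "\<dots> = (\<Prod>x\<in>G. p)"
    using assms by (simp add: prod.If_cases Int_absorb1)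
  finally show ?thesis by simp
qed

lemma sum_bern: "(\<Sum>X\<in>Pow (edges r n). bernoulli_weight r n p X) = 1"
  using sum_bern_superset[of "{}" r n p] by simp

lemma Ex2_add: "round_expectation r n p \<mu> (\<lambda>S X. f S X + g S X) = round_expectation r n p \<mu> f + round_expectation r n p \<mu> g"
  by (simp add: round_expectation_def sum.distrib distrib_left)

lemma Ex2_cmult: "round_expectation r n p \<mu> (\<lambda>S X. c * f S X) = c * round_expectation r n p \<mu> f"
  by (simp add: round_expectation_def sum_distrib_left mult_ac)

lemma Ex2_sum: "round_expectation r n p \<mu> (\<lambda>S X. \<Sum>i\<in>I. f i S X) = (\<Sum>i\<in>I. round_expectation r n p \<mu> (f i))"
proof (induction I rule: infinite_finite_induct)
  case (insert x F)
  thus ?case by (simp add: Ex2_add)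
qed (simp_all add: round_expectation_def)

lemma Ex2_cong:
  assumes "\<And>S X. S \<subseteq> edges r n \<Longrightarrow> X \<subseteq> edges r n \<Longrightarrow> \<mu> S \<noteq> 0 \<Longrightarrow> f S X = g S X"
  shows "round_expectation r n p \<mu> f = round_expectation r n p \<mu> g"
  unfolding round_expectation_def
proof (intro sum.cong refl)
  fix S X assume "S \<in> Pow (edges r n)" "X \<in> Pow (edges r n)"
  thus "\<mu> S * bernoulli_weight r n p X * f S X = \<mu> S * bernoulli_weight r n p X * g S X"
    using assms[of S X] by (cases "\<mu> S = 0") auto
qed

lemma Ex2_mono:
  assumes "state r n \<mu>" "0 \<le> p" "p \<le> 1"
    "\<And>S X. S \<subseteq> edges r n \<Longrightarrow> X \<subseteq> edges r n \<Longrightarrow> f S X \<le> g S X"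
  shows "round_expectation r n p \<mu> f \<le> round_expectation r n p \<mu> g"
  unfolding round_expectation_def using assms bern_nonneg[OF assms(2,3)]
  by (intro sum_mono mult_left_mono mult_nonneg_nonneg) (auto simp: state_def)

lemma incl_nonneg: "state r n \<mu> \<Longrightarrow> incl_prob r n \<mu> E \<ge> 0"
  unfolding incl_prob_def state_def by (intro sum_nonneg) auto

lemma incl_not_cf: "state r n \<mu> \<Longrightarrow> \<not> conflict_free r E \<Longrightarrow> incl_prob r n \<mu> E = 0"
  unfolding incl_prob_def state_def by (intro sum.neutral) (auto intro: cf_subset)

lemma upd_subset: "S \<subseteq> edges r n \<Longrightarrow> X \<subseteq> edges r n \<Longrightarrow> S \<union> accept r S X \<subseteq> edges r n"
  by (auto simp: accept_def)

text \<open>A minimal bad set in the result would contain an accepted edge and lie in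
  \<open>S \<union> X\<close>; that edge would have been discarded.\<close>

lemma cf_upd:
  assumes "conflict_free r S"
  shows "conflict_free r (S \<union> accept r S X)"
  unfolding cf_iff_no_minbad
proof (intro allI impI notI)
  fix Z assume Z: "Z \<subseteq> S \<union> accept r S X" "minbad r Z"
  show False
  proof (cases "Z \<subseteq> S")
    case True thus False using assms Z by (simp add: cf_iff_no_minbad)
  next
    case False
    then obtain e where "e \<in> Z" "e \<in> accept r S X" using Z by blast
    moreover have "Z \<subseteq> S \<union> X" using Z unfolding accept_def by blast
    ultimately show False using Z(2) unfolding accept_def by blast
  qed
qed

lemma sum_step:
  "(\<Sum>S'\<in>Pow (edges r n). step r n p \<mu> S' * g S') = round_expectation r n p \<mu> (\<lambda>S X. g (S \<union> accept r S X))"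
proof -
  have "(\<Sum>S'\<in>Pow (edges r n). step r n p \<mu> S' * g S')
     = round_expectation r n p \<mu> (\<lambda>S X. \<Sum>S'\<in>Pow (edges r n). g S' * of_bool (S \<union> accept r S X = S'))"
    unfolding step_def Ex2_sum by (intro sum.cong refl) (simp add: Ex2_cmult mult.commute)
  also have "\<dots> = round_expectation r n p \<mu> (\<lambda>S X. g (S \<union> accept r S X))"
  proof (rule Ex2_cong)
    fix S X assume "S \<subseteq> edges r n" "X \<subseteq> edges r n"
    hence "S \<union> accept r S X \<in> Pow (edges r n)" using upd_subset by simp
    hence "(\<Sum>S'\<in>Pow (edges r n). if S \<union> accept r S X = S' then g S' else 0) = g (S \<union> accept r S X)"
      by (subst sum.delta') auto
    thus "(\<Sum>S'\<in>Pow (edges r n). g S' * of_bool (S \<union> accept r S X = S')) = g (S \<union> accept r S X)"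
      by (simp add: of_bool_def if_distrib cong: if_cong)
  qed
  finally show ?thesis .
qed

lemma incl_step: "incl_prob r n (step r n p \<mu>) E = round_expectation r n p \<mu> (\<lambda>S X. of_bool (E \<subseteq> S \<union> accept r S X))"
  unfolding incl_prob_def by (rule sum_step)

lemma state_step:
  assumes "state r n \<mu>" "0 \<le> p" "p \<le> 1"
  shows "state r n (step r n p \<mu>)"
  unfolding state_def
proof (intro conjI allI impI)
  fix S'
  show "step r n p \<mu> S' \<ge> 0"
    unfolding step_def round_expectation_def using assms bern_nonneg[OF assms(2,3)]
    by (intro sum_nonneg mult_nonneg_nonneg) (auto simp: state_def)
  assume ne: "step r n p \<mu> S' \<noteq> 0"
  show "conflict_free r S'"
  proof (rule ccontr)
    assume "\<not> conflict_free r S'"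
    hence "step r n p \<mu> S' = round_expectation r n p \<mu> (\<lambda>S X. 0)"
      unfolding step_def using assms(1) cf_upd by (intro Ex2_cong) (auto simp: state_def)
    thus False using ne by (simp add: round_expectation_def)
  qed
next
  have "(\<Sum>S'\<in>Pow (edges r n). step r n p \<mu> S') = round_expectation r n p \<mu> (\<lambda>S X. 1)"
    using sum_step[of r n p \<mu> "\<lambda>_. 1"] by simp
  also have "\<dots> = (\<Sum>S\<in>Pow (edges r n). \<mu> S * (\<Sum>X\<in>Pow (edges r n). bernoulli_weight r n p X))"
    by (simp add: round_expectation_def sum_distrib_left)
  also have "\<dots> = 1" using assms(1) by (simp add: sum_bern state_def)
  finally show "(\<Sum>S'\<in>Pow (edges r n). step r n p \<mu> S') = 1" .
qed

section \<open>Edges already present and edges newly offered\<close>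

definition split_prob :: "nat \<Rightarrow> nat \<Rightarrow> real \<Rightarrow> (nat set set \<Rightarrow> real) \<Rightarrow> nat set set \<Rightarrow> nat set set \<Rightarrow> real" where
  "split_prob r n p \<mu> A B = round_expectation r n p \<mu> (\<lambda>S X. of_bool (A \<subseteq> S \<and> B \<subseteq> X - S))"

lemma split_prob_eq:
  assumes "B \<subseteq> edges r n"
  shows "split_prob r n p \<mu> A B = p ^ card B * (\<Sum>S\<in>Pow (edges r n). \<mu> S * of_bool (A \<subseteq> S \<and> B \<inter> S = {}))"
proof -
  have "split_prob r n p \<mu> A B = (\<Sum>S\<in>Pow (edges r n). \<mu> S * of_bool (A \<subseteq> S \<and> B \<inter> S = {}) *
         (\<Sum>X\<in>Pow (edges r n). bernoulli_weight r n p X * of_bool (B \<subseteq> X)))"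
    unfolding split_prob_def round_expectation_def sum_distrib_left
    by (intro sum.cong refl) auto
  thus ?thesis unfolding sum_bern_superset[OF assms] by (simp only: sum_distrib_left mult_ac)
qed

text \<open>\<open>X\<close> is independent of \<open>S\<close>. The lower bound gives away, by a
  union bound, the event that some edge of \<open>B\<close> is already present.\<close>

lemma split_prob_bounds:
  assumes "state r n \<mu>" "0 \<le> p" "B \<subseteq> edges r n"
  shows "split_prob r n p \<mu> A B \<le> p ^ card B * incl_prob r n \<mu> A"
    "split_prob r n p \<mu> A B \<ge> p ^ card B * (incl_prob r n \<mu> A - (\<Sum>b\<in>B. incl_prob r n \<mu> (insert b A)))"
    "0 \<le> split_prob r n p \<mu> A B"
proof -
  have mu: "\<mu> S \<ge> 0" for S using assms(1) by (simp add: state_def)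
  have finB: "finite B" using assms(3) finite_edges finite_subset by blast
  have "(\<Sum>S\<in>Pow (edges r n). \<mu> S * of_bool (A \<subseteq> S \<and> B \<inter> S = {})) \<le> incl_prob r n \<mu> A"
    unfolding incl_prob_def using mu by (intro sum_mono mult_left_mono) auto
  thus "split_prob r n p \<mu> A B \<le> p ^ card B * incl_prob r n \<mu> A"
    unfolding split_prob_eq[OF assms(3)] using assms(2) by (intro mult_left_mono) auto
  have "incl_prob r n \<mu> A - (\<Sum>b\<in>B. incl_prob r n \<mu> (insert b A)) =
     (\<Sum>S\<in>Pow (edges r n). \<mu> S * (of_bool (A \<subseteq> S) - (\<Sum>b\<in>B. of_bool (insert b A \<subseteq> S))))"
  proof -
    have "(\<Sum>b\<in>B. incl_prob r n \<mu> (insert b A)) = (\<Sum>S\<in>Pow (edges r n). \<mu> S * (\<Sum>b\<in>B. of_bool (insert b A \<subseteq> S)))"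
      unfolding incl_prob_def sum_distrib_left by (rule sum.swap)
    thus ?thesis unfolding incl_prob_def[of r n \<mu> A] by (simp only: right_diff_distrib sum_subtractf)
  qed
  also have "\<dots> \<le> (\<Sum>S\<in>Pow (edges r n). \<mu> S * of_bool (A \<subseteq> S \<and> B \<inter> S = {}))"
  proof (intro sum_mono mult_left_mono mu)
    fix S
    show "of_bool (A \<subseteq> S) - (\<Sum>b\<in>B. of_bool (insert b A \<subseteq> S)) \<le> (of_bool (A \<subseteq> S \<and> B \<inter> S = {}) :: real)"
    proof (cases "A \<subseteq> S \<and> B \<inter> S \<noteq> {}")
      case True
      then obtain b where b: "b \<in> B" "b \<in> S" by blast
      have "of_bool (insert b A \<subseteq> S) \<le> (\<Sum>b\<in>B. of_bool (insert b A \<subseteq> S) :: real)"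
        using b finB by (intro member_le_sum) auto
      thus ?thesis using True b by simp
    next
      case False
      have "(\<Sum>b\<in>B. of_bool (insert b A \<subseteq> S) :: real) \<ge> 0" by (intro sum_nonneg) auto
      moreover have "(of_bool (A \<subseteq> S) :: real) = of_bool (A \<subseteq> S \<and> B \<inter> S = {})" using False by auto
      ultimately show ?thesis by linarith
    qed
  qed
  finally show "split_prob r n p \<mu> A B \<ge> p ^ card B * (incl_prob r n \<mu> A - (\<Sum>b\<in>B. incl_prob r n \<mu> (insert b A)))"
    unfolding split_prob_eq[OF assms(3)] using assms(2) by (intro mult_left_mono) auto
  show "0 \<le> split_prob r n p \<mu> A B"
    unfolding split_prob_eq[OF assms(3)] using assms(2) mu by (intro mult_nonneg_nonneg sum_nonneg) auto
qed

text \<open>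
  An upper bound without error term, valid for all \<open>E\<close>; \<open>pure\<close> below is the sharp
  asymptotics, but only for conflict-free \<open>E\<close> of bounded size.
\<close>

definition apriori :: "nat \<Rightarrow> nat \<Rightarrow> real \<Rightarrow> (nat set set \<Rightarrow> real) \<Rightarrow> bool" where
  "apriori r n c \<mu> \<longleftrightarrow> (\<forall>E\<subseteq>edges r n. incl_prob r n \<mu> E \<le> (c / scale r n) ^ card E)"

lemma sum_Pow_binomial:
  fixes a b :: real
  assumes "finite G"
  shows "(\<Sum>H\<in>Pow G. a ^ card H * b ^ card (G - H)) = (a + b) ^ card G"
  using prod_add[OF assms, of "\<lambda>_. a" "\<lambda>_. b"] by simp

text \<open>Every edge of \<open>E\<close> is old or offered; dropping the condition of acceptance
  only enlarges the event, and the binomial theorem sums the splits to (c/D + \<alpha>/D)^|E| with D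
  = \<open>scale r n\<close>.\<close>

lemma apriori_step:
  assumes "state r n \<mu>" "apriori r n c \<mu>" "0 \<le> p" "p \<le> 1" "p = \<alpha> / scale r n" "r \<ge> 2" "n \<ge> 2 * r" "c \<ge> 0"
  shows "apriori r n (c + \<alpha>) (step r n p \<mu>)"
  unfolding apriori_def
proof (intro allI impI)
  fix E assume E: "E \<subseteq> edges r n"
  hence finE: "finite E" using finite_edges finite_subset by blast
  have "incl_prob r n (step r n p \<mu>) E \<le> round_expectation r n p \<mu> (\<lambda>S X. \<Sum>B\<in>Pow E. of_bool (E - B \<subseteq> S \<and> B \<subseteq> X - S))"
    unfolding incl_step
  proof (rule Ex2_mono[OF assms(1,3,4)])
    fix S X
    show "of_bool (E \<subseteq> S \<union> accept r S X) \<le> (\<Sum>B\<in>Pow E. of_bool (E - B \<subseteq> S \<and> B \<subseteq> X - S) :: real)"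
    proof (cases "E \<subseteq> S \<union> accept r S X")
      case True
      hence "E - (E - S) \<subseteq> S \<and> E - S \<subseteq> X - S" unfolding accept_def by blast
      hence "(1::real) = of_bool (E - (E - S) \<subseteq> S \<and> E - S \<subseteq> X - S)" by simp
      also have "\<dots> \<le> (\<Sum>B\<in>Pow E. of_bool (E - B \<subseteq> S \<and> B \<subseteq> X - S) :: real)"
        using finE by (intro member_le_sum[of "E - S" "Pow E" "\<lambda>B. of_bool (E - B \<subseteq> S \<and> B \<subseteq> X - S)"]) auto
      finally show ?thesis using True by simp
    qed (auto intro: sum_nonneg)
  qed
  also have "\<dots> = (\<Sum>B\<in>Pow E. split_prob r n p \<mu> (E - B) B)"
    unfolding Ex2_sum split_prob_def ..
  also have "\<dots> \<le> (\<Sum>B\<in>Pow E. p ^ card B * (c / scale r n) ^ card (E - B))"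
  proof (rule sum_mono)
    fix B assume B: "B \<in> Pow E"
    have "split_prob r n p \<mu> (E - B) B \<le> p ^ card B * incl_prob r n \<mu> (E - B)"
      using B E by (intro split_prob_bounds[OF assms(1,3)]) auto
    also have "\<dots> \<le> p ^ card B * (c / scale r n) ^ card (E - B)"
    proof (rule mult_left_mono)
      have "E - B \<subseteq> edges r n" using E by blast
      thus "incl_prob r n \<mu> (E - B) \<le> (c / scale r n) ^ card (E - B)" using assms(2) unfolding apriori_def by blast
    qed (use assms(3) in simp)
    finally show "split_prob r n p \<mu> (E - B) B \<le> p ^ card B * (c / scale r n) ^ card (E - B)" .
  qed
  also have "\<dots> = (p + c / scale r n) ^ card E" by (rule sum_Pow_binomial[OF finE])
  also have "p + c / scale r n = (c + \<alpha>) / scale r n" using assms(5) by (simp add: add_divide_distrib)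
  finally show "incl_prob r n (step r n p \<mu>) E \<le> ((c + \<alpha>) / scale r n) ^ card E" .
qed

text \<open>For positive w the sum truncated at J is (-1)^J times w - 1 over J, which Pascal's rule
  bounds by w over J + 1.\<close>

lemma bonferroni:
  "\<bar>of_bool (w = 0) - (\<Sum>j\<le>J. (-1) ^ j * real (w choose j))\<bar> \<le> real (w choose (Suc J))"
proof (cases w)
  case 0
  have "(\<Sum>j\<le>J. (-1) ^ j * real (0 choose j)) = (\<Sum>j\<in>{0}. (-1) ^ j * real (0 choose j))"
    by (rule sum.mono_neutral_right) auto
  thus ?thesis using 0 by simp
next
  case (Suc v)
  have "(\<Sum>j\<le>J. (-1) ^ j * real (w choose j)) = (\<Sum>j\<le>J. (real w gchoose j) * (-1) ^ j)"
    by (simp add: binomial_gbinomial mult.commute)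
  also have "\<dots> = (-1) ^ J * (real w - 1 gchoose J)" by (rule gbinomial_sum_lower_neg)
  also have "real w - 1 = real v" using Suc by simp
  finally have "(\<Sum>j\<le>J. (-1) ^ j * real (w choose j)) = (-1) ^ J * real (v choose J)"
    by (simp add: binomial_gbinomial)
  thus ?thesis using Suc by (simp add: abs_mult)
qed

section \<open>Inclusion and exclusion over the obstructions to acceptance\<close>

definition hits :: "nat \<Rightarrow> nat \<Rightarrow> nat set set \<Rightarrow> nat set set \<Rightarrow> nat set set \<Rightarrow> nat set set set" where
  "hits r n B S X = {Z \<in> min_bad_meeting r n B. Z \<subseteq> S \<union> X}"

definition fam_prob :: "nat \<Rightarrow> nat \<Rightarrow> real \<Rightarrow> (nat set set \<Rightarrow> real) \<Rightarrow> nat set set \<Rightarrow> nat set set \<Rightarrow> nat set set set \<Rightarrow> real" where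
  "fam_prob r n p \<mu> A B \<Z> = round_expectation r n p \<mu> (\<lambda>S X. of_bool (A \<subseteq> S \<and> B \<subseteq> X - S \<and> \<Union>\<Z> \<subseteq> S \<union> X))"

definition new_prob :: "nat \<Rightarrow> nat \<Rightarrow> real \<Rightarrow> (nat set set \<Rightarrow> real) \<Rightarrow> nat set set \<Rightarrow> nat set set \<Rightarrow> real" where
  "new_prob r n p \<mu> A B = round_expectation r n p \<mu> (\<lambda>S X. of_bool (A \<subseteq> S \<and> B \<subseteq> X - S \<and> card (hits r n B S X) = 0))"

text \<open>The events are disjoint, since the new part of \<open>E\<close> can only be
  \<open>E - S\<close>. It is accepted as a whole exactly when no minimal bad set through one of its
  edges lies in \<open>S \<union> X\<close>.\<close>

lemma incl_step_decompose:
  assumes E: "E \<subseteq> edges r n"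
  shows "incl_prob r n (step r n p \<mu>) E = (\<Sum>B\<in>Pow E. new_prob r n p \<mu> (E - B) B)"
  unfolding incl_step new_prob_def Ex2_sum[symmetric]
proof (rule Ex2_cong)
  fix S X assume SX: "S \<subseteq> edges r n" "X \<subseteq> edges r n"
  have finE: "finite E" using E finite_edges finite_subset by blast
  have eq: "of_bool (E - B \<subseteq> S \<and> B \<subseteq> X - S \<and> card (hits r n B S X) = 0)
     = (if B = E - S then of_bool (E \<subseteq> S \<union> accept r S X) else 0 :: real)" if B: "B \<subseteq> E" for B
  proof (cases "E - B \<subseteq> S \<and> B \<subseteq> X - S")
    case True
    hence BE: "B = E - S" using B by blast
    have "card (hits r n B S X) = 0 \<longleftrightarrow> hits r n B S X = {}" by (simp add: hits_def)
    also have "\<dots> \<longleftrightarrow> (\<forall>b\<in>B. \<forall>Z. minbad r Z \<longrightarrow> b \<in> Z \<longrightarrow> \<not> Z \<subseteq> S \<union> X)"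
    proof
      assume h: "hits r n B S X = {}"
      show "\<forall>b\<in>B. \<forall>Z. minbad r Z \<longrightarrow> b \<in> Z \<longrightarrow> \<not> Z \<subseteq> S \<union> X"
      proof (intro ballI allI impI notI)
        fix b Z assume Z: "b \<in> B" "minbad r Z" "b \<in> Z" "Z \<subseteq> S \<union> X"
        have "Z \<subseteq> edges r n" using Z(4) Un_least[OF SX] by (rule order_trans)
        hence "Z \<in> hits r n B S X"
          unfolding hits_def min_bad_meeting_def min_bad_sets_def using Z by auto
        thus False using h by simp
      qed
    next
      assume a: "\<forall>b\<in>B. \<forall>Z. minbad r Z \<longrightarrow> b \<in> Z \<longrightarrow> \<not> Z \<subseteq> S \<union> X"
      show "hits r n B S X = {}"
      proof (rule equals0I)
        fix Z assume "Z \<in> hits r n B S X"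
        hence Z: "minbad r Z" "Z \<inter> B \<noteq> {}" "Z \<subseteq> S \<union> X"
          unfolding hits_def min_bad_meeting_def min_bad_sets_def by auto
        then obtain b where "b \<in> B" "b \<in> Z" by blast
        thus False using a Z by simp
      qed
    qed
    also have "\<dots> \<longleftrightarrow> E \<subseteq> S \<union> accept r S X" unfolding accept_def using True BE by blast
    finally show ?thesis using True BE by simp
  next
    case False
    have "\<not> E \<subseteq> S \<union> accept r S X" if "B = E - S" using False that unfolding accept_def by blast
    thus ?thesis using False by auto
  qed
  have "(\<Sum>B\<in>Pow E. of_bool (E - B \<subseteq> S \<and> B \<subseteq> X - S \<and> card (hits r n B S X) = 0) :: real)
     = (\<Sum>B\<in>Pow E. if B = E - S then of_bool (E \<subseteq> S \<union> accept r S X) else 0)"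
    by (intro sum.cong refl eq) auto
  also have "\<dots> = of_bool (E \<subseteq> S \<union> accept r S X)" using finE by (subst sum.delta) auto
  finally show "of_bool (E \<subseteq> S \<union> accept r S X) =
      (\<Sum>B\<in>Pow E. of_bool (E - B \<subseteq> S \<and> B \<subseteq> X - S \<and> card (hits r n B S X) = 0) :: real)" ..
qed

text \<open>The coefficient counts families of j obstructions, which turns the Bonferroni sums into
  sums of containment probabilities.\<close>

lemma binomial_hits:
  "real (card (hits r n B S X) choose j) = (\<Sum>\<Z> | \<Z> \<subseteq> min_bad_meeting r n B \<and> card \<Z> = j. of_bool (\<Union>\<Z> \<subseteq> S \<union> X))"
proof -
  have fin: "finite {\<Z>. \<Z> \<subseteq> min_bad_meeting r n B \<and> card \<Z> = j}"
    by (rule finite_subset[of _ "Pow (min_bad_meeting r n B)"]) auto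
  have "finite (hits r n B S X)" by (simp add: hits_def)
  hence "card (hits r n B S X) choose j = card {\<Z>. \<Z> \<subseteq> hits r n B S X \<and> card \<Z> = j}"
    by (simp add: n_subsets)
  also have "{\<Z>. \<Z> \<subseteq> hits r n B S X \<and> card \<Z> = j} = {\<Z> \<in> {\<Z>. \<Z> \<subseteq> min_bad_meeting r n B \<and> card \<Z> = j}. \<Union>\<Z> \<subseteq> S \<union> X}"
    unfolding hits_def by blast
  finally show ?thesis using fin by (simp add: of_bool_def sum.If_cases Int_def)
qed

lemma new_prob_bonferroni:
  fixes A B :: "nat set set"
  assumes "state r n \<mu>" "0 \<le> p" "p \<le> 1"
  defines "t \<equiv> \<lambda>j. \<Sum>\<Z> | \<Z> \<subseteq> min_bad_meeting r n B \<and> card \<Z> = j. fam_prob r n p \<mu> A B \<Z>"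
  shows "\<bar>new_prob r n p \<mu> A B - (\<Sum>j\<le>J. (-1) ^ j * t j)\<bar> \<le> t (Suc J)"
proof -
  define I where "I S X = (of_bool (A \<subseteq> S \<and> B \<subseteq> X - S) :: real)" for S X
  define w where "w S X = card (hits r n B S X)" for S X
  have t: "t j = round_expectation r n p \<mu> (\<lambda>S X. I S X * real (w S X choose j))" for j
    unfolding t_def fam_prob_def Ex2_sum[symmetric] w_def binomial_hits I_def sum_distrib_left
    by (rule Ex2_cong) (auto intro!: sum.cong)
  have np: "new_prob r n p \<mu> A B = round_expectation r n p \<mu> (\<lambda>S X. I S X * of_bool (w S X = 0))"
    unfolding new_prob_def I_def w_def by (rule Ex2_cong) auto
  have s: "(\<Sum>j\<le>J. (-1) ^ j * t j) = round_expectation r n p \<mu> (\<lambda>S X. I S X * (\<Sum>j\<le>J. (-1) ^ j * real (w S X choose j)))"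
    unfolding t Ex2_cmult[symmetric] Ex2_sum[symmetric]
    by (rule Ex2_cong) (simp add: sum_distrib_left mult_ac)
  have I0: "I S X \<ge> 0" for S X by (simp add: I_def)
  have d: "I S X * of_bool (w S X = 0) \<le> I S X * (\<Sum>j\<le>J. (-1) ^ j * real (w S X choose j)) + I S X * real (w S X choose Suc J)"
     "I S X * (\<Sum>j\<le>J. (-1) ^ j * real (w S X choose j)) \<le> I S X * of_bool (w S X = 0) + I S X * real (w S X choose Suc J)" for S X
  proof -
    have "of_bool (w S X = 0) \<le> (\<Sum>j\<le>J. (-1) ^ j * real (w S X choose j)) + real (w S X choose Suc J)"
      "(\<Sum>j\<le>J. (-1) ^ j * real (w S X choose j)) \<le> of_bool (w S X = 0) + real (w S X choose Suc J)"
      using bonferroni[of "w S X" J] by linarith+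
    thus "I S X * of_bool (w S X = 0) \<le> I S X * (\<Sum>j\<le>J. (-1) ^ j * real (w S X choose j)) + I S X * real (w S X choose Suc J)"
     "I S X * (\<Sum>j\<le>J. (-1) ^ j * real (w S X choose j)) \<le> I S X * of_bool (w S X = 0) + I S X * real (w S X choose Suc J)"
      unfolding distrib_left[symmetric] using I0 by (auto intro: mult_left_mono simp del: of_bool_eq_0_iff)
  qed
  have "new_prob r n p \<mu> A B \<le> (\<Sum>j\<le>J. (-1) ^ j * t j) + t (Suc J)"
    unfolding np s t[of "Suc J"] Ex2_add[symmetric] by (rule Ex2_mono[OF assms(1-3)]) (rule d)
  moreover have "(\<Sum>j\<le>J. (-1) ^ j * t j) \<le> new_prob r n p \<mu> A B + t (Suc J)"
    unfolding np s t[of "Suc J"] Ex2_add[symmetric] by (rule Ex2_mono[OF assms(1-3)]) (rule d)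
  ultimately show ?thesis by linarith
qed

text \<open>The event is divided according to which of the further edges \<open>G\<close> of the
  family are already in \<open>S\<close> (these form \<open>G1\<close>) and which are only
  offered.\<close>

lemma fam_prob_split:
  assumes "A \<subseteq> edges r n" "B \<subseteq> edges r n" "finite G" "G = \<Union>\<Z> - (A \<union> B)"
  shows "fam_prob r n p \<mu> A B \<Z> = (\<Sum>G1\<in>Pow G. split_prob r n p \<mu> (A \<union> G1) (B \<union> (G - G1)))"
  unfolding fam_prob_def split_prob_def Ex2_sum[symmetric]
proof (rule Ex2_cong)
  fix S X
  have eq: "of_bool (A \<union> G1 \<subseteq> S \<and> B \<union> (G - G1) \<subseteq> X - S)
      = (if G1 = G \<inter> S then of_bool (A \<subseteq> S \<and> B \<subseteq> X - S \<and> \<Union>\<Z> \<subseteq> S \<union> X) else 0 :: real)" if "G1 \<subseteq> G" for G1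
  proof (cases "G1 = G \<inter> S")
    case True
    have "A \<union> G1 \<subseteq> S \<and> B \<union> (G - G1) \<subseteq> X - S \<longleftrightarrow> A \<subseteq> S \<and> B \<subseteq> X - S \<and> \<Union>\<Z> \<subseteq> S \<union> X"
      unfolding True assms(4) by blast
    thus ?thesis using True by simp
  next
    case False
    hence "\<not> (A \<union> G1 \<subseteq> S \<and> B \<union> (G - G1) \<subseteq> X - S)" using that by blast
    thus ?thesis using False by simp
  qed
  have "(\<Sum>G1\<in>Pow G. of_bool (A \<union> G1 \<subseteq> S \<and> B \<union> (G - G1) \<subseteq> X - S) :: real)
     = (\<Sum>G1\<in>Pow G. if G1 = G \<inter> S then of_bool (A \<subseteq> S \<and> B \<subseteq> X - S \<and> \<Union>\<Z> \<subseteq> S \<union> X) else 0)"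
    by (intro sum.cong refl eq) auto
  also have "\<dots> = of_bool (A \<subseteq> S \<and> B \<subseteq> X - S \<and> \<Union>\<Z> \<subseteq> S \<union> X)" using assms(3) by (subst sum.delta) auto
  finally show "of_bool (A \<subseteq> S \<and> B \<subseteq> X - S \<and> \<Union>\<Z> \<subseteq> S \<union> X) =
     (\<Sum>G1\<in>Pow G. of_bool (A \<union> G1 \<subseteq> S \<and> B \<union> (G - G1) \<subseteq> X - S) :: real)" ..
qed

text \<open>A crude bound that applies also to families that are not nice: \<open>apriori\<close> on
  each split, then the binomial theorem.\<close>

lemma fam_prob_le:
  assumes st: "state r n \<mu>" "apriori r n c \<mu>" and p: "0 \<le> p" "p = \<alpha> / scale r n"
    and E: "A \<subseteq> edges r n" "B \<subseteq> edges r n" "A \<inter> B = {}" and \<Z>: "\<Z> \<subseteq> min_bad_meeting r n B"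
    and cc: "cc \<ge> 1" "cc \<ge> c + \<alpha>" "c \<ge> 0" "\<alpha> \<ge> 0" and D: "scale r n > 0"
  shows "fam_prob r n p \<mu> A B \<Z> \<le> (cc / scale r n) ^ (card (A \<union> B) + card (\<Union>\<Z> - (A \<union> B)))"
proof -
  define D where "D = scale r n"
  define G where "G = \<Union>\<Z> - (A \<union> B)"
  have Gs: "G \<subseteq> edges r n" using \<Z> unfolding G_def min_bad_meeting_def min_bad_sets_def by blast
  have fin: "finite A" "finite B" "finite G" using E Gs finite_edges finite_subset by blast+
  have D0: "D > 0" using D D_def by simp
  have c': "(c / D) \<ge> 0" "c / D \<le> cc / D" "p \<le> cc / D" "p + c / D \<le> cc / D"
  proof -
    show "c / D \<ge> 0" using cc D0 by simp
    show "c / D \<le> cc / D" using cc D0 by (intro divide_right_mono) auto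
    show "p \<le> cc / D" unfolding p(2) D_def[symmetric] using cc D0 by (intro divide_right_mono) auto
    have "p + c / D = (c + \<alpha>) / D" unfolding p(2) D_def[symmetric] by (simp add: add_divide_distrib)
    also have "\<dots> \<le> cc / D" using cc D0 by (intro divide_right_mono) auto
    finally show "p + c / D \<le> cc / D" .
  qed
  have "fam_prob r n p \<mu> A B \<Z> = (\<Sum>G1\<in>Pow G. split_prob r n p \<mu> (A \<union> G1) (B \<union> (G - G1)))"
    by (rule fam_prob_split[OF E(1,2) fin(3) G_def])
  also have "\<dots> \<le> (\<Sum>G1\<in>Pow G. (p ^ card B * (c / D) ^ card A) * ((c / D) ^ card G1 * p ^ card (G - G1)))"
  proof (rule sum_mono)
    fix G1 assume G1: "G1 \<in> Pow G"
    hence finG1: "finite G1" using fin finite_subset by blast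
    have "card (B \<union> (G - G1)) = card B + card (G - G1)"
      using fin by (intro card_Un_disjoint) (auto simp: G_def)
    moreover have "card (A \<union> G1) = card A + card G1"
      using fin finG1 G1 by (intro card_Un_disjoint) (auto simp: G_def)
    moreover have "split_prob r n p \<mu> (A \<union> G1) (B \<union> (G - G1)) \<le> p ^ card (B \<union> (G - G1)) * incl_prob r n \<mu> (A \<union> G1)"
      using E Gs by (intro split_prob_bounds(1)[OF st(1) p(1)]) auto
    moreover have "A \<union> G1 \<subseteq> edges r n" using E G1 Gs by blast
    hence "incl_prob r n \<mu> (A \<union> G1) \<le> (c / D) ^ card (A \<union> G1)" using st(2) unfolding apriori_def D_def by blast
    hence "p ^ card (B \<union> (G - G1)) * incl_prob r n \<mu> (A \<union> G1) \<le> p ^ card (B \<union> (G - G1)) * (c / D) ^ card (A \<union> G1)"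
      using p(1) by (intro mult_left_mono) auto
    ultimately show "split_prob r n p \<mu> (A \<union> G1) (B \<union> (G - G1)) \<le>
       (p ^ card B * (c / D) ^ card A) * ((c / D) ^ card G1 * p ^ card (G - G1))"
      by (simp add: power_add mult_ac)
  qed
  also have "\<dots> = p ^ card B * (c / D) ^ card A * (c / D + p) ^ card G"
    by (simp only: sum_distrib_left[symmetric] sum_Pow_binomial[OF fin(3)])
  also have "\<dots> \<le> (cc / D) ^ card B * (cc / D) ^ card A * (cc / D) ^ card G"
    using c' p(1) by (intro mult_mono power_mono) (auto simp: add.commute)
  also have "\<dots> = (cc / D) ^ (card (A \<union> B) + card G)"
    using E fin by (simp add: card_Un_disjoint power_add mult_ac)
  finally show ?thesis unfolding G_def D_def .
qed

lemma fam_prob_nonneg: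
  "state r n \<mu> \<Longrightarrow> 0 \<le> p \<Longrightarrow> p \<le> 1 \<Longrightarrow> fam_prob r n p \<mu> A B \<Z> \<ge> 0"
  unfolding fam_prob_def round_expectation_def using bern_nonneg
  by (intro sum_nonneg mult_nonneg_nonneg) (auto simp: state_def)

section \<open>The limiting model of a round\<close>

lemma sum_Pow_Un_disjoint:
  fixes f :: "'a set \<Rightarrow> real"
  assumes "finite A" "finite B" "A \<inter> B = {}"
  shows "(\<Sum>T\<in>Pow (A \<union> B). f T) = (\<Sum>S\<in>Pow A. \<Sum>T\<in>Pow B. f (S \<union> T))"
proof -
  have "(\<Sum>S\<in>Pow A. \<Sum>T\<in>Pow B. f (S \<union> T)) = (\<Sum>(S,T)\<in>Pow A \<times> Pow B. f (S \<union> T))"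
    by (rule sum.cartesian_product)
  also have "\<dots> = (\<Sum>T\<in>Pow (A \<union> B). f T)"
    by (rule sum.reindex_bij_witness[of _ "\<lambda>T. (T \<inter> A, T \<inter> B)" "\<lambda>(S,T). S \<union> T"]) (use assms in auto)
  finally show ?thesis ..
qed

lemma sum_Pow_UN_prod:
  fixes v :: "'i \<Rightarrow> 'a set \<Rightarrow> real"
  assumes "finite I" "\<And>i. i \<in> I \<Longrightarrow> finite (G i)"
    "\<And>i j. i \<in> I \<Longrightarrow> j \<in> I \<Longrightarrow> i \<noteq> j \<Longrightarrow> G i \<inter> G j = {}"
  shows "(\<Sum>T\<in>Pow (\<Union>i\<in>I. G i). \<Prod>i\<in>I. v i (T \<inter> G i)) = (\<Prod>i\<in>I. \<Sum>T\<in>Pow (G i). v i T)"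
  using assms
proof (induction I rule: finite_induct)
  case (insert x F)
  have dj: "G x \<inter> (\<Union>i\<in>F. G i) = {}" using insert by fastforce
  have "(\<Sum>T\<in>Pow (\<Union>i\<in>insert x F. G i). \<Prod>i\<in>insert x F. v i (T \<inter> G i))
      = (\<Sum>T\<in>Pow (G x \<union> (\<Union>i\<in>F. G i)). \<Prod>i\<in>insert x F. v i (T \<inter> G i))" by simp
  also have "\<dots> = (\<Sum>S\<in>Pow (G x). \<Sum>T\<in>Pow (\<Union>i\<in>F. G i). \<Prod>i\<in>insert x F. v i ((S \<union> T) \<inter> G i))"
    using insert dj by (intro sum_Pow_Un_disjoint) auto
  also have "\<dots> = (\<Sum>S\<in>Pow (G x). \<Sum>T\<in>Pow (\<Union>i\<in>F. G i). v x S * (\<Prod>i\<in>F. v i (T \<inter> G i)))"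
  proof (intro sum.cong refl)
    fix S T assume S: "S \<in> Pow (G x)" and T: "T \<in> Pow (\<Union>i\<in>F. G i)"
    have "(S \<union> T) \<inter> G x = S" using S T dj by blast
    moreover have "(S \<union> T) \<inter> G i = T \<inter> G i" if "i \<in> F" for i
      using S that dj by blast
    ultimately show "(\<Prod>i\<in>insert x F. v i ((S \<union> T) \<inter> G i)) = v x S * (\<Prod>i\<in>F. v i (T \<inter> G i))"
      using insert by simp
  qed
  also have "\<dots> = (\<Sum>S\<in>Pow (G x). v x S) * (\<Sum>T\<in>Pow (\<Union>i\<in>F. G i). \<Prod>i\<in>F. v i (T \<inter> G i))"
    by (simp only: sum_product)
  also have "(\<Sum>T\<in>Pow (\<Union>i\<in>F. G i). \<Prod>i\<in>F. v i (T \<inter> G i)) = (\<Prod>i\<in>F. \<Sum>T\<in>Pow (G i). v i T)"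
    using insert by (intro insert.IH) auto
  finally show ?case using insert by simp
qed simp

text \<open>Marking one element of each set gives (j + 1) e_(j+1) \<le> e_j * e_1 for the elementary
  symmetric sums; the factorial follows by induction.\<close>

lemma elementary_symmetric_le:
  fixes x :: "'a \<Rightarrow> real"
  assumes "finite A" "\<And>a. a \<in> A \<Longrightarrow> x a \<ge> 0"
  shows "(\<Sum>T | T \<subseteq> A \<and> card T = j. \<Prod>a\<in>T. x a) \<le> (\<Sum>a\<in>A. x a) ^ j / fact j"
proof (induction j)
  case 0
  have "{T. T \<subseteq> A \<and> card T = 0} = {{}}" using assms(1) by (auto dest: finite_subset)
  thus ?case by simp
next
  case (Suc j)
  define e where "e j = (\<Sum>T | T \<subseteq> A \<and> card T = j. \<Prod>a\<in>T. x a)" for j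
  have fin: "finite {T. T \<subseteq> A \<and> card T = j}" for j
    by (rule finite_subset[of _ "Pow A"]) (use assms(1) in auto)
  have finT: "finite T" if "T \<subseteq> A" for T using that assms(1) finite_subset by blast
  define open_pairs where "open_pairs = (SIGMA T:{T. T \<subseteq> A \<and> card T = Suc j}. T)"
  have "real (Suc j) * e (Suc j) = (\<Sum>T | T \<subseteq> A \<and> card T = Suc j. \<Sum>a\<in>T. \<Prod>a\<in>T. x a)"
    unfolding e_def by (simp add: sum_distrib_left)
  also have "\<dots> = (\<Sum>T | T \<subseteq> A \<and> card T = Suc j. \<Sum>a\<in>T. x a * (\<Prod>a\<in>T - {a}. x a))"
    using finT by (intro sum.cong refl) (auto intro: prod.remove)
  also have "\<dots> = (\<Sum>(T,a)\<in>open_pairs. x a * (\<Prod>a\<in>T - {a}. x a))"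
    unfolding open_pairs_def using fin finT by (intro sum.Sigma) auto
  also have "\<dots> = (\<Sum>(T0,a)\<in>(\<lambda>(T,a). (T - {a}, a)) ` open_pairs. x a * (\<Prod>a\<in>T0. x a))"
  proof (subst sum.reindex)
    show "inj_on (\<lambda>(T,a). (T - {a}, a)) open_pairs" unfolding inj_on_def open_pairs_def by (auto)
  qed (auto simp: case_prod_unfold intro!: sum.cong)
  also have "\<dots> \<le> (\<Sum>(T0,a)\<in>{T. T \<subseteq> A \<and> card T = j} \<times> A. x a * (\<Prod>a\<in>T0. x a))"
  proof (rule sum_mono2)
    show "finite ({T. T \<subseteq> A \<and> card T = j} \<times> A)" using fin assms(1) by blast
    show "(\<lambda>(T,a). (T - {a}, a)) ` open_pairs \<subseteq> {T. T \<subseteq> A \<and> card T = j} \<times> A"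
      unfolding open_pairs_def using finT by auto
    fix b assume "b \<in> {T. T \<subseteq> A \<and> card T = j} \<times> A - (\<lambda>(T,a). (T - {a}, a)) ` open_pairs"
    thus "0 \<le> (case b of (T0, a) \<Rightarrow> x a * (\<Prod>a\<in>T0. x a))"
      using assms(2) by (auto intro!: mult_nonneg_nonneg prod_nonneg)
  qed
  also have "\<dots> = (\<Sum>T0\<in>{T. T \<subseteq> A \<and> card T = j}. \<Sum>a\<in>A. x a * (\<Prod>a\<in>T0. x a))"
    by (rule sum.cartesian_product[symmetric])
  also have "\<dots> = e j * (\<Sum>a\<in>A. x a)"
    unfolding e_def sum_product by (simp only: mult.commute)
  also have "\<dots> \<le> ((\<Sum>a\<in>A. x a) ^ j / fact j) * (\<Sum>a\<in>A. x a)"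
    using Suc assms(2) unfolding e_def by (intro mult_right_mono sum_nonneg) auto
  finally have "real (Suc j) * e (Suc j) \<le> (\<Sum>a\<in>A. x a) ^ Suc j / fact j" by (simp add: mult_ac)
  hence "e (Suc j) \<le> (\<Sum>a\<in>A. x a) ^ Suc j / fact j / real (Suc j)"
    by (simp only: pos_le_divide_eq of_nat_0_less_iff zero_less_Suc mult.commute)
  also have "\<dots> = (\<Sum>a\<in>A. x a) ^ Suc j / fact (Suc j)" by (simp add: mult.commute)
  finally show ?case unfolding e_def .
qed

text \<open>Weight of l outer edges through one vertex pair: all are newly offered, or all but one.
  Two of them cannot both be old, because together they are bad.\<close>

definition pair_weight :: "real \<Rightarrow> real \<Rightarrow> real \<Rightarrow> nat \<Rightarrow> real" where
  "pair_weight y \<alpha> D l = (\<alpha> ^ l + real l * y * \<alpha> ^ (l - 1)) / D ^ l"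

text \<open>The numerator consists of the terms of degree at most 1 in y of (y +
  \<alpha>)^l.\<close>

lemma pair_weight_le:
  assumes "y \<ge> 0" "\<alpha> \<ge> 0" "D > 0"
  shows "0 \<le> pair_weight y \<alpha> D l" "pair_weight y \<alpha> D l \<le> ((y + \<alpha>) / D) ^ l"
proof -
  have "\<alpha> ^ l + real l * y * \<alpha> ^ (l - 1) \<le> (y + \<alpha>) ^ l"
  proof (induction l)
    case (Suc l)
    have "\<alpha> ^ Suc l + real (Suc l) * y * \<alpha> ^ l \<le> (y + \<alpha>) * (\<alpha> ^ l + real l * y * \<alpha> ^ (l - 1))"
    proof (cases l)
      case (Suc l')
      have "(y + \<alpha>) * (\<alpha> ^ l + real l * y * \<alpha> ^ (l - 1)) =
         \<alpha> ^ Suc l + real (Suc l) * y * \<alpha> ^ l + real l * y * y * \<alpha> ^ l'"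
        using Suc by (simp add: algebra_simps)
      thus ?thesis using assms by simp
    qed (use assms in auto)
    also have "\<dots> \<le> (y + \<alpha>) * (y + \<alpha>) ^ l" using Suc assms by (intro mult_left_mono) auto
    finally show ?case by simp
  qed simp
  thus "pair_weight y \<alpha> D l \<le> ((y + \<alpha>) / D) ^ l"
    unfolding pair_weight_def power_divide using assms by (intro divide_right_mono) auto
  show "0 \<le> pair_weight y \<alpha> D l" unfolding pair_weight_def using assms by simp
qed

text \<open>The value of the alternating sum of \<open>pair_weight\<close> over the subsets of an
  N-element set. For N = D and large D it approaches (1 - y) exp(-\<alpha>): the pair must not be
  covered yet, and no offered edge may cover it.\<close>

definition pair_factor :: "real \<Rightarrow> real \<Rightarrow> real \<Rightarrow> nat \<Rightarrow> real" where
  "pair_factor y \<alpha> D N = (1 - \<alpha> / D) ^ N - real N * (y / D) * (1 - \<alpha> / D) ^ (N - 1)"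

text \<open>The derivative in u of the binomial sum of u^|T|.\<close>

lemma sum_Pow_card_power:
  fixes u :: real
  assumes "finite G"
  shows "(\<Sum>T\<in>Pow G. real (card T) * u ^ (card T - 1)) = real (card G) * (1 + u) ^ (card G - 1)"
  using assms
proof (induction G rule: finite_induct)
  case (insert x F)
  have P: "(\<Sum>T\<in>Pow F. u ^ card T) = (1 + u) ^ card F"
    using sum_Pow_binomial[OF insert(1), of u 1] by (simp add: add.commute)
  have fT: "finite T" "x \<notin> T" if "T \<in> Pow F" for T using that insert finite_subset by auto
  have "(\<Sum>T\<in>Pow (insert x F). real (card T) * u ^ (card T - 1))
     = (\<Sum>T\<in>Pow F. real (card T) * u ^ (card T - 1)) + (\<Sum>T\<in>Pow F. real (card (insert x T)) * u ^ (card (insert x T) - 1))"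
  proof -
    have "(\<Sum>T\<in>Pow ({x} \<union> F). real (card T) * u ^ (card T - 1))
       = (\<Sum>S\<in>Pow {x}. \<Sum>T\<in>Pow F. real (card (S \<union> T)) * u ^ (card (S \<union> T) - 1))"
      using insert by (intro sum_Pow_Un_disjoint) auto
    also have "\<dots> = (\<Sum>S\<in>{{},{x}}. \<Sum>T\<in>Pow F. real (card (S \<union> T)) * u ^ (card (S \<union> T) - 1))"
      by (simp add: Pow_insert insert_commute)
    finally show ?thesis by simp
  qed
  also have "(\<Sum>T\<in>Pow F. real (card (insert x T)) * u ^ (card (insert x T) - 1))
     = (\<Sum>T\<in>Pow F. u * (real (card T) * u ^ (card T - 1)) + u ^ card T)"
  proof (rule sum.cong[OF refl])
    fix T assume T: "T \<in> Pow F"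
    show "real (card (insert x T)) * u ^ (card (insert x T) - 1) = u * (real (card T) * u ^ (card T - 1)) + u ^ card T"
      using fT[OF T] by (cases "card T") (auto simp: algebra_simps)
  qed
  also have "\<dots> = u * (real (card F) * (1 + u) ^ (card F - 1)) + (1 + u) ^ card F"
    by (simp only: sum.distrib sum_distrib_left[symmetric] insert.IH P)
  also note insert.IH
  finally show ?case
    using insert(1,2) by (cases "card F") (simp_all add: algebra_simps)
qed simp

lemma sum_Pow_pair_weight:
  assumes "finite G" "D > 0"
  shows "(\<Sum>T\<in>Pow G. (-1) ^ card T * pair_weight y \<alpha> D (card T)) = pair_factor y \<alpha> D (card G)"
proof -
  define u where "u = - (\<alpha> / D)"
  have "(-1) ^ l * pair_weight y \<alpha> D l = u ^ l - (y / D) * (real l * u ^ (l - 1))" for l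
  proof (cases l)
    case (Suc l')
    have A: "\<alpha> = - (u * D)" using assms(2) by (simp add: u_def)
    show ?thesis using Suc assms(2)
      by (cases "even l'") (simp_all add: pair_weight_def A power_mult_distrib field_simps)
  qed (simp add: pair_weight_def)
  hence "(\<Sum>T\<in>Pow G. (-1) ^ card T * pair_weight y \<alpha> D (card T)) =
     (\<Sum>T\<in>Pow G. u ^ card T) - (y / D) * (\<Sum>T\<in>Pow G. real (card T) * u ^ (card T - 1))"
    by (simp add: sum_subtractf sum_distrib_left)
  also have "(\<Sum>T\<in>Pow G. u ^ card T) = (1 + u) ^ card G"
    using sum_Pow_binomial[OF assms(1), of u 1] by (simp add: add.commute)
  also note sum_Pow_card_power[OF assms(1)]
  finally show ?thesis unfolding pair_factor_def u_def by (simp add: mult_ac)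
qed

text \<open>The configurations that can occur in a nice family. Not every subfamily is nice, since
  members may meet outside \<open>E\<close>, but only the sum over all subfamilies factorises; the
  surplus is O(1/n).\<close>

definition Omega :: "nat \<Rightarrow> nat \<Rightarrow> nat set set \<Rightarrow> nat set set \<Rightarrow> nat set set set" where
  "Omega r n E B = {Z \<in> min_bad_sets r n. exc r Z = 2 \<and> (\<exists>b\<in>B. b \<in> Z \<and> \<Union>Z \<inter> \<Union>E = b)}"

text \<open>
  Two configurations of size 2 on the same vertex pair interact, since their outer edges cannot both
  be in a conflict-free set. They are grouped by that pair; all others are independent.
\<close>

definition key :: "nat set set \<Rightarrow> nat set + nat set set" where
  "key Z = (if card Z = 2 then Inl (\<Inter>Z) else Inr Z)"

text \<open>Each of the \<open>card Z - 1\<close> outer edges is either old, with weight y/D, or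
  offered, with weight \<alpha>/D.\<close>

definition conf_weight :: "real \<Rightarrow> real \<Rightarrow> real \<Rightarrow> nat set set \<Rightarrow> real" where
  "conf_weight y \<alpha> D Z = ((y + \<alpha>) / D) ^ (card Z - 1)"

definition group_weight :: "real \<Rightarrow> real \<Rightarrow> real \<Rightarrow> nat set + nat set set \<Rightarrow> nat set set set \<Rightarrow> real" where
  "group_weight y \<alpha> D \<kappa> \<T> = (case \<kappa> of Inl q \<Rightarrow> pair_weight y \<alpha> D (card \<T>) | Inr Z \<Rightarrow> \<Prod>Z\<in>\<T>. conf_weight y \<alpha> D Z)"

definition fam_weight :: "nat \<Rightarrow> nat \<Rightarrow> nat set set \<Rightarrow> nat set set \<Rightarrow> real \<Rightarrow> real \<Rightarrow> real \<Rightarrow> nat set set set \<Rightarrow> real" where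
  "fam_weight r n E B y \<alpha> D \<Z> = (\<Prod>\<kappa>\<in>key ` Omega r n E B. group_weight y \<alpha> D \<kappa> {Z \<in> \<Z>. key Z = \<kappa>})"

lemma finite_Omega [simp]: "finite (Omega r n E B)"
  by (simp add: Omega_def)

lemma Omega_subset_MBB: "Omega r n E B \<subseteq> min_bad_meeting r n B"
  unfolding Omega_def min_bad_meeting_def by blast

lemma prod_group_key:
  fixes g :: "nat set set \<Rightarrow> real"
  assumes "finite \<Z>" "\<Z> \<subseteq> \<Omega>" "finite \<Omega>"
  shows "(\<Prod>\<kappa>\<in>key ` \<Omega>. \<Prod>Z\<in>{Z \<in> \<Z>. key Z = \<kappa>}. g Z) = (\<Prod>Z\<in>\<Z>. g Z)"
  using assms by (intro prod.group) auto

lemma fam_weight_bounds: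
  assumes "\<Z> \<subseteq> Omega r n E B" "y \<ge> 0" "\<alpha> \<ge> 0" "D > 0"
  shows "0 \<le> fam_weight r n E B y \<alpha> D \<Z>" "fam_weight r n E B y \<alpha> D \<Z> \<le> (\<Prod>Z\<in>\<Z>. conf_weight y \<alpha> D Z)"
proof -
  have finZ: "finite \<Z>" using assms(1) finite_Omega finite_subset by blast
  have cw: "conf_weight y \<alpha> D Z \<ge> 0" for Z using assms by (simp add: conf_weight_def)
  have gw: "0 \<le> group_weight y \<alpha> D \<kappa> {Z \<in> \<Z>. key Z = \<kappa>} \<and>
     group_weight y \<alpha> D \<kappa> {Z \<in> \<Z>. key Z = \<kappa>} \<le> (\<Prod>Z\<in>{Z \<in> \<Z>. key Z = \<kappa>}. conf_weight y \<alpha> D Z)" for \<kappa>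
  proof (cases \<kappa>)
    case (Inl q)
    have "card Z = 2" if "key Z = \<kappa>" for Z using that Inl by (auto simp: key_def split: if_splits)
    hence "(\<Prod>Z\<in>{Z \<in> \<Z>. key Z = \<kappa>}. conf_weight y \<alpha> D Z) = (\<Prod>Z\<in>{Z \<in> \<Z>. key Z = \<kappa>}. (y + \<alpha>) / D)"
      by (intro prod.cong) (auto simp: conf_weight_def)
    thus ?thesis using pair_weight_le[OF assms(2-4)] Inl by (simp add: group_weight_def)
  qed (use cw in \<open>auto simp: group_weight_def intro: prod_nonneg\<close>)
  show "0 \<le> fam_weight r n E B y \<alpha> D \<Z>" unfolding fam_weight_def using gw by (intro prod_nonneg) auto
  have "fam_weight r n E B y \<alpha> D \<Z> \<le> (\<Prod>\<kappa>\<in>key ` Omega r n E B. \<Prod>Z\<in>{Z \<in> \<Z>. key Z = \<kappa>}. conf_weight y \<alpha> D Z)"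
    unfolding fam_weight_def using gw by (intro prod_mono) auto
  also have "\<dots> = (\<Prod>Z\<in>\<Z>. conf_weight y \<alpha> D Z)" using finZ assms(1) by (intro prod_group_key) auto
  finally show "fam_weight r n E B y \<alpha> D \<Z> \<le> (\<Prod>Z\<in>\<Z>. conf_weight y \<alpha> D Z)" .
qed

text \<open>The weight is a product over keys, so the alternating sum over subfamilies is a product
  of sums, one per key: 1 minus its weight for a configuration standing alone,
  \<open>pair_factor\<close> for all configurations of size 2 on one vertex pair.\<close>

lemma fam_weight_total:
  assumes "D > 0"
  shows "(\<Sum>\<Z>\<in>Pow (Omega r n E B). (-1) ^ card \<Z> * fam_weight r n E B y \<alpha> D \<Z>) =
     (\<Prod>Z\<in>{Z\<in>Omega r n E B. card Z \<noteq> 2}. 1 - conf_weight y \<alpha> D Z) *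
     (\<Prod>q\<in>Inter ` {Z\<in>Omega r n E B. card Z = 2}. pair_factor y \<alpha> D (card {Z\<in>Omega r n E B. card Z = 2 \<and> \<Inter>Z = q}))"
proof -
  define \<Omega> where "\<Omega> = Omega r n E B"
  define G where "G \<kappa> = {Z\<in>\<Omega>. key Z = \<kappa>}" for \<kappa>
  have fin: "finite \<Omega>" unfolding \<Omega>_def by simp
  define v where "v \<kappa> \<T> = (-1) ^ card \<T> * group_weight y \<alpha> D \<kappa> \<T>" for \<kappa> \<T>
  have Un: "(\<Union>\<kappa>\<in>key ` \<Omega>. G \<kappa>) = \<Omega>" unfolding G_def by blast
  have term_eq: "(-1) ^ card \<Z> * fam_weight r n E B y \<alpha> D \<Z> = (\<Prod>\<kappa>\<in>key ` \<Omega>. v \<kappa> (\<Z> \<inter> G \<kappa>))"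
    if Z: "\<Z> \<subseteq> \<Omega>" for \<Z>
  proof -
    have eq: "\<Z> \<inter> G \<kappa> = {Z \<in> \<Z>. key Z = \<kappa>}" for \<kappa> using Z unfolding G_def by blast
    have "finite \<Z>" using Z fin finite_subset by blast
    have "(-1::real) ^ card \<Z> = (\<Prod>Z\<in>\<Z>. -1)" by simp
    also have "\<dots> = (\<Prod>\<kappa>\<in>key ` \<Omega>. \<Prod>Z\<in>{Z \<in> \<Z>. key Z = \<kappa>}. -1)"
      using \<open>finite \<Z>\<close> Z fin by (intro prod_group_key[symmetric])
    finally have "(-1::real) ^ card \<Z> = (\<Prod>\<kappa>\<in>key ` \<Omega>. (-1) ^ card {Z \<in> \<Z>. key Z = \<kappa>})" by simp
    thus ?thesis unfolding fam_weight_def \<Omega>_def[symmetric] v_def eq by (simp add: prod.distrib)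
  qed
  have "(\<Sum>\<Z>\<in>Pow \<Omega>. (-1) ^ card \<Z> * fam_weight r n E B y \<alpha> D \<Z>)
     = (\<Sum>\<Z>\<in>Pow (\<Union>\<kappa>\<in>key ` \<Omega>. G \<kappa>). \<Prod>\<kappa>\<in>key ` \<Omega>. v \<kappa> (\<Z> \<inter> G \<kappa>))"
    unfolding Un by (intro sum.cong refl term_eq) auto
  also have "\<dots> = (\<Prod>\<kappa>\<in>key ` \<Omega>. \<Sum>\<T>\<in>Pow (G \<kappa>). v \<kappa> \<T>)"
    using fin by (intro sum_Pow_UN_prod) (auto simp: G_def)
  also have "key ` \<Omega> = Inr ` {Z\<in>\<Omega>. card Z \<noteq> 2} \<union> Inl ` Inter ` {Z\<in>\<Omega>. card Z = 2}"
    unfolding key_def by (auto simp: image_iff)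
  also have "(\<Prod>\<kappa>\<in>\<dots>. \<Sum>\<T>\<in>Pow (G \<kappa>). v \<kappa> \<T>) =
     (\<Prod>\<kappa>\<in>Inr ` {Z\<in>\<Omega>. card Z \<noteq> 2}. \<Sum>\<T>\<in>Pow (G \<kappa>). v \<kappa> \<T>) *
     (\<Prod>\<kappa>\<in>Inl ` Inter ` {Z\<in>\<Omega>. card Z = 2}. \<Sum>\<T>\<in>Pow (G \<kappa>). v \<kappa> \<T>)"
    using fin by (intro prod.union_disjoint) auto
  also have "(\<Prod>\<kappa>\<in>Inr ` {Z\<in>\<Omega>. card Z \<noteq> 2}. \<Sum>\<T>\<in>Pow (G \<kappa>). v \<kappa> \<T>)
     = (\<Prod>Z\<in>{Z\<in>\<Omega>. card Z \<noteq> 2}. 1 - conf_weight y \<alpha> D Z)"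
  proof (subst prod.reindex)
    show "prod ((\<lambda>\<kappa>. \<Sum>\<T>\<in>Pow (G \<kappa>). v \<kappa> \<T>) \<circ> Inr) {Z\<in>\<Omega>. card Z \<noteq> 2} = (\<Prod>Z\<in>{Z\<in>\<Omega>. card Z \<noteq> 2}. 1 - conf_weight y \<alpha> D Z)"
    proof (rule prod.cong[OF refl])
      fix Z assume Z: "Z \<in> {Z\<in>\<Omega>. card Z \<noteq> 2}"
      hence "G (Inr Z) = {Z}" unfolding G_def key_def by auto
      hence "Pow (G (Inr Z)) = {{}, {Z}}" by auto
      thus "((\<lambda>\<kappa>. \<Sum>\<T>\<in>Pow (G \<kappa>). v \<kappa> \<T>) \<circ> Inr) Z = 1 - conf_weight y \<alpha> D Z"
        by (simp add: v_def group_weight_def)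
    qed
  qed simp
  also have "(\<Prod>\<kappa>\<in>Inl ` Inter ` {Z\<in>\<Omega>. card Z = 2}. \<Sum>\<T>\<in>Pow (G \<kappa>). v \<kappa> \<T>)
     = (\<Prod>q\<in>Inter ` {Z\<in>\<Omega>. card Z = 2}. pair_factor y \<alpha> D (card {Z\<in>\<Omega>. card Z = 2 \<and> \<Inter>Z = q}))"
  proof (subst prod.reindex)
    show "prod ((\<lambda>\<kappa>. \<Sum>\<T>\<in>Pow (G \<kappa>). v \<kappa> \<T>) \<circ> Inl) (Inter ` {Z\<in>\<Omega>. card Z = 2}) =
      (\<Prod>q\<in>Inter ` {Z\<in>\<Omega>. card Z = 2}. pair_factor y \<alpha> D (card {Z\<in>\<Omega>. card Z = 2 \<and> \<Inter>Z = q}))"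
    proof (rule prod.cong[OF refl])
      fix q assume "q \<in> Inter ` {Z\<in>\<Omega>. card Z = 2}"
      have "G (Inl q) = {Z\<in>\<Omega>. card Z = 2 \<and> \<Inter>Z = q}" unfolding G_def key_def by auto
      moreover have "finite (G (Inl q))" using fin unfolding G_def by simp
      ultimately show "((\<lambda>\<kappa>. \<Sum>\<T>\<in>Pow (G \<kappa>). v \<kappa> \<T>) \<circ> Inl) q = pair_factor y \<alpha> D (card {Z\<in>\<Omega>. card Z = 2 \<and> \<Inter>Z = q})"
        using sum_Pow_pair_weight[OF _ assms, of "G (Inl q)" y \<alpha>] by (simp add: v_def group_weight_def)
    qed
  qed simp
  finally show ?thesis unfolding \<Omega>_def .
qed

section \<open>Families of configurations against the model\<close>

lemma nice_subset_Omega: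
  assumes "nice r E B \<Z>" "\<Z> \<subseteq> min_bad_sets r n"
  shows "\<Z> \<subseteq> Omega r n E B"
  using assms niceD[OF assms(1)] unfolding Omega_def by blast

lemma nice_new_edges_disjoint:
  assumes E: "unif r E" "B \<subseteq> E" and n: "nice r E B \<Z>" and Z: "Z \<in> \<Z>" "Z' \<in> \<Z>" "Z \<noteq> Z'"
  shows "(Z - E) \<inter> (Z' - E) = {}"
proof (rule ccontr)
  assume "(Z - E) \<inter> (Z' - E) \<noteq> {}"
  then obtain g where g: "g \<in> Z" "g \<in> Z'" "g \<notin> E" by blast
  obtain b where b: "b \<in> B" "b \<in> Z" "\<Union>Z \<inter> \<Union>E = b" using niceD(4)[OF n Z(1)] by blast
  have "\<Union>Z \<inter> \<Union>Z' \<subseteq> \<Union>E" using n Z unfolding nice_def by simp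
  hence "g \<subseteq> b" using g b by blast
  moreover have "card g = r" "card b = r" "finite b"
    using niceD(1)[OF n Z(1)] g b unfolding unif_def by blast+
  ultimately have "g = b" by (simp add: card_subset_eq)
  thus False using g b E(2) by blast
qed

text \<open>Excludes the exceptional case of \<open>nice_glue\<close>, the only way in which the old
  part of a nice family can fail to be conflict-free.\<close>

definition shared_pair_free :: "nat set set \<Rightarrow> nat set set set \<Rightarrow> nat set set \<Rightarrow> bool" where
  "shared_pair_free E \<Z> G \<longleftrightarrow> \<not> (\<exists>Z1\<in>\<Z>. \<exists>Z2\<in>\<Z>. Z1 \<noteq> Z2 \<and> card Z1 = 2 \<and> card Z2 = 2 \<and> \<Inter>Z1 = \<Inter>Z2 \<and> (Z1 \<union> Z2) - E \<subseteq> G)"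

lemma nice_pair_configuration:
  assumes E: "unif r E" "B \<subseteq> E" "r \<ge> 2" and n: "nice r E B \<Z>" and Z: "Z \<in> \<Z>"
  obtains b where "b \<in> B" "Z \<inter> E = {b}" "b \<in> Z" "card (Z - E) = card Z - 1" "finite Z"
proof -
  obtain b where b: "b \<in> B" "b \<in> Z" "\<Union>Z \<inter> \<Union>E = b" using niceD(4)[OF n Z] by blast
  have ZE: "Z \<inter> E = {b}" using nice_Int[OF E(1) niceD(1)[OF n Z] E(3) _ b(2,3)] b(1) E(2) by blast
  have fin: "finite Z" using niceD(1)[OF n Z] by simp
  have "Z - E = Z - {b}" using ZE by blast
  hence "card (Z - E) = card Z - 1" using b fin by simp
  thus ?thesis using that b ZE fin by blast
qed

text \<open>Without \<open>B\<close> no member of the family is complete, so by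
  \<open>nice_glue\<close> only two outer edges on one vertex pair can spoil the set. Conversely two
  such edges share two vertices and are bad.\<close>

lemma cf_nice_iff:
  assumes E: "unif r E" "conflict_free r E" "B \<subseteq> E" "r \<ge> 2" and n: "nice r E B \<Z>" "finite \<Z>"
    and G: "G \<subseteq> \<Union>\<Z> - E"
  shows "conflict_free r ((E - B) \<union> G) \<longleftrightarrow> shared_pair_free E \<Z> G"
proof
  assume conflict_free: "conflict_free r ((E - B) \<union> G)"
  show "shared_pair_free E \<Z> G" unfolding shared_pair_free_def
  proof (rule notI)
    assume "\<exists>Z1\<in>\<Z>. \<exists>Z2\<in>\<Z>. Z1 \<noteq> Z2 \<and> card Z1 = 2 \<and> card Z2 = 2 \<and> \<Inter>Z1 = \<Inter>Z2 \<and> (Z1 \<union> Z2) - E \<subseteq> G"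
    then obtain Z1 Z2 where Z: "Z1 \<in> \<Z>" "Z2 \<in> \<Z>" "Z1 \<noteq> Z2" "card Z1 = 2" "card Z2 = 2" "\<Inter>Z1 = \<Inter>Z2" "(Z1 \<union> Z2) - E \<subseteq> G"
      by blast
    have *: "\<exists>f. Z - E = {f} \<and> card (\<Inter>Z) = 2 \<and> \<Inter>Z \<subseteq> f \<and> card f = r \<and> finite f" if Z: "Z \<in> \<Z>" "card Z = 2" for Z
    proof -
      obtain b where b: "b \<in> B" "Z \<inter> E = {b}" "b \<in> Z" "card (Z - E) = card Z - 1" "finite Z"
        using nice_pair_configuration[OF E(1,3,4) n(1) Z(1)] .
      have "card (Z - E) = 1" using b(4) Z(2) by simp
      then obtain f where f: "Z - E = {f}" by (rule card_1_singletonE)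
      have Zeq: "Z = {b} \<union> {f}" using b(2) f by blast
      have bf: "b \<noteq> f" using f b E(3) by blast
      have fin: "finite b" "finite f" "card b = r" "card f = r"
        using niceD(1)[OF n(1) Z(1)] f b(3) unfolding unif_def by blast+
      have "exc r ({b} \<union> {f}) = exc r {b} + exc r {f} - int (card (\<Union>{b} \<inter> \<Union>{f}))"
        using bf fin by (intro exc_Un) (auto simp: unif_def)
      hence "card (b \<inter> f) = 2"
        using niceD(3)[OF n(1) Z(1)] exc_singleton[OF E(4) fin(3)] exc_singleton[OF E(4) fin(4)]
        unfolding Zeq by simp
      moreover have "\<Inter>Z = b \<inter> f" unfolding Zeq by (simp add: Int_commute)
      ultimately show ?thesis using f fin by auto
    qed
    obtain f1 where f1: "Z1 - E = {f1}" "card (\<Inter>Z1) = 2" "\<Inter>Z1 \<subseteq> f1" "card f1 = r" "finite f1" using *[OF Z(1,4)] by blast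
    obtain f2 where f2: "Z2 - E = {f2}" "\<Inter>Z2 \<subseteq> f2" "card f2 = r" "finite f2" using *[OF Z(2,5)] by blast
    have ne: "f1 \<noteq> f2" using nice_new_edges_disjoint[OF E(1,3) n(1) Z(1-3)] f1 f2 by auto
    have "exc r ({f1} \<union> {f2}) = exc r {f1} + exc r {f2} - int (card (\<Union>{f1} \<inter> \<Union>{f2}))"
      using ne f1 f2 by (intro exc_Un) (auto simp: unif_def)
    moreover have "card (\<Inter>Z1) \<le> card (f1 \<inter> f2)" using f1 f2 Z(6) by (intro card_mono) auto
    ultimately have "exc r {f1,f2} \<le> 2" using exc_singleton[OF E(4) f1(4)] exc_singleton[OF E(4) f2(3)] f1(2)
      by (simp add: insert_commute)
    hence "bad r {f1,f2}" unfolding bad_def using ne by simp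
    moreover have "{f1,f2} \<subseteq> (E - B) \<union> G" using Z(7) f1 f2 by blast
    ultimately show False using conflict_free unfolding conflict_free_def by blast
  qed
next
  assume shared_pair_free: "shared_pair_free E \<Z> G"
  show "conflict_free r ((E - B) \<union> G)" unfolding cf_iff_no_minbad
  proof (intro allI impI notI)
    fix W assume W: "W \<subseteq> (E - B) \<union> G" "minbad r W"
    have "W \<subseteq> E \<union> \<Union>\<Z>" using W G by blast
    from nice_glue[OF E(1,2) n(2,1) E(3,4) this W(2)] show False
    proof
      assume "W \<in> \<Z>"
      then obtain b where "b \<in> B" "b \<in> W" using niceD(4)[OF n(1)] by blast
      thus False using W(1) G E(3) by blast
    next
      assume *: "W \<inter> E = {} \<and> (\<exists>Z1\<in>\<Z>. \<exists>Z2\<in>\<Z>. Z1 \<noteq> Z2 \<and> card Z1 = 2 \<and> card Z2 = 2 \<and> \<Inter> Z1 = \<Inter> Z2 \<and> Z1 \<union> Z2 - E \<subseteq> W)"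
      hence "W \<subseteq> G" using W(1) by blast
      thus False using * shared_pair_free unfolding shared_pair_free_def by (meson subset_trans)
    qed
  qed
qed

lemma sum_Pow_card_le1:
  fixes y \<alpha> :: real
  assumes "finite G"
  shows "(\<Sum>T\<in>Pow G. of_bool (card T \<le> 1) * (y ^ card T * \<alpha> ^ card (G - T)))
      = \<alpha> ^ card G + real (card G) * y * \<alpha> ^ (card G - 1)"
proof -
  have eq: "{T \<in> Pow G. card T \<le> 1} = insert {} ((\<lambda>g. {g}) ` G)"
  proof (intro equalityI subsetI)
    fix T assume "T \<in> {T \<in> Pow G. card T \<le> 1}"
    hence T: "T \<subseteq> G" "card T \<le> 1" by auto
    have "finite T" using T assms finite_subset by blast
    show "T \<in> insert {} ((\<lambda>g. {g}) ` G)"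
    proof (cases "T = {}")
      case False
      hence "card T = 1" using T \<open>finite T\<close> by (simp add: le_antisym Suc_leI card_gt_0_iff)
      then obtain g where "T = {g}" by (rule card_1_singletonE)
      thus ?thesis using T by auto
    qed simp
  qed auto
  have "(\<Sum>T\<in>Pow G. of_bool (card T \<le> 1) * (y ^ card T * \<alpha> ^ card (G - T)))
     = (\<Sum>T\<in>{T \<in> Pow G. card T \<le> 1}. y ^ card T * \<alpha> ^ card (G - T))"
    by (rule sum.mono_neutral_cong_right) (use assms in auto)
  also have "\<dots> = \<alpha> ^ card G + (\<Sum>T\<in>(\<lambda>g. {g}) ` G. y ^ card T * \<alpha> ^ card (G - T))"
    unfolding eq using assms by (subst sum.insert) auto
  also have "(\<Sum>T\<in>(\<lambda>g. {g}) ` G. y ^ card T * \<alpha> ^ card (G - T)) = (\<Sum>g\<in>G. y * \<alpha> ^ (card G - 1))"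
    using assms by (subst sum.reindex) (auto simp: inj_on_def)
  finally show ?thesis by simp
qed

text \<open>\<open>G1\<close> is the old part of the new edges. New edges of different members are
  distinct, so the sum factorises over keys. In a group on one vertex pair at most one edge may be
  old, which yields \<open>pair_weight\<close>; for the other keys the binomial theorem
  applies.\<close>

lemma nice_fam_weight:
  assumes E: "unif r E" "B \<subseteq> E" "r \<ge> 2" and n: "nice r E B \<Z>" "\<Z> \<subseteq> min_bad_sets r n" and D: "D > 0"
  defines "G \<equiv> \<Union>\<Z> - E"
  shows "(\<Sum>G1\<in>Pow G. of_bool (shared_pair_free E \<Z> G1) * (y ^ card G1 * \<alpha> ^ card (G - G1)))
     = fam_weight r n E B y \<alpha> D \<Z> * D ^ card G"
proof -
  have fin\<Z>: "finite \<Z>" using n(2) finite_MB finite_subset by blast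
  have finZ: "finite Z" if "Z \<in> \<Z>" for Z using niceD(1)[OF n(1) that] by simp
  define I where "I = key ` \<Z>"
  define K where "K \<kappa> = {Z \<in> \<Z>. key Z = \<kappa>}" for \<kappa>
  define H where "H \<kappa> = \<Union>(K \<kappa>) - E" for \<kappa>
  define two where "two \<kappa> = (case \<kappa> of Inl q \<Rightarrow> True | Inr Z \<Rightarrow> False)" for \<kappa> :: "nat set + nat set set"
  define v where "v \<kappa> T = of_bool (two \<kappa> \<longrightarrow> card T \<le> 1) * (y ^ card T * \<alpha> ^ card (H \<kappa> - T))" for \<kappa> T
  have finI: "finite I" unfolding I_def using fin\<Z> by simp
  have finH: "finite (H \<kappa>)" for \<kappa> unfolding H_def K_def
    by (intro finite_Diff finite_Union) (use fin\<Z> finZ in auto)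
  have disjZ: "(Z - E) \<inter> (Z' - E) = {}" if "Z \<in> \<Z>" "Z' \<in> \<Z>" "Z \<noteq> Z'" for Z Z'
    by (rule nice_new_edges_disjoint[OF E(1,2) n(1) that])
  have disjH: "H \<kappa> \<inter> H \<kappa>' = {}" if "\<kappa> \<noteq> \<kappa>'" for \<kappa> \<kappa>'
  proof (rule ccontr)
    assume "H \<kappa> \<inter> H \<kappa>' \<noteq> {}"
    then obtain g Z Z' where g: "g \<in> Z" "g \<in> Z'" "g \<notin> E" "Z \<in> \<Z>" "Z' \<in> \<Z>" "key Z = \<kappa>" "key Z' = \<kappa>'"
      unfolding H_def K_def by blast
    hence "Z \<noteq> Z'" using that by blast
    thus False using disjZ[OF g(4,5)] g(1-3) by blast
  qed
  have GH: "G = (\<Union>\<kappa>\<in>I. H \<kappa>)" unfolding G_def I_def H_def K_def by blast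
  have cardG: "card G = (\<Sum>\<kappa>\<in>I. card (H \<kappa>))"
    unfolding GH using finI finH disjH by (intro card_UN_disjoint) auto
  have cardZE: "card (Z - E) = card Z - 1" if Z: "Z \<in> \<Z>" for Z
    by (rule nice_pair_configuration[OF E n(1) Z])
  have single: "\<exists>f. Z - E = {f}" if Z: "Z \<in> \<Z>" "card Z = 2" for Z
  proof -
    have "card (Z - E) = 1" using cardZE[OF Z(1)] Z(2) by simp
    thus ?thesis by (auto simp: card_1_singleton_iff)
  qed
  have keyInl: "card Z = 2 \<and> \<Inter>Z = q" if "key Z = Inl q" for Z q
    using that unfolding key_def by (auto split: if_splits)
  have cardT: "card (G1 \<inter> H \<kappa>) \<le> 1 \<longleftrightarrow> \<not> (\<exists>Z1\<in>K \<kappa>. \<exists>Z2\<in>K \<kappa>. Z1 \<noteq> Z2 \<and> (Z1 \<union> Z2) - E \<subseteq> G1)"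
    if k: "two \<kappa>" for \<kappa> G1
  proof -
    obtain q where q: "\<kappa> = Inl q" using k unfolding two_def by (cases \<kappa>) auto
    have K2: "Z \<in> \<Z>" "card Z = 2" if "Z \<in> K \<kappa>" for Z using that keyInl q unfolding K_def by auto
    have "finite (G1 \<inter> H \<kappa>)" using finH by blast
    hence "card (G1 \<inter> H \<kappa>) \<le> 1 \<longleftrightarrow> (\<forall>a\<in>G1 \<inter> H \<kappa>. \<forall>b\<in>G1 \<inter> H \<kappa>. a = b)"
      using card_le_Suc0_iff_eq by (metis One_nat_def)
    also have "\<dots> \<longleftrightarrow> \<not> (\<exists>Z1\<in>K \<kappa>. \<exists>Z2\<in>K \<kappa>. Z1 \<noteq> Z2 \<and> (Z1 \<union> Z2) - E \<subseteq> G1)"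
    proof
      assume *: "\<forall>a\<in>G1 \<inter> H \<kappa>. \<forall>b\<in>G1 \<inter> H \<kappa>. a = b"
      show "\<not> (\<exists>Z1\<in>K \<kappa>. \<exists>Z2\<in>K \<kappa>. Z1 \<noteq> Z2 \<and> (Z1 \<union> Z2) - E \<subseteq> G1)"
      proof (rule notI)
        assume "\<exists>Z1\<in>K \<kappa>. \<exists>Z2\<in>K \<kappa>. Z1 \<noteq> Z2 \<and> (Z1 \<union> Z2) - E \<subseteq> G1"
        then obtain Z1 Z2 where Z: "Z1 \<in> K \<kappa>" "Z2 \<in> K \<kappa>" "Z1 \<noteq> Z2" "(Z1 \<union> Z2) - E \<subseteq> G1" by blast
        obtain f1 where f1: "Z1 - E = {f1}" using single[OF K2[OF Z(1)]] by blast
        obtain f2 where f2: "Z2 - E = {f2}" using single[OF K2[OF Z(2)]] by blast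
        note f = f1 f2
        have "f1 \<in> Z1 - E" "f2 \<in> Z2 - E" unfolding f by simp_all
        hence "f1 \<in> G1 \<inter> H \<kappa>" "f2 \<in> G1 \<inter> H \<kappa>" using Z unfolding H_def by blast+
        hence "f1 = f2" using * by blast
        thus False using disjZ[OF K2(1)[OF Z(1)] K2(1)[OF Z(2)] Z(3)] unfolding f by simp
      qed
    next
      assume *: "\<not> (\<exists>Z1\<in>K \<kappa>. \<exists>Z2\<in>K \<kappa>. Z1 \<noteq> Z2 \<and> (Z1 \<union> Z2) - E \<subseteq> G1)"
      show "\<forall>a\<in>G1 \<inter> H \<kappa>. \<forall>b\<in>G1 \<inter> H \<kappa>. a = b"
      proof (intro ballI)
        fix a b assume ab: "a \<in> G1 \<inter> H \<kappa>" "b \<in> G1 \<inter> H \<kappa>"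
        then obtain Z1 Z2 where Z: "Z1 \<in> K \<kappa>" "a \<in> Z1 - E" "Z2 \<in> K \<kappa>" "b \<in> Z2 - E" unfolding H_def by blast
        obtain f1 where f1: "Z1 - E = {f1}" using single[OF K2[OF Z(1)]] by blast
        obtain f2 where f2: "Z2 - E = {f2}" using single[OF K2[OF Z(3)]] by blast
        note f = f1 f2
        have eq: "a = f1" "b = f2" using Z(2,4) unfolding f by simp_all
        have "Z1 \<union> Z2 - E = {f1} \<union> {f2}" unfolding f[symmetric] by blast
        hence "Z1 \<union> Z2 - E \<subseteq> G1" using eq ab by simp
        hence "Z1 = Z2" using * Z(1,3) by blast
        hence "{f1} = {f2}" using f by simp
        thus "a = b" using eq by simp
      qed
    qed
    finally show ?thesis .
  qed
  have spf_iff: "shared_pair_free E \<Z> G1 \<longleftrightarrow> (\<forall>\<kappa>\<in>I. two \<kappa> \<longrightarrow> card (G1 \<inter> H \<kappa>) \<le> 1)" for G1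
  proof -
    have "(\<forall>\<kappa>\<in>I. two \<kappa> \<longrightarrow> card (G1 \<inter> H \<kappa>) \<le> 1) \<longleftrightarrow>
       (\<forall>\<kappa>\<in>I. two \<kappa> \<longrightarrow> \<not> (\<exists>Z1\<in>K \<kappa>. \<exists>Z2\<in>K \<kappa>. Z1 \<noteq> Z2 \<and> (Z1 \<union> Z2) - E \<subseteq> G1))"
      by (intro ball_cong refl imp_cong cardT)
    also have "\<dots> \<longleftrightarrow> shared_pair_free E \<Z> G1"
    proof
      assume *: "\<forall>\<kappa>\<in>I. two \<kappa> \<longrightarrow> \<not> (\<exists>Z1\<in>K \<kappa>. \<exists>Z2\<in>K \<kappa>. Z1 \<noteq> Z2 \<and> (Z1 \<union> Z2) - E \<subseteq> G1)"
      show "shared_pair_free E \<Z> G1" unfolding shared_pair_free_def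
      proof (rule notI)
        assume "\<exists>Z1\<in>\<Z>. \<exists>Z2\<in>\<Z>. Z1 \<noteq> Z2 \<and> card Z1 = 2 \<and> card Z2 = 2 \<and> \<Inter>Z1 = \<Inter>Z2 \<and> (Z1 \<union> Z2) - E \<subseteq> G1"
        then obtain Z1 Z2 where Z: "Z1 \<in> \<Z>" "Z2 \<in> \<Z>" "Z1 \<noteq> Z2" "card Z1 = 2" "card Z2 = 2" "\<Inter>Z1 = \<Inter>Z2" "(Z1 \<union> Z2) - E \<subseteq> G1"
          by blast
        have k: "key Z1 = Inl (\<Inter>Z1)" "key Z2 = Inl (\<Inter>Z1)" using Z(4-6) by (simp_all add: key_def)
        have "Inl (\<Inter>Z1) \<in> I" unfolding I_def k(1)[symmetric] using Z(1) by blast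
        moreover have "two (Inl (\<Inter>Z1))" by (simp add: two_def)
        moreover have "Z1 \<in> K (Inl (\<Inter>Z1))" "Z2 \<in> K (Inl (\<Inter>Z1))" using k Z(1,2) by (auto simp: K_def)
        ultimately show False using * Z(3,7) by blast
      qed
    next
      assume shared_pair_free: "shared_pair_free E \<Z> G1"
      show "\<forall>\<kappa>\<in>I. two \<kappa> \<longrightarrow> \<not> (\<exists>Z1\<in>K \<kappa>. \<exists>Z2\<in>K \<kappa>. Z1 \<noteq> Z2 \<and> (Z1 \<union> Z2) - E \<subseteq> G1)"
      proof (intro ballI impI notI)
        fix \<kappa> assume "\<kappa> \<in> I" and k: "two \<kappa>" and "\<exists>Z1\<in>K \<kappa>. \<exists>Z2\<in>K \<kappa>. Z1 \<noteq> Z2 \<and> (Z1 \<union> Z2) - E \<subseteq> G1"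
        then obtain Z1 Z2 where Z: "Z1 \<in> K \<kappa>" "Z2 \<in> K \<kappa>" "Z1 \<noteq> Z2" "(Z1 \<union> Z2) - E \<subseteq> G1" by blast
        obtain q where q: "\<kappa> = Inl q" using k unfolding two_def by (cases \<kappa>) auto
        have a: "Z1 \<in> \<Z>" "Z2 \<in> \<Z>" "card Z1 = 2" "card Z2 = 2" "\<Inter>Z1 = \<Inter>Z2"
          using Z(1,2) keyInl[of _ q] q unfolding K_def by auto
        show False using shared_pair_free a Z(3,4) unfolding shared_pair_free_def by blast
      qed
    qed
    finally show ?thesis ..
  qed
  have term_eq: "of_bool (shared_pair_free E \<Z> G1) * (y ^ card G1 * \<alpha> ^ card (G - G1)) = (\<Prod>\<kappa>\<in>I. v \<kappa> (G1 \<inter> H \<kappa>))"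
    if G1: "G1 \<subseteq> G" for G1
  proof -
    have "card G1 = card (\<Union>\<kappa>\<in>I. G1 \<inter> H \<kappa>)" using G1 unfolding GH by (intro arg_cong[of _ _ card]) blast
    also have "\<dots> = (\<Sum>\<kappa>\<in>I. card (G1 \<inter> H \<kappa>))" using finI finH disjH by (intro card_UN_disjoint) auto
    finally have c1: "card G1 = (\<Sum>\<kappa>\<in>I. card (G1 \<inter> H \<kappa>))" .
    have "card (G - G1) = card (\<Union>\<kappa>\<in>I. H \<kappa> - G1 \<inter> H \<kappa>)" unfolding GH by (intro arg_cong[of _ _ card]) blast
    also have "\<dots> = (\<Sum>\<kappa>\<in>I. card (H \<kappa> - G1 \<inter> H \<kappa>))" using finI finH disjH by (intro card_UN_disjoint) auto
    finally have c2: "card (G - G1) = (\<Sum>\<kappa>\<in>I. card (H \<kappa> - G1 \<inter> H \<kappa>))" .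
    have c3: "of_bool (shared_pair_free E \<Z> G1) = (\<Prod>\<kappa>\<in>I. of_bool (two \<kappa> \<longrightarrow> card (G1 \<inter> H \<kappa>) \<le> 1) :: real)"
    proof (cases "shared_pair_free E \<Z> G1")
      case True thus ?thesis unfolding spf_iff by simp
    next
      case False
      then obtain \<kappa> where "\<kappa> \<in> I" "\<not> (two \<kappa> \<longrightarrow> card (G1 \<inter> H \<kappa>) \<le> 1)" unfolding spf_iff by blast
      hence "(\<Prod>\<kappa>\<in>I. of_bool (two \<kappa> \<longrightarrow> card (G1 \<inter> H \<kappa>) \<le> 1) :: real) = 0"
        using finI by (intro prod_zero) auto
      thus ?thesis using False by simp
    qed
    show ?thesis unfolding v_def c1 c2 c3 power_sum prod.distrib ..
  qed
  have "(\<Sum>G1\<in>Pow G. of_bool (shared_pair_free E \<Z> G1) * (y ^ card G1 * \<alpha> ^ card (G - G1)))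
     = (\<Sum>G1\<in>Pow (\<Union>\<kappa>\<in>I. H \<kappa>). \<Prod>\<kappa>\<in>I. v \<kappa> (G1 \<inter> H \<kappa>))"
    using term_eq unfolding GH[symmetric] by (intro sum.cong) auto
  also have "\<dots> = (\<Prod>\<kappa>\<in>I. \<Sum>T\<in>Pow (H \<kappa>). v \<kappa> T)"
    using finI finH disjH by (intro sum_Pow_UN_prod)
  also have "\<dots> = (\<Prod>\<kappa>\<in>I. group_weight y \<alpha> D \<kappa> (K \<kappa>) * D ^ card (H \<kappa>))"
  proof (rule prod.cong[OF refl])
    fix \<kappa> assume \<kappa>: "\<kappa> \<in> I"
    show "(\<Sum>T\<in>Pow (H \<kappa>). v \<kappa> T) = group_weight y \<alpha> D \<kappa> (K \<kappa>) * D ^ card (H \<kappa>)"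
    proof (cases \<kappa>)
      case (Inl q)
      have K2: "Z \<in> \<Z>" "card Z = 2" if "Z \<in> K \<kappa>" for Z using that keyInl Inl unfolding K_def by auto
      have "H \<kappa> = (\<Union>Z\<in>K \<kappa>. Z - E)" unfolding H_def by blast
      hence "card (H \<kappa>) = card (\<Union>Z\<in>K \<kappa>. Z - E)" by simp
      also have "\<dots> = (\<Sum>Z\<in>K \<kappa>. card (Z - E))"
        using fin\<Z> finZ disjZ by (intro card_UN_disjoint) (auto simp: K_def)
      also have "\<dots> = (\<Sum>Z\<in>K \<kappa>. 1)" using K2 cardZE by (intro sum.cong) auto
      finally have "card (H \<kappa>) = card (K \<kappa>)" by simp
      moreover have "(\<Sum>T\<in>Pow (H \<kappa>). v \<kappa> T) = \<alpha> ^ card (H \<kappa>) + real (card (H \<kappa>)) * y * \<alpha> ^ (card (H \<kappa>) - 1)"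
        unfolding v_def using sum_Pow_card_le1[OF finH[of \<kappa>], of y \<alpha>] Inl by (simp add: two_def)
      ultimately show ?thesis using D Inl by (simp add: group_weight_def pair_weight_def)
    next
      case (Inr Z)
      have "Z \<in> \<Z>" "K \<kappa> = {Z}" using \<kappa> Inr unfolding I_def K_def key_def by (auto split: if_splits)
      hence "H \<kappa> = Z - E" "card (H \<kappa>) = card Z - 1" using cardZE unfolding H_def by auto
      moreover have "(\<Sum>T\<in>Pow (H \<kappa>). v \<kappa> T) = (y + \<alpha>) ^ card (H \<kappa>)"
        unfolding v_def using sum_Pow_binomial[OF finH[of \<kappa>], of y \<alpha>] Inr by (simp add: two_def)
      ultimately show ?thesis using D Inr \<open>K \<kappa> = {Z}\<close>
        by (simp add: group_weight_def conf_weight_def power_divide)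
    qed
  qed
  also have "\<dots> = (\<Prod>\<kappa>\<in>I. group_weight y \<alpha> D \<kappa> (K \<kappa>)) * D ^ card G"
    unfolding prod.distrib cardG power_sum ..
  also have "(\<Prod>\<kappa>\<in>I. group_weight y \<alpha> D \<kappa> (K \<kappa>)) = fam_weight r n E B y \<alpha> D \<Z>"
    unfolding fam_weight_def K_def
  proof (rule prod.mono_neutral_left)
    show "finite (key ` Omega r n E B)" by simp
    show "I \<subseteq> key ` Omega r n E B" unfolding I_def using nice_subset_Omega[OF n] by blast
    show "\<forall>\<kappa>\<in>key ` Omega r n E B - I. group_weight y \<alpha> D \<kappa> {Z \<in> \<Z>. key Z = \<kappa>} = 1"
    proof
      fix \<kappa> assume "\<kappa> \<in> key ` Omega r n E B - I"
      hence "{Z \<in> \<Z>. key Z = \<kappa>} = {}" unfolding I_def by blast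
      thus "group_weight y \<alpha> D \<kappa> {Z \<in> \<Z>. key Z = \<kappa>} = 1"
        by (simp only:) (cases \<kappa>; simp add: group_weight_def pair_weight_def)
    qed
  qed
  finally show ?thesis .
qed

text \<open>Edges of a small conflict-free set appear as if independent with probability y divided
  by \<open>scale\<close>. The size bound \<open>K\<close> drops with every round, see
  \<open>round_estimate\<close>.\<close>

definition pure :: "nat \<Rightarrow> nat \<Rightarrow> nat \<Rightarrow> real \<Rightarrow> real \<Rightarrow> (nat set set \<Rightarrow> real) \<Rightarrow> bool" where
  "pure r n K \<epsilon> y \<mu> \<longleftrightarrow> (\<forall>E\<subseteq>edges r n. conflict_free r E \<longrightarrow> card E \<le> K \<longrightarrow>
      \<bar>incl_prob r n \<mu> E * scale r n ^ card E - y ^ card E\<bar> \<le> \<epsilon>)"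

text \<open>The two bounds of \<open>split_prob_bounds\<close> differ by the union bound over
  \<open>B\<close>: one more edge is present there, which by \<open>apriori\<close> costs a factor
  of order 1/\<open>scale\<close>.\<close>

lemma split_prob_approx:
  assumes st: "state r n \<mu>" "apriori r n c \<mu>" "pure r n K \<epsilon> y \<mu>"
    and AB: "A \<subseteq> edges r n" "B \<subseteq> edges r n" "A \<inter> B = {}" "conflict_free r A" "card A \<le> K"
    and p: "p = \<alpha> / scale r n" "0 \<le> \<alpha>" "\<alpha> \<le> 1" and D: "scale r n \<ge> 1" and c: "c \<ge> 0"
  shows "\<bar>split_prob r n p \<mu> A B * scale r n ^ (card A + card B) - y ^ card A * \<alpha> ^ card B\<bar>
     \<le> \<epsilon> + real (card B) * c ^ (card A + 1) / scale r n"
proof -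
  define D where "D = scale r n"
  have D1: "D > 0" using D unfolding D_def by simp
  have p0: "p \<ge> 0" using p D1 by (simp add: D_def)
  have pD: "p ^ card B * D ^ card B = \<alpha> ^ card B"
    using D1 unfolding p(1) D_def[symmetric] by (simp add: power_divide)
  define I where "I = incl_prob r n \<mu> A * D ^ card A"
  define \<theta> where "\<theta> = (\<Sum>b\<in>B. incl_prob r n \<mu> (insert b A)) * D ^ card A"
  have pureA: "\<bar>I - y ^ card A\<bar> \<le> \<epsilon>" using st(3) AB unfolding pure_def I_def D_def by blast
  have finA: "finite A" using AB(1) finite_edges finite_subset by blast
  have "(\<Sum>b\<in>B. incl_prob r n \<mu> (insert b A)) \<le> (\<Sum>b\<in>B. (c / D) ^ (card A + 1))"
  proof (rule sum_mono)
    fix b assume b: "b \<in> B"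
    have "insert b A \<subseteq> edges r n" using b AB by blast
    hence "incl_prob r n \<mu> (insert b A) \<le> (c / D) ^ card (insert b A)"
      using st(2) unfolding apriori_def D_def by blast
    moreover have "b \<notin> A" using b AB(3) by blast
    ultimately show "incl_prob r n \<mu> (insert b A) \<le> (c / D) ^ (card A + 1)" using finA by simp
  qed
  hence "\<theta> \<le> (real (card B) * (c / D) ^ (card A + 1)) * D ^ card A"
    unfolding \<theta>_def using D1 by (intro mult_right_mono) auto
  also have "\<dots> = real (card B) * c ^ (card A + 1) / D" using D1 by (simp add: power_divide)
  finally have th: "\<theta> \<le> real (card B) * c ^ (card A + 1) / D" .
  have th0: "\<theta> \<ge> 0" unfolding \<theta>_def using D1 incl_nonneg[OF st(1)] by (intro mult_nonneg_nonneg sum_nonneg) auto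
  define s where "s = split_prob r n p \<mu> A B * D ^ (card A + card B)"
  have "s \<le> (p ^ card B * incl_prob r n \<mu> A) * D ^ (card A + card B)"
    unfolding s_def using split_prob_bounds(1)[OF st(1) p0 AB(2), of A] D1 by (intro mult_right_mono) auto
  also have "\<dots> = (p ^ card B * D ^ card B) * I" unfolding I_def by (simp add: power_add)
  finally have s1: "s \<le> \<alpha> ^ card B * I" unfolding pD .
  have "s \<ge> (p ^ card B * (incl_prob r n \<mu> A - (\<Sum>b\<in>B. incl_prob r n \<mu> (insert b A)))) * D ^ (card A + card B)"
    unfolding s_def using split_prob_bounds(2)[OF st(1) p0 AB(2), of A] D1 by (intro mult_right_mono) auto
  also have "(p ^ card B * (incl_prob r n \<mu> A - (\<Sum>b\<in>B. incl_prob r n \<mu> (insert b A)))) * D ^ (card A + card B)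
      = (p ^ card B * D ^ card B) * (I - \<theta>)" unfolding I_def \<theta>_def by (simp add: power_add algebra_simps)
  finally have s2: "s \<ge> \<alpha> ^ card B * (I - \<theta>)" unfolding pD .
  have a: "0 \<le> \<alpha> ^ card B" "\<alpha> ^ card B \<le> 1" using p by (auto intro: power_le_one)
  have e0: "\<epsilon> \<ge> 0" using pureA by linarith
  have "s - y ^ card A * \<alpha> ^ card B \<le> \<alpha> ^ card B * (I - y ^ card A)" using s1 by (simp add: algebra_simps)
  also have "\<dots> \<le> \<alpha> ^ card B * \<epsilon>" using pureA a by (intro mult_left_mono) auto
  also have "\<dots> \<le> \<epsilon>" using a e0 by (simp add: mult_left_le_one_le)
  finally have u: "s - y ^ card A * \<alpha> ^ card B \<le> \<epsilon>" .
  have "y ^ card A * \<alpha> ^ card B - s \<le> \<alpha> ^ card B * (y ^ card A - I + \<theta>)" using s2 by (simp add: algebra_simps)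
  also have "\<dots> \<le> \<alpha> ^ card B * (\<epsilon> + \<theta>)" using pureA a by (intro mult_left_mono) auto
  also have "\<dots> \<le> \<epsilon> + \<theta>" using a e0 th0 by (simp add: mult_left_le_one_le)
  finally have l: "y ^ card A * \<alpha> ^ card B - s \<le> \<epsilon> + \<theta>" .
  have "real (card B) * c ^ (card A + 1) / D \<ge> 0" using th th0 by linarith
  thus ?thesis using u l th unfolding s_def[symmetric] D_def[symmetric] by (simp add: abs_le_iff)
qed

text \<open>\<open>split_prob_approx\<close> is summed over the old parts \<open>G1\<close>. When
  the old edges are not conflict-free the probability is exactly 0 instead of close to a power of y;
  \<open>pair_weight\<close> encodes just this correction.\<close>

lemma fam_prob_nice:
  assumes st: "state r n \<mu>" "apriori r n c \<mu>" "pure r n L \<epsilon> y \<mu>"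
    and E: "E \<subseteq> edges r n" "conflict_free r E" "B \<subseteq> E" and r: "r \<ge> 2" "n \<ge> 2 * r"
    and n: "nice r E B \<Z>" "\<Z> \<subseteq> min_bad_sets r n"
    and p: "p = \<alpha> / scale r n" "0 \<le> \<alpha>" "\<alpha> \<le> 1" and cc: "0 \<le> c" "c \<le> cc" "1 \<le> cc"
    and L: "card E + card (\<Union>\<Z> - E) \<le> L"
  shows "\<bar>fam_prob r n p \<mu> (E - B) B \<Z> * scale r n ^ (card E + card (\<Union>\<Z> - E)) -
      y ^ card (E - B) * \<alpha> ^ card B * (fam_weight r n E B y \<alpha> (scale r n) \<Z> * scale r n ^ card (\<Union>\<Z> - E))\<bar>
     \<le> 2 ^ L * (\<epsilon> + real L * cc ^ (L + 1) / scale r n)"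
proof -
  define D where "D = scale r n"
  define G where "G = \<Union>\<Z> - E"
  define A where "A = E - B"
  define \<eta> where "\<eta> = \<epsilon> + real L * cc ^ (L + 1) / D"
  have D1: "D \<ge> 1" unfolding D_def by (rule scale_lower(2)[OF r])
  have uE: "unif r E" by (rule unif_edges[OF E(1)])
  have Gs: "G \<subseteq> edges r n" using n(2) unfolding G_def min_bad_sets_def by blast
  have fin: "finite E" "finite G" "finite A" "finite B" "finite \<Z>"
    using E Gs n(2) finite_edges finite_MB finite_subset unfolding A_def by (meson finite_Diff)+
  have cE: "card E = card A + card B" unfolding A_def using fin E(3) by (simp add: card_Diff_subset card_mono)
  have AB: "A \<subseteq> edges r n" "B \<subseteq> edges r n" using E unfolding A_def by blast+
  have e0: "\<epsilon> \<ge> 0"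
  proof -
    have "conflict_free r {}" unfolding conflict_free_def bad_def by auto
    hence "\<bar>incl_prob r n \<mu> {} * scale r n ^ card {} - y ^ card {}\<bar> \<le> \<epsilon>" 
      using st(3)[unfolded pure_def, rule_format, of "{}"] by simp
    thus ?thesis by linarith
  qed
  have eta0: "\<eta> \<ge> 0" unfolding \<eta>_def using e0 D1 cc by simp
  have AE: "\<Union>\<Z> - (A \<union> B) = G" unfolding A_def G_def using E(3) by blast
  have pt: "\<bar>split_prob r n p \<mu> (A \<union> G1) (B \<union> (G - G1)) * D ^ (card E + card G)
      - y ^ card A * \<alpha> ^ card B * (of_bool (shared_pair_free E \<Z> G1) * (y ^ card G1 * \<alpha> ^ card (G - G1)))\<bar> \<le> \<eta>"
    if G1: "G1 \<in> Pow G" for G1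
  proof -
    have finG1: "finite G1" using G1 fin finite_subset by blast
    have c1: "card (A \<union> G1) = card A + card G1"
      using fin finG1 G1 by (intro card_Un_disjoint) (auto simp: A_def G_def)
    have c2: "card (B \<union> (G - G1)) = card B + card (G - G1)"
      using fin E(3) by (intro card_Un_disjoint) (auto simp: G_def)
    have c3: "card G = card G1 + card (G - G1)" using G1 fin finG1 by (simp add: card_Diff_subset card_mono)
    show ?thesis
    proof (cases "shared_pair_free E \<Z> G1")
      case True
      have conflict_free: "conflict_free r (A \<union> G1)"
        using cf_nice_iff[OF uE E(2,3) r(1) n(1) fin(5), of G1] True G1 unfolding A_def G_def by blast
      have sub: "A \<union> G1 \<subseteq> edges r n" "B \<union> (G - G1) \<subseteq> edges r n" using AB Gs G1 by blast+
      have disj: "(A \<union> G1) \<inter> (B \<union> (G - G1)) = {}" using G1 E(3) unfolding A_def G_def by blast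
      have le: "card (A \<union> G1) \<le> L" "card (B \<union> (G - G1)) \<le> L" using L c1 c2 c3 cE unfolding G_def[symmetric] by linarith+
      have "\<bar>split_prob r n p \<mu> (A \<union> G1) (B \<union> (G - G1)) * D ^ (card (A \<union> G1) + card (B \<union> (G - G1))) -
           y ^ card (A \<union> G1) * \<alpha> ^ card (B \<union> (G - G1))\<bar> \<le> \<epsilon> + real (card (B \<union> (G - G1))) * c ^ (card (A \<union> G1) + 1) / D"
        unfolding D_def by (rule split_prob_approx[OF st sub disj conflict_free le(1) p D1[unfolded D_def] cc(1)])
      also have "\<dots> \<le> \<eta>"
      proof -
        have "c ^ (card (A \<union> G1) + 1) \<le> cc ^ (card (A \<union> G1) + 1)" using cc by (intro power_mono) auto
        also have "\<dots> \<le> cc ^ (L + 1)" using cc le by (intro power_increasing) auto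
        finally have "real (card (B \<union> (G - G1))) * c ^ (card (A \<union> G1) + 1) \<le> real L * cc ^ (L + 1)"
          using le cc by (intro mult_mono) auto
        thus ?thesis unfolding \<eta>_def using D1 by (simp add: divide_right_mono)
      qed
      also have "card (A \<union> G1) + card (B \<union> (G - G1)) = card E + card G" using c1 c2 c3 cE by simp
      finally show ?thesis using True unfolding c1 c2 power_add by (simp add: mult_ac)
    next
      case False
      have "\<not> conflict_free r (A \<union> G1)"
        using cf_nice_iff[OF uE E(2,3) r(1) n(1) fin(5), of G1] False G1 unfolding A_def G_def by blast
      hence "incl_prob r n \<mu> (A \<union> G1) = 0" by (rule incl_not_cf[OF st(1)])
      moreover have "B \<union> (G - G1) \<subseteq> edges r n" using AB Gs G1 by blast
      moreover have "p \<ge> 0" using p D1 unfolding D_def by simp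
      ultimately have "split_prob r n p \<mu> (A \<union> G1) (B \<union> (G - G1)) = 0"
        using split_prob_bounds(1,3)[OF st(1), of p "B \<union> (G - G1)" "A \<union> G1"] by auto
      thus ?thesis using False eta0 by simp
    qed
  qed
  have "fam_prob r n p \<mu> A B \<Z> * D ^ (card E + card G) - y ^ card A * \<alpha> ^ card B * (fam_weight r n E B y \<alpha> D \<Z> * D ^ card G)
     = (\<Sum>G1\<in>Pow G. split_prob r n p \<mu> (A \<union> G1) (B \<union> (G - G1)) * D ^ (card E + card G)
      - y ^ card A * \<alpha> ^ card B * (of_bool (shared_pair_free E \<Z> G1) * (y ^ card G1 * \<alpha> ^ card (G - G1))))"
    unfolding fam_prob_split[OF AB fin(2) AE[symmetric]]
      nice_fam_weight[OF uE E(3) r(1) n, of D y \<alpha>, folded G_def, OF order.strict_trans2[OF zero_less_one D1], symmetric]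
    by (simp only: sum_subtractf sum_distrib_left sum_distrib_right)
  also have "\<bar>\<dots>\<bar> \<le> (\<Sum>G1\<in>Pow G. \<eta>)"
    by (rule order_trans[OF sum_abs]) (intro sum_mono pt)
  also have "\<dots> = 2 ^ card G * \<eta>" using fin by (simp add: card_Pow)
  also have "\<dots> \<le> 2 ^ L * \<eta>"
    using L eta0 unfolding G_def[symmetric] by (intro mult_right_mono power_increasing) auto
  finally show ?thesis unfolding A_def G_def D_def \<eta>_def .
qed

section \<open>Truncated inclusion and exclusion\<close>

lemma Omega_attached:
  assumes E: "E \<subseteq> edges r n" "B \<subseteq> E" and r: "r \<ge> 2" and Z: "Z \<in> Omega r n E B"
  shows "unif r Z" "minbad r Z" "Z \<subseteq> edges r n" "Z \<inter> E \<noteq> {}" "card (Z - E) = card Z - 1" "2 \<le> card Z" "card Z \<le> 8"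
proof -
  show sub: "Z \<subseteq> edges r n" and mb: "minbad r Z" using Z unfolding Omega_def min_bad_sets_def by blast+
  show u: "unif r Z" by (rule unif_edges[OF sub])
  obtain b where b: "b \<in> B" "b \<in> Z" "\<Union>Z \<inter> \<Union>E = b" using Z unfolding Omega_def by blast
  have "Z \<inter> E = {b}" using nice_Int[OF unif_edges[OF E(1)] u r _ b(2,3)] b(1) E(2) by blast
  hence "Z - E = Z - {b}" by blast
  thus "card (Z - E) = card Z - 1" using b u by simp
  show "Z \<inter> E \<noteq> {}" using b E(2) by blast
  show "2 \<le> card Z" "card Z \<le> 8" using minbad_card[OF mb] by auto
qed

lemma card_Union_edges_le:
  assumes "E \<subseteq> edges r n" "card E \<le> K"
  shows "finite (\<Union>E)" "card (\<Union>E) \<le> r * K"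
proof -
  have u: "unif r E" by (rule unif_edges[OF assms(1)])
  thus "finite (\<Union>E)" by simp
  have "card (\<Union>E) \<le> (\<Sum>e\<in>E. card e)" using card_Union_le_sum_card by blast
  also have "\<dots> = card E * r" using u by (simp add: unif_def)
  finally show "card (\<Union>E) \<le> r * K" using assms(2) by (metis le_trans mult.commute mult_le_mono2)
qed

lemma conf_weight_le:
  assumes "0 \<le> y" "y \<le> 1" "0 \<le> \<alpha>" "\<alpha> \<le> 1" "D > 0" "card Z \<le> 8"
  shows "0 \<le> conf_weight y \<alpha> D Z" "conf_weight y \<alpha> D Z \<le> 2 ^ 8 * (1 / D) ^ (card Z - 1)"
proof -
  show "0 \<le> conf_weight y \<alpha> D Z" unfolding conf_weight_def using assms by simp
  have "conf_weight y \<alpha> D Z \<le> (2 / D) ^ (card Z - 1)"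
    unfolding conf_weight_def using assms by (intro power_mono divide_right_mono) auto
  also have "\<dots> = 2 ^ (card Z - 1) * (1 / D) ^ (card Z - 1)" by (simp add: power_divide)
  also have "\<dots> \<le> 2 ^ 8 * (1 / D) ^ (card Z - 1)"
    using assms by (intro mult_right_mono power_increasing) auto
  finally show "conf_weight y \<alpha> D Z \<le> 2 ^ 8 * (1 / D) ^ (card Z - 1)" .
qed

lemma sum_conf_weight_le:
  assumes E: "E \<subseteq> edges r n" "B \<subseteq> E" "card E \<le> K" and r: "r \<ge> 2" "n \<ge> 2 * r"
    and y: "0 \<le> y" "y \<le> 1" "0 \<le> \<alpha>" "\<alpha> \<le> 1"
  shows "(\<Sum>Z\<in>Omega r n E B. conf_weight y \<alpha> (scale r n) Z) \<le> 2 ^ 8 * attach_const r (r * K)"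
proof -
  note OA = Omega_attached[OF E(1,2) r(1)]
  have D: "scale r n > 0" using scale_lower(2)[OF r] by linarith
  have "(\<Sum>Z\<in>Omega r n E B. conf_weight y \<alpha> (scale r n) Z) \<le> (\<Sum>Z\<in>Omega r n E B. 2 ^ 8 * (1 / scale r n) ^ card (Z - E))"
    using conf_weight_le(2)[OF y D] OA by (intro sum_mono) simp
  also have "\<dots> = 2 ^ 8 * (\<Sum>Z\<in>Omega r n E B. (1 / scale r n) ^ card (Z - E))" by (simp add: sum_distrib_left)
  also have "(\<Sum>Z\<in>Omega r n E B. (1 / scale r n) ^ card (Z - E)) \<le> attach_const r (r * K) / real n ^ 0"
  proof (rule attach_sum_bound[OF r card_Union_edges_le[OF E(1,3)]])
    show "Omega r n E B \<subseteq> min_bad_sets r n" unfolding Omega_def by blast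
    fix Z assume Z: "Z \<in> Omega r n E B"
    show "card (\<Union>Z - \<Union>E) + 0 \<le> (r - 2) * card (Z - E)"
      using new_vertices_bound(1)[OF r(1) OA(1)[OF Z] OA(2)[OF Z] OA(4)[OF Z] order_refl] by simp
  qed
  finally show ?thesis by simp
qed

text \<open>Members may overlap here. Overlaps make the union smaller than the sum of the sizes, and
  since 1/\<open>scale\<close> is at most 1 the product of the weights is then only smaller.\<close>

lemma fam_weight_le_Union:
  assumes E: "E \<subseteq> edges r n" "B \<subseteq> E" and r: "r \<ge> 2" "n \<ge> 2 * r" and Z: "\<Z> \<subseteq> Omega r n E B"
    and y: "0 \<le> y" "y \<le> 1" "0 \<le> \<alpha>" "\<alpha> \<le> 1"
  shows "fam_weight r n E B y \<alpha> (scale r n) \<Z> \<le> 2 ^ (8 * card \<Z>) * (1 / scale r n) ^ card (\<Union>\<Z> - E)"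
proof -
  define D where "D = scale r n"
  note OA = Omega_attached[OF E r(1)]
  have D1: "D \<ge> 1" using scale_lower(2)[OF r] unfolding D_def by simp
  have finZ: "finite \<Z>" using Z finite_Omega finite_subset by blast
  have "fam_weight r n E B y \<alpha> D \<Z> \<le> (\<Prod>Z\<in>\<Z>. conf_weight y \<alpha> D Z)"
    using fam_weight_bounds(2)[OF Z y(1,3)] D1 by simp
  also have "\<dots> \<le> (\<Prod>Z\<in>\<Z>. 2 ^ 8 * (1 / D) ^ card (Z - E))"
  proof (rule prod_mono)
    fix Z' assume "Z' \<in> \<Z>"
    hence Z': "Z' \<in> Omega r n E B" using Z by blast
    show "0 \<le> conf_weight y \<alpha> D Z' \<and> conf_weight y \<alpha> D Z' \<le> 2 ^ 8 * (1 / D) ^ card (Z' - E)"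
      using conf_weight_le[OF y, of D Z'] OA(5,7)[OF Z' ] D1 Z' by simp
  qed
  also have "\<dots> = 2 ^ (8 * card \<Z>) * (1 / D) ^ (\<Sum>Z\<in>\<Z>. card (Z - E))"
    by (simp add: prod.distrib power_mult power_sum)
  also have "\<dots> \<le> 2 ^ (8 * card \<Z>) * (1 / D) ^ card (\<Union>\<Z> - E)"
  proof (intro mult_left_mono power_decreasing)
    have "\<Union>\<Z> - E = (\<Union>Z\<in>\<Z>. Z - E)" by blast
    thus "card (\<Union>\<Z> - E) \<le> (\<Sum>Z\<in>\<Z>. card (Z - E))" using card_UN_le[OF finZ, of "\<lambda>Z. Z - E"] by (simp only:)
  qed (use D1 in auto)
  finally show ?thesis unfolding D_def .
qed

definition level_sum :: "nat \<Rightarrow> nat \<Rightarrow> real \<Rightarrow> (nat set set \<Rightarrow> real) \<Rightarrow> nat set set \<Rightarrow> nat set set \<Rightarrow> nat \<Rightarrow> real" where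
  "level_sum r n p \<mu> A B j = (\<Sum>\<Z> | \<Z> \<subseteq> min_bad_meeting r n B \<and> card \<Z> = j. fam_prob r n p \<mu> A B \<Z>)"

definition model_sum :: "nat \<Rightarrow> nat \<Rightarrow> nat set set \<Rightarrow> nat set set \<Rightarrow> real \<Rightarrow> real \<Rightarrow> nat \<Rightarrow> real" where
  "model_sum r n E B y \<alpha> j = (\<Sum>\<Z> | \<Z> \<subseteq> Omega r n E B \<and> card \<Z> = j. fam_weight r n E B y \<alpha> (scale r n) \<Z>)"

text \<open>The first summand is the error of \<open>fam_prob_nice\<close>, with (2r)^(8r) turning
  1/\<open>scale\<close> into a multiple of 1/n; \<open>cc ^ L\<close> and
  \<open>2 ^ (8 * L)\<close> bound a family that is not nice in the process and in the
  model.\<close>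

definition level_err :: "nat \<Rightarrow> nat \<Rightarrow> real \<Rightarrow> nat \<Rightarrow> nat \<Rightarrow> real" where
  "level_err r K cc L j = fam_const r K j *
     (2 ^ L * (1 + real L * cc ^ (L + 1) * (2 * real r) ^ (8 * r)) + cc ^ L + 2 ^ (8 * L))"

lemma level_err_nonneg: "cc \<ge> 1 \<Longrightarrow> level_err r K cc L j \<ge> 0"
  unfolding level_err_def by (intro mult_nonneg_nonneg add_nonneg_nonneg) auto

text \<open>On nice families process and model differ by a small multiple of the weight; on the
  others each is at most a constant times the weight, and by \<open>family_sums\<close> the total
  weight of those is O(1/n).\<close>

lemma level_estimate:
  assumes st: "state r n \<mu>" "apriori r n c \<mu>" "pure r n L \<epsilon> y \<mu>"
    and E: "E \<subseteq> edges r n" "conflict_free r E" "B \<subseteq> E" "card E \<le> K" and r: "r \<ge> 3" "n \<ge> 2 * r"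
    and p: "p = \<alpha> / scale r n" "0 \<le> \<alpha>" "\<alpha> \<le> 1" and y: "0 \<le> y" "y \<le> 1"
    and cc: "0 \<le> c" "c + \<alpha> \<le> cc" "1 \<le> cc" and L: "K + 8 * j \<le> L"
  shows "\<bar>level_sum r n p \<mu> (E - B) B j * scale r n ^ card E -
      y ^ card (E - B) * \<alpha> ^ card B * model_sum r n E B y \<alpha> j\<bar> \<le> level_err r K cc L j * (\<epsilon> + 1 / real n)"
proof -
  define D where "D = scale r n"
  have r2: "r \<ge> 2" using r by simp
  have D1: "D \<ge> 1" unfolding D_def by (rule scale_lower(2)[OF r2 r(2)])
  define \<F> where "\<F> = {\<Z>. \<Z> \<subseteq> min_bad_meeting r n B \<and> card \<Z> = j}"
  have fin\<F>: "finite \<F>" unfolding \<F>_def by (rule finite_subset[of _ "Pow (min_bad_meeting r n B)"]) auto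
  define m where "m = y ^ card (E - B) * \<alpha> ^ card B"
  have m: "0 \<le> m" "m \<le> 1" unfolding m_def using y p by (auto intro!: mult_le_one power_le_one)
  \<comment> \<open>The model extended by 0 to all families meeting \<open>B\<close>, so that
    process and model are summed over the same index set.\<close>
  define \<psi> where "\<psi> \<Z> = (if \<Z> \<subseteq> Omega r n E B then m * fam_weight r n E B y \<alpha> D \<Z> else 0)" for \<Z>
  have ms: "m * model_sum r n E B y \<alpha> j = (\<Sum>\<Z>\<in>\<F>. \<psi> \<Z>)"
  proof -
    have "(\<Sum>\<Z>\<in>\<F>. \<psi> \<Z>) = (\<Sum>\<Z> | \<Z> \<subseteq> Omega r n E B \<and> card \<Z> = j. m * fam_weight r n E B y \<alpha> D \<Z>)"
      by (rule sum.mono_neutral_cong_right[OF fin\<F>])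
         (use Omega_subset_MBB[of r n E B] in \<open>auto simp: \<psi>_def \<F>_def\<close>)
    thus ?thesis unfolding model_sum_def D_def by (simp add: sum_distrib_left)
  qed
  define w where "w \<Z> = (1 / D) ^ card (\<Union>\<Z> - E)" for \<Z>
  have w0: "w \<Z> \<ge> 0" for \<Z> unfolding w_def using D1 by simp
  define \<eta> where "\<eta> = 2 ^ L * (\<epsilon> + real L * cc ^ (L + 1) / D)"
  define \<xi> where "\<xi> = cc ^ L + 2 ^ (8 * L)"
  have xi0: "\<xi> \<ge> 0" unfolding \<xi>_def using cc by simp
  have e0: "\<epsilon> \<ge> 0"
  proof -
    have "conflict_free r {}" unfolding conflict_free_def bad_def by auto
    hence "\<bar>incl_prob r n \<mu> {} * scale r n ^ card {} - y ^ card {}\<bar> \<le> \<epsilon>"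
      using st(3)[unfolded pure_def, rule_format, of "{}"] by simp
    thus ?thesis by linarith
  qed
  have eta0: "\<eta> \<ge> 0" unfolding \<eta>_def using e0 D1 cc by simp
  have pt: "\<bar>fam_prob r n p \<mu> (E - B) B \<Z> * D ^ card E - \<psi> \<Z>\<bar> \<le> \<eta> * w \<Z> + (if \<not> nice r E B \<Z> then \<xi> * w \<Z> else 0)"
    if Z: "\<Z> \<in> \<F>" for \<Z>
  proof -
    have sub: "\<Z> \<subseteq> min_bad_meeting r n B" "\<Z> \<subseteq> min_bad_sets r n" "card \<Z> = j" using Z unfolding \<F>_def min_bad_meeting_def by auto
    have finZ: "finite \<Z>" using sub finite_MB finite_subset by blast
    have "card (\<Union>\<Z>) \<le> (\<Sum>Z\<in>\<Z>. card Z)" using card_Union_le_sum_card by blast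
    also have "\<dots> \<le> (\<Sum>Z\<in>\<Z>. 8)" using sub by (intro sum_mono) (auto simp: min_bad_sets_def minbad_card)
    finally have "card (\<Union>\<Z>) \<le> 8 * j" using sub by simp
    moreover have "finite (\<Union>\<Z>)"
      by (rule finite_subset[of _ "edges r n"]) (use sub in \<open>auto simp: min_bad_sets_def\<close>)
    hence "card (\<Union>\<Z> - E) \<le> card (\<Union>\<Z>)" by (intro card_mono) auto
    ultimately have g: "card E + card (\<Union>\<Z> - E) \<le> L" using E(4) L by linarith
    have Dw: "w \<Z> * D ^ card (\<Union>\<Z> - E) = 1" unfolding w_def using D1 by (simp add: power_divide)
    show ?thesis
    proof (cases "nice r E B \<Z>")
      case True
      have sO: "\<Z> \<subseteq> Omega r n E B" by (rule nice_subset_Omega[OF True sub(2)])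
      have "c \<le> cc" using cc p by simp
      from fam_prob_nice[OF st E(1,2,3) r2 r(2) True sub(2) p cc(1) this cc(3) g]
      have "\<bar>fam_prob r n p \<mu> (E - B) B \<Z> * D ^ (card E + card (\<Union>\<Z> - E)) -
          m * (fam_weight r n E B y \<alpha> D \<Z> * D ^ card (\<Union>\<Z> - E))\<bar> \<le> \<eta>"
        unfolding \<eta>_def m_def D_def .
      hence "\<bar>fam_prob r n p \<mu> (E - B) B \<Z> * D ^ (card E + card (\<Union>\<Z> - E)) -
          m * (fam_weight r n E B y \<alpha> D \<Z> * D ^ card (\<Union>\<Z> - E))\<bar> * w \<Z> \<le> \<eta> * w \<Z>"
        using w0 by (rule mult_right_mono)
      also have "\<bar>fam_prob r n p \<mu> (E - B) B \<Z> * D ^ (card E + card (\<Union>\<Z> - E)) -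
          m * (fam_weight r n E B y \<alpha> D \<Z> * D ^ card (\<Union>\<Z> - E))\<bar> * w \<Z>
         = \<bar>(fam_prob r n p \<mu> (E - B) B \<Z> * D ^ (card E + card (\<Union>\<Z> - E)) -
          m * (fam_weight r n E B y \<alpha> D \<Z> * D ^ card (\<Union>\<Z> - E))) * w \<Z>\<bar>"
        using w0[of \<Z>] by (simp add: abs_mult)
      also have "(fam_prob r n p \<mu> (E - B) B \<Z> * D ^ (card E + card (\<Union>\<Z> - E)) -
          m * (fam_weight r n E B y \<alpha> D \<Z> * D ^ card (\<Union>\<Z> - E))) * w \<Z>
         = (fam_prob r n p \<mu> (E - B) B \<Z> * D ^ card E - m * fam_weight r n E B y \<alpha> D \<Z>) * (w \<Z> * D ^ card (\<Union>\<Z> - E))"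
        by (simp add: power_add algebra_simps)
      finally show ?thesis using True sO unfolding Dw by (simp add: \<psi>_def)
    next
      case False
      have AB: "E - B \<subseteq> edges r n" "B \<subseteq> edges r n" "(E - B) \<inter> B = {}" "E - B \<union> B = E" using E by blast+
      have p0: "p \<ge> 0" using p D1 unfolding D_def by simp
      have p1: "p \<le> 1" using p D1 unfolding D_def by simp
      have D0: "scale r n > 0" using D1 unfolding D_def by simp
      have "fam_prob r n p \<mu> (E - B) B \<Z> \<le> (cc / D) ^ (card E + card (\<Union>\<Z> - E))"
        using fam_prob_le[OF st(1,2) p0 p(1) AB(1,2,3) sub(1) cc(3,2,1) p(2) D0] unfolding AB(4) D_def .
      hence "fam_prob r n p \<mu> (E - B) B \<Z> * D ^ card E \<le> (cc / D) ^ (card E + card (\<Union>\<Z> - E)) * D ^ card E"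
        using D1 by (intro mult_right_mono) auto
      also have "\<dots> = cc ^ (card E + card (\<Union>\<Z> - E)) * w \<Z>"
        unfolding w_def using D1 by (simp add: power_divide power_add field_simps)
      also have "\<dots> \<le> cc ^ L * w \<Z>" using cc g w0 by (intro mult_right_mono power_increasing) auto
      finally have f1: "fam_prob r n p \<mu> (E - B) B \<Z> * D ^ card E \<le> cc ^ L * w \<Z>" .
      have f0: "fam_prob r n p \<mu> (E - B) B \<Z> * D ^ card E \<ge> 0"
        using fam_prob_nonneg[OF st(1) p0 p1] D1 by (intro mult_nonneg_nonneg) auto
      have "0 \<le> \<psi> \<Z> \<and> \<psi> \<Z> \<le> 2 ^ (8 * L) * w \<Z>"
      proof (cases "\<Z> \<subseteq> Omega r n E B")
        case True
        have nn: "0 \<le> fam_weight r n E B y \<alpha> D \<Z>" using fam_weight_bounds(1)[OF True y(1) p(2)] D1 by simp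
        have "m * fam_weight r n E B y \<alpha> D \<Z> \<le> fam_weight r n E B y \<alpha> D \<Z>"
          using m nn by (intro mult_left_le_one_le)
        also have "\<dots> \<le> 2 ^ (8 * card \<Z>) * w \<Z>"
          using fam_weight_le_Union[OF E(1,3) r2 r(2) True y p(2,3)] unfolding w_def D_def .
        also have "\<dots> \<le> 2 ^ (8 * L) * w \<Z>"
          using w0 sub(3) L by (intro mult_right_mono power_increasing) auto
        finally show ?thesis using True m nn by (simp add: \<psi>_def)
      qed (use w0 in \<open>auto simp: \<psi>_def\<close>)
      moreover have "\<eta> * w \<Z> \<ge> 0" using eta0 w0 by simp
      ultimately show ?thesis using f0 f1 False unfolding \<xi>_def by (simp add: abs_le_iff algebra_simps)
    qed
  qed
  note FS = family_sums[OF r2 r(2) E(1,2,4,3), of j, folded D_def]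
  have W1: "(\<Sum>\<Z>\<in>\<F>. w \<Z>) \<le> fam_const r K j" using FS(1) unfolding \<F>_def w_def .
  have W2: "(\<Sum>\<Z>\<in>\<F>. if \<not> nice r E B \<Z> then \<xi> * w \<Z> else 0) \<le> \<xi> * (fam_const r K j / real n)"
  proof -
    have "(\<Sum>\<Z>\<in>\<F>. if \<not> nice r E B \<Z> then \<xi> * w \<Z> else 0)
       = (\<Sum>\<Z> | \<Z> \<subseteq> min_bad_meeting r n B \<and> card \<Z> = j \<and> \<not> nice r E B \<Z>. \<xi> * w \<Z>)"
      by (rule sum.mono_neutral_cong_right[OF fin\<F>]) (auto simp: \<F>_def)
    also have "\<dots> = \<xi> * (\<Sum>\<Z> | \<Z> \<subseteq> min_bad_meeting r n B \<and> card \<Z> = j \<and> \<not> nice r E B \<Z>. w \<Z>)" by (simp add: sum_distrib_left)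
    also have "\<dots> \<le> \<xi> * (fam_const r K j / real n)"
      using FS(2) xi0 unfolding w_def by (intro mult_left_mono)
    finally show ?thesis .
  qed
  have "level_sum r n p \<mu> (E - B) B j * D ^ card E - m * model_sum r n E B y \<alpha> j
     = (\<Sum>\<Z>\<in>\<F>. fam_prob r n p \<mu> (E - B) B \<Z> * D ^ card E - \<psi> \<Z>)"
    unfolding ms level_sum_def \<F>_def[symmetric] by (simp add: sum_subtractf sum_distrib_right)
  also have "\<bar>\<dots>\<bar> \<le> (\<Sum>\<Z>\<in>\<F>. \<eta> * w \<Z> + (if \<not> nice r E B \<Z> then \<xi> * w \<Z> else 0))"
    by (rule order_trans[OF sum_abs]) (intro sum_mono pt)
  also have "\<dots> \<le> \<eta> * fam_const r K j + \<xi> * (fam_const r K j / real n)"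
    unfolding sum.distrib sum_distrib_left[symmetric] using W1 W2 eta0 by (intro add_mono mult_left_mono)
  also have "\<dots> \<le> level_err r K cc L j * (\<epsilon> + 1 / real n)"
  proof -
    define R where "R = (2 * real r) ^ (8 * r)"
    have n0: "real n > 0" using r by simp
    have R0: "R \<ge> 0" unfolding R_def by simp
    have "(1 / D) ^ 1 \<le> R / real n ^ 1"
      unfolding D_def R_def by (rule inverse_scale_power[OF r2 r(2)]) (use r in auto)
    hence "real L * cc ^ (L + 1) * (1 / D) \<le> real L * cc ^ (L + 1) * (R / real n)"
      using cc by (intro mult_left_mono) auto
    hence "\<eta> \<le> 2 ^ L * (\<epsilon> + real L * cc ^ (L + 1) * R / real n)"
      unfolding \<eta>_def by (intro mult_left_mono add_left_mono) auto
    also have "\<dots> \<le> 2 ^ L * (1 + real L * cc ^ (L + 1) * R) * (\<epsilon> + 1 / real n)"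
    proof -
      have "\<epsilon> + real L * cc ^ (L + 1) * R / real n \<le> (1 + real L * cc ^ (L + 1) * R) * (\<epsilon> + 1 / real n)"
        using e0 n0 R0 cc by (simp add: algebra_simps)
      thus ?thesis by (simp only: mult.assoc) (intro mult_left_mono, auto)
    qed
    finally have h1: "\<eta> \<le> 2 ^ L * (1 + real L * cc ^ (L + 1) * R) * (\<epsilon> + 1 / real n)" .
    have h2: "\<xi> / real n \<le> \<xi> * (\<epsilon> + 1 / real n)" using xi0 e0 by (simp add: algebra_simps)
    have "\<eta> * fam_const r K j + \<xi> * (fam_const r K j / real n) = fam_const r K j * (\<eta> + \<xi> / real n)"
      by (simp add: algebra_simps)
    also have "\<dots> \<le> fam_const r K j * (2 ^ L * (1 + real L * cc ^ (L + 1) * R) * (\<epsilon> + 1 / real n) + \<xi> * (\<epsilon> + 1 / real n))"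
      using h1 h2 by (intro mult_left_mono add_mono) auto
    also have "\<dots> = level_err r K cc L j * (\<epsilon> + 1 / real n)"
      unfolding level_err_def R_def \<xi>_def by (simp add: algebra_simps)
    finally show ?thesis .
  qed
  finally show ?thesis unfolding D_def m_def .
qed

section \<open>Truncation, with exponential tails\<close>

definition exp_tail :: "real \<Rightarrow> nat \<Rightarrow> real" where
  "exp_tail \<Lambda> J = (\<Sum>i. \<Lambda> ^ (i + Suc J) / fact (i + Suc J))"

lemma summable_exp_terms: "summable (\<lambda>i. (\<Lambda>::real) ^ i / fact i)"
  using summable_exp[of \<Lambda>] by (simp add: field_simps)

lemma exp_tail_tendsto: "exp_tail \<Lambda> \<longlonglongrightarrow> 0"
proof (rule LIMSEQ_I)
  fix e :: real assume "e > 0"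
  from suminf_exist_split[OF this summable_exp_terms[of \<Lambda>]]
  obtain N where "\<forall>k\<ge>N. norm (\<Sum>i. \<Lambda> ^ (i + k) / fact (i + k)) < e" by blast
  hence "\<forall>J\<ge>N. norm (exp_tail \<Lambda> J - 0) < e" unfolding exp_tail_def diff_zero by (meson le_SucI)
  thus "\<exists>N. \<forall>J\<ge>N. norm (exp_tail \<Lambda> J - 0) < e" by blast
qed

lemma exp_tail_ge:
  assumes "\<Lambda> \<ge> 0"
  shows "(\<Sum>j\<in>{Suc J..N}. \<Lambda> ^ j / fact j) \<le> exp_tail \<Lambda> J" "\<Lambda> ^ Suc J / fact (Suc J) \<le> exp_tail \<Lambda> J"
proof -
  have s: "summable (\<lambda>i. \<Lambda> ^ (i + Suc J) / fact (i + Suc J))"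
    using summable_exp_terms by (subst summable_iff_shift[of "\<lambda>i. \<Lambda> ^ i / fact i"])
  have *: "(\<Sum>i<k. \<Lambda> ^ (i + Suc J) / fact (i + Suc J)) \<le> exp_tail \<Lambda> J" for k
    unfolding exp_tail_def using s assms by (intro sum_le_suminf) auto
  show "(\<Sum>j\<in>{Suc J..N}. \<Lambda> ^ j / fact j) \<le> exp_tail \<Lambda> J"
  proof -
    have "(\<Sum>j\<in>{Suc J..N}. \<Lambda> ^ j / fact j) = (\<Sum>i<Suc N - Suc J. \<Lambda> ^ (i + Suc J) / fact (i + Suc J))"
      by (rule sum.reindex_bij_witness[of _ "\<lambda>i. i + Suc J" "\<lambda>j. j - Suc J"]) auto
    thus ?thesis using * by simp
  qed
  show "\<Lambda> ^ Suc J / fact (Suc J) \<le> exp_tail \<Lambda> J" using *[of 1] by simp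
qed

definition model_total :: "nat \<Rightarrow> nat \<Rightarrow> nat set set \<Rightarrow> nat set set \<Rightarrow> real \<Rightarrow> real \<Rightarrow> real" where
  "model_total r n E B y \<alpha> = (\<Sum>\<Z>\<in>Pow (Omega r n E B). (-1) ^ card \<Z> * fam_weight r n E B y \<alpha> (scale r n) \<Z>)"

text \<open>The weights of single configurations have a total bounded uniformly in n, so level j is
  at most \<Lambda>^j / j! with one \<Lambda> for all n. This is what permits truncation.\<close>

lemma model_sum_bounds:
  assumes E: "E \<subseteq> edges r n" "B \<subseteq> E" "card E \<le> K" and r: "r \<ge> 2" "n \<ge> 2 * r"
    and y: "0 \<le> y" "y \<le> 1" "0 \<le> \<alpha>" "\<alpha> \<le> 1"
  shows "0 \<le> model_sum r n E B y \<alpha> j" "model_sum r n E B y \<alpha> j \<le> (2 ^ 8 * attach_const r (r * K)) ^ j / fact j"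
proof -
  have D: "scale r n > 0" using scale_lower(2)[OF r] by linarith
  show "0 \<le> model_sum r n E B y \<alpha> j"
    unfolding model_sum_def using fam_weight_bounds(1)[OF _ y(1,3) D] by (intro sum_nonneg) auto
  have cw: "conf_weight y \<alpha> (scale r n) Z \<ge> 0" for Z unfolding conf_weight_def using y D by simp
  have "model_sum r n E B y \<alpha> j \<le> (\<Sum>\<Z> | \<Z> \<subseteq> Omega r n E B \<and> card \<Z> = j. \<Prod>Z\<in>\<Z>. conf_weight y \<alpha> (scale r n) Z)"
    unfolding model_sum_def using fam_weight_bounds(2)[OF _ y(1,3) D] by (intro sum_mono) auto
  also have "\<dots> \<le> (\<Sum>Z\<in>Omega r n E B. conf_weight y \<alpha> (scale r n) Z) ^ j / fact j"
    using cw by (intro elementary_symmetric_le) auto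
  also have "\<dots> \<le> (2 ^ 8 * attach_const r (r * K)) ^ j / fact j"
    using sum_conf_weight_le[OF E r y] cw by (intro divide_right_mono power_mono sum_nonneg) auto
  finally show "model_sum r n E B y \<alpha> j \<le> (2 ^ 8 * attach_const r (r * K)) ^ j / fact j" .
qed

lemma model_total_truncate:
  assumes E: "E \<subseteq> edges r n" "B \<subseteq> E" "card E \<le> K" and r: "r \<ge> 2" "n \<ge> 2 * r"
    and y: "0 \<le> y" "y \<le> 1" "0 \<le> \<alpha>" "\<alpha> \<le> 1"
  shows "\<bar>(\<Sum>j\<le>J. (-1) ^ j * model_sum r n E B y \<alpha> j) - model_total r n E B y \<alpha>\<bar>
      \<le> exp_tail (2 ^ 8 * attach_const r (r * K)) J"
proof -
  define s where "s j = model_sum r n E B y \<alpha> j" for j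
  define N where "N = max J (card (Omega r n E B))"
  have "model_total r n E B y \<alpha> = (\<Sum>j\<le>N. \<Sum>\<Z>\<in>{\<Z>\<in>Pow (Omega r n E B). card \<Z> = j}. (-1) ^ card \<Z> * fam_weight r n E B y \<alpha> (scale r n) \<Z>)"
    unfolding model_total_def
  proof (rule sum.group[symmetric])
    show "card ` Pow (Omega r n E B) \<subseteq> {..N}" unfolding N_def
      by (auto intro!: max.coboundedI2 card_mono)
  qed auto
  also have "\<dots> = (\<Sum>j\<le>N. (-1) ^ j * s j)"
    unfolding s_def model_sum_def sum_distrib_left by (intro sum.cong) auto
  also have "{..N} = {..J} \<union> {Suc J..N}" unfolding N_def by auto
  also have "(\<Sum>j\<in>{..J} \<union> {Suc J..N}. (-1) ^ j * s j) = (\<Sum>j\<le>J. (-1) ^ j * s j) + (\<Sum>j\<in>{Suc J..N}. (-1) ^ j * s j)"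
    by (rule sum.union_disjoint) auto
  finally have "\<bar>(\<Sum>j\<le>J. (-1) ^ j * s j) - model_total r n E B y \<alpha>\<bar> = \<bar>\<Sum>j\<in>{Suc J..N}. (-1) ^ j * s j\<bar>" by simp
  also have "\<dots> \<le> (\<Sum>j\<in>{Suc J..N}. (2 ^ 8 * attach_const r (r * K)) ^ j / fact j)"
    using model_sum_bounds[OF E r y] unfolding s_def
    by (intro order_trans[OF sum_abs] sum_mono) (simp add: abs_mult)
  also have "\<dots> \<le> exp_tail (2 ^ 8 * attach_const r (r * K)) J" by (rule exp_tail_ge(1)) simp
  finally show ?thesis unfolding s_def .
qed

text \<open>Bonferroni truncates the process at level J with error at most level J + 1, which is
  itself compared to the model; the model is truncated too. The two tails explain the factor 2.
  \<open>L\<close> has room for J + 1 configurations of at most 8 edges besides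
  \<open>E\<close>.\<close>

lemma new_prob_estimate:
  assumes st: "state r n \<mu>" "apriori r n c \<mu>" "pure r n L \<epsilon> y \<mu>"
    and E: "E \<subseteq> edges r n" "conflict_free r E" "B \<subseteq> E" "card E \<le> K" and r: "r \<ge> 3" "n \<ge> 2 * r"
    and p: "p = \<alpha> / scale r n" "0 \<le> \<alpha>" "\<alpha> \<le> 1" and y: "0 \<le> y" "y \<le> 1"
    and cc: "0 \<le> c" "c + \<alpha> \<le> cc" "1 \<le> cc" and L: "K + 8 * Suc J \<le> L"
  shows "\<bar>new_prob r n p \<mu> (E - B) B * scale r n ^ card E -
      y ^ card (E - B) * \<alpha> ^ card B * model_total r n E B y \<alpha>\<bar>
    \<le> (\<Sum>j\<le>Suc J. level_err r K cc L j) * (\<epsilon> + 1 / real n) + 2 * exp_tail (2 ^ 8 * attach_const r (r * K)) J"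
proof -
  define D where "D = scale r n"
  define m where "m = y ^ card (E - B) * \<alpha> ^ card B"
  define t where "t j = level_sum r n p \<mu> (E - B) B j" for j
  define s where "s j = model_sum r n E B y \<alpha> j" for j
  define \<tau> where "\<tau> = exp_tail (2 ^ 8 * attach_const r (r * K)) J"
  define e where "e j = level_err r K cc L j * (\<epsilon> + 1 / real n)" for j
  have r2: "r \<ge> 2" using r by simp
  have D1: "D \<ge> 1" unfolding D_def by (rule scale_lower(2)[OF r2 r(2)])
  have m: "0 \<le> m" "m \<le> 1" unfolding m_def using y p by (auto intro!: mult_le_one power_le_one)
  have p01: "0 \<le> p" "p \<le> 1" using p D1 unfolding D_def by auto
  have lev: "\<bar>t j * D ^ card E - m * s j\<bar> \<le> e j" if "j \<le> Suc J" for j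
  proof -
    have "K + 8 * j \<le> L" using that L mult_le_mono2[OF that, of 8] by linarith
    from level_estimate[OF st E r p y cc this] show ?thesis unfolding t_def s_def e_def m_def D_def .
  qed
  note ms = model_sum_bounds[OF E(1,3,4) r2 r(2) y p(2,3)]
  have "\<bar>new_prob r n p \<mu> (E - B) B - (\<Sum>j\<le>J. (-1) ^ j * t j)\<bar> \<le> t (Suc J)"
    unfolding t_def level_sum_def by (rule new_prob_bonferroni[OF st(1) p01])
  hence "\<bar>new_prob r n p \<mu> (E - B) B - (\<Sum>j\<le>J. (-1) ^ j * t j)\<bar> * D ^ card E \<le> t (Suc J) * D ^ card E"
    using D1 by (intro mult_right_mono) auto
  moreover have "\<bar>new_prob r n p \<mu> (E - B) B - (\<Sum>j\<le>J. (-1) ^ j * t j)\<bar> * D ^ card E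
     = \<bar>new_prob r n p \<mu> (E - B) B * D ^ card E - (\<Sum>j\<le>J. (-1) ^ j * (t j * D ^ card E))\<bar>"
  proof -
    have "\<bar>new_prob r n p \<mu> (E - B) B - (\<Sum>j\<le>J. (-1) ^ j * t j)\<bar> * D ^ card E
      = \<bar>(new_prob r n p \<mu> (E - B) B - (\<Sum>j\<le>J. (-1) ^ j * t j)) * D ^ card E\<bar>" using D1 by (simp add: abs_mult)
    thus ?thesis by (simp add: left_diff_distrib sum_distrib_right mult.assoc)
  qed
  ultimately have b1: "\<bar>new_prob r n p \<mu> (E - B) B * D ^ card E - (\<Sum>j\<le>J. (-1) ^ j * (t j * D ^ card E))\<bar> \<le> t (Suc J) * D ^ card E"
    by simp
  have "s (Suc J) \<le> \<tau>"
    using ms(2)[of "Suc J"] exp_tail_ge(2)[of "2 ^ 8 * attach_const r (r * K)" J] unfolding s_def \<tau>_def by simp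
  moreover have "m * s (Suc J) \<le> s (Suc J)" using m ms(1)[of "Suc J"] unfolding s_def by (intro mult_left_le_one_le)
  ultimately have b2: "t (Suc J) * D ^ card E \<le> \<tau> + e (Suc J)" using lev[of "Suc J"] by linarith
  have "(\<Sum>j\<le>J. (-1) ^ j * (t j * D ^ card E)) - m * (\<Sum>j\<le>J. (-1) ^ j * s j)
      = (\<Sum>j\<le>J. (-1) ^ j * (t j * D ^ card E - m * s j))"
    by (simp add: sum_distrib_left sum_subtractf algebra_simps)
  also have "\<bar>\<dots>\<bar> \<le> (\<Sum>j\<le>J. e j)"
    by (rule order_trans[OF sum_abs]) (intro sum_mono, simp add: abs_mult lev)
  finally have b3: "\<bar>(\<Sum>j\<le>J. (-1) ^ j * (t j * D ^ card E)) - m * (\<Sum>j\<le>J. (-1) ^ j * s j)\<bar> \<le> (\<Sum>j\<le>J. e j)" .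
  have "\<bar>m * (\<Sum>j\<le>J. (-1) ^ j * s j) - m * model_total r n E B y \<alpha>\<bar> = m * \<bar>(\<Sum>j\<le>J. (-1) ^ j * s j) - model_total r n E B y \<alpha>\<bar>"
    using m by (simp add: right_diff_distrib[symmetric] abs_mult)
  also have "\<dots> \<le> \<bar>(\<Sum>j\<le>J. (-1) ^ j * s j) - model_total r n E B y \<alpha>\<bar>" using m by (intro mult_left_le_one_le) auto
  also have "\<dots> \<le> \<tau>" unfolding s_def \<tau>_def by (rule model_total_truncate[OF E(1,3,4) r2 r(2) y p(2,3)])
  finally have b4: "\<bar>m * (\<Sum>j\<le>J. (-1) ^ j * s j) - m * model_total r n E B y \<alpha>\<bar> \<le> \<tau>" .
  have "(\<Sum>j\<le>Suc J. level_err r K cc L j) * (\<epsilon> + 1 / real n) = (\<Sum>j\<le>J. e j) + e (Suc J)"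
    unfolding e_def by (simp add: sum_distrib_right distrib_right)
  thus ?thesis using b1 b2 b3 b4 unfolding m_def[symmetric] D_def[symmetric] \<tau>_def[symmetric] by linarith
qed

section \<open>The acceptance probability\<close>

lemma card_2_member:
  assumes "card Z = 2" "b \<in> Z"
  obtains f where "Z = {b, f}" "b \<noteq> f"
proof -
  obtain x y where xy: "Z = {x, y}" "x \<noteq> y" using assms(1) by (auto simp: card_2_iff)
  show ?thesis
  proof (cases "b = x")
    case True thus ?thesis using that[of y] xy by simp
  next
    case False
    hence "b = y" using assms(2) xy by simp
    thus ?thesis using that[of x] xy by auto
  qed
qed

section \<open>Invariance under permutations of the vertices\<close>

lemma exc_image:
  assumes "inj_on f V" "W \<subseteq> Pow V"
  shows "exc r ((`) f ` W) = exc r W" "card ((`) f ` W) = card W"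
proof -
  have i: "inj_on ((`) f) W" by (rule inj_on_subset[OF inj_on_image_Pow[OF assms(1)] assms(2)])
  show c: "card ((`) f ` W) = card W" by (rule card_image[OF i])
  have "\<Union>((`) f ` W) = f ` \<Union>W" by (simp only: image_Union)
  moreover have "inj_on f (\<Union>W)" by (rule inj_on_subset[OF assms(1)]) (use assms(2) in blast)
  ultimately have "card (\<Union>((`) f ` W)) = card (\<Union>W)" by (simp add: card_image)
  thus "exc r ((`) f ` W) = exc r W" unfolding exc_def c by simp
qed

lemma MB_image:
  assumes f: "bij_betw f {..<n} {..<n}" and Z: "Z \<in> min_bad_sets r n"
  shows "(`) f ` Z \<in> min_bad_sets r n"
proof -
  have inj: "inj_on f {..<n}" and im: "f ` {..<n} = {..<n}" using f by (auto simp: bij_betw_def)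
  have sub: "Z \<subseteq> edges r n" and mb: "minbad r Z" using Z unfolding min_bad_sets_def by blast+
  have P: "Z \<subseteq> Pow {..<n}" using sub unfolding edges_def by blast
  have "f ` e \<in> edges r n" if "e \<in> Z" for e
  proof -
    have e: "e \<subseteq> {..<n}" "card e = r" using that sub unfolding edges_def by blast+
    have "f ` e \<subseteq> {..<n}" using e im by blast
    moreover have "card (f ` e) = card e" using card_image[OF inj_on_subset[OF inj e(1)]] .
    ultimately show ?thesis using e unfolding edges_def by simp
  qed
  hence 1: "(`) f ` Z \<subseteq> edges r n" by blast
  have 2: "bad r ((`) f ` Z)" using mb exc_image[OF inj P] unfolding minbad_def bad_def by simp
  have 3: "\<not> bad r Y" if Y: "Y \<subset> (`) f ` Z" for Y
  proof
    assume bY: "bad r Y"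
    obtain Y0 where Y0: "Y0 \<subseteq> Z" "Y = (`) f ` Y0" using Y by (metis psubset_imp_subset subset_imageE)
    have "Y0 \<subset> Z" using Y Y0 by blast
    moreover have "bad r Y0" using bY exc_image[OF inj, of Y0] Y0 P unfolding bad_def by auto
    ultimately show False using mb unfolding minbad_def by blast
  qed
  show ?thesis unfolding min_bad_sets_def minbad_def using 1 2 3 by blast
qed

text \<open>Unlike \<open>Omega\<close> this ignores \<open>E\<close>, so it also contains
  configurations that meet \<open>E\<close> outside \<open>b\<close>. Size 2 is left to
  \<open>pair_factor\<close>.\<close>

definition Phi :: "nat \<Rightarrow> nat \<Rightarrow> nat set \<Rightarrow> nat set set set" where
  "Phi r n b = {Z \<in> min_bad_sets r n. b \<in> Z \<and> exc r Z = 2 \<and> card Z \<noteq> 2}"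

lemma finite_Phi [simp]: "finite (Phi r n b)"
  by (simp add: Phi_def)

lemma Phi_image:
  assumes f: "bij_betw f {..<n} {..<n}" and Z: "Z \<in> Phi r n b"
  shows "(`) f ` Z \<in> Phi r n (f ` b)" "card ((`) f ` Z) = card Z"
proof -
  have inj: "inj_on f {..<n}" using f by (auto simp: bij_betw_def)
  have ZM: "Z \<in> min_bad_sets r n" "b \<in> Z" "exc r Z = 2" "card Z \<noteq> 2" using Z unfolding Phi_def by auto
  have P: "Z \<subseteq> Pow {..<n}" using ZM(1) unfolding min_bad_sets_def edges_def by blast
  show c: "card ((`) f ` Z) = card Z" by (rule exc_image(2)[OF inj P])
  show "(`) f ` Z \<in> Phi r n (f ` b)"
    unfolding Phi_def using MB_image[OF f ZM(1)] ZM c exc_image(1)[OF inj P] by auto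
qed

text \<open>A permutation of the vertices that maps \<open>b\<close> to \<open>b'\<close> carries
  one index set to the other and preserves sizes.\<close>

lemma prod_Phi_symmetric:
  fixes g :: "nat \<Rightarrow> real"
  assumes b: "b \<in> edges r n" "b' \<in> edges r n"
  shows "(\<Prod>Z\<in>Phi r n b. g (card Z)) = (\<Prod>Z\<in>Phi r n b'. g (card Z))"
proof -
  have sub: "b \<subseteq> {..<n}" "b' \<subseteq> {..<n}" "card b = r" "card b' = r" using b unfolding edges_def by auto
  have fin: "finite b" "finite b'" using sub finite_subset by blast+
  obtain f where f: "bij_betw f b b'" using finite_same_card_bij[OF fin] sub by auto
  have "card ({..<n} - b) = card ({..<n} - b')" using sub fin by (simp add: card_Diff_subset)
  then obtain g' where g': "bij_betw g' ({..<n} - b) ({..<n} - b')"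
    using finite_same_card_bij[of "{..<n} - b" "{..<n} - b'"] by auto
  define h where "h x = (if x \<in> b then f x else g' x)" for x
  have "bij_betw h (b \<union> ({..<n} - b)) (b' \<union> ({..<n} - b'))"
    unfolding h_def by (rule bij_betw_disjoint_Un[OF f g']) auto
  moreover have "b \<union> ({..<n} - b) = {..<n}" "b' \<union> ({..<n} - b') = {..<n}" using sub by blast+
  ultimately have h: "bij_betw h {..<n} {..<n}" by simp
  have hb: "h ` b = b'"
  proof -
    have "h ` b = f ` b" unfolding h_def by simp
    thus ?thesis using f by (simp add: bij_betw_def)
  qed
  define k where "k = the_inv_into {..<n} h"
  have k: "bij_betw k {..<n} {..<n}" unfolding k_def by (rule bij_betw_the_inv_into[OF h])
  have inj: "inj_on h {..<n}" using h by (simp add: bij_betw_def)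
  have kh: "k (h x) = x" if "x < n" for x unfolding k_def using the_inv_into_f_f[OF inj] that by simp
  have hk: "h (k x) = x" if "x < n" for x
    unfolding k_def using f_the_inv_into_f_bij_betw[OF h] that by simp
  have khe: "k ` (h ` e) = e" if "e \<subseteq> {..<n}" for e
  proof -
    have "k ` (h ` e) = (\<lambda>x. k (h x)) ` e" by (simp add: image_image)
    also have "\<dots> = (\<lambda>x. x) ` e" using that kh by (intro image_cong) auto
    finally show ?thesis by simp
  qed
  have hke: "h ` (k ` e) = e" if "e \<subseteq> {..<n}" for e
  proof -
    have "h ` (k ` e) = (\<lambda>x. h (k x)) ` e" by (simp add: image_image)
    also have "\<dots> = (\<lambda>x. x) ` e" using that hk by (intro image_cong) auto
    finally show ?thesis by simp
  qed
  have kb: "k ` b' = b" using khe[OF sub(1)] hb by simp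
  have inV: "e \<subseteq> {..<n}" if "Z \<in> Phi r n c" "e \<in> Z" for Z c e
    using that unfolding Phi_def min_bad_sets_def edges_def by blast
  show ?thesis
  proof (rule prod.reindex_bij_witness[of _ "\<lambda>Z. (`) k ` Z" "\<lambda>Z. (`) h ` Z"])
    fix Z assume Z: "Z \<in> Phi r n b"
    have "(`) k ` (`) h ` Z = (\<lambda>e. k ` (h ` e)) ` Z" by (rule image_image)
    also have "\<dots> = (\<lambda>e. e) ` Z" by (rule image_cong[OF refl]) (rule khe[OF inV[OF Z]])
    finally show "(`) k ` (`) h ` Z = Z" by simp
    show "(`) h ` Z \<in> Phi r n b'" using Phi_image(1)[OF h Z] hb by simp
    show "g (card ((`) h ` Z)) = g (card Z)" using Phi_image(2)[OF h Z] by simp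
  next
    fix Z assume Z: "Z \<in> Phi r n b'"
    have "(`) h ` (`) k ` Z = (\<lambda>e. h ` (k ` e)) ` Z" by (rule image_image)
    also have "\<dots> = (\<lambda>e. e) ` Z" by (rule image_cong[OF refl]) (rule hke[OF inV[OF Z]])
    finally show "(`) h ` (`) k ` Z = Z" by simp
    show "(`) k ` Z \<in> Phi r n b" using Phi_image(1)[OF k Z] kb by simp
  qed
qed

lemma minbad_pair:
  assumes "card {b, f} = 2" "exc r {b, f} = 2"
  shows "minbad r {b, f}"
proof -
  have "\<not> bad r Y" if "Y \<subset> {b, f}" for Y
    using psubset_card_mono[OF _ that] assms by (simp add: bad_def)
  moreover have "bad r {b, f}" using assms by (simp add: bad_def)
  ultimately show ?thesis unfolding minbad_def by blast
qed

text \<open>The other edge is \<open>q\<close> together with r - 2 vertices outside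
  \<open>b\<close>. The count is exactly \<open>scale\<close>, which is the reason for that
  unit.\<close>

lemma card_pair_group:
  assumes b: "b \<in> edges r n" and q: "q \<subseteq> b" "card q = 2" and r: "r \<ge> 3"
  shows "card {Z \<in> min_bad_sets r n. b \<in> Z \<and> exc r Z = 2 \<and> card Z = 2 \<and> \<Inter>Z = q} = (n - r) choose (r - 2)"
proof -
  have bV: "b \<subseteq> {..<n}" "card b = r" using b unfolding edges_def by auto
  have finb: "finite b" using bV finite_subset by blast
  have finq: "finite q" using q finb finite_subset by blast
  define T where "T = {g. g \<subseteq> {..<n} - b \<and> card g = r - 2}"
  define S where "S = {Z \<in> min_bad_sets r n. b \<in> Z \<and> exc r Z = 2 \<and> card Z = 2 \<and> \<Inter>Z = q}"
  have uf: "unif r {x}" if "finite x" "card x = r" for x :: "nat set" using that by (simp add: unif_def)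
  have r2: "r \<ge> 2" using r by simp
  have fwd: "f \<inter> b = q \<and> f \<noteq> b \<and> f \<in> edges r n \<and> {b, f} \<in> S" if g: "g \<in> T" "f = q \<union> g" for f g
  proof -
    have gV: "g \<subseteq> {..<n} - b" "card g = r - 2" using g unfolding T_def by auto
    have fing: "finite g" using gV finite_subset by blast
    have "q \<inter> g = {}" using q gV by blast
    hence conflict_free: "card f = r" using g(2) gV q r2 finq fing by (simp add: card_Un_disjoint)
    have fb: "f \<inter> b = q" using g(2) gV q by blast
    have "g \<noteq> {}" using gV r by auto
    hence ne: "f \<noteq> b" using g(2) gV by blast
    have fe: "f \<in> edges r n" using g(2) gV q bV conflict_free unfolding edges_def by auto
    have "exc r ({b} \<union> {f}) = exc r {b} + exc r {f} - int (card (\<Union>{b} \<inter> \<Union>{f}))"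
      using ne conflict_free bV finb finq fing g(2) by (intro exc_Un uf) auto
    hence e2: "exc r {b, f} = 2" using exc_singleton[OF r2 bV(2)] exc_singleton[OF r2 conflict_free] fb q
      by (simp add: insert_commute Int_commute)
    have c2: "card {b, f} = 2" using ne by simp
    have "{b, f} \<in> S" unfolding S_def min_bad_sets_def using minbad_pair[OF c2 e2] e2 c2 b fe fb by (auto simp: Int_commute)
    thus ?thesis using fb ne fe by blast
  qed
  have "bij_betw (\<lambda>g. {b, q \<union> g}) T S"
  proof (rule bij_betwI')
    fix g g' assume g: "g \<in> T" "g' \<in> T"
    have nb: "q \<union> g \<noteq> b" "q \<union> g' \<noteq> b" using fwd[OF g(1) refl] fwd[OF g(2) refl] by blast+
    have "g \<inter> q = {}" "g' \<inter> q = {}" using g q unfolding T_def by blast+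
    thus "({b, q \<union> g} = {b, q \<union> g'}) = (g = g')" using nb by (auto simp: doubleton_eq_iff)
  next
    fix g assume "g \<in> T" thus "{b, q \<union> g} \<in> S" using fwd by blast
  next
    fix Z assume Z: "Z \<in> S"
    hence Zs: "Z \<subseteq> edges r n" "b \<in> Z" "card Z = 2" "\<Inter>Z = q" unfolding S_def min_bad_sets_def by auto
    obtain f where f: "Z = {b, f}" "b \<noteq> f" by (rule card_2_member[OF Zs(3,2)])
    have fe: "f \<subseteq> {..<n}" "card f = r" using Zs(1) f unfolding edges_def by auto
    have fb: "b \<inter> f = q" using Zs(4) f by auto
    have finf: "finite f" using fe finite_subset by blast
    have "card (f - b) = r - 2"
    proof -
      have "card (f - b) = card f - card (f \<inter> b)" using finf by (simp add: card_Diff_subset_Int)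
      thus ?thesis using fe fb q by (simp add: Int_commute)
    qed
    hence "f - b \<in> T" using fe unfolding T_def by blast
    moreover have "q \<union> (f - b) = f" using fb by blast
    ultimately show "\<exists>g\<in>T. Z = {b, q \<union> g}" using f by metis
  qed
  hence "card S = card T" using bij_betw_same_card by metis
  also have "card T = card ({..<n} - b) choose (r - 2)" unfolding T_def by (rule n_subsets) simp
  also have "card ({..<n} - b) = n - r" using bV finb by (simp add: card_Diff_subset)
  finally show ?thesis unfolding S_def .
qed

lemma power_diff_le:
  fixes x :: real
  assumes "0 \<le> x" "x \<le> 1" "N \<le> M"
  shows "0 \<le> x ^ N - x ^ M" "x ^ N - x ^ M \<le> real (M - N) * (1 - x)"
proof -
  have eq: "x ^ N - x ^ M = x ^ N * (1 - x ^ (M - N))"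
    using assms(3) by (simp add: algebra_simps flip: power_add)
  have l: "0 \<le> 1 - x ^ (M - N)" using assms by (simp add: power_le_one)
  show "0 \<le> x ^ N - x ^ M" unfolding eq using l assms by simp
  have "x ^ N * (1 - x ^ (M - N)) \<le> 1 - x ^ (M - N)"
    using l assms by (intro mult_left_le_one_le) (auto simp: power_le_one)
  also have "\<dots> \<le> real (M - N) * (1 - x)"
    using Bernoulli_inequality[of "x - 1" "M - N"] assms by (simp add: algebra_simps)
  finally show "x ^ N - x ^ M \<le> real (M - N) * (1 - x)" unfolding eq .
qed

text \<open>Bounded by 1, and Lipschitz in N on the scale D, so that removing few configurations
  from a group changes its factor little.\<close>

lemma pair_factor_bounds:
  assumes y: "0 \<le> y" "y \<le> 1" "0 \<le> \<alpha>" "\<alpha> \<le> 1" and D: "D \<ge> 1" and N: "N \<le> N0" "real N0 \<le> D"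
  shows "\<bar>pair_factor y \<alpha> D N\<bar> \<le> 1"
    "\<bar>pair_factor y \<alpha> D N - pair_factor y \<alpha> D N0\<bar> \<le> 3 * (real (N0 - N) / D)"
proof -
  define x where "x = 1 - \<alpha> / D"
  have aD: "\<alpha> / D \<le> 1" "\<alpha> / D \<le> 1 / D" "0 \<le> \<alpha> / D" using y D by (auto simp: divide_right_mono)
  have x: "0 \<le> x" "x \<le> 1" unfolding x_def using aD by auto
  have p1: "0 \<le> x ^ k" "x ^ k \<le> 1" for k using x by (auto simp: power_le_one)
  have ND: "real N / D \<le> 1" using N D by (simp add: field_simps)
  have eq: "real N * (y / D) * x ^ (N - 1) = (real N / D) * (y * x ^ (N - 1))" by simp
  have "y * x ^ (N - 1) \<le> 1" "0 \<le> y * x ^ (N - 1)" using y p1 by (auto intro: mult_le_one)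
  moreover have "0 \<le> real N / D" using D by simp
  ultimately have "real N * (y / D) * x ^ (N - 1) \<le> 1" "0 \<le> real N * (y / D) * x ^ (N - 1)"
    unfolding eq using ND by (auto intro: mult_le_one simp del: times_divide_eq_left times_divide_eq_right)
  thus "\<bar>pair_factor y \<alpha> D N\<bar> \<le> 1" unfolding pair_factor_def x_def[symmetric] using p1[of N] by (simp add: abs_le_iff)
  define d where "d = real (N0 - N)"
  have d0: "d \<ge> 0" unfolding d_def by simp
  have "d * (1 - x) \<le> d * (1 / D)" using aD d0 unfolding x_def by (intro mult_left_mono) auto
  hence A: "\<bar>x ^ N - x ^ N0\<bar> \<le> d / D" using power_diff_le[OF x N(1)] unfolding d_def by simp
  have B: "\<bar>real N * x ^ (N - 1) - real N0 * x ^ (N0 - 1)\<bar> \<le> 2 * d"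
  proof (cases N)
    case 0
    have "real N0 * x ^ (N0 - 1) \<le> real N0 * 1" using p1 by (intro mult_left_mono) auto
    moreover have "0 \<le> real N0 * x ^ (N0 - 1)" using p1 by simp
    ultimately show ?thesis using 0 unfolding d_def by simp
  next
    case (Suc N')
    have le: "N - 1 \<le> N0 - 1" using N by simp
    have dd: "real (N0 - 1 - (N - 1)) = d" using Suc N unfolding d_def by simp
    have E: "0 \<le> x ^ (N - 1) - x ^ (N0 - 1)" "x ^ (N - 1) - x ^ (N0 - 1) \<le> d * (1 - x)"
      using power_diff_le[OF x le] unfolding dd by auto
    have "real N * (x ^ (N - 1) - x ^ (N0 - 1)) \<le> real N * (d * (1 / D))"
      using E \<open>d * (1 - x) \<le> d * (1 / D)\<close> by (intro mult_left_mono) auto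
    also have "\<dots> = d * (real N / D)" by simp
    also have "\<dots> \<le> d" using ND d0 by (intro mult_right_le_one_le) (use D in auto)
    finally have F: "real N * (x ^ (N - 1) - x ^ (N0 - 1)) \<le> d" .
    have F0: "0 \<le> real N * (x ^ (N - 1) - x ^ (N0 - 1))" using E by simp
    have G: "d * x ^ (N0 - 1) \<le> d" "0 \<le> d * x ^ (N0 - 1)" using d0 p1 by (auto intro: mult_right_le_one_le)
    have "real N0 = real N + d" unfolding d_def using N by simp
    hence "real N * x ^ (N - 1) - real N0 * x ^ (N0 - 1) = real N * (x ^ (N - 1) - x ^ (N0 - 1)) - d * x ^ (N0 - 1)"
      by (simp add: algebra_simps)
    thus ?thesis using F F0 G d0 by (simp add: abs_le_iff)
  qed
  have "pair_factor y \<alpha> D N - pair_factor y \<alpha> D N0 = (x ^ N - x ^ N0) - (y / D) * (real N * x ^ (N - 1) - real N0 * x ^ (N0 - 1))"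
    unfolding pair_factor_def x_def[symmetric] by (simp add: algebra_simps)
  also have "\<bar>\<dots>\<bar> \<le> \<bar>x ^ N - x ^ N0\<bar> + (y / D) * \<bar>real N * x ^ (N - 1) - real N0 * x ^ (N0 - 1)\<bar>"
    using y D by (intro order_trans[OF abs_triangle_ineq4]) (simp add: abs_mult)
  also have "\<dots> \<le> d / D + (1 / D) * (2 * d)"
    using A B y D by (intro add_mono mult_mono divide_right_mono) auto
  also have "\<dots> = 3 * (d / D)" by simp
  finally show "\<bar>pair_factor y \<alpha> D N - pair_factor y \<alpha> D N0\<bar> \<le> 3 * (real (N0 - N) / D)" unfolding d_def .
qed

text \<open>
  The limiting probability that an offered edge is accepted. By symmetry it may be computed at
  the edge \<open>{..<r}\<close>.
\<close>

definition hazard :: "nat \<Rightarrow> nat \<Rightarrow> real \<Rightarrow> real \<Rightarrow> real" where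
  "hazard r n y \<alpha> = (\<Prod>Z\<in>Phi r n {..<r}. 1 - conf_weight y \<alpha> (scale r n) Z) *
      pair_factor y \<alpha> (scale r n) ((n - r) choose (r - 2)) ^ (r choose 2)"

lemma scale_ge_2: "r \<ge> 3 \<Longrightarrow> n \<ge> 4 * r \<Longrightarrow> scale r n \<ge> 2"
proof -
  assume r: "r \<ge> 3" and n: "n \<ge> 4 * r"
  have "real n / (2 * real r) \<ge> 2" using r n by (simp add: field_simps)
  hence "1 \<le> real n / (2 * real r)" by linarith
  moreover have "1 \<le> r - 2" using r by simp
  ultimately have "(real n / (2 * real r)) ^ 1 \<le> (real n / (2 * real r)) ^ (r - 2)"
    by (intro power_increasing)
  thus ?thesis using scale_lower(1)[of r n] r n \<open>real n / (2 * real r) \<ge> 2\<close> by simp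
qed

lemma conf_weight_01:
  assumes y: "0 \<le> y" "y \<le> 1" "0 \<le> \<alpha>" "\<alpha> \<le> 1" and D: "D \<ge> 2"
  shows "0 \<le> conf_weight y \<alpha> D Z" "conf_weight y \<alpha> D Z \<le> 1"
proof -
  have "0 \<le> (y + \<alpha>) / D" "(y + \<alpha>) / D \<le> 1" using assms by auto
  thus "0 \<le> conf_weight y \<alpha> D Z" "conf_weight y \<alpha> D Z \<le> 1"
    unfolding conf_weight_def by (auto simp: power_le_one)
qed

lemma hazard_eq:
  assumes "b \<in> edges r n" "r \<le> n"
  shows "hazard r n y \<alpha> = (\<Prod>Z\<in>Phi r n b. 1 - conf_weight y \<alpha> (scale r n) Z) *
      pair_factor y \<alpha> (scale r n) ((n - r) choose (r - 2)) ^ (r choose 2)"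
proof -
  have "{..<r} \<in> edges r n" using assms by (auto simp: edges_def)
  thus ?thesis
    unfolding hazard_def conf_weight_def
    using prod_Phi_symmetric[OF _ assms(1), of "{..<r}" "\<lambda>m. 1 - ((y + \<alpha>) / scale r n) ^ (m - 1)"] by simp
qed

lemma prod_abs_le_1:
  fixes f :: "'a \<Rightarrow> real"
  assumes "\<And>x. x \<in> A \<Longrightarrow> \<bar>f x\<bar> \<le> 1"
  shows "\<bar>\<Prod>x\<in>A. f x\<bar> \<le> 1"
  unfolding abs_prod using assms by (intro prod_le_1) auto

text \<open>Configurations through \<open>b\<close> that touch \<open>E\<close> outside
  \<open>b\<close> are the non-tight case of \<open>new_vertices_bound\<close>, of total weight
  O(1/n), so they may be added. The product then splits over \<open>b\<close>, because the edges of
  a conflict-free set have no vertex pair in common.\<close>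

lemma model_total_hazard:
  assumes E: "E \<subseteq> edges r n" "conflict_free r E" "B \<subseteq> E" "card E \<le> K" and r: "r \<ge> 3" "n \<ge> 4 * r"
    and y: "0 \<le> y" "y \<le> 1" "0 \<le> \<alpha>" "\<alpha> \<le> 1"
  shows "\<bar>model_total r n E B y \<alpha> - hazard r n y \<alpha> ^ card B\<bar>
     \<le> real K * ((2 ^ 8 + 3 * real (r choose 2)) * attach_const r (r * K)) / real n"
proof -
  define D where "D = scale r n"
  define N0 where "N0 = (n - r) choose (r - 2)"
  define \<Omega> where "\<Omega> = Omega r n E B"
  define V where "V = \<Union>E"
  define cw where "cw Z = conf_weight y \<alpha> D Z" for Z
  define pf where "pf N = pair_factor y \<alpha> D N" for N
  define \<Delta> where "\<Delta> b = {Z \<in> min_bad_sets r n. b \<in> Z \<and> exc r Z = 2 \<and> \<Union>Z \<inter> V \<noteq> b}" for b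
  define C where "C = attach_const r (r * K)"
  have r2: "r \<ge> 2" "n \<ge> 2 * r" "r \<le> n" using r by simp_all
  have D2: "D \<ge> 2" unfolding D_def by (rule scale_ge_2[OF r])
  have N0D: "real N0 = D" unfolding N0_def D_def scale_def ..
  have uE: "unif r E" by (rule unif_edges[OF E(1)])
  have finE: "finite E" using uE by simp
  have finB: "finite B" using finE E(3) finite_subset by blast
  have fin\<Omega>: "finite \<Omega>" unfolding \<Omega>_def by simp
  have cw01: "0 \<le> cw Z" "cw Z \<le> 1" for Z unfolding cw_def using conf_weight_01[OF y D2] by auto
  have dsum: "(\<Sum>Z\<in>\<Delta> b. (1 / D) ^ card (Z - E)) \<le> C / real n" if b: "b \<in> B" for b
  proof -
    have "(\<Sum>Z\<in>\<Delta> b. (1 / scale r n) ^ card (Z - E)) \<le> attach_const r (r * K) / real n ^ 1"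
    proof (rule attach_sum_bound[OF r2(1,2) card_Union_edges_le[OF E(1,4)]])
      show "\<Delta> b \<subseteq> min_bad_sets r n" unfolding \<Delta>_def by blast
      fix Z assume "Z \<in> \<Delta> b"
      hence Z: "Z \<subseteq> edges r n" "minbad r Z" "b \<in> Z" "\<Union>Z \<inter> V \<noteq> b" unfolding \<Delta>_def min_bad_sets_def by auto
      have "\<not> Z \<subseteq> E" using E(2) Z(2) unfolding cf_iff_no_minbad by blast
      moreover have "\<not> (\<exists>b'\<in>E. b' \<in> Z \<and> \<Union>Z \<inter> \<Union>E = b' \<and> exc r Z = 2)"
      proof
        assume "\<exists>b'\<in>E. b' \<in> Z \<and> \<Union>Z \<inter> \<Union>E = b' \<and> exc r Z = 2"
        then obtain b' where b': "b' \<in> E" "\<Union>Z \<inter> \<Union>E = b'" by blast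
        have "b \<subseteq> b'" using b'(2) Z(3) b E(3) by blast
        moreover have "card b = r" "card b' = r" "finite b'" using uE b b' E(3) unfolding unif_def by blast+
        ultimately have "b = b'" by (simp add: card_subset_eq)
        thus False using b'(2) Z(4) unfolding V_def by simp
      qed
      moreover have "Z \<inter> E \<noteq> {}" using Z(3) b E(3) by blast
      ultimately show "card (\<Union>Z - \<Union>E) + 1 \<le> (r - 2) * card (Z - E)"
        using new_vertices_bound(2)[OF r2(1) unif_edges[OF Z(1)] Z(2) _ order_refl] by blast
    qed
    thus ?thesis unfolding D_def C_def by simp
  qed
  have ZE: "card (Z - E) \<le> card Z - 1" if "Z \<in> \<Delta> b" "b \<in> B" for Z b
  proof -
    have "finite Z" using that minbad_card(4) unfolding \<Delta>_def min_bad_sets_def by blast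
    have "Z - E \<subseteq> Z - {b}" using that E(3) by blast
    hence "card (Z - E) \<le> card (Z - {b})" using \<open>finite Z\<close> by (intro card_mono) auto
    thus ?thesis using that \<open>finite Z\<close> unfolding \<Delta>_def by simp
  qed
  have fin\<Delta>: "finite (\<Delta> b)" for b unfolding \<Delta>_def by simp
  define BG where "BG b = {Z \<in> {Z\<in>\<Omega>. card Z \<noteq> 2}. \<Union>Z \<inter> V = b}" for b
  have big: "(\<Prod>Z\<in>{Z\<in>\<Omega>. card Z \<noteq> 2}. 1 - cw Z) = (\<Prod>b\<in>B. \<Prod>Z\<in>BG b. 1 - cw Z)"
    unfolding BG_def
  proof (rule prod.group[symmetric])
    show "(\<lambda>Z. \<Union>Z \<inter> V) ` {Z\<in>\<Omega>. card Z \<noteq> 2} \<subseteq> B" unfolding \<Omega>_def Omega_def V_def by auto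
  qed (use fin\<Omega> finB in auto)
  have BGsub: "BG b \<subseteq> Phi r n b" "Phi r n b - BG b \<subseteq> \<Delta> b" if "b \<in> B" for b
    using that unfolding BG_def \<Omega>_def Omega_def Phi_def \<Delta>_def V_def by auto
  have bigdiff: "\<bar>(\<Prod>Z\<in>BG b. 1 - cw Z) - (\<Prod>Z\<in>Phi r n b. 1 - cw Z)\<bar> \<le> 2 ^ 8 * C / real n" if b: "b \<in> B" for b
  proof -
    define f where "f Z = (if Z \<in> BG b then 1 - cw Z else 1)" for Z
    have "(\<Prod>Z\<in>BG b. 1 - cw Z) = (\<Prod>Z\<in>Phi r n b. f Z)"
      by (rule prod.mono_neutral_cong_left) (use BGsub[OF b] in \<open>auto simp: f_def\<close>)
    hence "\<bar>(\<Prod>Z\<in>BG b. 1 - cw Z) - (\<Prod>Z\<in>Phi r n b. 1 - cw Z)\<bar> = norm ((\<Prod>Z\<in>Phi r n b. f Z) - (\<Prod>Z\<in>Phi r n b. 1 - cw Z))" by simp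
    also have "\<dots> \<le> (\<Sum>Z\<in>Phi r n b. norm (f Z - (1 - cw Z)))"
      by (rule norm_prod_diff) (use cw01 in \<open>auto simp: f_def\<close>)
    also have "\<dots> = (\<Sum>Z\<in>Phi r n b - BG b. cw Z)"
      by (rule sum.mono_neutral_cong_right) (use cw01 in \<open>auto simp: f_def\<close>)
    also have "\<dots> \<le> (\<Sum>Z\<in>\<Delta> b. cw Z)" using BGsub[OF b] fin\<Delta> cw01 by (intro sum_mono2) auto
    also have "\<dots> \<le> (\<Sum>Z\<in>\<Delta> b. 2 ^ 8 * (1 / D) ^ card (Z - E))"
    proof (rule sum_mono)
      fix Z assume Z: "Z \<in> \<Delta> b"
      hence "card Z \<le> 8" using minbad_card(2) unfolding \<Delta>_def min_bad_sets_def by blast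
      hence "cw Z \<le> 2 ^ 8 * (1 / D) ^ (card Z - 1)" unfolding cw_def using conf_weight_le(2)[OF y] D2 by simp
      also have "\<dots> \<le> 2 ^ 8 * (1 / D) ^ card (Z - E)"
        using ZE[OF Z b] D2 by (intro mult_left_mono power_decreasing) auto
      finally show "cw Z \<le> 2 ^ 8 * (1 / D) ^ card (Z - E)" .
    qed
    also have "\<dots> = 2 ^ 8 * (\<Sum>Z\<in>\<Delta> b. (1 / D) ^ card (Z - E))" by (simp add: sum_distrib_left)
    also have "\<dots> \<le> 2 ^ 8 * (C / real n)" using dsum[OF b] by (intro mult_left_mono) auto
    finally show ?thesis by simp
  qed
  define open_pairs where "open_pairs b = {q. q \<subseteq> b \<and> card q = 2}" for b :: "nat set"
  define GR where "GR q = {Z\<in>\<Omega>. card Z = 2 \<and> \<Inter>Z = q}" for q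
  have finb: "finite b" "card b = r" "b \<in> edges r n" if "b \<in> B" for b
    using uE E(1,3) that unfolding unif_def by blast+
  have finQ: "finite (open_pairs b)" if "b \<in> B" for b
    unfolding open_pairs_def by (rule finite_subset[of _ "Pow b"]) (use finb(1)[OF that] in auto)
  have disjQ: "open_pairs b \<inter> open_pairs b' = {}" if "b \<in> B" "b' \<in> B" "b \<noteq> b'" for b b'
  proof (rule ccontr)
    assume "open_pairs b \<inter> open_pairs b' \<noteq> {}"
    then obtain q where q: "q \<subseteq> b \<inter> b'" "card q = 2" unfolding open_pairs_def by blast
    have "card q \<le> card (b \<inter> b')" using q finb(1)[OF that(1)] by (intro card_mono) auto
    moreover have "card (b \<inter> b') \<le> 1" using cf_linear[OF E(2) uE _ _ that(3) r2(1)] that(1,2) E(3) by blast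
    ultimately show False using q by simp
  qed
  have inQ: "\<exists>b\<in>B. b \<in> Z \<and> \<Union>Z \<inter> V = b \<and> \<Inter>Z \<in> open_pairs b" if Z: "Z \<in> \<Omega>" "card Z = 2" for Z
  proof -
    obtain b where b: "b \<in> B" "b \<in> Z" "\<Union>Z \<inter> V = b" "exc r Z = 2" "Z \<subseteq> edges r n"
      using Z unfolding \<Omega>_def Omega_def min_bad_sets_def V_def by blast
    obtain f where f: "Z = {b, f}" "b \<noteq> f" by (rule card_2_member[OF Z(2) b(2)])
    have uZ: "unif r Z" by (rule unif_edges[OF b(5)])
    have ub: "unif r {b}" "unif r {f}" using uZ f by (auto simp: unif_def)
    have "exc r ({b} \<union> {f}) = exc r {b} + exc r {f} - int (card (\<Union>{b} \<inter> \<Union>{f}))"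
      using ub f by (intro exc_Un) auto
    moreover have "exc r {b} = 2" "exc r {f} = 2" using ub r2(1) by (simp_all add: exc_singleton unif_def)
    moreover have "{b} \<union> {f} = Z" using f by auto
    ultimately have "card (b \<inter> f) = 2" using b(4) by simp
    moreover have "\<Inter>Z = b \<inter> f" using f by simp
    ultimately show ?thesis using b unfolding open_pairs_def by auto
  qed
  have pairs: "(\<Prod>q\<in>Inter ` {Z\<in>\<Omega>. card Z = 2}. pf (card (GR q))) = (\<Prod>b\<in>B. \<Prod>q\<in>open_pairs b. pf (card (GR q)))"
  proof -
    have "(\<Prod>q\<in>Inter ` {Z\<in>\<Omega>. card Z = 2}. pf (card (GR q))) = (\<Prod>q\<in>(\<Union>b\<in>B. open_pairs b). pf (card (GR q)))"
    proof (rule prod.mono_neutral_left)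
      show "finite (\<Union>b\<in>B. open_pairs b)" using finB finQ by blast
      show "Inter ` {Z\<in>\<Omega>. card Z = 2} \<subseteq> (\<Union>b\<in>B. open_pairs b)" using inQ by blast
      show "\<forall>q\<in>(\<Union>b\<in>B. open_pairs b) - Inter ` {Z\<in>\<Omega>. card Z = 2}. pf (card (GR q)) = 1"
      proof
        fix q assume "q \<in> (\<Union>b\<in>B. open_pairs b) - Inter ` {Z\<in>\<Omega>. card Z = 2}"
        hence "GR q = {}" unfolding GR_def by blast
        thus "pf (card (GR q)) = 1" by (simp add: pf_def pair_factor_def)
      qed
    qed
    also have "\<dots> = (\<Prod>b\<in>B. \<Prod>q\<in>open_pairs b. pf (card (GR q)))"
      using finB finQ disjQ by (intro prod.UNION_disjoint) auto
    finally show ?thesis .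
  qed
  \<comment> \<open>The group of \<open>q\<close> has full size \<open>N0\<close> except for
    configurations in \<open>\<Delta> b\<close>, and each of these has weight at least 1/D.\<close>
  have GRle: "card (GR q) \<le> N0" "real (N0 - card (GR q)) / D \<le> C / real n" if b: "b \<in> B" and q: "q \<in> open_pairs b" for b q
  proof -
    define \<Gamma> where "\<Gamma> = {Z \<in> min_bad_sets r n. b \<in> Z \<and> exc r Z = 2 \<and> card Z = 2 \<and> \<Inter>Z = q}"
    have c\<Gamma>: "card \<Gamma> = N0"
      unfolding \<Gamma>_def N0_def using card_pair_group[OF finb(3)[OF b] _ _ r(1)] q unfolding open_pairs_def by blast
    have sub: "GR q \<subseteq> \<Gamma>"
    proof
      fix Z assume "Z \<in> GR q"
      hence Z: "Z \<in> \<Omega>" "card Z = 2" "\<Inter>Z = q" unfolding GR_def by auto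
      obtain b' where b': "b' \<in> B" "b' \<in> Z" "\<Inter>Z \<in> open_pairs b'" using inQ[OF Z(1,2)] by blast
      have "b' = b" using disjQ[OF b'(1) b] b'(3) q Z(3) by blast
      thus "Z \<in> \<Gamma>" using Z b' unfolding \<Gamma>_def \<Omega>_def Omega_def by blast
    qed
    have fin\<Gamma>: "finite \<Gamma>" unfolding \<Gamma>_def by simp
    show "card (GR q) \<le> N0" using card_mono[OF fin\<Gamma> sub] c\<Gamma> by simp
    have sub2: "\<Gamma> - GR q \<subseteq> \<Delta> b" using b unfolding \<Gamma>_def GR_def \<Omega>_def Omega_def \<Delta>_def V_def by blast
    have "real (N0 - card (GR q)) / D = (\<Sum>Z\<in>\<Gamma> - GR q. 1 / D)"
      using c\<Gamma> sub fin\<Gamma> finite_subset[OF sub fin\<Gamma>] by (simp add: card_Diff_subset)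
    also have "\<dots> \<le> (\<Sum>Z\<in>\<Gamma> - GR q. (1 / D) ^ card (Z - E))"
    proof (rule sum_mono)
      fix Z assume "Z \<in> \<Gamma> - GR q"
      hence "card (Z - E) \<le> 1" using ZE[OF _ b, of Z] sub2 unfolding \<Gamma>_def by auto
      hence "(1 / D) ^ 1 \<le> (1 / D) ^ card (Z - E)" using D2 by (intro power_decreasing) auto
      thus "1 / D \<le> (1 / D) ^ card (Z - E)" by simp
    qed
    also have "\<dots> \<le> (\<Sum>Z\<in>\<Delta> b. (1 / D) ^ card (Z - E))" using sub2 fin\<Delta> D2 by (intro sum_mono2) auto
    also have "\<dots> \<le> C / real n" by (rule dsum[OF b])
    finally show "real (N0 - card (GR q)) / D \<le> C / real n" .
  qed
  have cardQ: "card (open_pairs b) = r choose 2" if "b \<in> B" for b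
    unfolding open_pairs_def using n_subsets[OF finb(1)[OF that], of 2] finb(2)[OF that] by simp
  have D1: "D \<ge> 1" using D2 by simp
  have N0D': "real N0 \<le> D" using N0D by simp
  have pf1: "\<bar>pf (card (GR q))\<bar> \<le> 1" if "b \<in> B" "q \<in> open_pairs b" for b q
    unfolding pf_def by (rule pair_factor_bounds(1)[OF y D1 GRle(1)[OF that] N0D'])
  have pf01: "\<bar>pf N0\<bar> \<le> 1" unfolding pf_def by (rule pair_factor_bounds(1)[OF y D1 order_refl N0D'])
  have pairdiff: "\<bar>(\<Prod>q\<in>open_pairs b. pf (card (GR q))) - pf N0 ^ (r choose 2)\<bar> \<le> 3 * real (r choose 2) * C / real n"
    if b: "b \<in> B" for b
  proof -
    have "\<bar>(\<Prod>q\<in>open_pairs b. pf (card (GR q))) - pf N0 ^ (r choose 2)\<bar> = norm ((\<Prod>q\<in>open_pairs b. pf (card (GR q))) - (\<Prod>q\<in>open_pairs b. pf N0))"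
      using cardQ[OF b] by simp
    also have "\<dots> \<le> (\<Sum>q\<in>open_pairs b. norm (pf (card (GR q)) - pf N0))"
      by (rule norm_prod_diff) (use pf1[OF b] pf01 in auto)
    also have "\<dots> \<le> (\<Sum>q\<in>open_pairs b. 3 * (C / real n))"
    proof (rule sum_mono)
      fix q assume q: "q \<in> open_pairs b"
      have "norm (pf (card (GR q)) - pf N0) \<le> 3 * (real (N0 - card (GR q)) / D)"
        unfolding pf_def real_norm_def by (rule pair_factor_bounds(2)[OF y D1 GRle(1)[OF b q] N0D'])
      thus "norm (pf (card (GR q)) - pf N0) \<le> 3 * (C / real n)" using GRle(2)[OF b q] by simp
    qed
    also have "\<dots> = 3 * real (r choose 2) * C / real n" using cardQ[OF b] by simp
    finally show ?thesis .
  qed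
  have tot: "model_total r n E B y \<alpha> = (\<Prod>b\<in>B. (\<Prod>Z\<in>BG b. 1 - cw Z) * (\<Prod>q\<in>open_pairs b. pf (card (GR q))))"
  proof -
    have "D > 0" using D2 by simp
    hence "model_total r n E B y \<alpha> = (\<Prod>Z\<in>{Z\<in>\<Omega>. card Z \<noteq> 2}. 1 - cw Z) * (\<Prod>q\<in>Inter ` {Z\<in>\<Omega>. card Z = 2}. pf (card (GR q)))"
      unfolding model_total_def D_def \<Omega>_def GR_def pf_def cw_def by (rule fam_weight_total)
    thus ?thesis unfolding big pairs prod.distrib .
  qed
  have hz: "hazard r n y \<alpha> = (\<Prod>Z\<in>Phi r n b. 1 - cw Z) * pf N0 ^ (r choose 2)" if "b \<in> B" for b
    unfolding cw_def pf_def N0_def D_def by (rule hazard_eq[OF finb(3)[OF that] r2(3)])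
  have b1: "\<bar>\<Prod>Z\<in>S. 1 - cw Z\<bar> \<le> 1" for S using cw01 by (intro prod_abs_le_1) (simp add: abs_le_iff)
  have b2: "\<bar>\<Prod>q\<in>open_pairs b. pf (card (GR q))\<bar> \<le> 1" if "b \<in> B" for b using pf1[OF that] by (intro prod_abs_le_1)
  have b3: "\<bar>pf N0 ^ (r choose 2)\<bar> \<le> 1" using pf01 by (simp add: power_abs power_le_one)
  have "\<bar>model_total r n E B y \<alpha> - hazard r n y \<alpha> ^ card B\<bar>
     = norm ((\<Prod>b\<in>B. (\<Prod>Z\<in>BG b. 1 - cw Z) * (\<Prod>q\<in>open_pairs b. pf (card (GR q)))) - (\<Prod>b\<in>B. (\<Prod>Z\<in>Phi r n b. 1 - cw Z) * pf N0 ^ (r choose 2)))"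
  proof -
    have "(\<Prod>b\<in>B. (\<Prod>Z\<in>Phi r n b. 1 - cw Z) * pf N0 ^ (r choose 2)) = (\<Prod>b\<in>B. hazard r n y \<alpha>)"
      by (intro prod.cong refl hz[symmetric])
    thus ?thesis unfolding tot by simp
  qed
  also have "\<dots> \<le> (\<Sum>b\<in>B. norm ((\<Prod>Z\<in>BG b. 1 - cw Z) * (\<Prod>q\<in>open_pairs b. pf (card (GR q))) - (\<Prod>Z\<in>Phi r n b. 1 - cw Z) * pf N0 ^ (r choose 2)))"
  proof (rule norm_prod_diff)
    fix b assume b: "b \<in> B"
    show "norm ((\<Prod>Z\<in>BG b. 1 - cw Z) * (\<Prod>q\<in>open_pairs b. pf (card (GR q)))) \<le> 1"
      unfolding real_norm_def abs_mult using b1 b2[OF b] by (intro mult_le_one) auto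
    show "norm ((\<Prod>Z\<in>Phi r n b. 1 - cw Z) * pf N0 ^ (r choose 2)) \<le> 1"
      unfolding real_norm_def abs_mult using b1 b3 by (intro mult_le_one) auto
  qed
  also have "\<dots> \<le> (\<Sum>b\<in>B. (2 ^ 8 + 3 * real (r choose 2)) * C / real n)"
  proof (rule sum_mono)
    fix b assume b: "b \<in> B"
    define P where "P = (\<Prod>Z\<in>BG b. 1 - cw Z)"
    define P' where "P' = (\<Prod>Z\<in>Phi r n b. 1 - cw Z)"
    define R where "R = (\<Prod>q\<in>open_pairs b. pf (card (GR q)))"
    define R' where "R' = pf N0 ^ (r choose 2)"
    have "P * R - P' * R' = (P - P') * R + P' * (R - R')" by (simp add: algebra_simps)
    hence "\<bar>P * R - P' * R'\<bar> \<le> \<bar>P - P'\<bar> * \<bar>R\<bar> + \<bar>P'\<bar> * \<bar>R - R'\<bar>"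
      using abs_triangle_ineq[of "(P - P') * R" "P' * (R - R')"] by (simp add: abs_mult)
    also have "\<dots> \<le> \<bar>P - P'\<bar> + \<bar>R - R'\<bar>"
      using b1[of "Phi r n b"] b2[OF b] unfolding P'_def[symmetric] R_def[symmetric]
      by (intro add_mono) (auto intro: mult_right_le_one_le mult_left_le_one_le)
    also have "\<dots> \<le> 2 ^ 8 * C / real n + 3 * real (r choose 2) * C / real n"
      using bigdiff[OF b] pairdiff[OF b] unfolding P_def P'_def R_def R'_def by linarith
    also have "\<dots> = (2 ^ 8 + 3 * real (r choose 2)) * C / real n" by (simp add: add_divide_distrib algebra_simps)
    finally show "norm ((\<Prod>Z\<in>BG b. 1 - cw Z) * (\<Prod>q\<in>open_pairs b. pf (card (GR q))) - (\<Prod>Z\<in>Phi r n b. 1 - cw Z) * pf N0 ^ (r choose 2))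
        \<le> (2 ^ 8 + 3 * real (r choose 2)) * C / real n" unfolding P_def P'_def R_def R'_def real_norm_def .
  qed
  also have "\<dots> = real (card B) * ((2 ^ 8 + 3 * real (r choose 2)) * C) / real n" by simp
  also have "\<dots> \<le> real K * ((2 ^ 8 + 3 * real (r choose 2)) * C) / real n"
  proof -
    have "card B \<le> K" using card_mono[OF finE E(3)] E(4) by simp
    thus ?thesis unfolding C_def by (intro divide_right_mono mult_right_mono mult_nonneg_nonneg) auto
  qed
  finally show ?thesis unfolding C_def .
qed

section \<open>Iterating the rounds\<close>

lemma scale_ge:
  assumes "r \<ge> 3" "n \<ge> 2 * r * k" "k \<ge> 1"
  shows "scale r n \<ge> real k"
proof -
  have n: "n \<ge> 2 * r" using assms by (metis le_trans mult.right_neutral mult_le_mono2)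
  have "real n \<ge> real (2 * r * k)" using assms(2) of_nat_le_iff by blast
  hence "real k \<le> real n / (2 * real r)" using assms by (simp add: pos_le_divide_eq mult_ac)
  moreover have "1 \<le> real n / (2 * real r)" using calculation assms(3) by linarith
  moreover have "1 \<le> r - 2" using assms by simp
  ultimately have "real k \<le> (real n / (2 * real r)) ^ (r - 2)"
    using power_increasing[of 1 "r - 2" "real n / (2 * real r)"] by simp
  thus ?thesis using scale_lower(1)[of r n] assms n by simp
qed

text \<open>Order of choices: J makes the truncation error small, L is the size that families of J +
  1 configurations need, then come \<epsilon>' and n0. The factor 2^K counts the possible new parts
  of \<open>E\<close>. The rate \<alpha> = 1/2 is the same in all rounds.\<close>

lemma round_estimate:
  fixes \<epsilon> c :: real
  assumes r: "r \<ge> 3" and eps: "\<epsilon> > 0" and c: "c \<ge> 0"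
  shows "\<exists>L \<epsilon>' n0. \<epsilon>' > 0 \<and> (\<forall>n\<ge>n0. \<forall>\<mu> y. 0 \<le> y \<longrightarrow> y \<le> 1 \<longrightarrow> state r n \<mu> \<longrightarrow> apriori r n c \<mu> \<longrightarrow>
     pure r n L \<epsilon>' y \<mu> \<longrightarrow>
     pure r n K \<epsilon> (y + 1/2 * hazard r n y (1/2)) (step r n (1/2 / scale r n) \<mu>))"
proof -
  define \<tau> where "\<tau> J = exp_tail (2 ^ 8 * attach_const r (r * K)) J" for J
  have "eventually (\<lambda>J. \<tau> J < \<epsilon> / (6 * 2 ^ K)) sequentially"
    unfolding \<tau>_def by (rule order_tendstoD(2)[OF exp_tail_tendsto]) (use eps in simp)
  then obtain J where J: "\<tau> J < \<epsilon> / (6 * 2 ^ K)" by (auto simp: eventually_sequentially)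
  define L where "L = K + 8 * Suc J"
  define M1 where "M1 = (\<Sum>j\<le>Suc J. level_err r K (c + 1) L j)"
  define M2 where "M2 = real K * ((2 ^ 8 + 3 * real (r choose 2)) * attach_const r (r * K))"
  have M1: "M1 \<ge> 0" unfolding M1_def using c by (intro sum_nonneg level_err_nonneg) auto
  have M2: "M2 \<ge> 0" unfolding M2_def by (intro mult_nonneg_nonneg) auto
  define \<epsilon>' where "\<epsilon>' = \<epsilon> / (3 * 2 ^ K * (M1 + 1))"
  have e': "\<epsilon>' > 0" unfolding \<epsilon>'_def using eps M1 by simp
  obtain n1 :: nat where n1: "real n1 > (M1 + M2) * (3 * 2 ^ K) / \<epsilon>" using reals_Archimedean2 by blast
  define n0 where "n0 = max (max n1 1) (4 * r)"
  have main: "pure r n K \<epsilon> (y + 1/2 * hazard r n y (1/2)) (step r n (1/2 / scale r n) \<mu>)"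
    if n: "n \<ge> n0" and y: "0 \<le> y" "y \<le> 1" and st: "state r n \<mu>" "apriori r n c \<mu>" "pure r n L \<epsilon>' y \<mu>" for n \<mu> y
    unfolding pure_def
  proof (intro allI impI)
    fix E assume E: "E \<subseteq> edges r n" "conflict_free r E" "card E \<le> K"
    have finE: "finite E" using E(1) finite_edges finite_subset by blast
    have nr: "n \<ge> 4 * r" "n \<ge> 2 * r" "n \<ge> n1" "n \<ge> 1" using n unfolding n0_def by auto
    define D where "D = scale r n"
    define p where "p = 1/2 / scale r n"
    define h where "h = hazard r n y (1/2)"
    have al: "(0::real) \<le> 1/2" "(1/2::real) \<le> 1" by auto
    have cc: "c + 1/2 \<le> c + 1" "1 \<le> c + 1" using c by auto
    have each: "\<bar>new_prob r n p \<mu> (E - B) B * D ^ card E - y ^ card (E - B) * (1/2 * h) ^ card B\<bar>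
        \<le> M1 * (\<epsilon>' + 1 / real n) + 2 * \<tau> J + M2 / real n" if B: "B \<in> Pow E" for B
    proof -
      have BE: "B \<subseteq> E" using B by simp
      define m where "m = y ^ card (E - B) * (1/2) ^ card B"
      have m: "0 \<le> m" "m \<le> 1" unfolding m_def using y by (auto intro!: mult_le_one power_le_one)
      have 1: "\<bar>new_prob r n p \<mu> (E - B) B * D ^ card E - m * model_total r n E B y (1/2)\<bar>
          \<le> M1 * (\<epsilon>' + 1 / real n) + 2 * \<tau> J"
        unfolding M1_def \<tau>_def D_def m_def
        by (rule new_prob_estimate[OF st E(1,2) BE E(3) r nr(2) p_def al y c cc]) (simp add: L_def)
      have 2: "\<bar>model_total r n E B y (1/2) - h ^ card B\<bar> \<le> M2 / real n"
        unfolding M2_def h_def by (rule model_total_hazard[OF E(1,2) BE E(3) r nr(1) y al])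
      have "\<bar>m * model_total r n E B y (1/2) - m * h ^ card B\<bar> = m * \<bar>model_total r n E B y (1/2) - h ^ card B\<bar>"
        using m by (simp add: right_diff_distrib[symmetric] abs_mult)
      also have "\<dots> \<le> M2 / real n" using m 2 by (intro order_trans[OF mult_left_le_one_le]) auto
      finally have 3: "\<bar>m * model_total r n E B y (1/2) - m * h ^ card B\<bar> \<le> M2 / real n" .
      have 4: "m * h ^ card B = y ^ card (E - B) * (1/2 * h) ^ card B" unfolding m_def power_mult_distrib by (simp only: mult.assoc)
      show ?thesis using 1 3 unfolding 4 by linarith
    qed
    have "incl_prob r n (step r n p \<mu>) E * D ^ card E - (y + 1/2 * h) ^ card E
       = (\<Sum>B\<in>Pow E. new_prob r n p \<mu> (E - B) B * D ^ card E - y ^ card (E - B) * (1/2 * h) ^ card B)"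
    proof -
      have "(y + 1/2 * h) ^ card E = (\<Sum>B\<in>Pow E. (1/2 * h) ^ card B * y ^ card (E - B))"
        using sum_Pow_binomial[OF finE, of "1/2 * h" y] by (simp add: add.commute)
      thus ?thesis unfolding incl_step_decompose[OF E(1)]
        by (simp only: sum_subtractf sum_distrib_right sum_distrib_left mult.commute)
    qed
    also have "\<bar>\<dots>\<bar> \<le> (\<Sum>B\<in>Pow E. M1 * (\<epsilon>' + 1 / real n) + 2 * \<tau> J + M2 / real n)"
      by (rule order_trans[OF sum_abs]) (intro sum_mono each)
    also have "\<dots> = 2 ^ card E * (M1 * (\<epsilon>' + 1 / real n) + 2 * \<tau> J + M2 / real n)"
      using finE by (simp add: card_Pow)
    also have "\<dots> \<le> 2 ^ K * (M1 * (\<epsilon>' + 1 / real n) + 2 * \<tau> J + M2 / real n)"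
    proof (intro mult_right_mono power_increasing)
      have "{} \<in> Pow E" by simp
      from order_trans[OF abs_ge_zero each[OF this]]
      show "0 \<le> M1 * (\<epsilon>' + 1 / real n) + 2 * \<tau> J + M2 / real n" .
    qed (use E in auto)
    also have "\<dots> = 2 ^ K * (M1 * \<epsilon>') + 2 ^ K * (2 * \<tau> J) + 2 ^ K * (M1 + M2) / real n"
      by (simp add: algebra_simps add_divide_distrib)
    also have "\<dots> \<le> \<epsilon> / 3 + \<epsilon> / 3 + \<epsilon> / 3"
    proof (intro add_mono)
      have "2 ^ K * (M1 * \<epsilon>') = \<epsilon> / 3 * (M1 / (M1 + 1))" 
      proof -
        have "\<epsilon>' = \<epsilon> / 3 / 2 ^ K / (M1 + 1)" unfolding \<epsilon>'_def by simp
        thus ?thesis by simp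
      qed
      also have "\<dots> \<le> \<epsilon> / 3" using M1 eps by (intro mult_right_le_one_le) auto
      finally show "2 ^ K * (M1 * \<epsilon>') \<le> \<epsilon> / 3" .
      have "2 ^ K * (2 * \<tau> J) \<le> 2 ^ K * (2 * (\<epsilon> / (6 * 2 ^ K)))" using J by (intro mult_left_mono) auto
      thus "2 ^ K * (2 * \<tau> J) \<le> \<epsilon> / 3" by simp
      have "(M1 + M2) * (3 * 2 ^ K) / \<epsilon> \<le> real n" using n1 nr(3) by linarith
      hence "(M1 + M2) * (3 * 2 ^ K) \<le> real n * \<epsilon>" using eps by (simp add: pos_divide_le_eq)
      thus "2 ^ K * (M1 + M2) / real n \<le> \<epsilon> / 3" using nr(4) by (simp add: field_simps)
    qed
    finally show "\<bar>incl_prob r n (step r n (1/2 / scale r n) \<mu>) E * scale r n ^ card E - (y + 1/2 * hazard r n y (1/2)) ^ card E\<bar> \<le> \<epsilon>"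
      unfolding p_def h_def D_def by simp
  qed
  show ?thesis using e' main by blast
qed

text \<open>A recursion in place of a differential equation; it still depends on n through the
  acceptance probability.\<close>

fun dens :: "nat \<Rightarrow> nat \<Rightarrow> nat \<Rightarrow> real" where
  "dens r n 0 = 0"
| "dens r n (Suc i) = dens r n i + 1/2 * hazard r n (dens r n i) (1/2)"

text \<open>The exponential accounts for the configurations with at least 3 edges, the factor 1/4 is
  lost once for each vertex pair of the edge.\<close>

definition hazard_const :: "nat \<Rightarrow> real" where
  "hazard_const r = exp (- (2 * (2 ^ 8 * attach_const r r))) * (1/4) ^ (r choose 2)"

lemma one_minus_ge_exp:
  fixes x :: real
  assumes "0 \<le> x" "x \<le> 1/2"
  shows "1 - x \<ge> exp (- (2 * x))"
proof -
  have "(1 - x) * (1 + 2 * x) \<ge> 1"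
  proof -
    have "x * (1 - 2 * x) \<ge> 0" using assms by (intro mult_nonneg_nonneg) auto
    thus ?thesis by (simp add: algebra_simps)
  qed
  moreover have "(1 - x) * (1 + 2 * x) \<le> (1 - x) * exp (2 * x)"
    using assms exp_ge_add_one_self[of "2 * x"] by (intro mult_left_mono) auto
  ultimately have "1 \<le> (1 - x) * exp (2 * x)" by linarith
  thus ?thesis by (simp add: exp_minus divide_simps)
qed

text \<open>Each vertex pair has exactly D = \<open>scale r n\<close> possible outer edges, so its
  factor is (1 - a)^(D - 1) * (1 - a - y) with a = 1/(2D). By Bernoulli the power is at least 1/2,
  and 1/D \<le> 1 - y keeps a below (1 - y)/2, so the factor lies between (1 - y)/4 and 1 - y. The
  upper bound keeps the density below 1, the lower bound keeps it growing.\<close>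

lemma hazard_bounds:
  assumes r: "r \<ge> 3" and n: "n \<ge> 8 * r" and y: "0 \<le> y" "1 / scale r n \<le> 1 - y"
  shows "0 \<le> hazard r n y (1/2)" "hazard r n y (1/2) \<le> 1 - y" "hazard r n y (1/2) \<ge> hazard_const r * (1 - y) ^ (r choose 2)"
proof -
  define D where "D = scale r n"
  define N0 where "N0 = (n - r) choose (r - 2)"
  define \<rho> where "\<rho> = r choose 2"
  define a where "a = 1/2 / D"
  define P where "P = (\<Prod>Z\<in>Phi r n {..<r}. 1 - conf_weight y (1/2) D Z)"
  have D4: "D \<ge> 4" using scale_ge[OF r, of 4 n] n unfolding D_def by simp
  have N0D: "real N0 = D" unfolding N0_def D_def scale_def ..
  have y1: "y \<le> 1" using y(2) D4 unfolding D_def[symmetric] by (smt (verit) divide_nonneg_nonneg)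
  have al: "(0::real) \<le> 1/2" "(1/2::real) \<le> 1" by auto
  have rho: "\<rho> \<ge> 1" unfolding \<rho>_def using r by (simp add: Suc_leI zero_less_binomial)
  have ha: "hazard r n y (1/2) = P * pair_factor y (1/2) D N0 ^ \<rho>"
    unfolding hazard_def P_def D_def N0_def \<rho>_def ..
  have a: "0 \<le> a" "a \<le> (1 - y) / 2" "a \<le> 1" unfolding a_def using y(2) D4 unfolding D_def[symmetric] by (auto simp: field_simps)
  have pf: "pair_factor y (1/2) D N0 = (1 - a) ^ (N0 - 1) * (1 - a - y)"
  proof -
    obtain N where N: "N0 = Suc N" using N0D D4 by (cases N0) auto
    have "real N0 * (y / D) = y" using N0D D4 by simp
    thus ?thesis unfolding pair_factor_def a_def[symmetric] N by (simp add: algebra_simps)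
  qed
  have q: "(1 - a) ^ (N0 - 1) \<ge> 1/2" "(1 - a) ^ (N0 - 1) \<le> 1"
  proof -
    have "1 - real (N0 - 1) * a \<le> (1 - a) ^ (N0 - 1)"
      using Bernoulli_inequality[of "- a" "N0 - 1"] a by simp
    moreover have "real (N0 - 1) * a \<le> D * a" using N0D a by (intro mult_right_mono) auto
    moreover have "D * a = 1/2" unfolding a_def using D4 by simp
    ultimately show "(1 - a) ^ (N0 - 1) \<ge> 1/2" by linarith
    show "(1 - a) ^ (N0 - 1) \<le> 1" using a by (intro power_le_one) auto
  qed
  have d: "1 - a - y \<ge> (1 - y) / 2" "1 - a - y \<le> 1 - y" "1 - a - y \<ge> 0" using a y1 by (auto simp: field_simps)
  have pf_lo: "pair_factor y (1/2) D N0 \<ge> (1 - y) / 4"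
  proof -
    have "1/2 * ((1 - y) / 2) \<le> (1 - a) ^ (N0 - 1) * (1 - a - y)" using q d y1 by (intro mult_mono) auto
    thus ?thesis unfolding pf by simp
  qed
  have pf_hi: "pair_factor y (1/2) D N0 \<le> 1 - y"
  proof -
    have "(1 - a) ^ (N0 - 1) * (1 - a - y) \<le> 1 - a - y"
      using q d by (intro mult_left_le_one_le) auto
    also have "\<dots> \<le> 1 - y" using d by simp
    finally show ?thesis unfolding pf .
  qed
  have pf0: "pair_factor y (1/2) D N0 \<ge> 0" using pf_lo y1 by (smt (verit) divide_nonneg_nonneg)
  have cw: "0 \<le> conf_weight y (1/2) D Z" "conf_weight y (1/2) D Z \<le> 1" for Z
    using conf_weight_01[OF y(1) y1 al, of D Z] D4 by auto
  have P01: "0 \<le> P" "P \<le> 1" unfolding P_def using cw by (auto intro!: prod_nonneg prod_le_1)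
  show "0 \<le> hazard r n y (1/2)" unfolding ha using P01 pf0 by simp
  have "pair_factor y (1/2) D N0 ^ \<rho> \<le> pair_factor y (1/2) D N0 ^ 1"
    using pf0 pf_hi y rho by (intro power_decreasing) auto
  hence "pair_factor y (1/2) D N0 ^ \<rho> \<le> 1 - y" using pf_hi by simp
  moreover have "P * pair_factor y (1/2) D N0 ^ \<rho> \<le> pair_factor y (1/2) D N0 ^ \<rho>"
    using P01 pf0 by (intro mult_left_le_one_le) auto
  ultimately show "hazard r n y (1/2) \<le> 1 - y" unfolding ha by linarith
  have Plo: "P \<ge> exp (- (2 * (2 ^ 8 * attach_const r r)))"
  proof -
    \<comment> \<open>\<open>one_minus_ge_exp\<close> requires weights of at most 1/2, which D \<ge>
      4 provides.\<close>
    have half: "conf_weight y (1/2) D Z \<le> 1/2" if Z: "Z \<in> Phi r n {..<r}" for Z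
    proof -
      have "2 \<le> card Z" "card Z \<noteq> 2" using Z minbad_card(1) unfolding Phi_def min_bad_sets_def by auto
      hence c1: "1 \<le> card Z - 1" by simp
      have base: "0 \<le> (y + 1/2) / D" "(y + 1/2) / D \<le> 1/2" using y y1 D4 by (auto simp: field_simps)
      have "((y + 1/2) / D) ^ (card Z - 1) \<le> ((y + 1/2) / D) ^ 1" 
        by (rule power_decreasing[OF c1 base(1)]) (use base(2) in linarith)
      thus ?thesis unfolding conf_weight_def power_one_right using base(2) by linarith
    qed
    have b0: "{..<r} \<in> edges r n" using n unfolding edges_def by auto
    have "(\<Sum>Z\<in>Phi r n {..<r}. conf_weight y (1/2) D Z) \<le> (\<Sum>Z\<in>Omega r n {{..<r}} {{..<r}}. conf_weight y (1/2) D Z)"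
      using cw by (intro sum_mono2) (auto simp: Phi_def Omega_def)
    also have "\<dots> \<le> 2 ^ 8 * attach_const r (r * 1)"
      unfolding D_def using b0 r n by (intro sum_conf_weight_le y(1) y1 al) auto
    finally have S: "(\<Sum>Z\<in>Phi r n {..<r}. conf_weight y (1/2) D Z) \<le> 2 ^ 8 * attach_const r r" by simp
    have "exp (- (2 * (2 ^ 8 * attach_const r r))) \<le> exp (- (2 * (\<Sum>Z\<in>Phi r n {..<r}. conf_weight y (1/2) D Z)))"
      using S by simp
    also have "\<dots> = (\<Prod>Z\<in>Phi r n {..<r}. exp (- (2 * conf_weight y (1/2) D Z)))"
      by (subst exp_sum[symmetric]) (auto simp: sum_negf sum_distrib_left)
    also have "\<dots> \<le> P" unfolding P_def using one_minus_ge_exp cw half by (intro prod_mono) auto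
    finally show ?thesis .
  qed
  have "hazard_const r * (1 - y) ^ \<rho> = exp (- (2 * (2 ^ 8 * attach_const r r))) * ((1 - y) / 4) ^ \<rho>"
    unfolding hazard_const_def \<rho>_def by (simp add: power_divide)
  also have "\<dots> \<le> P * pair_factor y (1/2) D N0 ^ \<rho>"
    using Plo pf_lo y1 P01 by (intro mult_mono power_mono) auto
  finally show "hazard r n y (1/2) \<ge> hazard_const r * (1 - y) ^ (r choose 2)" unfolding ha \<rho>_def .
qed

text \<open>By the upper bound on the acceptance probability a round at most halves the gap 1 - y.
  After i \<le> M rounds the gap is at least 2^-i, and the assumption on \<open>scale\<close> makes
  this at least 1/\<open>scale\<close>.\<close>

lemma dens_bounds:
  assumes r: "r \<ge> 3" and n: "n \<ge> 8 * r" "scale r n \<ge> 2 ^ M" and i: "i \<le> M"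
  shows "0 \<le> dens r n i" "1 / 2 ^ i \<le> 1 - dens r n i" "1 / scale r n \<le> 1 - dens r n i"
proof -
  have "0 \<le> dens r n i \<and> 1 / 2 ^ i \<le> 1 - dens r n i \<and> 1 / scale r n \<le> 1 - dens r n i" using i
  proof (induction i)
    case 0
    have "scale r n \<ge> 1" using scale_lower(2)[of r n] r n by simp
    thus ?case by simp
  next
    case (Suc i)
    hence IH: "0 \<le> dens r n i" "1 / 2 ^ i \<le> 1 - dens r n i" "1 / scale r n \<le> 1 - dens r n i" by auto
    note h = hazard_bounds(1,2)[OF r n(1) IH(1,3)]
    have "1 / 2 ^ Suc i \<le> 1 - dens r n (Suc i)" using h IH by simp
    moreover have "(0::real) < 2 ^ M" by simp
    hence "1 / scale r n \<le> 1 / 2 ^ M" using n(2) by (intro divide_left_mono mult_pos_pos) linarith+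
    moreover have "(1::real) / 2 ^ M \<le> 1 / 2 ^ Suc i" using Suc.prems by (intro divide_left_mono power_increasing) auto
    ultimately show ?case using h IH by simp
  qed
  thus "0 \<le> dens r n i" "1 / 2 ^ i \<le> 1 - dens r n i" "1 / scale r n \<le> 1 - dens r n i" by auto
qed

text \<open>While the gap exceeds \<delta> each round gains at least \<gamma>, so M > 1/\<gamma>
  rounds would push the density above 1. The number M does not depend on n.\<close>

lemma dens_near_one:
  assumes r: "r \<ge> 3" and \<delta>: "\<delta> > 0"
  shows "\<exists>M n1. \<forall>n\<ge>n1. dens r n M \<ge> 1 - \<delta>"
proof -
  define \<gamma> where "\<gamma> = 1/2 * (hazard_const r * \<delta> ^ (r choose 2))"
  have g: "\<gamma> > 0" unfolding \<gamma>_def hazard_const_def using \<delta> by simp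
  obtain M :: nat where M: "real M > 1 / \<gamma>" using reals_Archimedean2 by blast
  define n1 where "n1 = max (8 * r) (2 * r * 2 ^ M)"
  have "dens r n M \<ge> 1 - \<delta>" if n: "n \<ge> n1" for n
  proof (rule ccontr)
    assume neg: "\<not> dens r n M \<ge> 1 - \<delta>"
    have n8: "n \<ge> 8 * r" and nM: "n \<ge> 2 * r * 2 ^ M" using n unfolding n1_def by auto
    have sc: "scale r n \<ge> 2 ^ M" using scale_ge[OF r nM] by simp
    note db = dens_bounds[OF r n8 sc]
    have mono: "dens r n i \<le> dens r n (Suc i)" if "i \<le> M" for i
      using hazard_bounds(1)[OF r n8 db(1,3)[OF that]] by simp
    have le: "dens r n (M - k) \<le> dens r n M" if "k \<le> M" for k using that
    proof (induction k)
      case (Suc k)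
      have "dens r n (M - Suc k) \<le> dens r n (Suc (M - Suc k))" by (rule mono) simp
      moreover have "Suc (M - Suc k) = M - k" using Suc.prems by simp
      ultimately show ?case using Suc by simp
    qed simp
    have "dens r n i \<ge> real i * \<gamma>" if "i \<le> M" for i using that
    proof (induction i)
      case (Suc i)
      have iM: "i \<le> M" using Suc.prems by simp
      have "dens r n i \<le> dens r n M" using le[of "M - i"] iM by simp
      hence "\<delta> \<le> 1 - dens r n i" using neg by simp
      hence "\<delta> ^ (r choose 2) \<le> (1 - dens r n i) ^ (r choose 2)" using \<delta> by (intro power_mono) auto
      hence "hazard_const r * \<delta> ^ (r choose 2) \<le> hazard_const r * (1 - dens r n i) ^ (r choose 2)"
        unfolding hazard_const_def by (intro mult_left_mono) auto
      also have "\<dots> \<le> hazard r n (dens r n i) (1/2)" by (rule hazard_bounds(3)[OF r n8 db(1,3)[OF iM]])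
      finally have "dens r n (Suc i) \<ge> dens r n i + \<gamma>" unfolding \<gamma>_def by simp
      thus ?case using Suc.IH[OF iM] by (simp add: algebra_simps)
    qed simp
    hence "dens r n M \<ge> real M * \<gamma>" by simp
    moreover have "real M * \<gamma> > 1" using M g by (simp add: field_simps)
    moreover have "(0::real) < 1 / 2 ^ M" by simp
    ultimately show False using db(2)[OF order_refl] by linarith
  qed
  thus ?thesis by blast
qed

text \<open>\<open>K\<close> and \<open>\<epsilon>\<close> are generalised because a round asks for
  larger sets and a smaller error before it. The process starts from the empty hypergraph with
  density 0.\<close>

lemma process_exists:
  assumes r: "r \<ge> 3"
  shows "\<epsilon> > 0 \<Longrightarrow> \<exists>n0. \<forall>n\<ge>n0. \<exists>\<mu>. state r n \<mu> \<and> apriori r n (real i / 2) \<mu> \<and> pure r n K \<epsilon> (dens r n i) \<mu>"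
proof (induction i arbitrary: K \<epsilon>)
  case 0
  define \<mu> where "\<mu> S = (of_bool (S = {}) :: real)" for S :: "nat set set"
  have incl_prob: "incl_prob r n \<mu> E = of_bool (E = {})" for n E
  proof -
    have "incl_prob r n \<mu> E = (\<Sum>S\<in>{{}}. \<mu> S * of_bool (E \<subseteq> S))"
      unfolding incl_prob_def by (rule sum.mono_neutral_right) (auto simp: \<mu>_def)
    thus ?thesis by (simp add: \<mu>_def)
  qed
  have zero: "(0::real) ^ card E = of_bool (E = {})" if "finite E" for E :: "nat set set"
    using that by (simp add: card_gt_0_iff zero_power)
  have fin: "finite E" if "E \<subseteq> edges r n" for E n using that finite_edges finite_subset by blast
  have "state r n \<mu>" for n
  proof -
    have "(\<Sum>S\<in>Pow (edges r n). \<mu> S) = 1" using incl_prob[of n "{}"] by (simp add: incl_prob_def)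
    moreover have "conflict_free r {}" unfolding conflict_free_def bad_def by auto
    ultimately show ?thesis unfolding state_def by (auto simp: \<mu>_def)
  qed
  moreover have "apriori r n (real 0 / 2) \<mu>" for n
    unfolding apriori_def incl_prob using zero fin by simp
  moreover have "pure r n K \<epsilon> (dens r n 0) \<mu>" for n
    unfolding pure_def incl_prob
  proof (intro allI impI)
    fix E assume "E \<subseteq> edges r n"
    thus "\<bar>of_bool (E = {}) * scale r n ^ card E - dens r n 0 ^ card E\<bar> \<le> \<epsilon>"
      using zero[OF fin] 0 by (cases "E = {}") auto
  qed
  ultimately show ?case by blast
next
  case (Suc i)
  have c0: "real i / 2 \<ge> 0" by simp
  from round_estimate[OF r Suc.prems c0, of K]
  obtain L \<epsilon>' n0 where R1: "\<epsilon>' > 0" and R0: "\<forall>n\<ge>n0. \<forall>\<mu> y. 0 \<le> y \<longrightarrow> y \<le> 1 \<longrightarrow> state r n \<mu> \<longrightarrow>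
     apriori r n (real i / 2) \<mu> \<longrightarrow> pure r n L \<epsilon>' y \<mu> \<longrightarrow>
     pure r n K \<epsilon> (y + 1/2 * hazard r n y (1/2)) (step r n (1/2 / scale r n) \<mu>)" by blast
  note R = R1 R0[rule_format]
  obtain n2 where n2: "\<forall>n\<ge>n2. \<exists>\<mu>. state r n \<mu> \<and> apriori r n (real i / 2) \<mu> \<and> pure r n L \<epsilon>' (dens r n i) \<mu>"
    using Suc.IH[OF R(1)] by blast
  define N where "N = max (max n0 n2) (max (8 * r) (2 * r * 2 ^ i))"
  show ?case
  proof (intro exI[of _ N] allI impI)
    fix n assume n: "n \<ge> N"
    have ns: "n \<ge> n0" "n \<ge> n2" "n \<ge> 8 * r" "n \<ge> 2 * r * 2 ^ i" using n unfolding N_def by auto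
    obtain \<mu> where mu: "state r n \<mu>" "apriori r n (real i / 2) \<mu>" "pure r n L \<epsilon>' (dens r n i) \<mu>" using n2 ns by blast
    have sc: "scale r n \<ge> 2 ^ i" using scale_ge[OF r ns(4)] by simp
    have d: "0 \<le> dens r n i" "1 / 2 ^ i \<le> 1 - dens r n i" using dens_bounds[OF r ns(3) sc order_refl] by auto
    have "(0::real) \<le> 1 / 2 ^ i" by simp
    hence d1: "dens r n i \<le> 1" using d by linarith
    have s1: "scale r n \<ge> 1" using scale_lower(2)[of r n] r ns by simp
    have p: "0 \<le> 1/2 / scale r n" "1/2 / scale r n \<le> 1" using s1 by (auto simp: field_simps)
    have "state r n (step r n (1/2 / scale r n) \<mu>)" by (rule state_step[OF mu(1) p])
    moreover have "apriori r n (real i / 2 + 1/2) (step r n (1/2 / scale r n) \<mu>)"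
      using r ns by (intro apriori_step[OF mu(1,2) p refl]) auto
    moreover have "real i / 2 + 1/2 = real (Suc i) / 2" by simp
    moreover have "pure r n K \<epsilon> (dens r n (Suc i)) (step r n (1/2 / scale r n) \<mu>)"
      using R(2)[OF ns(1) d(1) d1 mu] by simp
    ultimately show "\<exists>\<mu>. state r n \<mu> \<and> apriori r n (real (Suc i) / 2) \<mu> \<and> pure r n K \<epsilon> (dens r n (Suc i)) \<mu>" by metis
  qed
qed

text \<open>Count r-sets with a marked pair in two ways; \<open>scale\<close> has n - r where the
  identity has n - 2, which makes it smaller.\<close>

lemma choose_ratio:
  assumes "r \<ge> 2" "n \<ge> 2 * r"
  shows "real (n choose r) / scale r n \<ge> real (n choose 2) / real (r choose 2)"
proof -
  have "(n choose r) * (r choose 2) = (n choose 2) * ((n - 2) choose (r - 2))"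
    using assms by (intro choose_mult) auto
  hence eq: "real (n choose r) * real (r choose 2) = real (n choose 2) * real ((n - 2) choose (r - 2))"
    by (metis of_nat_mult)
  have "(n - r) choose (r - 2) \<le> (n - 2) choose (r - 2)"
    using assms by (intro binomial_right_mono) auto
  hence "scale r n \<le> real ((n - 2) choose (r - 2))" unfolding scale_def by simp
  hence "real (n choose 2) * scale r n \<le> real (n choose r) * real (r choose 2)"
    unfolding eq by (intro mult_left_mono) auto
  moreover have "scale r n > 0" using scale_lower(2)[OF assms] by linarith
  moreover have "real (r choose 2) > 0" using assms by (simp add: zero_less_binomial)
  ultimately show ?thesis by (simp add: divide_simps mult_ac)
qed

text \<open>First moment: by \<open>pure\<close> for single edges the mean number of edges reaches
  the target, hence so does some outcome of positive weight, and such outcomes are conflict-free.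
  Half of \<delta> is spent on the density and half on the error.\<close>

theorem conflict_free_exists:
  assumes r: "r \<ge> 3" and \<delta>: "\<delta> > 0" "\<delta> < 1"
  shows "\<exists>n0. \<forall>n\<ge>n0. \<exists>S\<subseteq>edges r n. conflict_free r S \<and> real (card S) \<ge> (1 - \<delta>) * (real (n choose 2) / real (r choose 2))"
proof -
  obtain M n1 where n1: "\<forall>n\<ge>n1. dens r n M \<ge> 1 - \<delta> / 2" using dens_near_one[OF r, of "\<delta> / 2"] \<delta> by auto
  obtain n2 where n2: "\<forall>n\<ge>n2. \<exists>\<mu>. state r n \<mu> \<and> apriori r n (real M / 2) \<mu> \<and> pure r n 1 (\<delta> / 2) (dens r n M) \<mu>"
    using process_exists[OF r, of "\<delta> / 2" M 1] \<delta> by auto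
  show ?thesis
  proof (intro exI[of _ "max (max n1 n2) (2 * r)"] allI impI)
    fix n assume "n \<ge> max (max n1 n2) (2 * r)"
    hence n: "n \<ge> n1" "n \<ge> n2" "n \<ge> 2 * r" by auto
    have r2: "r \<ge> 2" using r by simp
    obtain \<mu> where mu: "state r n \<mu>" "pure r n 1 (\<delta> / 2) (dens r n M) \<mu>" using n2 n by blast
    define D where "D = scale r n"
    have D1: "D \<ge> 1" unfolding D_def by (rule scale_lower(2)[OF r2 n(3)])
    define T where "T = (1 - \<delta>) * (real (n choose 2) / real (r choose 2))"
    have inc: "incl_prob r n \<mu> {e} \<ge> (1 - \<delta>) / D" if e: "e \<in> edges r n" for e
    proof -
      have "conflict_free r {e}" unfolding conflict_free_def
      proof (intro allI impI notI)
        fix Z assume "Z \<subseteq> {e}" "bad r Z"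
        hence "card Z \<le> 1" "2 \<le> card Z" using card_mono[of "{e}" Z] unfolding bad_def by auto
        thus False by simp
      qed
      hence "\<bar>incl_prob r n \<mu> {e} * scale r n ^ card {e} - dens r n M ^ card {e}\<bar> \<le> \<delta> / 2"
        using mu(2)[unfolded pure_def, rule_format, of "{e}"] e by simp
      hence "\<bar>incl_prob r n \<mu> {e} * D - dens r n M\<bar> \<le> \<delta> / 2" unfolding D_def by simp
      hence "incl_prob r n \<mu> {e} * D \<ge> dens r n M - \<delta> / 2" unfolding abs_le_iff by linarith
      moreover have "dens r n M \<ge> 1 - \<delta> / 2" using n1 n(1) by blast
      ultimately have "incl_prob r n \<mu> {e} * D \<ge> 1 - \<delta>" by linarith
      thus ?thesis using D1 by (simp add: divide_le_eq)
    qed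
    have "T \<le> (1 - \<delta>) * (real (n choose r) / D)"
      unfolding T_def D_def using choose_ratio[OF r2 n(3)] \<delta> by (intro mult_left_mono) auto
    also have "\<dots> = (\<Sum>e\<in>edges r n. (1 - \<delta>) / D)"
      using n_subsets[of "{..<n}" r] by (simp add: edges_def)
    also have "\<dots> \<le> (\<Sum>e\<in>edges r n. incl_prob r n \<mu> {e})" by (intro sum_mono inc)
    also have "\<dots> = (\<Sum>S\<in>Pow (edges r n). \<mu> S * (\<Sum>e\<in>edges r n. of_bool ({e} \<subseteq> S)))"
      unfolding incl_prob_def sum_distrib_left by (rule sum.swap)
    also have "\<dots> = (\<Sum>S\<in>Pow (edges r n). \<mu> S * real (card S))"
    proof (intro sum.cong refl)
      fix S assume "S \<in> Pow (edges r n)"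
      hence "{e \<in> edges r n. e \<in> S} = S" by blast
      thus "\<mu> S * (\<Sum>e\<in>edges r n. of_bool ({e} \<subseteq> S)) = \<mu> S * real (card S)"
        by (simp add: sum.If_cases of_bool_def Int_def)
    qed
    finally have avg: "T \<le> (\<Sum>S\<in>Pow (edges r n). \<mu> S * real (card S))" .
    show "\<exists>S\<subseteq>edges r n. conflict_free r S \<and> real (card S) \<ge> (1 - \<delta>) * (real (n choose 2) / real (r choose 2))"
    proof (rule ccontr)
      assume "\<not> ?thesis"
      hence small: "real (card S) < T" if "S \<subseteq> edges r n" "conflict_free r S" for S using that unfolding T_def by force
      have tot: "(\<Sum>S\<in>Pow (edges r n). \<mu> S) = 1" and mu0: "\<And>S. \<mu> S \<ge> 0" and mucf: "\<And>S. \<mu> S \<noteq> 0 \<Longrightarrow> conflict_free r S"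
        using mu(1) unfolding state_def by auto
      have "\<exists>S\<in>Pow (edges r n). \<mu> S \<noteq> 0"
      proof (rule ccontr)
        assume "\<not> (\<exists>S\<in>Pow (edges r n). \<mu> S \<noteq> 0)"
        hence "(\<Sum>S\<in>Pow (edges r n). \<mu> S) = 0" by (intro sum.neutral) auto
        thus False using tot by simp
      qed
      then obtain S0 where S0: "S0 \<in> Pow (edges r n)" "\<mu> S0 \<noteq> 0" by blast
      have "(\<Sum>S\<in>Pow (edges r n). \<mu> S * real (card S)) < (\<Sum>S\<in>Pow (edges r n). \<mu> S * T)"
      proof (rule sum_strict_mono_ex1)
        show "\<forall>S\<in>Pow (edges r n). \<mu> S * real (card S) \<le> \<mu> S * T"
        proof
          fix S assume S: "S \<in> Pow (edges r n)"
          show "\<mu> S * real (card S) \<le> \<mu> S * T"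
          proof (cases "\<mu> S = 0")
            case False
            thus ?thesis using small[of S] mucf[OF False] S mu0[of S] by (intro mult_left_mono) auto
          qed simp
        qed
        have "\<mu> S0 > 0" using S0(2) mu0[of S0] by simp
        hence "\<mu> S0 * real (card S0) < \<mu> S0 * T" using small[of S0] mucf[OF S0(2)] S0(1) by simp
        thus "\<exists>S\<in>Pow (edges r n). \<mu> S * real (card S) < \<mu> S * T" using S0(1) by blast
      qed simp
      also have "\<dots> = T" using tot by (simp add: sum_distrib_right[symmetric])
      finally show False using avg by simp
    qed
  qed
qed

section \<open>Cleaning, and classes of edges meeting in pairs\<close>

text \<open>Each further set adds excess at most 1 and shares \<open>v\<close> with the rest, so the
  bound 1 persists.\<close>

lemma exc_star_le:
  assumes "finite \<S>" "\<S> \<noteq> {}" "\<And>S. S \<in> \<S> \<Longrightarrow> unif r S \<and> v \<in> \<Union>S \<and> exc r S \<le> 1"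
    "\<And>S T. S \<in> \<S> \<Longrightarrow> T \<in> \<S> \<Longrightarrow> S \<noteq> T \<Longrightarrow> S \<inter> T = {}"
  shows "exc r (\<Union>\<S>) \<le> 1 \<and> unif r (\<Union>\<S>) \<and> v \<in> \<Union>(\<Union>\<S>)"
  using assms
proof (induction \<S> rule: finite_ne_induct)
  case (singleton S)
  thus ?case by auto
next
  case (insert S \<S>)
  have IH: "exc r (\<Union>\<S>) \<le> 1" "unif r (\<Union>\<S>)" "v \<in> \<Union>(\<Union>\<S>)" using insert by auto
  have S: "unif r S" "v \<in> \<Union>S" "exc r S \<le> 1" using insert by auto
  have "S \<inter> T = {}" if "T \<in> \<S>" for T
  proof -
    have "S \<noteq> T" using that insert.hyps by blast
    thus ?thesis using insert.prems(2)[of S T] that by simp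
  qed
  hence disj: "S \<inter> \<Union>\<S> = {}" by blast
  have "exc r (S \<union> \<Union>\<S>) = exc r S + exc r (\<Union>\<S>) - int (card (\<Union>S \<inter> \<Union>(\<Union>\<S>)))"
    by (rule exc_Un[OF S(1) IH(2) disj])
  moreover have "card (\<Union>S \<inter> \<Union>(\<Union>\<S>)) \<ge> 1"
  proof -
    have "finite (\<Union>S \<inter> \<Union>(\<Union>\<S>))" using S(1) by simp
    moreover have "v \<in> \<Union>S \<inter> \<Union>(\<Union>\<S>)" using S IH by blast
    ultimately show ?thesis by (metis One_nat_def Suc_leI card_gt_0_iff empty_iff)
  qed
  ultimately show ?case using S IH unif_Un[OF S(1) IH(2)] by auto
qed

text \<open>
  Copies of a defective set glued at a vertex to each other and to one \<open>A\<close> give exactly 8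
  edges, of excess at most 2; hence edge-disjoint defective sets are few.
\<close>

definition defective :: "nat \<Rightarrow> 'a set set \<Rightarrow> bool" where
  "defective r J \<longleftrightarrow> 2 \<le> card J \<and> card J \<le> 7 \<and> exc r J \<le> 1 \<and>
     (\<exists>A\<subseteq>J. card A = 8 mod card J \<and> exc r A \<le> 2)"

text \<open>With 8 = f * j + s, f sets anchored at one vertex have together excess at most 1, and
  the s edges of \<open>A\<close> in one more set, glued at the same vertex, raise it to at most 1 +
  2 - 1. So at most f \<le> 4 sets have the same anchor.\<close>

lemma few_disjoint_defectives:
  assumes V: "finite V" "card V = n" and H: "unif r H" "\<Union>H \<subseteq> V" "r \<ge> 1"
    and P8: "\<And>J. J \<subseteq> H \<Longrightarrow> card J = 8 \<Longrightarrow> exc r J \<ge> 3"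
    and \<J>: "finite \<J>" "\<And>J. J \<in> \<J> \<Longrightarrow> J \<subseteq> H \<and> defective r J \<and> card J = j"
    "\<And>J J'. J \<in> \<J> \<Longrightarrow> J' \<in> \<J> \<Longrightarrow> J \<noteq> J' \<Longrightarrow> J \<inter> J' = {}"
    and j: "2 \<le> j" "j \<le> 7"
  shows "card \<J> \<le> 4 * n"
proof -
  define s where "s = 8 mod j"
  define f where "f = 8 div j"
  have fs: "f * j + s = 8" unfolding f_def s_def by simp
  have f4: "1 \<le> f" "f \<le> 4" unfolding f_def using j by (auto simp: less_eq_div_iff_mult_less_eq div_le_mono2[of 2 j 8, simplified])
  \<comment> \<open>The anchor has to lie on an edge of \<open>A\<close> when \<open>A\<close> is
    nonempty, because \<open>A\<close> is glued there.\<close>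
  have "\<exists>A v. A \<subseteq> J \<and> card A = s \<and> exc r A \<le> 2 \<and> v \<in> \<Union>J \<and> v \<in> V \<and> (s > 0 \<longrightarrow> v \<in> \<Union>A)" if J: "J \<in> \<J>" for J
  proof -
    obtain A where A: "A \<subseteq> J" "card A = s" "exc r A \<le> 2" using \<J>(2)[OF J] unfolding defective_def s_def by auto
    have "J \<noteq> {}" using \<J>(2)[OF J] j by auto
    have "\<exists>e. e \<in> J \<and> (s > 0 \<longrightarrow> e \<in> A)"
    proof (cases "A = {}")
      case True
      hence "s = 0" using A(2) by simp
      thus ?thesis using \<open>J \<noteq> {}\<close> by auto
    next
      case False
      thus ?thesis using A(1) by blast
    qed
    then obtain e where e: "e \<in> J" "s > 0 \<longrightarrow> e \<in> A" by blast
    have eH: "e \<in> H" using e \<J>(2)[OF J] by blast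
    have "card e = r" using eH H(1) unfolding unif_def by blast
    hence "e \<noteq> {}" using H(3) by auto
    then obtain v where "v \<in> e" by blast
    have "v \<in> \<Union>J" "v \<in> V" "s > 0 \<longrightarrow> v \<in> \<Union>A" using \<open>v \<in> e\<close> e eH H(2) by blast+
    thus ?thesis using A by blast
  qed
  hence "\<forall>J\<in>\<J>. \<exists>Av. fst Av \<subseteq> J \<and> card (fst Av) = s \<and> exc r (fst Av) \<le> 2 \<and> snd Av \<in> \<Union>J \<and> snd Av \<in> V \<and> (s > 0 \<longrightarrow> snd Av \<in> \<Union>(fst Av))"
    by fastforce
  from bchoice[OF this] obtain Av where Av: "\<forall>J\<in>\<J>. fst (Av J) \<subseteq> J \<and> card (fst (Av J)) = s \<and> exc r (fst (Av J)) \<le> 2 \<and>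
     snd (Av J) \<in> \<Union>J \<and> snd (Av J) \<in> V \<and> (s > 0 \<longrightarrow> snd (Av J) \<in> \<Union>(fst (Av J)))" by blast
  define A where "A J = fst (Av J)" for J
  define v where "v J = snd (Av J)" for J
  have A: "A J \<subseteq> J" "card (A J) = s" "exc r (A J) \<le> 2" "v J \<in> \<Union>J" "v J \<in> V" "s > 0 \<Longrightarrow> v J \<in> \<Union>(A J)" if "J \<in> \<J>" for J
    using Av that unfolding A_def v_def by auto
  have fiber: "card {J \<in> \<J>. v J = x} \<le> f" for x
  proof (rule ccontr)
    assume "\<not> card {J \<in> \<J>. v J = x} \<le> f"
    hence le: "Suc f \<le> card {J \<in> \<J>. v J = x}" by simp
    obtain \<T> where \<T>: "\<T> \<subseteq> {J \<in> \<J>. v J = x}" "card \<T> = Suc f" "finite \<T>"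
      by (rule obtain_subset_with_card_n[OF le])
    obtain J0 \<S> where S: "\<T> = insert J0 \<S>" "J0 \<notin> \<S>" "card \<S> = f" using card_eq_SucD[OF \<T>(2)] by blast
    have finS: "finite \<S>" using S(1) \<T>(3) by simp
    have neS: "\<S> \<noteq> {}" using S f4 by auto
    have inJ: "J \<in> \<J>" "v J = x" if "J \<in> \<T>" for J using that \<T> by auto
    have Su: "unif r S' \<and> x \<in> \<Union>S' \<and> exc r S' \<le> 1" if S': "S' \<in> \<S>" for S'
    proof -
      have T: "S' \<in> \<T>" using S' S(1) by simp
      have "S' \<subseteq> H" "exc r S' \<le> 1" using \<J>(2)[OF inJ(1)[OF T]] unfolding defective_def by auto
      moreover have "x \<in> \<Union>S'" using A(4)[OF inJ(1)[OF T]] inJ(2)[OF T] by simp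
      ultimately show ?thesis using unif_subset[OF H(1)] by simp
    qed
    have Sd: "S' \<inter> T = {}" if ST: "S' \<in> \<T>" "T \<in> \<T>" "S' \<noteq> T" for S' T
      by (rule \<J>(3)[OF inJ(1)[OF ST(1)] inJ(1)[OF ST(2)] ST(3)])
    have Sd': "S' \<inter> T = {}" if "S' \<in> \<S>" "T \<in> \<S>" "S' \<noteq> T" for S' T
      by (rule Sd) (use that S(1) in auto)
    have star: "exc r (\<Union>\<S>) \<le> 1" "unif r (\<Union>\<S>)" "x \<in> \<Union>(\<Union>\<S>)"
      using exc_star_le[OF finS neS Su Sd'] by blast+
    have cS: "card (\<Union>\<S>) = f * j"
    proof -
      have "card (\<Union>\<S>) = (\<Sum>T\<in>\<S>. card T)"
        using Sd' Su by (intro card_Union_disjoint) (auto simp: pairwise_def disjnt_def unif_def)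
      also have "\<dots> = (\<Sum>T\<in>\<S>. j)"
      proof (rule sum.cong[OF refl])
        fix T assume "T \<in> \<S>"
        hence "T \<in> \<T>" using S(1) by simp
        thus "card T = j" using \<J>(2)[OF inJ(1)] by blast
      qed
      finally show ?thesis using S by simp
    qed
    have J0: "J0 \<in> \<T>" using S by simp
    have uA: "unif r (A J0)" using A(1)[OF inJ(1)[OF J0]] \<J>(2)[OF inJ(1)[OF J0]] unif_subset[OF H(1)] by blast
    have "T \<inter> J0 = {}" if T: "T \<in> \<S>" for T
    proof -
      have "T \<in> \<T>" "T \<noteq> J0" using T S(1,2) by auto
      thus ?thesis by (rule Sd[OF _ J0])
    qed
    hence disj: "\<Union>\<S> \<inter> A J0 = {}" using A(1)[OF inJ(1)[OF J0]] by blast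
    have ex: "exc r (\<Union>\<S> \<union> A J0) = exc r (\<Union>\<S>) + exc r (A J0) - int (card (\<Union>(\<Union>\<S>) \<inter> \<Union>(A J0)))"
      by (rule exc_Un[OF star(2) uA disj])
    have le2: "exc r (\<Union>\<S> \<union> A J0) \<le> 2"
    proof (cases "s > 0")
      case True
      have "x \<in> \<Union>(\<Union>\<S>) \<inter> \<Union>(A J0)" using star(3) A(6)[OF inJ(1)[OF J0] True] inJ(2)[OF J0] by blast
      moreover have "finite (\<Union>(\<Union>\<S>) \<inter> \<Union>(A J0))" using star(2) by simp
      ultimately have "card (\<Union>(\<Union>\<S>) \<inter> \<Union>(A J0)) \<ge> 1" by (metis One_nat_def Suc_leI card_gt_0_iff empty_iff)
      thus ?thesis using ex star(1) A(3)[OF inJ(1)[OF J0]] by linarith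
    next
      case False
      hence "A J0 = {}" using A(2)[OF inJ(1)[OF J0]] uA by simp
      thus ?thesis using star(1) by simp
    qed
    have "card (\<Union>\<S> \<union> A J0) = 8"
      using card_Un_disjoint[OF _ _ disj] star(2) uA cS A(2)[OF inJ(1)[OF J0]] fs by simp
    moreover have "\<Union>\<S> \<union> A J0 \<subseteq> H"
    proof -
      have "T \<subseteq> H" if "T \<in> \<T>" for T using \<J>(2)[OF inJ(1)[OF that]] by blast
      hence "\<Union>\<T> \<subseteq> H" by blast
      moreover have "A J0 \<subseteq> J0" by (rule A(1)[OF inJ(1)[OF J0]])
      ultimately show ?thesis using S(1) by auto
    qed
    ultimately show False using P8[of "\<Union>\<S> \<union> A J0"] le2 by simp
  qed
  have "card \<J> = (\<Sum>x\<in>V. card {J \<in> \<J>. v J = x})"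
  proof -
    have "(\<Sum>x\<in>V. \<Sum>J\<in>{J \<in> \<J>. v J = x}. (1::nat)) = (\<Sum>J\<in>\<J>. 1)"
      using V(1) \<J>(1) A(5) by (intro sum.group) auto
    thus ?thesis by simp
  qed
  also have "\<dots> \<le> (\<Sum>x\<in>V. f)" by (intro sum_mono fiber)
  also have "\<dots> \<le> 4 * n" using V f4 by simp
  finally show ?thesis .
qed

text \<open>Remove all edges of a maximal disjoint family of defective sets: 6 sizes, at most 4n
  sets of each, at most 7 edges in a set, and 6 * 4 * 7 = 168.\<close>

lemma clean_subhypergraph:
  assumes V: "finite V" "card V = n" and H: "unif r H" "\<Union>H \<subseteq> V" "r \<ge> 1"
    and P8: "\<And>J. J \<subseteq> H \<Longrightarrow> card J = 8 \<Longrightarrow> exc r J \<ge> 3"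
  obtains H' where "H' \<subseteq> H" "card H \<le> card H' + 168 * n" "\<And>J. J \<subseteq> H' \<Longrightarrow> \<not> defective r J"
proof -
  have finH: "finite H" using H by simp
  define \<X> where "\<X> = {\<J>. \<J> \<subseteq> {J. J \<subseteq> H \<and> defective r J} \<and> (\<forall>J\<in>\<J>. \<forall>J'\<in>\<J>. J \<noteq> J' \<longrightarrow> J \<inter> J' = {})}"
  have finX: "finite \<X>" unfolding \<X>_def by (rule finite_subset[of _ "Pow (Pow H)"]) (use finH in auto)
  have "{} \<in> \<X>" unfolding \<X>_def by simp
  then obtain \<J> where J: "\<J> \<in> \<X>" "\<And>\<K>. \<K> \<in> \<X> \<Longrightarrow> \<J> \<subseteq> \<K> \<Longrightarrow> \<K> = \<J>"
    using finite_has_maximal[OF finX] by blast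
  have Jd: "J \<subseteq> H" "defective r J" "2 \<le> card J" "card J \<le> 7" if "J \<in> \<J>" for J
    using that J(1) unfolding \<X>_def defective_def by auto
  have Jdisj: "J \<inter> J' = {}" if "J \<in> \<J>" "J' \<in> \<J>" "J \<noteq> J'" for J J' using that J(1) unfolding \<X>_def by blast
  have finJ: "finite \<J>" by (rule finite_subset[of _ "Pow H"]) (use Jd finH in auto)
  have each: "card {J \<in> \<J>. card J = j} \<le> 4 * n" if "j \<in> {2..7}" for j
    by (rule few_disjoint_defectives[OF V H P8]) (use finJ Jd Jdisj that in auto)
  have "card \<J> = (\<Sum>j\<in>{2..7}. card {J \<in> \<J>. card J = j})"
  proof -
    have "(\<Sum>j\<in>{2..7}. \<Sum>J\<in>{J \<in> \<J>. card J = j}. (1::nat)) = (\<Sum>J\<in>\<J>. 1)"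
      using finJ Jd by (intro sum.group) auto
    thus ?thesis by simp
  qed
  also have "\<dots> \<le> (\<Sum>j\<in>{2..7::nat}. 4 * n)" by (intro sum_mono each)
  finally have cJ: "card \<J> \<le> 24 * n" by simp
  have "card (\<Union>\<J>) \<le> (\<Sum>J\<in>\<J>. card J)" using card_Union_le_sum_card by blast
  also have "\<dots> \<le> (\<Sum>J\<in>\<J>. 7)" using Jd by (intro sum_mono) auto
  finally have cU: "card (\<Union>\<J>) \<le> 168 * n" using cJ by simp
  define H' where "H' = H - \<Union>\<J>"
  have "card H \<le> card H' + card (\<Union>\<J>)"
  proof -
    have "finite (\<Union>\<J>)" by (rule finite_subset[OF _ finH]) (use Jd in blast)
    moreover have "H \<subseteq> H' \<union> \<Union>\<J>" unfolding H'_def by blast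
    ultimately have "card H \<le> card (H' \<union> \<Union>\<J>)" using finH H'_def by (intro card_mono) auto
    thus ?thesis using card_Un_le[of H' "\<Union>\<J>"] by linarith
  qed
  moreover have "\<not> defective r J" if JH: "J \<subseteq> H'" for J
  proof
    assume d: "defective r J"
    have "J \<noteq> {}" using d unfolding defective_def by auto
    have "insert J \<J> \<in> \<X>" using J(1) JH d unfolding \<X>_def H'_def by blast
    hence "J \<in> \<J>" using J(2)[of "insert J \<J>"] by blast
    thus False using JH \<open>J \<noteq> {}\<close> unfolding H'_def by blast
  qed
  ultimately show ?thesis using that[of H'] cU unfolding H'_def by auto
qed

section \<open>Dense sets and classes in a cleaned hypergraph\<close>

locale clean_hyp =
  fixes r :: nat and H :: "'a set set"
  assumes r4: "r \<ge> 4" and uH: "unif r H"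
    and no8: "\<And>J. J \<subseteq> H \<Longrightarrow> card J = 8 \<Longrightarrow> exc r J \<ge> 3"
    and nodef: "\<And>J. J \<subseteq> H \<Longrightarrow> \<not> defective r J"
begin

text \<open>Excess at most 2 is preserved by gluing along a vertex pair, as 2 + 2 - 2 = 2. The
  contradictions below are all of two kinds: a dense set of 8 edges, or a third common vertex
  against \<open>overlap_le_2\<close>.\<close>

definition dense :: "'a set set \<Rightarrow> bool" where
  "dense J \<longleftrightarrow> J \<subseteq> H \<and> exc r J \<le> 2"

lemma r2: "r \<ge> 2" using r4 by simp

lemma finH: "finite H" using uH by simp

lemma edge: "e \<in> H \<Longrightarrow> finite e" "e \<in> H \<Longrightarrow> card e = r"
  using uH unfolding unif_def by auto

lemma denseD: "dense J \<Longrightarrow> J \<subseteq> H" "dense J \<Longrightarrow> unif r J" "dense J \<Longrightarrow> finite J" "dense J \<Longrightarrow> finite (\<Union>J)"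
  "dense J \<Longrightarrow> exc r J \<le> 2"
  unfolding dense_def using unif_subset[OF uH] by (auto dest: unif_subset[OF uH])

lemma dense_single: "e \<in> H \<Longrightarrow> dense {e}"
  unfolding dense_def using exc_singleton[OF r2 edge(2)] by simp

lemma dense_not8: "dense J \<Longrightarrow> card J \<noteq> 8"
  using no8[of J] unfolding dense_def by auto

lemma exc_merge:
  assumes "dense J" "dense K" "J \<inter> K = {}"
  shows "exc r (J \<union> K) \<le> 4 - int (card (\<Union>J \<inter> \<Union>K))"
  using exc_Un[OF denseD(2)[OF assms(1)] denseD(2)[OF assms(2)] assms(3)] denseD(5)[OF assms(1)] denseD(5)[OF assms(2)]
  by simp

lemma two_common:
  assumes "q \<subseteq> X" "q \<subseteq> Y" "card q = 2" "finite X"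
  shows "2 \<le> card (X \<inter> Y)"
  using card_mono[of "X \<inter> Y" q] assms by auto

lemma three_common:
  assumes "q \<subseteq> X" "q \<subseteq> Y" "q' \<subseteq> X" "q' \<subseteq> Y" "card q = 2" "card q' = 2" "q \<noteq> q'" "finite X"
  shows "3 \<le> card (X \<inter> Y)"
proof -
  have fq: "finite q" "finite q'" using assms card.infinite by fastforce+
  have "\<not> q' \<subseteq> q" using assms(5-7) fq card_subset_eq[of q q'] by auto
  hence "q \<subset> q \<union> q'" by blast
  hence "card q < card (q \<union> q')" using fq by (intro psubset_card_mono) auto
  moreover have "card (q \<union> q') \<le> card (X \<inter> Y)" using assms by (intro card_mono) auto
  ultimately show ?thesis using assms by simp
qed

lemma dense_merge:
  assumes "dense J" "dense K" "J \<inter> K = {}" "q \<subseteq> \<Union>J" "q \<subseteq> \<Union>K" "card q = 2"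
  shows "dense (J \<union> K)"
  using exc_merge[OF assms(1-3)] two_common[OF assms(4-6) denseD(4)[OF assms(1)]] assms(1,2) unfolding dense_def by auto

lemma dense_insert:
  assumes "dense J" "g \<in> H" "g \<notin> J" "q \<subseteq> \<Union>J" "q \<subseteq> g" "card q = 2"
  shows "dense (insert g J)"
  using dense_merge[OF assms(1) dense_single[OF assms(2)], of q] assms by auto

text \<open>
  Two dense sets that together have between 2 and 7 edges share at most two vertices, provided
  the union contains a dense set of the size required by \<^const>\<open>defective\<close>.
\<close>

lemma overlap_le_2:
  assumes "dense J" "dense K" "J \<inter> K = {}" "A \<subseteq> J \<union> K" "dense A" "card A = 8 mod card (J \<union> K)"
    "2 \<le> card (J \<union> K)" "card (J \<union> K) \<le> 7"
  shows "card (\<Union>J \<inter> \<Union>K) \<le> 2"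
proof (rule ccontr)
  assume "\<not> card (\<Union>J \<inter> \<Union>K) \<le> 2"
  hence "exc r (J \<union> K) \<le> 1" using exc_merge[OF assms(1-3)] by simp
  hence "defective r (J \<union> K)" unfolding defective_def using assms denseD(5)[OF assms(5)] by blast
  moreover have "J \<union> K \<subseteq> H" using assms denseD(1) by blast
  ultimately show False using nodef by blast
qed

lemma dense_empty: "dense {}" by (simp add: dense_def)

definition adj :: "('a set \<times> 'a set) set" where
  "adj = {(e, f). e \<in> H \<and> f \<in> H \<and> 2 \<le> card (e \<inter> f)}"

definition edge_class :: "'a set \<Rightarrow> 'a set set" where
  "edge_class e = {f. (e, f) \<in> adj\<^sup>*}"

definition classes :: "'a set set set" where
  "classes = edge_class ` H"

lemma sym_adj: "sym adj" unfolding adj_def sym_def by (auto simp: Int_commute)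

lemma cls_eq: "f \<in> edge_class e \<Longrightarrow> edge_class f = edge_class e"
  unfolding edge_class_def using sym_rtrancl[OF sym_adj] by (auto dest: symD intro: rtrancl_trans)

lemma cls_self: "e \<in> edge_class e" unfolding edge_class_def by simp

lemma cls_sub: "e \<in> H \<Longrightarrow> edge_class e \<subseteq> H"
proof
  fix f assume e: "e \<in> H" and "f \<in> edge_class e"
  hence "(e, f) \<in> adj\<^sup>*" unfolding edge_class_def by simp
  thus "f \<in> H" by (induction rule: rtrancl_induct) (auto simp: adj_def e)
qed

lemma classesD:
  assumes "F \<in> classes"
  shows "F \<subseteq> H" "finite F" "F \<noteq> {}" "\<And>e. e \<in> F \<Longrightarrow> edge_class e = F"
proof -
  obtain e where e: "e \<in> H" "F = edge_class e" using assms unfolding classes_def by blast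
  show "F \<subseteq> H" using e cls_sub by simp
  thus "finite F" using finH finite_subset by blast
  show "F \<noteq> {}" using e cls_self by blast
  show "edge_class f = F" if "f \<in> F" for f using cls_eq that e by simp
qed

lemma classes_disjoint: "F \<in> classes \<Longrightarrow> F' \<in> classes \<Longrightarrow> F \<noteq> F' \<Longrightarrow> F \<inter> F' = {}"
  using classesD(4) by blast

lemma Union_classes: "\<Union>classes = H"
  unfolding classes_def using cls_self cls_sub by blast

lemma adj_same_class: "F \<in> classes \<Longrightarrow> e \<in> F \<Longrightarrow> f \<in> H \<Longrightarrow> 2 \<le> card (e \<inter> f) \<Longrightarrow> f \<in> F"
proof -
  assume F: "F \<in> classes" "e \<in> F" "f \<in> H" "2 \<le> card (e \<inter> f)"
  have "(e, f) \<in> adj" using F classesD(1)[OF F(1)] unfolding adj_def by blast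
  hence "f \<in> edge_class e" unfolding edge_class_def by blast
  thus "f \<in> F" using classesD(4)[OF F(1,2)] by simp
qed

lemma class_expand:
  assumes F: "F \<in> classes" and J: "J \<subseteq> F" "J \<noteq> {}" "J \<noteq> F"
  obtains e g where "e \<in> J" "g \<in> F - J" "2 \<le> card (e \<inter> g)"
proof -
  obtain a where a: "a \<in> J" using J by blast
  obtain z where z: "z \<in> F" "z \<notin> J" using J by blast
  have "z \<in> edge_class a" using classesD(4)[OF F] a J z by blast
  hence "(a, z) \<in> adj\<^sup>*" unfolding edge_class_def by simp
  hence "z \<in> J \<or> (\<exists>e\<in>J. \<exists>g\<in>F - J. 2 \<le> card (e \<inter> g))"
  proof (induction rule: rtrancl_induct)
    case base thus ?case using a by simp
  next
    case (step y z)
    thus ?case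
    proof (cases "y \<in> J \<and> z \<notin> J")
      case True
      have yz: "2 \<le> card (y \<inter> z)" "z \<in> H" using step(2) unfolding adj_def by auto
      have "z \<in> F" using adj_same_class[OF F _ yz(2,1)] True J by blast
      thus ?thesis using True yz by blast
    qed blast
  qed
  thus ?thesis using z that by blast
qed

lemma pair_of_inter:
  assumes "2 \<le> card (e \<inter> g)"
  obtains q where "q \<subseteq> e" "q \<subseteq> g" "card q = 2"
  by (rule obtain_subset_with_card_n[OF assms]) blast

lemma dense_grow_step:
  assumes F: "F \<in> classes" and J: "J \<subseteq> F" "J \<noteq> {}" "J \<noteq> F" "dense J"
  obtains e g where "e \<in> J" "g \<in> F - J" "2 \<le> card (e \<inter> g)" "dense (insert g J)"
proof -
  obtain e g where eg: "e \<in> J" "g \<in> F - J" "2 \<le> card (e \<inter> g)" using class_expand[OF F J(1-3)] .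
  obtain q where q: "q \<subseteq> e" "q \<subseteq> g" "card q = 2" using pair_of_inter[OF eg(3)] .
  have "dense (insert g J)"
    by (rule dense_insert[OF J(4) _ _ _ q(2,3)]) (use eg q classesD(1)[OF F] in auto)
  thus ?thesis using that eg by blast
qed

text \<open>Edges are added one at a time, so every intermediate size is reached; this provides
  dense pieces of exactly the size that completes 8.\<close>

lemma dense_grow:
  assumes F: "F \<in> classes" and J: "J \<subseteq> F" "J \<noteq> {}" "dense J" and i: "card J \<le> i" "i \<le> card F"
  obtains K where "J \<subseteq> K" "K \<subseteq> F" "card K = i" "dense K"
proof -
  have "\<exists>K. J \<subseteq> K \<and> K \<subseteq> F \<and> card K = i \<and> dense K" using i
  proof (induction i rule: dec_induct)
    case base thus ?case using J by blast
  next
    case (step i)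
    then obtain K where K: "J \<subseteq> K" "K \<subseteq> F" "card K = i" "dense K" by auto
    have "K \<noteq> F" using K step.prems by auto
    moreover have "K \<noteq> {}" using K J by blast
    ultimately obtain e g where g: "g \<in> F - K" "dense (insert g K)" using dense_grow_step[OF F K(2) _ _ K(4)] by metis
    have "finite K" using K(2) classesD(2)[OF F] finite_subset by blast
    hence "card (insert g K) = Suc i" using g K by simp
    thus ?case using g K by blast
  qed
  thus ?thesis using that by blast
qed

text \<open>A larger class would pass through a dense set of exactly 8 edges while being built
  up.\<close>

lemma class_card: "F \<in> classes \<Longrightarrow> card F \<le> 7"
proof (rule ccontr)
  assume F: "F \<in> classes" and "\<not> card F \<le> 7"
  hence c: "8 \<le> card F" by simp
  obtain e where e: "e \<in> F" using classesD(3)[OF F] by blast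
  have "dense {e}" using dense_single e classesD(1)[OF F] by blast
  then obtain K where "card K = 8" "dense K" using dense_grow[OF F, of "{e}" 8] e c by auto
  thus False using dense_not8 by blast
qed

lemma class_dense: "F \<in> classes \<Longrightarrow> dense F"
proof -
  assume F: "F \<in> classes"
  obtain e where e: "e \<in> F" using classesD(3)[OF F] by blast
  have "dense {e}" using dense_single e classesD(1)[OF F] by blast
  moreover have "card {e} \<le> card F" using e classesD(2)[OF F] by (intro card_mono) auto
  ultimately obtain K where "K \<subseteq> F" "card K = card F" "dense K" using dense_grow[OF F, of "{e}" "card F"] e by auto
  thus "dense F" using card_subset_eq[OF classesD(2)[OF F]] by metis
qed

definition covered_pairs :: "'a set set \<Rightarrow> 'a set set" where
  "covered_pairs J = {p. card p = 2 \<and> (\<exists>e\<in>J. p \<subseteq> e)}"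

text \<open>Two adjacent edges leave these pairs without necessarily covering them; they are the
  candidates for uncovered pairs.\<close>

definition cross_pairs :: "'a set set \<Rightarrow> 'a set set" where
  "cross_pairs J = {p. \<exists>e\<in>J. \<exists>f\<in>J. e \<noteq> f \<and> 2 \<le> card (e \<inter> f) \<and> (\<exists>x\<in>e - f. \<exists>y\<in>f - e. p = {x, y})}"

text \<open>Two edges with three common vertices would be defective, where 8 mod 2 = 0 allows the
  empty set as the dense part.\<close>

lemma edge_ne_inter:
  assumes "e \<in> H" "f \<in> H" "e \<noteq> f" "2 \<le> card (e \<inter> f)"
  shows "dense {e, f}" "card {e, f} = 2" "card (e \<inter> f) = 2"
proof -
  obtain q where q: "q \<subseteq> e" "q \<subseteq> f" "card q = 2" using pair_of_inter[OF assms(4)] .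
  have d: "dense ({e} \<union> {f})"
    by (rule dense_merge[OF dense_single[OF assms(1)] dense_single[OF assms(2)] _ _ _ q(3)]) (use assms q in auto)
  thus "dense {e, f}" by (simp add: insert_commute)
  show c: "card {e, f} = 2" using assms by simp
  have "card (\<Union>{e} \<inter> \<Union>{f}) \<le> 2"
  proof (rule overlap_le_2[OF dense_single[OF assms(1)] dense_single[OF assms(2)] _ _ dense_empty])
    have c2: "card ({e} \<union> {f}) = 2" using assms(3) by simp
    show "card {} = 8 mod card ({e} \<union> {f})" "2 \<le> card ({e} \<union> {f})" "card ({e} \<union> {f}) \<le> 7"
      unfolding c2 by simp_all
  qed (use assms(3) in auto)
  thus "card (e \<inter> f) = 2" using assms by simp
qed

lemma finite_cov: "J \<subseteq> H \<Longrightarrow> finite (covered_pairs J)"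
  unfolding covered_pairs_def by (rule finite_subset[of _ "Pow (\<Union>J)"]) (use unif_finite_Union[OF unif_subset[OF uH]] in auto)

lemma cross_card2: "p \<in> cross_pairs J \<Longrightarrow> card p = 2"
  unfolding cross_pairs_def by (auto simp: card_2_iff)

lemma cross_sub: "p \<in> cross_pairs J \<Longrightarrow> p \<subseteq> \<Union>J"
  unfolding cross_pairs_def by auto

lemma finite_cross: "J \<subseteq> H \<Longrightarrow> finite (cross_pairs J)"
  by (rule finite_subset[of _ "Pow (\<Union>J)"]) (use unif_finite_Union[OF unif_subset[OF uH]] cross_sub in blast)+

lemma cross_mono: "J \<subseteq> K \<Longrightarrow> cross_pairs J \<subseteq> cross_pairs K"
  unfolding cross_pairs_def by blast

text \<open>
  A class is assembled edge by edge, each new edge meeting the earlier ones in exactly one pair,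
  which is already covered_open. So every step repeats one covered_open pair, and creates
  \<open>(r - 2)\<^sup>2\<close> cross_pairs pairs that no edge of the class ever covers.
\<close>

lemma class_counts:
  assumes F: "F \<in> classes"
  shows "card F * (r choose 2) \<le> card (covered_pairs F) + (card F - 1)"
    "(card F - 1) * (r - 2)\<^sup>2 \<le> card (cross_pairs F - covered_pairs F)"
proof -
  define \<rho> where "\<rho> = r choose 2"
  obtain e0 where e0: "e0 \<in> F" using classesD(3)[OF F] by blast
  have FH: "F \<subseteq> H" and finF: "finite F" using classesD[OF F] by auto
  have pairs: "card {p. p \<subseteq> g \<and> card p = 2} = \<rho>" if "g \<in> H" for g
    using n_subsets[OF edge(1)[OF that], of 2] edge(2)[OF that] unfolding \<rho>_def by simp
  \<comment> \<open>Dense subsets of sizes 2 and 3 are carried along because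
    \<open>overlap_le_2\<close> asks for one of size 8 mod i inside the enlarged set.\<close>
  have "\<exists>J X. J \<subseteq> F \<and> J \<noteq> {} \<and> card J = i \<and> dense J \<and> i * \<rho> \<le> card (covered_pairs J) + (i - 1) \<and> X \<subseteq> cross_pairs J \<and> X \<inter> covered_pairs J = {} \<and>
      card X = (i - 1) * (r - 2)\<^sup>2 \<and> (3 \<le> i \<longrightarrow> (\<exists>T\<subseteq>J. card T = 3 \<and> dense T)) \<and> (2 \<le> i \<longrightarrow> (\<exists>T\<subseteq>J. card T = 2 \<and> dense T))"
    if "1 \<le> i" "i \<le> card F" for i
    using that
  proof (induction i rule: dec_induct)
    case base
    have "covered_pairs {e0} = {p. p \<subseteq> e0 \<and> card p = 2}" unfolding covered_pairs_def by auto
    thus ?case using pairs[of e0] e0 FH dense_single[of e0] by (intro exI[of _ "{e0}"] exI[of _ "{}"]) auto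
  next
    case (step i)
    then obtain J X where J: "J \<subseteq> F" "J \<noteq> {}" "card J = i" "dense J" "i * \<rho> \<le> card (covered_pairs J) + (i - 1)" "X \<subseteq> cross_pairs J" "X \<inter> covered_pairs J = {}"
      "card X = (i - 1) * (r - 2)\<^sup>2" "3 \<le> i \<longrightarrow> (\<exists>T\<subseteq>J. card T = 3 \<and> dense T)" "2 \<le> i \<longrightarrow> (\<exists>T\<subseteq>J. card T = 2 \<and> dense T)" by auto
    have finJ: "finite J" using J(1) finF finite_subset by blast
    have JF: "J \<noteq> F" using J step.prems by auto
    obtain e g where eg: "e \<in> J" "g \<in> F - J" "2 \<le> card (e \<inter> g)" "dense (insert g J)"
      using dense_grow_step[OF F J(1,2) JF J(4)] .
    have eH: "e \<in> H" and gH: "g \<in> H" and JH: "J \<subseteq> H" using eg J FH by auto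
    have "e \<noteq> g" using eg by blast
    note eg2 = edge_ne_inter[OF eH gH this eg(3)]
    have card': "card (insert g J) = Suc i" using eg finJ J by simp
    have i7: "Suc i \<le> 7" using step.prems class_card[OF F] by simp
    have T2: "\<exists>T\<subseteq>insert g J. card T = 2 \<and> dense T" using eg2 eg by (intro exI[of _ "{e, g}"]) auto
    have T3: "\<exists>T\<subseteq>insert g J. card T = 3 \<and> dense T" if "3 \<le> Suc i"
    proof (cases "3 \<le> i")
      case True thus ?thesis using J(9) by blast
    next
      case False
      hence "Suc i = 3" using that by simp
      thus ?thesis using eg(4) card' by (intro exI[of _ "insert g J"]) auto
    qed
    obtain e' where e': "e' \<in> J" using J by blast
    \<comment> \<open>The residues 8 mod k for k = 2, ..., 7 are 0, 2, 0, 3, 2, 1.\<close>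
    have A: "\<exists>A\<subseteq>J \<union> {g}. dense A \<and> card A = 8 mod Suc i"
    proof -
      define k where "k = Suc i"
      have "k = 2 \<or> k = 3 \<or> k = 4 \<or> k = 5 \<or> k = 6 \<or> k = 7" using i7 step(1) unfolding k_def by linarith
      moreover have "\<exists>A\<subseteq>J \<union> {g}. dense A \<and> card A = 0" using dense_empty by (intro exI[of _ "{}"]) auto
      moreover have "\<exists>A\<subseteq>J \<union> {g}. dense A \<and> card A = 1" using dense_single[OF eH] eg by (intro exI[of _ "{e}"]) auto
      moreover have "\<exists>A\<subseteq>J \<union> {g}. dense A \<and> card A = 2" using T2 by auto
      moreover have "\<exists>A\<subseteq>J \<union> {g}. dense A \<and> card A = 3" if "k = 5" using T3 that unfolding k_def by auto
      ultimately show ?thesis unfolding k_def[symmetric] by (elim disjE) simp_all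
    qed
    then obtain A where A: "A \<subseteq> J \<union> {g}" "dense A" "card A = 8 mod Suc i" by blast
    have cJg: "card (J \<union> {g}) = Suc i" using card' by simp
    have ov: "card (\<Union>J \<inter> \<Union>{g}) \<le> 2"
      by (rule overlap_le_2[OF J(4) dense_single[OF gH] _ A(1,2)]) (use A cJg i7 eg step in auto)
    define q where "q = e \<inter> g"
    have q: "card q = 2" "q \<subseteq> e" "q \<subseteq> g" using eg2 unfolding q_def by auto
    have finJU: "finite (\<Union>J)" using denseD(4)[OF J(4)] .
    \<comment> \<open>The new edge meets the earlier ones exactly in \<open>q\<close>, so at most
      the one pair \<open>q\<close> is covered again.\<close>
    have qeq: "\<Union>J \<inter> g = q"
    proof -
      have "q \<subseteq> \<Union>J \<inter> g" using q eg by blast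
      moreover have "card (\<Union>J \<inter> g) \<le> card q" using ov q by simp
      ultimately show ?thesis using finJU card_seteq[of "\<Union>J \<inter> g" q] by auto
    qed
    define P where "P = {p. p \<subseteq> g \<and> card p = 2}"
    have covU: "covered_pairs (insert g J) = covered_pairs J \<union> P" unfolding covered_pairs_def P_def by auto
    have finP: "finite P" unfolding P_def by (rule finite_subset[of _ "Pow g"]) (use edge(1)[OF gH] in auto)
    have inter: "covered_pairs J \<inter> P \<subseteq> {q}"
    proof
      fix p assume "p \<in> covered_pairs J \<inter> P"
      hence "p \<subseteq> \<Union>J \<inter> g" "card p = 2" unfolding covered_pairs_def P_def by auto
      hence "p \<subseteq> q" "card p = card q" using qeq q by auto
      moreover have "finite q" using q(2) edge(1)[OF eH] finite_subset by blast
      ultimately show "p \<in> {q}" using card_subset_eq by blast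
    qed
    have "card (covered_pairs J \<union> P) + card (covered_pairs J \<inter> P) = card (covered_pairs J) + card P"
      by (rule card_Un_Int[symmetric]) (use finite_cov[OF JH] finP in auto)
    moreover have "card (covered_pairs J \<inter> P) \<le> 1" using card_mono[OF _ inter] by simp
    moreover have "card P = \<rho>" unfolding P_def by (rule pairs[OF gH])
    ultimately have cc: "Suc i * \<rho> \<le> card (covered_pairs (insert g J)) + (Suc i - 1)"
      using J(5) step unfolding covU by simp
    \<comment> \<open>A vertex of \<open>g\<close> outside \<open>q\<close> is new. Hence these
      pairs are covered by no edge of the enlarged set and differ from all earlier cross
      pairs.\<close>
    define Y where "Y = (\<lambda>(x, y). {x, y}) ` ((e - q) \<times> (g - q))"
    have fq: "finite q" using q(2) edge(1)[OF eH] finite_subset by blast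
    have out: "x \<notin> g" if "x \<in> e - q" for x using that unfolding q_def by blast
    have out2: "y \<notin> \<Union>J" if "y \<in> g - q" for y using that qeq by blast
    have injY: "inj_on (\<lambda>(x, y). {x, y}) ((e - q) \<times> (g - q))"
    proof (rule inj_onI)
      fix a b assume ab: "a \<in> (e - q) \<times> (g - q)" "b \<in> (e - q) \<times> (g - q)" "(case a of (x, y) \<Rightarrow> {x, y}) = (case b of (x, y) \<Rightarrow> {x, y})"
      obtain x y where a: "a = (x, y)" by force
      obtain x' y' where b: "b = (x', y')" by force
      have "{x, y} = {x', y'}" "x \<notin> g" "x' \<notin> g" "y \<in> g" "y' \<in> g" using ab a b out by auto
      thus "a = b" unfolding a b by (auto simp: doubleton_eq_iff)
    qed
    have cY: "card Y = (r - 2)\<^sup>2"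
    proof -
      have "card (e - q) = r - 2" "card (g - q) = r - 2"
        using card_Diff_subset[OF fq q(2)] card_Diff_subset[OF fq q(3)] edge(2)[OF eH] edge(2)[OF gH] q(1) by auto
      thus ?thesis unfolding Y_def card_image[OF injY] by (simp add: card_cartesian_product power2_eq_square)
    qed
    have Ycross: "Y \<subseteq> cross_pairs (insert g J)"
    proof
      fix p assume "p \<in> Y"
      then obtain x y where xy: "x \<in> e - q" "y \<in> g - q" "p = {x, y}" unfolding Y_def by blast
      have "x \<in> e - g" "y \<in> g - e" using xy unfolding q_def by auto
      thus "p \<in> cross_pairs (insert g J)" unfolding cross_pairs_def using xy(3) eg(1,3) \<open>e \<noteq> g\<close> by blast
    qed
    have Yx: "\<exists>x y. x \<notin> g \<and> y \<notin> \<Union>J \<and> p = {x, y}" if "p \<in> Y" for p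
      using that out out2 unfolding Y_def by blast
    have Ycov: "Y \<inter> covered_pairs (insert g J) = {}"
    proof (rule ccontr)
      assume "Y \<inter> covered_pairs (insert g J) \<noteq> {}"
      then obtain p where p: "p \<in> Y" "p \<in> covered_pairs (insert g J)" by blast
      then obtain x y where xy: "x \<notin> g" "y \<notin> \<Union>J" "p = {x, y}" using Yx by blast
      show False using p(2) xy unfolding covered_pairs_def by auto
    qed
    have XY: "X \<inter> Y = {}"
    proof (rule ccontr)
      assume "X \<inter> Y \<noteq> {}"
      then obtain p where p: "p \<in> X" "p \<in> Y" by blast
      then obtain x y where xy: "y \<notin> \<Union>J" "p = {x, y}" using Yx by blast
      show False using cross_sub[of p J] p J(6) xy by blast
    qed
    have Xcov: "X \<inter> covered_pairs (insert g J) = {}"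
    proof (rule ccontr)
      assume "X \<inter> covered_pairs (insert g J) \<noteq> {}"
      then obtain p where p: "p \<in> X" "p \<in> P" using J(7) unfolding covU by blast
      have "p \<subseteq> \<Union>J \<inter> g" using p J(6) cross_sub[of p J] unfolding P_def by blast
      hence "p \<subseteq> q" using qeq by simp
      moreover have "card p = 2" using p(2) unfolding P_def by simp
      ultimately have "p \<in> covered_pairs J" unfolding covered_pairs_def using q(2) eg(1) by blast
      thus False using p(1) J(7) by blast
    qed
    have finX: "finite X" "finite Y"
      using finite_subset[OF J(6) finite_cross[OF JH]] finite_subset[OF Ycross finite_cross] JH gH by auto
    have "card (X \<union> Y) = card X + card Y" using finX XY by (rule card_Un_disjoint)
    also have "\<dots> = (i - 1) * (r - 2)\<^sup>2 + (r - 2)\<^sup>2" using J(8) cY by simp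
    also have "\<dots> = (Suc i - 1) * (r - 2)\<^sup>2" using step(1) by (cases i) auto
    finally have cXY: "card (X \<union> Y) = (Suc i - 1) * (r - 2)\<^sup>2" .
    have X1: "X \<union> Y \<subseteq> cross_pairs (insert g J)" using J(6) cross_mono[of J "insert g J"] Ycross by blast
    have X2: "(X \<union> Y) \<inter> covered_pairs (insert g J) = {}" using Xcov Ycov by blast
    have sub: "insert g J \<subseteq> F" "insert g J \<noteq> {}" using eg J by auto
    show ?case using sub card' eg(4) cc X1 X2 cXY T2 T3 by blast
  qed
  from this[of "card F"] obtain J X where J: "J \<subseteq> F" "card J = card F" "card F * \<rho> \<le> card (covered_pairs J) + (card F - 1)" "X \<subseteq> cross_pairs J" "X \<inter> covered_pairs J = {}"
      "card X = (card F - 1) * (r - 2)\<^sup>2"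
    using finF classesD(3)[OF F] by (auto simp: Suc_leI card_gt_0_iff)
  have "J = F" using card_subset_eq[OF finF J(1,2)] .
  thus "card F * (r choose 2) \<le> card (covered_pairs F) + (card F - 1)" using J(3) unfolding \<rho>_def by simp
  have "X \<subseteq> cross_pairs F - covered_pairs F" using J(4,5) \<open>J = F\<close> by blast
  thus "(card F - 1) * (r - 2)\<^sup>2 \<le> card (cross_pairs F - covered_pairs F)"
    using card_mono[of "cross_pairs F - covered_pairs F" X] finite_cross[OF FH] J(6) by simp
qed

section \<open>Claims on uncovered pairs\<close>

text \<open>The contrapositive of \<open>overlap_le_2\<close> with the residues evaluated: only
  residues 2 and 3 need a witness, since a dense set of size 0 or 1 is always at hand.\<close>

lemma overlap3:
  assumes "dense J" "dense K" "J \<inter> K = {}" "2 \<le> card (J \<union> K)" "card (J \<union> K) \<le> 7"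
    "card (J \<union> K) = 3 \<or> card (J \<union> K) = 6 \<Longrightarrow> \<exists>A\<subseteq>J \<union> K. dense A \<and> card A = 2"
    "card (J \<union> K) = 5 \<Longrightarrow> \<exists>A\<subseteq>J \<union> K. dense A \<and> card A = 3"
    "3 \<le> card (\<Union>J \<inter> \<Union>K)"
  shows False
proof -
  define k where "k = card (J \<union> K)"
  have "J \<union> K \<noteq> {}" using assms(4) by auto
  then obtain e where e: "e \<in> J \<union> K" by blast
  have "e \<in> H" using e denseD(1)[OF assms(1)] denseD(1)[OF assms(2)] by blast
  hence "\<exists>A\<subseteq>J \<union> K. dense A \<and> card A = 1" using dense_single e by (intro exI[of _ "{e}"]) auto
  moreover have "\<exists>A\<subseteq>J \<union> K. dense A \<and> card A = 0" using dense_empty by (intro exI[of _ "{}"]) auto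
  moreover have "k = 2 \<or> k = 3 \<or> k = 4 \<or> k = 5 \<or> k = 6 \<or> k = 7" using assms(4,5) unfolding k_def by linarith
  ultimately have "\<exists>A\<subseteq>J \<union> K. dense A \<and> card A = 8 mod k"
    using assms(6,7) unfolding k_def[symmetric] by (elim disjE) simp_all
  then obtain A where A: "A \<subseteq> J \<union> K" "dense A" "card A = 8 mod card (J \<union> K)" unfolding k_def by blast
  from overlap_le_2[OF assms(1-3) A assms(4,5)] assms(8) show False by simp
qed

lemma class_dense_subset:
  assumes "F \<in> classes" "i \<le> card F"
  shows "\<exists>A\<subseteq>F. dense A \<and> card A = i"
proof (cases "i = 0")
  case True
  thus ?thesis using dense_empty by (intro exI[of _ "{}"]) auto
next
  case False
  obtain e where e: "e \<in> F" using classesD(3)[OF assms(1)] by blast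
  have "dense {e}" using dense_single e classesD(1)[OF assms(1)] by blast
  thus ?thesis using dense_grow[OF assms(1), of "{e}" i] e assms(2) False by auto
qed

lemma dense_attach:
  assumes "dense J" "finite S" "S \<subseteq> H" "S \<inter> J = {}" "\<And>g. g \<in> S \<Longrightarrow> \<exists>q\<subseteq>g. card q = 2 \<and> q \<subseteq> \<Union>J"
  shows "dense (J \<union> S)"
  using assms(2-5)
proof (induction S rule: finite_induct)
  case empty thus ?case using assms(1) by simp
next
  case (insert g S)
  obtain q where q: "q \<subseteq> g" "card q = 2" "q \<subseteq> \<Union>J" using insert.prems(3)[of g] by blast
  have "dense (J \<union> S)" using insert by auto
  hence "dense (insert g (J \<union> S))" by (rule dense_insert[OF _ _ _ _ q(1,2)]) (use insert q in auto)
  thus ?case by simp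
qed

text \<open>Otherwise some of the edges of \<open>S\<close> would complete \<open>J\<close> to a
  dense set of exactly 8.\<close>

lemma dense_attach_card:
  assumes "dense J" "card J \<le> 7" "finite S" "S \<subseteq> H" "S \<inter> J = {}" "\<And>g. g \<in> S \<Longrightarrow> \<exists>q\<subseteq>g. card q = 2 \<and> q \<subseteq> \<Union>J"
  shows "card J + card S \<le> 7"
proof (rule ccontr)
  assume "\<not> card J + card S \<le> 7"
  hence le: "8 - card J \<le> card S" by simp
  obtain T where T: "T \<subseteq> S" "card T = 8 - card J" "finite T" by (rule obtain_subset_with_card_n[OF le])
  have "dense (J \<union> T)" by (rule dense_attach[OF assms(1) T(3)]) (use T assms in auto)
  moreover have "card (J \<union> T) = 8"
  proof -
    have "J \<inter> T = {}" using T assms(5) by blast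
    thus ?thesis using card_Un_disjoint[OF denseD(3)[OF assms(1)] T(3)] T assms(2) by simp
  qed
  ultimately show False using dense_not8 by blast
qed

text \<open>
  The uncovered pairs that pay for a class \<open>F\<close> are looked for among its cross pairs.
\<close>

definition open_pairs :: "'a set set \<Rightarrow> 'a set set" where "open_pairs F = cross_pairs F - covered_pairs F"
definition covered_open :: "'a set set \<Rightarrow> 'a set set" where "covered_open F = open_pairs F \<inter> covered_pairs H"
definition free_open :: "'a set set \<Rightarrow> 'a set set" where "free_open F = open_pairs F - covered_pairs H"
text \<open>A choice, meaningful only for pairs covered in \<open>H\<close>. For a pair in
  \<open>covered_open F\<close> the chosen edge lies outside \<open>F\<close>.\<close>

definition covering_edge :: "'a set \<Rightarrow> 'a set" where "covering_edge p = (SOME g. g \<in> H \<and> p \<subseteq> g)"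

lemma Q_card2: "q \<in> open_pairs F \<Longrightarrow> card q = 2" unfolding open_pairs_def using cross_card2 by blast
lemma Q_sub: "q \<in> open_pairs F \<Longrightarrow> q \<subseteq> \<Union>F" unfolding open_pairs_def using cross_sub by blast
lemma finite_Q: "F \<in> classes \<Longrightarrow> finite (open_pairs F)" unfolding open_pairs_def using finite_cross classesD(1) by blast

text \<open>The two adjacent edges behind an open pair, called a diamond below: a dense set of size
  2 whose vertices contain the pair.\<close>

lemma Q_diamond:
  assumes "F \<in> classes" "q \<in> open_pairs F"
  obtains e f x y where "e \<in> F" "f \<in> F" "e \<noteq> f" "2 \<le> card (e \<inter> f)" "x \<in> e - f" "y \<in> f - e" "q = {x, y}"
    "dense {e, f}" "card {e, f} = 2" "q \<subseteq> \<Union>{e, f}"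
proof -
  obtain e f x y where *: "e \<in> F" "f \<in> F" "e \<noteq> f" "2 \<le> card (e \<inter> f)" "x \<in> e - f" "y \<in> f - e" "q = {x, y}"
    using assms(2) unfolding open_pairs_def cross_pairs_def by blast
  have "e \<in> H" "f \<in> H" using * classesD(1)[OF assms(1)] by blast+
  from edge_ne_inter[OF this *(3,4)] have "dense {e, f}" "card {e, f} = 2" by auto
  moreover have "q \<subseteq> \<Union>{e, f}" using * by auto
  ultimately show ?thesis using that * by blast
qed

lemma Q_diamond':
  assumes "F \<in> classes" "q \<in> open_pairs F"
  obtains D where "D \<subseteq> F" "dense D" "card D = 2" "q \<subseteq> \<Union>D"
proof -
  obtain e f x y where *: "e \<in> F" "f \<in> F" "e \<noteq> f" "2 \<le> card (e \<inter> f)" "x \<in> e - f" "y \<in> f - e" "q = {x, y}"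
    "dense {e, f}" "card {e, f} = 2" "q \<subseteq> \<Union>{e, f}" using Q_diamond[OF assms] .
  have "{e, f} \<subseteq> F" using * by simp
  thus ?thesis using that * by blast
qed

lemma Q_card_ge2: "F \<in> classes \<Longrightarrow> q \<in> open_pairs F \<Longrightarrow> 2 \<le> card F"
proof -
  assume F: "F \<in> classes" "q \<in> open_pairs F"
  obtain D where "D \<subseteq> F" "dense D" "card D = 2" "q \<subseteq> \<Union>D" using Q_diamond'[OF F] .
  thus ?thesis using card_mono[OF classesD(2)[OF F(1)], of D] by simp
qed

lemma covering_edge:
  assumes "F \<in> classes" "a \<in> covered_open F"
  shows "covering_edge a \<in> H" "a \<subseteq> covering_edge a" "covering_edge a \<notin> F"
proof -
  have "\<exists>g. g \<in> H \<and> a \<subseteq> g" using assms(2) unfolding covered_open_def covered_pairs_def by auto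
  from someI_ex[OF this] show g: "covering_edge a \<in> H" "a \<subseteq> covering_edge a" unfolding covering_edge_def by auto
  have "card a = 2" "a \<notin> covered_pairs F" using assms(2) Q_card2 unfolding covered_open_def open_pairs_def by auto
  thus "covering_edge a \<notin> F" using g unfolding covered_pairs_def by blast
qed

text \<open>Two different pairs would give \<open>F\<close> and \<open>g\<close> three common
  vertices. The union has at most 7 edges, because with 7 edges in \<open>F\<close> it would be a
  dense set of 8.\<close>

lemma outside_overlap:
  assumes F: "F \<in> classes" "2 \<le> card F" and g: "g \<in> H" "g \<notin> F" and q: "q \<subseteq> \<Union>F" "q' \<subseteq> \<Union>F" "q \<subseteq> g" "q' \<subseteq> g" "card q = 2" "card q' = 2"
  shows "q = q'"
proof (rule ccontr)
  assume ne: "q \<noteq> q'"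
  note dF = class_dense[OF F(1)]
  have c: "card (F \<union> {g}) = Suc (card F)" using g classesD(2)[OF F(1)] by simp
  have d: "dense (F \<union> {g})" using dense_insert[OF dF g q(1,3,5)] by simp
  have "card F \<noteq> 7" using dense_not8[OF d] c by auto
  hence c6: "card F \<le> 6" using class_card[OF F(1)] by simp
  have "3 \<le> card (\<Union>F \<inter> \<Union>{g})" using three_common[OF q(1) _ q(2) _ q(5,6) ne denseD(4)[OF dF], of g] q by simp
  moreover have "\<exists>A\<subseteq>F \<union> {g}. dense A \<and> card A = 2" using class_dense_subset[OF F(1), of 2] F(2) by blast
  moreover have "\<exists>A\<subseteq>F \<union> {g}. dense A \<and> card A = 3" if "card (F \<union> {g}) = 5"
    using class_dense_subset[OF F(1), of 3] that c by auto
  ultimately show False using overlap3[OF dF dense_single[OF g(1)]] g(2) c c6 F(2) by auto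
qed

lemma gam_inj:
  assumes F: "F \<in> classes"
  shows "inj_on covering_edge (covered_open F)"
proof (rule inj_onI)
  fix a b assume ab: "a \<in> covered_open F" "b \<in> covered_open F" "covering_edge a = covering_edge b"
  have open_pairs: "a \<in> open_pairs F" "b \<in> open_pairs F" using ab unfolding covered_open_def by auto
  show "a = b"
    by (rule outside_overlap[OF F Q_card_ge2[OF F open_pairs(1)] covering_edge(1,3)[OF F ab(1)] Q_sub[OF open_pairs(1)] Q_sub[OF open_pairs(2)]])
       (use covering_edge(2)[OF F ab(1)] covering_edge(2)[OF F ab(2)] ab(3) Q_card2 open_pairs in auto)
qed

text \<open>The covering edges are distinct by \<open>gam_inj\<close> and each hangs on
  \<open>F\<close> along a pair. So a class of m edges with c covered open pairs satisfies m + c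
  \<le> 7: a class cannot lose many open pairs to other edges.\<close>

lemma star_dense:
  assumes F: "F \<in> classes" and A: "A \<subseteq> covered_open F"
  shows "dense (F \<union> covering_edge ` A)" "card (F \<union> covering_edge ` A) = card F + card A" "F \<inter> covering_edge ` A = {}" "card F + card A \<le> 7" "covering_edge ` A \<subseteq> H"
proof -
  have fin: "finite A" using A finite_Q[OF F] finite_subset unfolding covered_open_def by blast
  show sub: "covering_edge ` A \<subseteq> H" using covering_edge(1)[OF F] A by blast
  show disj: "F \<inter> covering_edge ` A = {}" using covering_edge(3)[OF F] A by blast
  have pair: "\<exists>q\<subseteq>g. card q = 2 \<and> q \<subseteq> \<Union>F" if g: "g \<in> covering_edge ` A" for g
  proof -
    obtain a where a: "a \<in> covered_open F" "g = covering_edge a" using g A by blast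
    have "a \<in> open_pairs F" using a unfolding covered_open_def by simp
    from covering_edge(2)[OF F a(1)] Q_card2[OF this] Q_sub[OF this] show ?thesis unfolding a(2) by (intro exI[of _ a]) simp
  qed
  show "dense (F \<union> covering_edge ` A)" by (rule dense_attach[OF class_dense[OF F] _ sub _ pair]) (use fin disj in auto)
  have ci: "card (covering_edge ` A) = card A" using card_image[OF inj_on_subset[OF gam_inj[OF F] A]] .
  show "card (F \<union> covering_edge ` A) = card F + card A"
    using card_Un_disjoint[OF classesD(2)[OF F] _ disj] fin ci by simp
  have "card F + card (covering_edge ` A) \<le> 7"
    by (rule dense_attach_card[OF class_dense[OF F] class_card[OF F] _ sub _ pair]) (use fin disj in auto)
  thus "card F + card A \<le> 7" using ci by simp
qed

text \<open>Here r \<ge> 4 enters, through (r - 2)^2 \<ge> 4.\<close>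

lemma Q_count: "F \<in> classes \<Longrightarrow> 4 * (card F - 1) \<le> card (open_pairs F)"
proof -
  assume F: "F \<in> classes"
  have "2 \<le> r - 2" using r4 by simp
  hence "2\<^sup>2 \<le> (r - 2)\<^sup>2" by (intro power_mono) auto
  hence "(card F - 1) * 4 \<le> (card F - 1) * (r - 2)\<^sup>2" by (intro mult_le_mono) auto
  also have "\<dots> \<le> card (open_pairs F)" unfolding open_pairs_def by (rule class_counts(2)[OF F])
  finally show ?thesis by simp
qed

lemma free_covered_card: "F \<in> classes \<Longrightarrow> card (open_pairs F) = card (free_open F) + card (covered_open F)"
proof -
  assume F: "F \<in> classes"
  have "open_pairs F = free_open F \<union> covered_open F" "free_open F \<inter> covered_open F = {}" unfolding free_open_def covered_open_def by auto
  thus ?thesis using card_Un_disjoint[of "free_open F" "covered_open F"] finite_Q[OF F] by (metis finite_Un)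
qed

lemma classes_dense_disjoint:
  "F \<in> classes \<Longrightarrow> F' \<in> classes \<Longrightarrow> F \<noteq> F' \<Longrightarrow> J \<subseteq> F \<Longrightarrow> J' \<subseteq> F' \<Longrightarrow> J \<inter> J' = {}"
  using classes_disjoint by blast

lemma dense_union_8:
  assumes "dense J" "dense K" "J \<inter> K = {}" "q \<subseteq> \<Union>J" "q \<subseteq> \<Union>K" "card q = 2" "card J + card K = 8"
  shows False
proof -
  have "dense (J \<union> K)" by (rule dense_merge[OF assms(1-6)])
  moreover have "card (J \<union> K) = 8"
    using card_Un_disjoint[OF denseD(3)[OF assms(1)] denseD(3)[OF assms(2)] assms(3)] assms(7) by simp
  ultimately show False using dense_not8 by blast
qed

text \<open>At most 5 + 2 edges with three common vertices. The diamond \<open>D\<close> serves the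
  residue 2; if the union has 5 edges, \<open>F\<close> has 3 and serves the residue 3.\<close>

lemma class_diamond_two_pairs:
  assumes F: "F \<in> classes" "2 \<le> card F" "card F \<le> 5" and F': "F' \<in> classes" "F' \<noteq> F" and D: "D \<subseteq> F'" "dense D" "card D = 2"
    and q: "q \<subseteq> \<Union>F" "q \<subseteq> \<Union>D" "q' \<subseteq> \<Union>F" "q' \<subseteq> \<Union>D" "card q = 2" "card q' = 2" "q \<noteq> q'"
  shows False
proof -
  note dF = class_dense[OF F(1)]
  have disj: "F \<inter> D = {}" using classes_disjoint[OF F(1) F'(1)] F'(2) D(1) by blast
  have c: "card (F \<union> D) = card F + 2" using card_Un_disjoint[OF classesD(2)[OF F(1)] denseD(3)[OF D(2)] disj] D(3) by simp
  have "3 \<le> card (\<Union>F \<inter> \<Union>D)" by (rule three_common[OF q denseD(4)[OF dF]])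
  moreover have "\<exists>A\<subseteq>F \<union> D. dense A \<and> card A = 2" using D by blast
  moreover have "\<exists>A\<subseteq>F \<union> D. dense A \<and> card A = 3" if "card (F \<union> D) = 5" using dF c that by (intro exI[of _ F]) auto
  ultimately show False using overlap3[OF dF D(2) disj] c F by auto
qed

text \<open>If \<open>F'\<close> has at most 5 edges the union is small enough for
  \<open>overlap3\<close>. A larger \<open>F'\<close> contains a dense set of six edges around
  \<open>D\<close>, and 6 + 2 = 8.\<close>

lemma two_classes_two_pairs:
  assumes F: "F \<in> classes" "card F = 2" and F': "F' \<in> classes" "F' \<noteq> F" and D: "D \<subseteq> F'" "dense D" "card D = 2" "q \<subseteq> \<Union>D"
    and q: "q \<subseteq> \<Union>F" "q' \<subseteq> \<Union>F" "q' \<subseteq> \<Union>F'" "card q = 2" "card q' = 2" "q \<noteq> q'"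
  shows False
proof -
  note dF = class_dense[OF F(1)] and dF' = class_dense[OF F'(1)]
  have disj: "F \<inter> F' = {}" using classes_disjoint[OF F(1) F'(1)] F'(2) by blast
  have c: "card (F \<union> F') = card F' + 2"
    using card_Un_disjoint[OF classesD(2)[OF F(1)] classesD(2)[OF F'(1)] disj] F(2) by simp
  have qF': "q \<subseteq> \<Union>F'" using D by blast
  have o3: "3 \<le> card (\<Union>F \<inter> \<Union>F')" by (rule three_common[OF q(1) qF' q(2,3,4,5,6) denseD(4)[OF dF]])
  have c2: "2 \<le> card F'" using card_mono[OF classesD(2)[OF F'(1)] D(1)] D(3) by simp
  consider "card F' \<le> 5" | "card F' = 6 \<or> card F' = 7" using class_card[OF F'(1)] by linarith
  thus False
  proof cases
    case 1
    have "\<exists>A\<subseteq>F \<union> F'. dense A \<and> card A = 2" using dF F(2) by (intro exI[of _ F]) auto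
    moreover have "\<exists>A\<subseteq>F \<union> F'. dense A \<and> card A = 3" if "card (F \<union> F') = 5" using dF' c that by (intro exI[of _ F']) auto
    ultimately show False using overlap3[OF dF dF' disj] c 1 c2 o3 by auto
  next
    case 2
    have D0: "D \<noteq> {}" using D(3) by auto
    have "card D \<le> 6" "6 \<le> card F'" using D(3) 2 by auto
    then obtain J where J: "D \<subseteq> J" "J \<subseteq> F'" "card J = 6" "dense J" using dense_grow[OF F'(1) D(1) D0 D(2)] by metis
    have "F \<inter> J = {}" using disj J(2) by blast
    moreover have "q \<subseteq> \<Union>J" using D(4) J(1) by blast
    ultimately show False using dense_union_8[OF dF J(4) _ q(1) _ q(4)] F(2) J(3) by simp
  qed
qed

text \<open>Otherwise \<open>F\<close> and \<open>F'\<close> would share two different pairs, the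
  free pair \<open>q\<close> and the covered pair \<open>a\<close>.\<close>

lemma gam_not_in_class:
  assumes F: "F \<in> classes" "card F = 2" and F': "F' \<in> classes" "F' \<noteq> F" and q: "q \<in> free_open F" "q \<in> open_pairs F'" and a: "a \<in> covered_open F"
  shows "covering_edge a \<notin> F'"
proof
  assume g: "covering_edge a \<in> F'"
  obtain D where D: "D \<subseteq> F'" "dense D" "card D = 2" "q \<subseteq> \<Union>D" using Q_diamond'[OF F'(1) q(2)] .
  have aQ: "a \<in> open_pairs F" "a \<in> covered_pairs H" using a unfolding covered_open_def by auto
  have qQ: "q \<in> open_pairs F" "q \<notin> covered_pairs H" using q unfolding free_open_def by auto
  have "q \<noteq> a" using aQ qQ by blast
  moreover have "a \<subseteq> \<Union>F'" using covering_edge(2)[OF F(1) a] g by blast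
  ultimately show False
    using two_classes_two_pairs[OF F F' D Q_sub[OF qQ(1)] Q_sub[OF aQ(1)]] Q_card2[OF qQ(1)] Q_card2[OF aQ(1)] by blast
qed

section \<open>Classes that claim a common pair\<close>

definition claimers :: "'a set \<Rightarrow> 'a set set set" where
  "claimers q = {F \<in> classes. q \<in> open_pairs F}"

lemma finite_classes: "finite classes" unfolding classes_def using finH by simp

lemma finite_claimers: "finite (claimers q)" unfolding claimers_def using finite_classes by simp

lemma dense_UN_common:
  assumes "finite I" "I \<noteq> {}" "\<And>i. i \<in> I \<Longrightarrow> dense (D i) \<and> q \<subseteq> \<Union>(D i)" "card q = 2"
    "\<And>i j. i \<in> I \<Longrightarrow> j \<in> I \<Longrightarrow> i \<noteq> j \<Longrightarrow> D i \<inter> D j = {}"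
  shows "dense (\<Union>i\<in>I. D i)"
  using assms(1,2,3,5)
proof (induction I rule: finite_ne_induct)
  case (singleton i) thus ?case by simp
next
  case (insert i I)
  have "dense (\<Union>i\<in>I. D i)" using insert by auto
  moreover have "D i \<inter> (\<Union>i\<in>I. D i) = {}"
  proof -
    have "D i \<inter> D j = {}" if "j \<in> I" for j using insert.prems(2)[of i j] insert.hyps that by auto
    thus ?thesis by blast
  qed
  moreover have "q \<subseteq> \<Union>(\<Union>i\<in>I. D i)"
  proof -
    obtain j where "j \<in> I" using insert.hyps by blast
    hence "q \<subseteq> \<Union>(D j)" using insert.prems(1)[of j] by simp
    thus ?thesis using \<open>j \<in> I\<close> by blast
  qed
  ultimately have "dense (D i \<union> (\<Union>i\<in>I. D i))" using dense_merge[of "D i" "\<Union>i\<in>I. D i" q] insert.prems(1)[of i] assms(4) by auto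
  thus ?case by simp
qed

text \<open>Four classes would contribute four disjoint diamonds through \<open>q\<close>, a dense
  set of 4 * 2 edges.\<close>

lemma card_claimers: "card (claimers q) \<le> 3"
proof (rule ccontr)
  assume "\<not> card (claimers q) \<le> 3"
  hence le: "4 \<le> card (claimers q)" by simp
  obtain I where I: "I \<subseteq> claimers q" "card I = 4" "finite I" by (rule obtain_subset_with_card_n[OF le])
  have "\<forall>F\<in>I. \<exists>D. D \<subseteq> F \<and> dense D \<and> card D = 2 \<and> q \<subseteq> \<Union>D"
  proof
    fix F assume "F \<in> I"
    hence FQ: "F \<in> classes" "q \<in> open_pairs F" using I unfolding claimers_def by auto
    obtain D where "D \<subseteq> F" "dense D" "card D = 2" "q \<subseteq> \<Union>D" using Q_diamond'[OF FQ] .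
    thus "\<exists>D. D \<subseteq> F \<and> dense D \<and> card D = 2 \<and> q \<subseteq> \<Union>D" by blast
  qed
  from bchoice[OF this] obtain D where D: "\<forall>F\<in>I. D F \<subseteq> F \<and> dense (D F) \<and> card (D F) = 2 \<and> q \<subseteq> \<Union>(D F)" by blast
  have disj: "D F \<inter> D F' = {}" if FF: "F \<in> I" "F' \<in> I" "F \<noteq> F'" for F F'
    by (rule classes_dense_disjoint[of F F']) (use FF D I in \<open>auto simp: claimers_def\<close>)
  have ne: "I \<noteq> {}" using I by auto
  then obtain F0 where "F0 \<in> I" by blast
  hence q2: "card q = 2" using I Q_card2 unfolding claimers_def by blast
  have "dense (\<Union>F\<in>I. D F)" by (rule dense_UN_common[OF I(3) ne _ q2 disj]) (use D in auto)
  moreover have "card (\<Union>F\<in>I. D F) = 8"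
  proof -
    have "card (\<Union>F\<in>I. D F) = (\<Sum>F\<in>I. card (D F))"
      using I(3) disj D denseD(3) by (intro card_UN_disjoint) auto
    thus ?thesis using D I(2) by simp
  qed
  ultimately show False using dense_not8 by blast
qed

text \<open>\<open>F\<close>, three covering edges and a diamond of another claimer: 3 + 3 + 2 = 8.
  By \<open>class_diamond_two_pairs\<close> no covering edge lies in that diamond.\<close>

lemma claimers_class3:
  assumes F: "F \<in> classes" "card F = 3" "3 \<le> card (covered_open F)" and q: "q \<in> free_open F"
  shows "claimers q = {F}"
proof -
  have qQ: "q \<in> open_pairs F" "q \<notin> covered_pairs H" using q unfolding free_open_def by auto
  have "F' = F" if F': "F' \<in> classes" "q \<in> open_pairs F'" for F'
  proof (rule ccontr)
    assume ne: "F' \<noteq> F"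
    obtain D where D: "D \<subseteq> F'" "dense D" "card D = 2" "q \<subseteq> \<Union>D" using Q_diamond'[OF F'] .
    obtain A where A: "A \<subseteq> covered_open F" "card A = 3" "finite A" by (rule obtain_subset_with_card_n[OF F(3)])
    note st = star_dense[OF F(1) A(1)]
    have FD: "F \<inter> D = {}" using classes_disjoint[OF F(1) F'(1)] ne D(1) by blast
    have "covering_edge a \<notin> D" if a: "a \<in> A" for a
    proof
      assume g: "covering_edge a \<in> D"
      have ac: "a \<in> covered_open F" using a A by blast
      have aQ: "a \<in> open_pairs F" "a \<in> covered_pairs H" using ac unfolding covered_open_def by auto
      have "a \<subseteq> \<Union>D" using covering_edge(2)[OF F(1) ac] g by blast
      moreover have "q \<noteq> a" using aQ qQ by blast
      ultimately show False
        using class_diamond_two_pairs[OF F(1) _ _ F'(1) ne D(1-3) Q_sub[OF qQ(1)] D(4) Q_sub[OF aQ(1)]]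
          F(2) Q_card2[OF qQ(1)] Q_card2[OF aQ(1)] by simp
    qed
    hence "(F \<union> covering_edge ` A) \<inter> D = {}" using FD by blast
    moreover have "q \<subseteq> \<Union>(F \<union> covering_edge ` A)" using Q_sub[OF qQ(1)] by blast
    ultimately show False
      using dense_union_8[OF st(1) D(2) _ _ D(4) Q_card2[OF qQ(1)]] st(2) F(2) A(2) D(3) by simp
  qed
  thus ?thesis unfolding claimers_def using F(1) qQ by blast
qed

text \<open>\<open>F\<close>, two covering edges and one diamond from each of \<open>F1\<close> and
  \<open>F2\<close>: 2 + 2 + 2 + 2 = 8.\<close>

lemma two_claimers_two_covers:
  assumes F: "F \<in> classes" "card F = 2" "2 \<le> card (covered_open F)" and q: "q1 \<in> free_open F" "q2 \<in> free_open F"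
    and F1: "F1 \<in> classes" "F1 \<noteq> F" "q1 \<in> open_pairs F1" and F2: "F2 \<in> classes" "F2 \<noteq> F" "q2 \<in> open_pairs F2" and ne: "F1 \<noteq> F2"
  shows False
proof -
  obtain D1 where D1: "D1 \<subseteq> F1" "dense D1" "card D1 = 2" "q1 \<subseteq> \<Union>D1" using Q_diamond'[OF F1(1,3)] .
  obtain D2 where D2: "D2 \<subseteq> F2" "dense D2" "card D2 = 2" "q2 \<subseteq> \<Union>D2" using Q_diamond'[OF F2(1,3)] .
  obtain A where A: "A \<subseteq> covered_open F" "card A = 2" "finite A" by (rule obtain_subset_with_card_n[OF F(3)])
  note st = star_dense[OF F(1) A(1)]
  have qQ: "q1 \<in> open_pairs F" "q2 \<in> open_pairs F" using q unfolding free_open_def by auto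
  have d1: "(F \<union> covering_edge ` A) \<inter> D1 = {}"
    using gam_not_in_class[OF F(1,2) F1(1,2) q(1) F1(3)] A(1) D1(1) classes_disjoint[OF F(1) F1(1)] F1(2) by blast
  have d2: "(F \<union> covering_edge ` A) \<inter> D2 = {}"
    using gam_not_in_class[OF F(1,2) F2(1,2) q(2) F2(3)] A(1) D2(1) classes_disjoint[OF F(1) F2(1)] F2(2) by blast
  have d12: "D1 \<inter> D2 = {}" using classes_disjoint[OF F1(1) F2(1) ne] D1(1) D2(1) by blast
  have q1: "q1 \<subseteq> \<Union>(F \<union> covering_edge ` A)" using Q_sub[OF qQ(1)] by blast
  have q2: "q2 \<subseteq> \<Union>(F \<union> covering_edge ` A)" using Q_sub[OF qQ(2)] by blast
  have J: "dense (F \<union> covering_edge ` A \<union> D1)" by (rule dense_merge[OF st(1) D1(2) d1 q1 D1(4) Q_card2[OF qQ(1)]])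
  have c: "card (F \<union> covering_edge ` A \<union> D1) = 6"
    using card_Un_disjoint[OF denseD(3)[OF st(1)] denseD(3)[OF D1(2)] d1] st(2) F(2) A(2) D1(3) by simp
  have "(F \<union> covering_edge ` A \<union> D1) \<inter> D2 = {}" using d2 d12 by (simp add: Int_Un_distrib2)
  moreover have "q2 \<subseteq> \<Union>(F \<union> covering_edge ` A \<union> D1)" using q2 unfolding Union_Un_distrib by (rule le_supI1)
  ultimately show False using dense_union_8[OF J D2(2) _ _ D2(4) Q_card2[OF qQ(2)]] c D2(3) by simp
qed

text \<open>If two free pairs both had another claimer, that would be either one class sharing two
  pairs with \<open>F\<close>, or two classes as in \<open>two_claimers_two_covers\<close>.\<close>

lemma exclusive_free_pair:
  assumes F: "F \<in> classes" "card F = 2" "2 \<le> card (covered_open F)" "2 \<le> card (free_open F)"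
  shows "\<exists>q\<in>free_open F. claimers q = {F}"
proof (rule ccontr)
  assume neg: "\<not> (\<exists>q\<in>free_open F. claimers q = {F})"
  obtain T where T: "T \<subseteq> free_open F" "card T = 2" by (rule obtain_subset_with_card_n[OF F(4)])
  obtain q1 q2 where q: "T = {q1, q2}" "q1 \<noteq> q2" using T(2) by (auto simp: card_2_iff)
  have qf: "q1 \<in> free_open F" "q2 \<in> free_open F" using T(1) q(1) by auto
  have ex: "\<exists>F'\<in>classes. F' \<noteq> F \<and> q \<in> open_pairs F'" if "q \<in> free_open F" for q
  proof -
    have "F \<in> claimers q" using that F(1) unfolding claimers_def free_open_def by auto
    moreover have "claimers q \<noteq> {F}" using neg that by blast
    ultimately show ?thesis unfolding claimers_def by blast
  qed
  obtain F1 where F1: "F1 \<in> classes" "F1 \<noteq> F" "q1 \<in> open_pairs F1" using ex[OF qf(1)] by blast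
  obtain F2 where F2: "F2 \<in> classes" "F2 \<noteq> F" "q2 \<in> open_pairs F2" using ex[OF qf(2)] by blast
  have qQ: "q1 \<in> open_pairs F" "q2 \<in> open_pairs F" using qf unfolding free_open_def by auto
  have "F1 \<noteq> F2"
  proof
    assume "F1 = F2"
    obtain D where D: "D \<subseteq> F1" "dense D" "card D = 2" "q1 \<subseteq> \<Union>D" using Q_diamond'[OF F1(1,3)] .
    show False
      using two_classes_two_pairs[OF F(1,2) F1(1,2) D Q_sub[OF qQ(1)] Q_sub[OF qQ(2)] _ Q_card2[OF qQ(1)] Q_card2[OF qQ(2)] q(2)]
        Q_sub[OF F2(3)] \<open>F1 = F2\<close> by blast
  qed
  thus False using two_claimers_two_covers[OF F(1-3) qf F1 F2] by blast
qed

text \<open>Poor and starving classes turn out to have two edges, hence a deficit of 1. The danger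
  is that the only free pair is contested, or that there is none.\<close>

definition poor :: "'a set set \<Rightarrow> bool" where
  "poor F \<longleftrightarrow> F \<in> classes \<and> 2 \<le> card F \<and> card (free_open F) = 1"

definition starving :: "'a set set \<Rightarrow> bool" where
  "starving F \<longleftrightarrow> F \<in> classes \<and> 2 \<le> card F \<and> card (free_open F) = 0"

text \<open>From m + c \<le> 7 and 4 (m - 1) \<le> 3 + c one gets 5m \<le> 14, where m counts the
  edges and c the covered open pairs.\<close>

lemma few_free:
  assumes F: "F \<in> classes" "2 \<le> card F" "card (free_open F) \<le> 3"
  shows "card F = 2" "card (free_open F) + card (covered_open F) \<ge> 4"
proof -
  have "card F + card (covered_open F) \<le> 7" by (rule star_dense(4)[OF F(1) order_refl])
  thus "card F = 2" using Q_count[OF F(1)] free_covered_card[OF F(1)] F(2,3) by linarith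
  thus "card (free_open F) + card (covered_open F) \<ge> 4" using Q_count[OF F(1)] free_covered_card[OF F(1)] by simp
qed

text \<open>A poor \<open>F\<close> has three covered open pairs, so with their covering edges it is
  a dense set of 5. A competitor with three or more edges would complete 8. One with two edges makes
  7, hence has no covered open pair itself. A further claimer of another of its pairs would give 8
  as \<open>F\<close>, two covering edges, \<open>F'\<close> and a diamond.\<close>

lemma poor_neighbour:
  assumes P: "poor F" and q0: "q0 \<in> free_open F" and F': "F' \<in> classes" "F' \<noteq> F" "q0 \<in> open_pairs F'"
  shows "card F' = 2" "free_open F' = open_pairs F'" "\<And>q. q \<in> open_pairs F' \<Longrightarrow> q \<noteq> q0 \<Longrightarrow> claimers q = {F'}"
proof -
  have F: "F \<in> classes" "2 \<le> card F" "card (free_open F) = 1" using P unfolding poor_def by auto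
  have cF: "card F = 2" "3 \<le> card (covered_open F)" using few_free[OF F(1,2)] F(3) by auto
  have q0Q: "q0 \<in> open_pairs F" "q0 \<notin> covered_pairs H" using q0 unfolding free_open_def by auto
  have q02: "card q0 = 2" by (rule Q_card2[OF q0Q(1)])
  note dF = class_dense[OF F(1)] and dF' = class_dense[OF F'(1)]
  obtain D where D: "D \<subseteq> F'" "dense D" "card D = 2" "q0 \<subseteq> \<Union>D" using Q_diamond'[OF F'(1,3)] .
  have D0: "D \<noteq> {}" using D(3) by auto
  obtain A where A: "A \<subseteq> covered_open F" "card A = 3" "finite A" by (rule obtain_subset_with_card_n[OF cF(2)])
  note st = star_dense[OF F(1) A(1)]
  have FF': "F \<inter> F' = {}" using classes_disjoint[OF F(1) F'(1)] F'(2) by blast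
  have gn: "covering_edge a \<notin> F'" if "a \<in> A" for a using gam_not_in_class[OF F(1) cF(1) F'(1,2) q0 F'(3)] that A(1) by blast
  have JF': "(F \<union> covering_edge ` A) \<inter> F' = {}" using FF' gn by blast
  have qJ: "q0 \<subseteq> \<Union>(F \<union> covering_edge ` A)" using Q_sub[OF q0Q(1)] by blast
  have c2: "2 \<le> card F'" by (rule Q_card_ge2[OF F'(1,3)])
  show cF': "card F' = 2"
  proof (rule ccontr)
    assume "card F' \<noteq> 2"
    hence "card D \<le> 3" "3 \<le> card F'" using c2 D(3) by auto
    then obtain T where T: "D \<subseteq> T" "T \<subseteq> F'" "card T = 3" "dense T" using dense_grow[OF F'(1) D(1) D0 D(2)] by metis
    have "(F \<union> covering_edge ` A) \<inter> T = {}" using Int_mono[OF order_refl T(2), of "F \<union> covering_edge ` A"] unfolding JF' by simp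
    moreover have "q0 \<subseteq> \<Union>T" using D(4) Union_mono[OF T(1)] by (rule order_trans)
    ultimately show False using dense_union_8[OF st(1) T(4) _ qJ _ q02] st(2) cF(1) A(2) T(3) by simp
  qed
  have q0F': "q0 \<subseteq> \<Union>F'" by (rule Q_sub[OF F'(3)])
  have JFd: "dense (F \<union> covering_edge ` A \<union> F')" by (rule dense_merge[OF st(1) dF' JF' qJ q0F' q02])
  have JFc: "card (F \<union> covering_edge ` A \<union> F') = 7"
    using card_Un_disjoint[OF denseD(3)[OF st(1)] classesD(2)[OF F'(1)] JF'] st(2) cF(1) A(2) cF' by simp
  have dFF': "dense (F \<union> F')" by (rule dense_merge[OF dF dF' FF' Q_sub[OF q0Q(1)] q0F' q02])
  have cFF': "card (F \<union> F') = 4" using card_Un_disjoint[OF classesD(2)[OF F(1)] classesD(2)[OF F'(1)] FF'] cF(1) cF' by simp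
  have cross2: False if "p \<subseteq> \<Union>F" "p \<subseteq> \<Union>F'" "card p = 2" "p \<noteq> q0" for p
    using two_classes_two_pairs[OF F(1) cF(1) F'(1,2) D Q_sub[OF q0Q(1)] that(1,2) q02 that(3)] that(4) by blast
  have "covered_open F' = {}"
  proof (rule ccontr)
    assume "covered_open F' \<noteq> {}"
    then obtain a' where a': "a' \<in> covered_open F'" by blast
    have a'Q: "a' \<in> open_pairs F'" "a' \<in> covered_pairs H" using a' unfolding covered_open_def by auto
    have a'2: "card a' = 2" "a' \<subseteq> \<Union>F'" using Q_card2[OF a'Q(1)] Q_sub[OF a'Q(1)] by auto
    have ne0: "a' \<noteq> q0" using a'Q q0Q by blast
    define g where "g = covering_edge a'"
    have g: "g \<in> H" "a' \<subseteq> g" "g \<notin> F'" unfolding g_def using covering_edge[OF F'(1) a'] by auto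
    have "g \<notin> F" using cross2[of a'] g(2) a'2 ne0 by blast
    \<comment> \<open>An edge over both \<open>a\<close> and \<open>a'\<close> would meet the four
      edges of the two classes in three vertices; the residue 8 mod 5 = 3 is served by
      \<open>F\<close> with \<open>g\<close>.\<close>
    moreover have "g \<noteq> covering_edge a" if a: "a \<in> A" for a
    proof
      assume eq: "g = covering_edge a"
      have ac: "a \<in> covered_open F" using a A by blast
      have aQ: "a \<in> open_pairs F" "a \<in> covered_pairs H" using ac unfolding covered_open_def by auto
      have a2: "card a = 2" "a \<subseteq> \<Union>F" "a \<noteq> q0" using Q_card2[OF aQ(1)] Q_sub[OF aQ(1)] aQ(2) q0Q(2) by auto
      have "a \<noteq> a'" using cross2[of a] a2 a'2 by blast
      hence "3 \<le> card (\<Union>(F \<union> F') \<inter> \<Union>{g})"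
        using three_common[of a "\<Union>(F \<union> F')" "\<Union>{g}" a'] a2 a'2 g(2) covering_edge(2)[OF F(1) ac] eq denseD(4)[OF dFF'] by auto
      moreover have "dense (F \<union> {g})" using dense_insert[OF dF g(1) \<open>g \<notin> F\<close> a2(2) _ a2(1)] covering_edge(2)[OF F(1) ac] eq by simp
      moreover have "card (F \<union> {g}) = 3" using \<open>g \<notin> F\<close> classesD(2)[OF F(1)] cF(1) by simp
      moreover have "(F \<union> F') \<inter> {g} = {}" using \<open>g \<notin> F\<close> g(3) by blast
      moreover have "card (F \<union> F' \<union> {g}) = 5" using cFF' \<open>g \<notin> F\<close> g(3) denseD(3)[OF dFF'] by simp
      ultimately show False
        using overlap3[OF dFF' dense_single[OF g(1)]] by (auto intro!: exI[of _ "insert g F"])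
    qed
    ultimately have "g \<notin> F \<union> covering_edge ` A \<union> F'" using g(3) by blast
    moreover have "a' \<subseteq> \<Union>(F \<union> covering_edge ` A \<union> F')" using a'2 by blast
    ultimately have "dense (insert g (F \<union> covering_edge ` A \<union> F'))" "card (insert g (F \<union> covering_edge ` A \<union> F')) = 8"
      using dense_insert[OF JFd g(1) _ _ g(2) a'2(1)] JFc denseD(3)[OF JFd] by auto
    thus False using dense_not8 by blast
  qed
  thus fr: "free_open F' = open_pairs F'" unfolding free_open_def covered_open_def by blast
  show "claimers q = {F'}" if q: "q \<in> open_pairs F'" "q \<noteq> q0" for q
  proof -
    have qc: "q \<notin> covered_pairs H" using q fr unfolding free_open_def by blast
    have q2: "card q = 2" "q \<subseteq> \<Union>F'" using Q_card2[OF q(1)] Q_sub[OF q(1)] by auto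
    have "F'' = F'" if F'': "F'' \<in> classes" "q \<in> open_pairs F''" for F''
    proof (rule ccontr)
      assume ne: "F'' \<noteq> F'"
      show False
      proof (cases "F'' = F")
        case True
        thus False using cross2[of q] Q_sub[OF F''(2)] q2 q(2) by blast
      next
        case False
        obtain E where E: "E \<subseteq> F''" "dense E" "card E = 2" "q \<subseteq> \<Union>E" using Q_diamond'[OF F''] .
        have EF: "F \<inter> E = {}" "F' \<inter> E = {}"
          using classes_dense_disjoint[OF F(1) F''(1) _ order_refl E(1)]
            classes_dense_disjoint[OF F'(1) F''(1) _ order_refl E(1)] False ne by auto
        \<comment> \<open>Otherwise \<open>E\<close> would share both \<open>a\<close> and
          \<open>q\<close> with the four edges of the two classes; the residue 8 mod 6 = 2 is served
          by \<open>E\<close>.\<close>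
        have gE: "covering_edge a \<notin> E" if a: "a \<in> A" for a
        proof
          assume g: "covering_edge a \<in> E"
          have ac: "a \<in> covered_open F" using a A by blast
          have aQ: "a \<in> open_pairs F" "a \<in> covered_pairs H" using ac unfolding covered_open_def by auto
          have a2: "card a = 2" "a \<subseteq> \<Union>F" "a \<noteq> q" using Q_card2[OF aQ(1)] Q_sub[OF aQ(1)] aQ(2) qc by auto
          have "a \<subseteq> \<Union>E" using covering_edge(2)[OF F(1) ac] g by blast
          hence o3: "3 \<le> card (\<Union>(F \<union> F') \<inter> \<Union>E)"
            using three_common[of a "\<Union>(F \<union> F')" "\<Union>E" q] a2 q2 E(4) denseD(4)[OF dFF'] by (simp add: le_supI1 le_supI2)
          have disj: "(F \<union> F') \<inter> E = {}" using EF by blast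
          have "card (F \<union> F' \<union> E) = 6" using card_Un_disjoint[OF denseD(3)[OF dFF'] denseD(3)[OF E(2)] disj] cFF' E(3) by simp
          moreover have "\<exists>A\<subseteq>F \<union> F' \<union> E. dense A \<and> card A = 2" using E by blast
          ultimately show False using overlap3[OF dFF' E(2) disj _ _ _ _ o3] by simp
        qed
        obtain A2 where A2: "A2 \<subseteq> A" "card A2 = 2" "finite A2" 
          using obtain_subset_with_card_n[of 2 A] A(2) by auto
        have A2c: "A2 \<subseteq> covered_open F" using A2 A by blast
        note st2 = star_dense[OF F(1) A2c]
        have d: "(F \<union> covering_edge ` A2) \<inter> F' = {}" using JF' A2(1) by blast
        have J: "dense (F \<union> covering_edge ` A2 \<union> F')"
          by (rule dense_merge[OF st2(1) dF' d _ q0F' q02]) (use Q_sub[OF q0Q(1)] in blast)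
        have "card (F \<union> covering_edge ` A2 \<union> F') = 6"
          using card_Un_disjoint[OF denseD(3)[OF st2(1)] classesD(2)[OF F'(1)] d] st2(2) cF(1) A2(2) cF' by simp
        moreover have "(F \<union> covering_edge ` A2 \<union> F') \<inter> E = {}" using EF gE A2(1) by blast
        moreover have "q \<subseteq> \<Union>(F \<union> covering_edge ` A2 \<union> F')" using q2 by blast
        ultimately show False using dense_union_8[OF J E(2) _ _ E(4) q2(1)] E(3) by simp
      qed
    qed
    thus ?thesis unfolding claimers_def using F'(1) q(1) by blast
  qed
qed

section \<open>Classes without a free_open pair\<close>

text \<open>
  Such a class is paid by an uncovered pair joining it to one of the edges covering its cross pairs.
\<close>

definition starving_pair :: "'a set set \<Rightarrow> 'a set set \<Rightarrow> 'a set \<Rightarrow> 'a set \<Rightarrow> bool" where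
  "starving_pair F A a p \<longleftrightarrow> F \<in> classes \<and> card F = 2 \<and> A \<subseteq> covered_open F \<and> card A = 4 \<and> a \<in> A \<and>
     p \<subseteq> \<Union>(insert (covering_edge a) F) \<and> card p = 2 \<and> p \<notin> covered_pairs H \<and> \<not> p \<subseteq> \<Union>F"

text \<open>\<open>F\<close> and four covering edges form a dense set \<open>K\<close> of 6, so two
  more edges cannot be attached. Take a covering edge \<open>g\<close>, a vertex \<open>y\<close> of
  \<open>F\<close> outside \<open>g\<close> and, using r \<ge> 4, two vertices \<open>x1\<close>,
  \<open>x2\<close> of \<open>g\<close> outside \<open>F\<close>. If both pairs with
  \<open>y\<close> were covered, two different edges would complete 8, and a single one would meet
  \<open>K\<close> in three vertices.\<close>

lemma starving_pair_exists:
  assumes "starving F"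
  shows "\<exists>A a p. starving_pair F A a p"
proof -
  have F: "F \<in> classes" "2 \<le> card F" "card (free_open F) = 0" using assms unfolding starving_def by auto
  have cF: "card F = 2" "4 \<le> card (covered_open F)" using few_free[OF F(1,2)] F(3) by auto
  obtain A where A: "A \<subseteq> covered_open F" "card A = 4" "finite A" by (rule obtain_subset_with_card_n[OF cF(2)])
  obtain a where a: "a \<in> A" using A(2) by fastforce
  note st = star_dense[OF F(1) A(1)] and dF = class_dense[OF F(1)]
  define g where "g = covering_edge a"
  define K where "K = F \<union> covering_edge ` A"
  have K: "dense K" "card K = 6" using st cF(1) A(2) unfolding K_def by auto
  have ac: "a \<in> covered_open F" using a A(1) by blast
  have g: "g \<in> H" "a \<subseteq> g" "g \<notin> F" unfolding g_def using covering_edge[OF F(1) ac] by auto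
  have a2: "card a = 2" "a \<subseteq> \<Union>F" using ac Q_card2 Q_sub unfolding covered_open_def by auto
  have c3: "card (F \<union> {g}) = 3" using g(3) cF(1) classesD(2)[OF F(1)] by simp
  have le2: "card (\<Union>F \<inter> g) \<le> 2"
    using overlap_le_2[OF dF dense_single[OF g(1)] _ _ dF] g(3) c3 cF(1) by auto
  have dFg: "dense (insert g F)" by (rule dense_insert[OF dF g(1,3) a2(2) g(2) a2(1)])
  have "2 \<le> card (g - \<Union>F)"
  proof -
    have "card (g - \<Union>F) = card g - card (g \<inter> \<Union>F)"
      by (rule card_Diff_subset_Int) (use edge(1)[OF g(1)] in auto)
    thus ?thesis using le2 edge(2)[OF g(1)] r4 by (simp add: Int_commute)
  qed
  then obtain X where X: "X \<subseteq> g - \<Union>F" "card X = 2" by (rule obtain_subset_with_card_n) blast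
  then obtain x1 x2 where x: "x1 \<noteq> x2" "x1 \<in> g - \<Union>F" "x2 \<in> g - \<Union>F" by (auto simp: card_2_iff)
  obtain f where f: "f \<in> F" using classesD(3)[OF F(1)] by blast
  have "\<not> f \<subseteq> g"
  proof
    assume "f \<subseteq> g"
    hence "card f \<le> card (\<Union>F \<inter> g)" using f denseD(4)[OF dF] by (intro card_mono) auto
    thus False using le2 edge(2) f classesD(1)[OF F(1)] r4 by fastforce
  qed
  then obtain y where y: "y \<in> \<Union>F" "y \<notin> g" using f by blast
  \<comment> \<open>An edge of \<open>K\<close> over such a pair would be a covering edge other than
    \<open>g\<close> and would meet \<open>F\<close> with \<open>g\<close> in three vertices, a
    union of four edges with 8 mod 4 = 0.\<close>
  have hK: "h \<notin> K" if h: "h \<in> H" "x \<in> g - \<Union>F" "{x, y} \<subseteq> h" for h x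
  proof
    assume "h \<in> K"
    moreover have "h \<notin> F" using h by blast
    ultimately obtain b where b: "b \<in> A" "h = covering_edge b" unfolding K_def by blast
    have bc: "b \<in> covered_open F" using b A(1) by blast
    have b2: "card b = 2" "b \<subseteq> \<Union>F" using bc Q_card2 Q_sub unfolding covered_open_def by auto
    have "h \<noteq> g" using h y by blast
    have "{x, y} \<noteq> b" using b2 h(2) by blast
    moreover have "card {x, y} = 2" using h(2) y by (auto simp: card_2_iff)
    ultimately have "3 \<le> card (\<Union>(insert g F) \<inter> \<Union>{h})"
      using three_common[of b "\<Union>(insert g F)" "\<Union>{h}" "{x, y}"] b2 covering_edge(2)[OF F(1) bc] b(2) h y denseD(4)[OF dFg] by auto
    moreover have "insert g F \<inter> {h} = {}" using \<open>h \<noteq> g\<close> \<open>h \<notin> F\<close> by blast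
    moreover have "card (insert g F \<union> {h}) = 4" using c3 \<open>h \<noteq> g\<close> \<open>h \<notin> F\<close> classesD(2)[OF F(1)] by simp
    ultimately show False using overlap3[OF dFg dense_single[OF h(1)]] by simp
  qed
  have gK: "g \<in> K" unfolding K_def g_def using a by blast
  have "\<exists>x\<in>{x1, x2}. {x, y} \<notin> covered_pairs H"
  proof (rule ccontr)
    assume neg: "\<not> (\<exists>x\<in>{x1, x2}. {x, y} \<notin> covered_pairs H)"
    then obtain h1 h2 where h: "h1 \<in> H" "{x1, y} \<subseteq> h1" "h2 \<in> H" "{x2, y} \<subseteq> h2" unfolding covered_pairs_def by auto
    have hn: "h1 \<notin> K" "h2 \<notin> K" using hK[OF h(1) x(2) h(2)] hK[OF h(3) x(3) h(4)] .
    have xy2: "card {x1, y} = 2" "card {x2, y} = 2" using x y by (auto simp: card_2_iff)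
    have xyK: "{x1, y} \<subseteq> \<Union>K" "{x2, y} \<subseteq> \<Union>K" using x y gK unfolding K_def by auto
    show False
    proof (cases "h1 = h2")
      case True
      have "{x1, y} \<noteq> {x2, y}" using x by (auto simp: doubleton_eq_iff)
      hence "3 \<le> card (\<Union>K \<inter> \<Union>{h1})"
        using three_common[OF xyK(1) _ xyK(2) _ xy2 _ denseD(4)[OF K(1)], of "\<Union>{h1}"] h(2,4) True by simp
      moreover have "card (K \<union> {h1}) = 7" using hn K denseD(3)[OF K(1)] by simp
      ultimately show False using overlap3[OF K(1) dense_single[OF h(1)]] hn by simp
    next
      case False
      have "dense (insert h1 K)" by (rule dense_insert[OF K(1) h(1) hn(1) xyK(1) h(2) xy2(1)])
      hence "dense (insert h2 (insert h1 K))"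
        by (rule dense_insert[OF _ h(3) _ _ h(4) xy2(2)]) (use hn False xyK in auto)
      moreover have "card (insert h2 (insert h1 K)) = 8" using hn False K denseD(3)[OF K(1)] by simp
      ultimately show False using dense_not8 by blast
    qed
  qed
  then obtain x where x': "x \<in> g - \<Union>F" "{x, y} \<notin> covered_pairs H" using x by blast
  have "starving_pair F A a {x, y}"
    unfolding starving_pair_def g_def[symmetric] using F(1) cF(1) A a x' y by (auto simp: card_2_iff)
  thus ?thesis by blast
qed

context
  fixes F A a p
  assumes sp: "starving_pair F A a p"
begin

lemma sp_basic: "F \<in> classes" "card F = 2" "A \<subseteq> covered_open F" "card A = 4" "a \<in> A"
  "p \<subseteq> \<Union>(insert (covering_edge a) F)" "card p = 2" "p \<notin> covered_pairs H" "\<not> p \<subseteq> \<Union>F" "p \<subseteq> \<Union>(F \<union> covering_edge ` A)"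
  using sp unfolding starving_pair_def by auto

lemma sp_star: "dense (F \<union> covering_edge ` A)" "card (F \<union> covering_edge ` A) = 6" "F \<inter> covering_edge ` A = {}" "covering_edge ` A \<subseteq> H"
  using star_dense[OF sp_basic(1,3)] sp_basic(2,4) by auto

lemma sp_gam: "b \<in> A \<Longrightarrow> covering_edge b \<in> H \<and> b \<subseteq> covering_edge b \<and> covering_edge b \<notin> F \<and> card b = 2 \<and> b \<subseteq> \<Union>F"
proof -
  assume "b \<in> A"
  hence b: "b \<in> covered_open F" using sp_basic(3) by blast
  hence "b \<in> open_pairs F" unfolding covered_open_def by simp
  from covering_edge[OF sp_basic(1) b] Q_card2[OF this] Q_sub[OF this] show ?thesis by simp
qed

text \<open>The common pair and the pair \<open>c\<close> of \<open>F\<close> would together be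
  three vertices in which the second covering edge meets \<open>F\<close> with the first, a union of
  four edges.\<close>

lemma sp_gam_sep:
  assumes b: "b \<in> A" "c \<in> A" "covering_edge b \<noteq> covering_edge c"
  shows "\<not> 2 \<le> card (covering_edge b \<inter> covering_edge c)"
proof
  assume "2 \<le> card (covering_edge b \<inter> covering_edge c)"
  then obtain q where q: "q \<subseteq> covering_edge b" "q \<subseteq> covering_edge c" "card q = 2" using pair_of_inter by blast
  note gb = sp_gam[OF b(1)] and gc = sp_gam[OF b(2)]
  note dF = class_dense[OF sp_basic(1)]
  have d: "dense (insert (covering_edge b) F)" by (rule dense_insert[OF dF _ _ , of _ b]) (use gb in auto)
  have "c \<noteq> q"
  proof
    assume "c = q"
    hence "b = c"
      by (intro outside_overlap[OF sp_basic(1), of "covering_edge b"]) (use gb gc q sp_basic(2) in auto)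
    thus False using b(3) by simp
  qed
  hence "3 \<le> card (\<Union>(insert (covering_edge b) F) \<inter> \<Union>{covering_edge c})"
    using three_common[of c "\<Union>(insert (covering_edge b) F)" "\<Union>{covering_edge c}" q] gb gc q denseD(4)[OF d] by (simp add: le_supI1 le_supI2)
  moreover have "insert (covering_edge b) F \<inter> {covering_edge c} = {}" using gc b(3) by blast
  moreover have "card (insert (covering_edge b) F \<union> {covering_edge c}) = 4"
    using gb gc b(3) classesD(2)[OF sp_basic(1)] sp_basic(2) by simp
  ultimately show False using overlap3[OF d dense_single, of "covering_edge c"] gc by simp
qed

text \<open>Keeps the private pairs of starving classes apart from the pairs shared by the others. A
  diamond over \<open>p\<close> that avoids the dense set of 6 completes 8; if it contains one of
  the covering edges, its other edge meets that set in three vertices, a union of 7.\<close>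

lemma sp_not_Q:
  assumes F': "F' \<in> classes"
  shows "p \<notin> open_pairs F'"
proof
  assume pQ: "p \<in> open_pairs F'"
  note st = sp_star and spb = sp_basic
  have ne: "F' \<noteq> F" using Q_sub[OF pQ] spb(9) by blast
  obtain e f x y where ef: "e \<in> F'" "f \<in> F'" "e \<noteq> f" "2 \<le> card (e \<inter> f)" "x \<in> e - f" "y \<in> f - e" "p = {x, y}"
    "dense {e, f}" "card {e, f} = 2" "p \<subseteq> \<Union>{e, f}" using Q_diamond[OF F' pQ] .
  have efF: "e \<notin> F" "f \<notin> F" using classes_disjoint[OF spb(1) F'] ne ef(1,2) by blast+
  have efH: "e \<in> H" "f \<in> H" using classesD(1)[OF F'] ef(1,2) by blast+
  have main: False if g: "g \<in> covering_edge ` A" "{g, h} = {e, f}" "g \<noteq> h" and z: "z \<in> h - g" "z \<in> p" "2 \<le> card (g \<inter> h)" for g h z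
  proof -
    have hH: "h \<in> H" "h \<notin> F" using g(2) efH efF by (auto simp: doubleton_eq_iff)
    have "h \<notin> covering_edge ` A"
    proof
      assume "h \<in> covering_edge ` A"
      then obtain b c where bc: "b \<in> A" "g = covering_edge b" "c \<in> A" "h = covering_edge c" using g(1) by auto
      show False using sp_gam_sep[OF bc(1,3)] bc(2,4) g(3) z(3) by simp
    qed
    hence hK: "h \<notin> F \<union> covering_edge ` A" using hH by blast
    obtain q where q: "q \<subseteq> g" "q \<subseteq> h" "card q = 2" using pair_of_inter[OF z(3)] .
    have "z \<notin> q" using z q by blast
    moreover have fq: "finite q" using q(2) edge(1)[OF hH(1)] finite_subset by blast
    ultimately have "card (insert z q) = 3" using q(3) by simp
    moreover have "insert z q \<subseteq> \<Union>(F \<union> covering_edge ` A) \<inter> \<Union>{h}" using z q g(1) spb(10) by auto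
    ultimately have "3 \<le> card (\<Union>(F \<union> covering_edge ` A) \<inter> \<Union>{h})"
      using card_mono[of "\<Union>(F \<union> covering_edge ` A) \<inter> \<Union>{h}" "insert z q"] edge(1)[OF hH(1)] by simp
    moreover have "card (F \<union> covering_edge ` A \<union> {h}) = 7" using hK st(2) denseD(3)[OF st(1)] by simp
    ultimately show False using overlap3[OF st(1) dense_single[OF hH(1)]] hK by simp
  qed
  show False
  proof (cases "e \<in> covering_edge ` A \<or> f \<in> covering_edge ` A")
    case True
    thus False
    proof
      assume "e \<in> covering_edge ` A"
      thus False using main[of e f y] ef by auto
    next
      assume "f \<in> covering_edge ` A"
      thus False using main[of f e x] ef by (auto simp: Int_commute)
    qed
  next
    case False
    hence "(F \<union> covering_edge ` A) \<inter> {e, f} = {}" using efF by blast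
    thus False using dense_union_8[OF st(1) ef(8) _ spb(10) ef(10) spb(7)] st(2) ef(9) by simp
  qed
qed

end

text \<open>If \<open>F'\<close> contained a covering edge of \<open>F\<close>, its other edge
  \<open>h\<close> would extend the dense set of 6 to 7, which then contains all covering edges of
  \<open>F'\<close>. These are four and lie outside \<open>F'\<close>, so they do not fit into the
  three remaining covering edges of \<open>F\<close>, and one of them lies in \<open>F\<close>. Then
  \<open>F\<close> and \<open>F'\<close> share two vertex pairs in a union of four edges.\<close>

lemma starving_pair_gam_other:
  assumes sp: "starving_pair F A a p" and sp': "starving_pair F' A' a' p'" and ne: "F \<noteq> F'"
  shows "covering_edge ` A \<inter> F' = {}"
proof (rule ccontr)
  assume "covering_edge ` A \<inter> F' \<noteq> {}"
  then obtain b where b: "b \<in> A" "covering_edge b \<in> F'" by blast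
  note B = sp_basic[OF sp] and B' = sp_basic[OF sp'] and S = sp_star[OF sp] and S' = sp_star[OF sp']
  have disj: "F \<inter> F' = {}" by (rule classes_disjoint[OF B(1) B'(1) ne])
  note dF = class_dense[OF B(1)] and dF' = class_dense[OF B'(1)]
  obtain u v where uv: "F' = {u, v}" "u \<noteq> v" using B'(2) by (auto simp: card_2_iff)
  obtain h where h: "F' = {covering_edge b, h}" "covering_edge b \<noteq> h"
  proof (cases "covering_edge b = u")
    case True
    show ?thesis by (rule that[of v]) (simp_all only: True uv simp_thms)
  next
    case False
    hence "covering_edge b = v" using b(2) unfolding uv(1) by blast
    show ?thesis by (rule that[of u]) (simp_all only: \<open>covering_edge b = v\<close> uv insert_commute uv(2)[symmetric] not_False_eq_True)
  qed
  have "{covering_edge b} \<subseteq> F'" "{covering_edge b} \<noteq> {}" "{covering_edge b} \<noteq> F'" using h by auto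
  from class_expand[OF B'(1) this] obtain e g where "e \<in> {covering_edge b}" "g \<in> F' - {covering_edge b}" "2 \<le> card (e \<inter> g)" .
  hence bh: "2 \<le> card (covering_edge b \<inter> h)" using h by auto
  have hH: "h \<in> H" "h \<notin> F" using h(1) classesD(1)[OF B'(1)] disj by auto
  have "h \<notin> covering_edge ` A"
  proof
    assume "h \<in> covering_edge ` A"
    then obtain c where c: "c \<in> A" "h = covering_edge c" by auto
    show False using sp_gam_sep[OF sp b(1) c(1)] c(2) h(2) bh by simp
  qed
  hence hK: "h \<notin> F \<union> covering_edge ` A" using hH by blast
  obtain q where q: "q \<subseteq> covering_edge b" "q \<subseteq> h" "card q = 2" using pair_of_inter[OF bh] .
  define L where "L = insert h (F \<union> covering_edge ` A)"
  have dL: "dense L" unfolding L_def by (rule dense_insert[OF S(1) hH(1) hK _ q(2,3)]) (use q b in auto)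
  have cL: "card L = 7" unfolding L_def using hK S(2) denseD(3)[OF S(1)] by simp
  have gL: "covering_edge c \<in> L" if c: "c \<in> A'" for c
  proof (rule ccontr)
    assume n: "covering_edge c \<notin> L"
    note gc = sp_gam[OF sp' c]
    have "F' \<subseteq> L" unfolding L_def h(1) using b(1) by blast
    hence "c \<subseteq> \<Union>L" using gc by blast
    hence "dense (insert (covering_edge c) L)" using dense_insert[OF dL _ n, of c] gc by simp
    moreover have "card (insert (covering_edge c) L) = 8" using n cL denseD(3)[OF dL] by simp
    ultimately show False using dense_not8 by blast
  qed
  have "\<exists>c\<in>A'. covering_edge c \<in> F"
  proof (rule ccontr)
    assume neg: "\<not> (\<exists>c\<in>A'. covering_edge c \<in> F)"
    have finA: "finite A" using B(4) card.infinite by fastforce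
    have "covering_edge ` A' \<subseteq> covering_edge ` A - {covering_edge b}"
    proof
      fix g assume g: "g \<in> covering_edge ` A'"
      then obtain c where c: "c \<in> A'" "g = covering_edge c" by blast
      have "g \<notin> F'" using sp_gam[OF sp' c(1)] c(2) by simp
      hence "g \<noteq> h" "g \<noteq> covering_edge b" using h(1) by auto
      moreover have "g \<notin> F" using neg c by blast
      ultimately show "g \<in> covering_edge ` A - {covering_edge b}" using gL[OF c(1)] c(2) unfolding L_def by blast
    qed
    hence "card (covering_edge ` A') \<le> card (covering_edge ` A - {covering_edge b})" using finA by (intro card_mono) auto
    also have "\<dots> < card (covering_edge ` A)" using finA b(1) by (intro psubset_card_mono) auto
    also have "\<dots> \<le> 4" using card_image_le[OF finA, of covering_edge] B(4) by simp
    finally have "card (covering_edge ` A') < 4" .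
    moreover have "card (covering_edge ` A') = 4" using card_image[OF inj_on_subset[OF gam_inj[OF B'(1)] B'(3)]] B'(4) by simp
    ultimately show False by simp
  qed
  then obtain c where c: "c \<in> A'" "covering_edge c \<in> F" by blast
  note gc = sp_gam[OF sp' c(1)] and gb = sp_gam[OF sp b(1)]
  have "c \<in> open_pairs F'" using c(1) B'(3) unfolding covered_open_def by blast
  hence "c \<notin> covered_pairs F'" unfolding open_pairs_def by blast
  hence "c \<noteq> b" using gb b(2) unfolding covered_pairs_def by blast
  moreover have "b \<subseteq> \<Union>F" "b \<subseteq> \<Union>F'" "c \<subseteq> \<Union>F" "c \<subseteq> \<Union>F'" using gb gc b(2) c(2) by auto
  ultimately have "3 \<le> card (\<Union>F \<inter> \<Union>F')"
    using three_common[of b "\<Union>F" "\<Union>F'" c] gb gc denseD(4)[OF dF] by auto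
  moreover have "card (F \<union> F') = 4" using card_Un_disjoint[OF classesD(2)[OF B(1)] classesD(2)[OF B'(1)] disj] B(2) B'(2) by simp
  ultimately show False using overlap3[OF dF dF' disj] by simp
qed

text \<open>With a common covering edge, the dense set of 6 edges around \<open>F\<close> shares a
  pair with \<open>F'\<close>: 6 + 2 = 8. Otherwise take \<open>F\<close> with three covering edges
  and \<open>F'\<close> with one, both carrying \<open>p\<close>: 5 + 3 = 8.\<close>

lemma starving_pair_inj:
  assumes sp: "starving_pair F A a p" and sp': "starving_pair F' A' a' p"
  shows "F = F'"
proof (rule ccontr)
  assume ne: "F \<noteq> F'"
  note B = sp_basic[OF sp] and B' = sp_basic[OF sp'] and S = sp_star[OF sp] and S' = sp_star[OF sp']
  have disj: "F \<inter> F' = {}" by (rule classes_disjoint[OF B(1) B'(1) ne])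
  note dF = class_dense[OF B(1)] and dF' = class_dense[OF B'(1)]
  have d1: "covering_edge ` A \<inter> F' = {}" by (rule starving_pair_gam_other[OF sp sp' ne])
  have d2: "covering_edge ` A' \<inter> F = {}" by (rule starving_pair_gam_other[OF sp' sp]) (use ne in simp)
  have KF': "(F \<union> covering_edge ` A) \<inter> F' = {}" using disj d1 by blast
  show False
  proof (cases "covering_edge ` A \<inter> covering_edge ` A' = {}")
    case False
    then obtain b b' where b: "b \<in> A" "b' \<in> A'" "covering_edge b = covering_edge b'" by blast
    note gb' = sp_gam[OF sp' b(2)]
    have b': "b' \<subseteq> \<Union>(F \<union> covering_edge ` A)" "b' \<subseteq> \<Union>F'" "card b' = 2" using gb' b by auto
    show False using dense_union_8[OF S(1) dF' KF' b'] S(2) B'(2) by simp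
  next
    case True
    have finA: "finite A" using B(4) card.infinite by fastforce
    have "2 \<le> card (A - {a})" using B(4,5) finA by simp
    then obtain T0 where T0: "T0 \<subseteq> A - {a}" "card T0 = 2" "finite T0" by (rule obtain_subset_with_card_n)
    \<comment> \<open>\<open>a\<close> is kept among the three, since \<open>p\<close> may use
      vertices of its covering edge.\<close>
    define T where "T = insert a T0"
    have aT0: "a \<notin> T0" using T0(1) by blast
    have T: "T \<subseteq> A" "card T = 3" "a \<in> T"
      unfolding T_def using T0 B(5) card_insert_disjoint[OF T0(3) aT0] by auto
    have Tc: "T \<subseteq> covered_open F" using T(1) B(3) by simp
    have Tc': "{a'} \<subseteq> covered_open F'" using B'(3,5) by blast
    note ST = star_dense[OF B(1) Tc] and ST' = star_dense[OF B'(1) Tc']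
    have "(F \<union> covering_edge ` A) \<inter> (F' \<union> covering_edge ` A') = {}"
      using disj d1 d2 True by (simp add: Int_Un_distrib Int_Un_distrib2 Int_commute)
    moreover have "F \<union> covering_edge ` T \<subseteq> F \<union> covering_edge ` A" using image_mono[OF T(1)] by (rule Un_mono[OF order_refl])
    moreover have "F' \<union> covering_edge ` {a'} \<subseteq> F' \<union> covering_edge ` A'" using B'(5) by simp
    ultimately have dd: "(F \<union> covering_edge ` T) \<inter> (F' \<union> covering_edge ` {a'}) = {}"
      using Int_mono[of "F \<union> covering_edge ` T" "F \<union> covering_edge ` A" "F' \<union> covering_edge ` {a'}" "F' \<union> covering_edge ` A'"] by (simp only: subset_empty)
    have "insert (covering_edge a) F \<subseteq> F \<union> covering_edge ` T" using T(3) by blast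
    from Union_mono[OF this] have p1: "p \<subseteq> \<Union>(F \<union> covering_edge ` T)" using B(6) by (rule order_trans[rotated])
    have "insert (covering_edge a') F' = F' \<union> covering_edge ` {a'}" by simp
    hence p2: "p \<subseteq> \<Union>(F' \<union> covering_edge ` {a'})" using B'(6) by metis
    show False using dense_union_8[OF ST(1) ST'(1) dd p1 p2 B(7)] ST(2) ST'(2) B(2) B'(2) T(2) by simp
  qed
qed

section \<open>Discharging\<close>

text \<open>
  A poor class has only one pair to live on and takes all of it; otherwise the claimers of a pair
  share it equally.
\<close>

definition share :: "'a set set \<Rightarrow> 'a set \<Rightarrow> real" where
  "share F q = (if \<exists>F'\<in>claimers q. poor F' then of_bool (poor F) else 1 / card (claimers q))"

lemma share_nonneg: "0 \<le> share F q"
  unfolding share_def by simp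

text \<open>A pair has at most one poor claimer: by \<open>poor_neighbour\<close> every competitor
  of a poor class has all its open pairs free, and these are at least four.\<close>

lemma sum_share_le_1:
  assumes q: "q \<notin> covered_pairs H"
  shows "(\<Sum>F\<in>claimers q. share F q) \<le> 1"
proof (cases "\<exists>F\<in>claimers q. poor F")
  case True
  then obtain F where F: "F \<in> claimers q" "poor F" by blast
  have uni: "F' = F" if F': "F' \<in> claimers q" "poor F'" for F'
  proof (rule ccontr)
    assume ne: "F' \<noteq> F"
    have c: "F \<in> classes" "q \<in> open_pairs F" "F' \<in> classes" "q \<in> open_pairs F'" using F F' unfolding claimers_def by auto
    have "q \<in> free_open F" using c(2) q unfolding free_open_def by blast
    from poor_neighbour(2)[OF F(2) this c(3) ne c(4)] have "card (free_open F') = card (open_pairs F')" by simp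
    moreover have "4 * (card F' - 1) \<le> card (open_pairs F')" by (rule Q_count[OF c(3)])
    moreover have "2 \<le> card F'" "card (free_open F') = 1" using F'(2) unfolding poor_def by auto
    ultimately show False by linarith
  qed
  have "(\<Sum>F'\<in>claimers q. share F' q) = (\<Sum>F'\<in>claimers q. if F' = F then 1 else 0)"
  proof (rule sum.cong[OF refl])
    fix F' assume F': "F' \<in> claimers q"
    have "poor F' \<longleftrightarrow> F' = F" using uni[OF F'] F(2) by metis
    thus "share F' q = (if F' = F then 1 else 0)" unfolding share_def if_P[OF True] by simp
  qed
  also have "\<dots> \<le> 1" using finite_claimers by simp
  finally show ?thesis .
next
  case False
  thus ?thesis by (simp add: share_def)
qed

lemma share_exclusive:
  assumes "claimers q = {F}"
  shows "share F q = 1"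
  using assms by (simp add: share_def)

lemma sum_share_ge_one:
  assumes F: "F \<in> classes" "q \<in> free_open F" "1 \<le> share F q"
  shows "1 \<le> (\<Sum>q\<in>free_open F. share F q)"
proof -
  have fin: "finite (free_open F)" using finite_Q[OF F(1)] unfolding free_open_def by simp
  have "share F q \<le> (\<Sum>q\<in>free_open F. share F q)"
    by (rule member_le_sum) (use fin F(2) share_nonneg in auto)
  thus ?thesis using F(3) by simp
qed

text \<open>A class that contests the pair of a poor one has two edges and another free pair to
  itself. Otherwise every free pair gives at least 1/3, so 3 (m - 1) of them suffice; the two
  exceptions have pairs claimed by no other class.\<close>

lemma sum_share_ge:
  assumes F: "F \<in> classes" "2 \<le> card F" "\<not> starving F"
  shows "real (card F - 1) \<le> (\<Sum>q\<in>free_open F. share F q)"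
proof -
  have fin: "finite (free_open F)" using finite_Q[OF F(1)] unfolding free_open_def by simp
  have f0: "card (free_open F) \<noteq> 0" using F unfolding starving_def by auto
  have cl: "F \<in> claimers q" if "q \<in> free_open F" for q using that F(1) unfolding claimers_def free_open_def by blast
  consider (poor) "poor F" | (neighbour) "\<not> poor F" "\<exists>q\<in>free_open F. \<exists>F0\<in>claimers q. poor F0"
    | (rich) "\<not> poor F" "\<forall>q\<in>free_open F. \<not> (\<exists>F0\<in>claimers q. poor F0)" by blast
  thus ?thesis
  proof cases
    case poor
    obtain q where q: "q \<in> free_open F" using f0 by fastforce
    have "share F q = 1" using poor cl[OF q] unfolding share_def by auto
    hence "1 \<le> (\<Sum>q\<in>free_open F. share F q)" by (intro sum_share_ge_one[OF F(1) q]) simp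
    moreover have "card F = 2" using few_free(1)[OF F(1,2)] poor unfolding poor_def by simp
    ultimately show ?thesis by simp
  next
    case neighbour
    then obtain q0 F0 where q0: "q0 \<in> free_open F" "F0 \<in> claimers q0" "poor F0" by blast
    have ne: "F \<noteq> F0" using neighbour q0(3) by blast
    have qQ: "q0 \<in> open_pairs F" "q0 \<notin> covered_pairs H" using q0(1) unfolding free_open_def by auto
    have "q0 \<in> free_open F0" using q0(2) qQ(2) unfolding claimers_def free_open_def by blast
    note pn = poor_neighbour[OF q0(3) this F(1) ne qQ(1)]
    have "4 \<le> card (open_pairs F)" using Q_count[OF F(1)] pn(1) by simp
    hence "open_pairs F \<noteq> {q0}" by auto
    then obtain q where q: "q \<in> open_pairs F" "q \<noteq> q0" using qQ(1) by blast
    have "1 \<le> (\<Sum>q\<in>free_open F. share F q)"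
      by (rule sum_share_ge_one[OF F(1), of q]) (use q pn(2) share_exclusive[OF pn(3)[OF q]] in auto)
    thus ?thesis using pn(1) by simp
  next
    case rich
    have sh: "share F q = 1 / card (claimers q)" if "q \<in> free_open F" for q using rich(2) that unfolding share_def by simp
    have third: "1 / 3 \<le> share F q" if q: "q \<in> free_open F" for q
    proof -
      have "0 < card (claimers q)" using cl[OF q] finite_claimers card_gt_0_iff by blast
      thus ?thesis using card_claimers[of q] unfolding sh[OF q] by (intro divide_left_mono) auto
    qed
    have "(\<Sum>q\<in>free_open F. 1 / 3) \<le> (\<Sum>q\<in>free_open F. share F q)" using third by (rule sum_mono)
    hence sum3: "real (card (free_open F)) / 3 \<le> (\<Sum>q\<in>free_open F. share F q)" by simp
    have f2: "2 \<le> card (free_open F)" using f0 rich(1) F unfolding poor_def by linarith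
    have c7: "card F + card (covered_open F) \<le> 7" by (rule star_dense(4)[OF F(1) order_refl])
    have c4: "4 * (card F - 1) \<le> card (free_open F) + card (covered_open F)"
      using Q_count[OF F(1)] free_covered_card[OF F(1)] by simp
    \<comment> \<open>With f free and c covered open pairs, m + c \<le> 7 and 4 (m - 1) \<le> f + c;
      for m \<ge> 4 these give the first alternative.\<close>
    consider "3 * (card F - 1) \<le> card (free_open F)"
      | (three) "card F = 3" "3 \<le> card (covered_open F)" "4 \<le> card (free_open F)"
      | (two) "card F = 2" "2 \<le> card (covered_open F)"
      using c7 c4 f2 F(2) by linarith
    thus ?thesis
    proof cases
      case 1
      hence "real (3 * (card F - 1)) \<le> real (card (free_open F))" by (rule of_nat_mono)
      hence "real (card F - 1) \<le> real (card (free_open F)) / 3" by simp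
      thus ?thesis using sum3 by linarith
    next
      case three
      have "(\<Sum>q\<in>free_open F. share F q) = (\<Sum>q\<in>free_open F. 1)"
        by (rule sum.cong[OF refl]) (rule share_exclusive[OF claimers_class3[OF F(1) three(1,2)]])
      thus ?thesis using three by simp
    next
      case two
      obtain q where q: "q \<in> free_open F" "claimers q = {F}" using exclusive_free_pair[OF F(1) two f2] by blast
      have "1 \<le> (\<Sum>q\<in>free_open F. share F q)"
        by (rule sum_share_ge_one[OF F(1) q(1)]) (use share_exclusive[OF q(2)] in simp)
      thus ?thesis using two by simp
    qed
  qed
qed

text \<open>Starving classes take the pairs \<open>I\<close>, injectively by
  \<open>starving_pair_inj\<close>. By \<open>sp_not_Q\<close> no class has these as open pairs, so
  the other classes discharge into the remaining uncovered pairs, and exchanging the sums leaves at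
  most 1 per pair.\<close>

lemma sum_class_deficit:
  "(\<Sum>F\<in>classes. card F - 1) \<le> card ({p. p \<subseteq> \<Union>H \<and> card p = 2} - covered_pairs H)"
proof -
  define U where "U = {p. p \<subseteq> \<Union>H \<and> card p = 2} - covered_pairs H"
  have finU: "finite U"
    unfolding U_def by (rule finite_subset[of _ "Pow (\<Union>H)"]) (use uH in auto)
  define S where "S = {F. starving F}"
  have Sc: "S \<subseteq> classes" unfolding S_def starving_def by blast
  have "\<forall>F\<in>S. \<exists>p A a. starving_pair F A a p" using starving_pair_exists unfolding S_def by blast
  from bchoice[OF this] obtain \<phi> where \<phi>: "\<forall>F\<in>S. \<exists>A a. starving_pair F A a (\<phi> F)" by blast
  have inj: "inj_on \<phi> S"
  proof (rule inj_onI)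
    fix F F' assume FF: "F \<in> S" "F' \<in> S" "\<phi> F = \<phi> F'"
    obtain A a where 1: "starving_pair F A a (\<phi> F)" using \<phi> FF(1) by blast
    obtain A' a' where 2: "starving_pair F' A' a' (\<phi> F)" using \<phi> FF(2,3) by auto
    show "F = F'" by (rule starving_pair_inj[OF 1 2])
  qed
  define I where "I = \<phi> ` S"
  have cS: "card F = 2" if F: "F \<in> S" for F
  proof -
    obtain A a where 1: "starving_pair F A a (\<phi> F)" using \<phi> F by blast
    show ?thesis by (rule sp_basic(2)[OF 1])
  qed
  have I: "p \<in> U \<and> (\<forall>F\<in>classes. p \<notin> open_pairs F)" if p: "p \<in> I" for p
  proof -
    obtain F where F: "F \<in> S" "p = \<phi> F" using p unfolding I_def by blast
    obtain A a where 1: "starving_pair F A a p" using \<phi> F by auto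
    note b = sp_basic[OF 1] and s = sp_star[OF 1]
    have "F \<union> covering_edge ` A \<subseteq> H" using s(4) classesD(1)[OF b(1)] by simp
    hence "p \<subseteq> \<Union>H" using b(10) by (meson Union_mono subset_trans)
    thus ?thesis unfolding U_def using b(7,8) sp_not_Q[OF 1] by simp
  qed
  have IU: "I \<subseteq> U" using I by blast
  have free_eq: "free_open F = {q \<in> U - I. q \<in> open_pairs F}" if F: "F \<in> classes" for F
  proof -
    have "\<Union>F \<subseteq> \<Union>H" by (rule Union_mono[OF classesD(1)[OF F]])
    hence "q \<in> U" if "q \<in> open_pairs F" "q \<notin> covered_pairs H" for q
      using Q_sub[OF that(1)] Q_card2[OF that(1)] that(2) unfolding U_def by simp
    moreover have "q \<notin> I" if "q \<in> open_pairs F" for q using I that F by blast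
    ultimately show ?thesis unfolding free_open_def using U_def by blast
  qed
  have "(\<Sum>F\<in>classes - S. real (card F - 1)) \<le> (\<Sum>F\<in>classes - S. \<Sum>q\<in>free_open F. share F q)"
  proof (rule sum_mono)
    fix F assume F: "F \<in> classes - S"
    show "real (card F - 1) \<le> (\<Sum>q\<in>free_open F. share F q)"
    proof (cases "2 \<le> card F")
      case True
      show ?thesis by (rule sum_share_ge[OF _ True]) (use F in \<open>auto simp: S_def\<close>)
    next
      case False
      hence "real (card F - 1) = 0" by simp
      also have "0 \<le> (\<Sum>q\<in>free_open F. share F q)" by (intro sum_nonneg share_nonneg)
      finally show ?thesis .
    qed
  qed
  also have "\<dots> \<le> (\<Sum>F\<in>classes. \<Sum>q\<in>free_open F. share F q)"
    by (rule sum_mono2) (use finite_classes share_nonneg in \<open>auto intro: sum_nonneg\<close>)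
  also have "\<dots> = (\<Sum>F\<in>classes. \<Sum>q | q \<in> U - I \<and> q \<in> open_pairs F. share F q)"
    by (rule sum.cong[OF refl]) (simp add: free_eq)
  also have "\<dots> = (\<Sum>q\<in>U - I. \<Sum>F | F \<in> classes \<and> q \<in> open_pairs F. share F q)"
    by (rule sum.swap_restrict) (use finite_classes finU in auto)
  also have "\<dots> \<le> (\<Sum>q\<in>U - I. 1)"
    by (rule sum_mono, fold claimers_def, rule sum_share_le_1) (simp add: U_def)
  also have "\<dots> = real (card (U - I))" by simp
  finally have "(\<Sum>F\<in>classes - S. card F - 1) \<le> card (U - I)" by (simp flip: of_nat_sum)
  moreover have "(\<Sum>F\<in>S. card F - 1) = card I"
    using cS card_image[OF inj] unfolding I_def by simp
  moreover have "(\<Sum>F\<in>classes. card F - 1) = (\<Sum>F\<in>classes - S. card F - 1) + (\<Sum>F\<in>S. card F - 1)"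
    by (rule sum.subset_diff[OF Sc finite_classes])
  moreover have "card (U - I) = card U - card I" "card I \<le> card U"
    using card_Diff_subset[OF finite_subset[OF IU finU] IU] card_mono[OF finU IU] by auto
  ultimately show ?thesis unfolding U_def by linarith
qed

lemma cov_classes_disjoint:
  assumes "F \<in> classes" "F' \<in> classes" "F \<noteq> F'"
  shows "covered_pairs F \<inter> covered_pairs F' = {}"
proof (rule ccontr)
  assume "covered_pairs F \<inter> covered_pairs F' \<noteq> {}"
  then obtain p e e' where p: "card p = 2" "e \<in> F" "p \<subseteq> e" "e' \<in> F'" "p \<subseteq> e'" unfolding covered_pairs_def by blast
  have e: "e' \<in> H" "e \<in> H" using p classesD(1) assms by blast+
  have "e' \<in> F" by (rule adj_same_class[OF assms(1) p(2) e(1) two_common[OF p(3,5,1) edge(1)[OF e(2)]]])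
  thus False using classes_disjoint[OF assms] p(4) by blast
qed

lemma card_edges_le: "card H * (r choose 2) \<le> card (\<Union>H) choose 2"
proof -
  have "card (\<Union>classes) = (\<Sum>F\<in>classes. card F)"
    by (rule card_Union_disjoint) (use classes_disjoint classesD(2) in \<open>auto simp: pairwise_def disjnt_def\<close>)
  hence cH: "card H = (\<Sum>F\<in>classes. card F)" by (simp only: Union_classes)
  have covH: "covered_pairs H = (\<Union>F\<in>classes. covered_pairs F)"
  proof -
    have "covered_pairs (\<Union>classes) = (\<Union>F\<in>classes. covered_pairs F)" unfolding covered_pairs_def by blast
    thus ?thesis by (simp only: Union_classes)
  qed
  have ccov: "card (covered_pairs H) = (\<Sum>F\<in>classes. card (covered_pairs F))"
    unfolding covH
    by (rule card_UN_disjoint) (use finite_classes finite_cov classesD(1) cov_classes_disjoint in auto)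
  have "card H * (r choose 2) = (\<Sum>F\<in>classes. card F * (r choose 2))" unfolding cH by (rule sum_distrib_right)
  also have "\<dots> \<le> (\<Sum>F\<in>classes. card (covered_pairs F) + (card F - 1))" by (rule sum_mono) (rule class_counts(1))
  also have "\<dots> = card (covered_pairs H) + (\<Sum>F\<in>classes. card F - 1)" unfolding ccov by (rule sum.distrib)
  also have "\<dots> \<le> card (covered_pairs H) + card ({p. p \<subseteq> \<Union>H \<and> card p = 2} - covered_pairs H)" using sum_class_deficit by simp
  also have "\<dots> = card {p. p \<subseteq> \<Union>H \<and> card p = 2}"
  proof -
    have fin: "finite {p. p \<subseteq> \<Union>H \<and> card p = 2}" by (rule finite_subset[of _ "Pow (\<Union>H)"]) (use uH in auto)
    have sub: "covered_pairs H \<subseteq> {p. p \<subseteq> \<Union>H \<and> card p = 2}" unfolding covered_pairs_def by blast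
    show ?thesis using card_Diff_subset[OF finite_subset[OF sub fin] sub] card_mono[OF fin sub] by simp
  qed
  also have "\<dots> = card (\<Union>H) choose 2" using n_subsets[of "\<Union>H" 2] uH by simp
  finally show ?thesis .
qed

end

section \<open>The limit\<close>

lemma exc_8_le_2_iff:
  assumes "card F = 8" "r \<ge> 2"
  shows "exc r F \<le> 2 \<longleftrightarrow> card (\<Union>F) \<le> 8 * r - 14"
proof -
  have "int (8 * r - 14) = 8 * int r - 14" "int (r - 2) = int r - 2" using assms(2) by auto
  thus ?thesis unfolding exc_def assms(1) by auto
qed

lemma uniform_hypergraph_unif: "uniform_hypergraph r V E \<Longrightarrow> r \<ge> 1 \<Longrightarrow> unif r E"
  unfolding uniform_hypergraph_def unif_def
  by (auto intro: finite_subset[of E "Pow V"] finite_subset[of _ V])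

text \<open>Cleaning costs 168 edges per vertex, which vanishes after division by n^2; the sharp
  count is \<open>card_edges_le\<close> for what remains.\<close>

lemma sparse_free_card_le:
  assumes V: "uniform_hypergraph r V E" "sparse_free (8 * r - 14) 8 E" and r: "r \<ge> 4"
  shows "card E * (r choose 2) \<le> (card V choose 2) + 168 * card V * (r choose 2)"
proof -
  have fV: "finite V" and EV: "\<Union>E \<subseteq> V" using V(1) unfolding uniform_hypergraph_def by auto
  have u: "unif r E" by (rule uniform_hypergraph_unif[OF V(1)]) (use r in simp)
  have ex3: "exc r J \<ge> 3" if J: "J \<subseteq> E" "card J = 8" for J
  proof -
    have "finite J" using J(2) card.infinite by fastforce
    hence "\<not> card (\<Union>J) \<le> 8 * r - 14" using V(2) J unfolding sparse_free_def by blast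
    thus ?thesis using exc_8_le_2_iff[OF J(2), of r] r by linarith
  qed
  have r1: "r \<ge> 1" using r by simp
  obtain H where H: "H \<subseteq> E" "card E \<le> card H + 168 * card V" "\<And>J. J \<subseteq> H \<Longrightarrow> \<not> defective r J"
    by (rule clean_subhypergraph[OF fV refl u EV r1 ex3]) (assumption | rule that)+
  interpret clean_hyp r H
    by unfold_locales (use r unif_subset[OF u H(1)] ex3 H in auto)
  have "card (\<Union>H) \<le> card V" by (rule card_mono[OF fV]) (use EV H(1) in blast)
  hence "card H * (r choose 2) \<le> card V choose 2"
    using card_edges_le binomial_right_mono order_trans by metis
  moreover have "card E * (r choose 2) \<le> (card H + 168 * card V) * (r choose 2)" using H(2) by (rule mult_le_mono1)
  ultimately show ?thesis by (simp add: algebra_simps)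
qed

lemma cf_sparse_free: "conflict_free r S \<Longrightarrow> r \<ge> 2 \<Longrightarrow> sparse_free (8 * r - 14) 8 S"
  unfolding sparse_free_def conflict_free_def bad_def by (auto simp: exc_8_le_2_iff)

lemma finite_turan_set:
  "finite {card E | (V :: nat set) E. uniform_hypergraph r V E \<and> card V = n \<and> sparse_free s k E}"
proof (rule finite_subset[of _ "{..n choose r}"])
  show "{card E | (V :: nat set) E. uniform_hypergraph r V E \<and> card V = n \<and> sparse_free s k E} \<subseteq> {..n choose r}"
  proof
    fix m assume "m \<in> {card E | (V :: nat set) E. uniform_hypergraph r V E \<and> card V = n \<and> sparse_free s k E}"
    then obtain V :: "nat set" and E where E: "m = card E" "uniform_hypergraph r V E" "card V = n" by blast
    from E(2) have V: "finite V" "E \<subseteq> {e. e \<subseteq> V \<and> card e = r}" unfolding uniform_hypergraph_def by auto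
    have "card E \<le> card {e. e \<subseteq> V \<and> card e = r}"
      by (rule card_mono[OF _ V(2)]) (rule finite_subset[of _ "Pow V"], use V(1) in auto)
    thus "m \<in> {..n choose r}" using n_subsets[OF V(1)] E by simp
  qed
qed simp

lemma card_le_turan_f:
  assumes "S \<subseteq> edges r n" "sparse_free s k S"
  shows "card S \<le> turan_f r n s k"
  unfolding turan_f_def
proof (rule Max_ge[OF finite_turan_set])
  have "uniform_hypergraph r {..<n} S" using assms(1) unfolding uniform_hypergraph_def edges_def by auto
  thus "card S \<in> {card E | (V :: nat set) E. uniform_hypergraph r V E \<and> card V = n \<and> sparse_free s k E}"
    using assms(2) by (intro CollectI exI[of _ "{..<n}"] exI[of _ S]) simp
qed

lemma turan_f_attained:
  assumes "k \<ge> 1"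
  obtains V :: "nat set" and E where "uniform_hypergraph r V E" "card V = n" "sparse_free s k E" "card E = turan_f r n s k"
proof -
  have "uniform_hypergraph r {..<n} {}" "sparse_free s k ({} :: nat set set)"
    unfolding uniform_hypergraph_def sparse_free_def using assms by auto
  hence "card {} \<in> {card E | (V :: nat set) E. uniform_hypergraph r V E \<and> card V = n \<and> sparse_free s k E}"
    by (intro CollectI exI[of _ "{..<n}"] exI[of _ "{}"]) simp
  hence "turan_f r n s k \<in> {card E | (V :: nat set) E. uniform_hypergraph r V E \<and> card V = n \<and> sparse_free s k E}"
    unfolding turan_f_def by (intro Max_in[OF finite_turan_set]) blast
  thus ?thesis using that by auto
qed

lemma real_choose_2: "real (n choose 2) = real n * (real n - 1) / 2"
  by (induction n) (auto simp: numeral_2_eq_2 field_simps)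

lemma squeeze_limit:
  fixes t b :: "nat \<Rightarrow> real"
  assumes b: "b \<longlonglongrightarrow> L" "L > 0" and upper: "\<And>n. t n \<le> b n + C / n"
    and lower: "\<And>\<delta>. 0 < \<delta> \<Longrightarrow> \<delta> < 1 \<Longrightarrow> eventually (\<lambda>n. (1 - \<delta>) * b n \<le> t n) sequentially"
  shows "t \<longlonglongrightarrow> L"
proof (rule order_tendstoI)
  fix a assume a: "a < L"
  \<comment> \<open>\<open>a\<close> may be negative, so the minimum with 1/2 secures \<delta> < 1;
    the other term makes \<delta> * L smaller than L - a.\<close>
  define \<delta> where "\<delta> = min (1 / 2) ((L - a) / (2 * L))"
  have \<delta>: "0 < \<delta>" "\<delta> < 1" using a b(2) unfolding \<delta>_def by auto
  have "\<delta> * L \<le> (L - a) / (2 * L) * L" using b(2) unfolding \<delta>_def by (intro mult_right_mono) auto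
  also have "\<dots> < L - a" using a b(2) by simp
  finally have "a < (1 - \<delta>) * L" by (simp add: algebra_simps)
  moreover have "(\<lambda>n. (1 - \<delta>) * b n) \<longlonglongrightarrow> (1 - \<delta>) * L" using b(1) by (rule tendsto_mult_left)
  ultimately have "eventually (\<lambda>n. a < (1 - \<delta>) * b n) sequentially" using order_tendstoD(1) by blast
  thus "eventually (\<lambda>n. a < t n) sequentially" using lower[OF \<delta>] by eventually_elim simp
next
  fix a assume a: "L < a"
  have "(\<lambda>n. b n + C / n) \<longlonglongrightarrow> L + 0" by (intro tendsto_add b(1) lim_const_over_n)
  hence "eventually (\<lambda>n. b n + C / n < a) sequentially" using order_tendstoD(2) a by force
  thus "eventually (\<lambda>n. t n < a) sequentially" by eventually_elim (use upper le_less_trans in blast)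
qed

theorem theorem1p1:
  fixes r :: nat
  assumes "r \<ge> 4"
  shows "(\<lambda>n. real (turan_f r n (8 * r - 14) 8) / (real n)\<^sup>2)
           \<longlonglongrightarrow> 1 / ((real r)\<^sup>2 - real r)"
proof -
  define b where "b n = real (n choose 2) / real (r choose 2) / (real n)\<^sup>2" for n
  have rc: "real (r choose 2) = ((real r)\<^sup>2 - real r) / 2" unfolding real_choose_2 by (simp add: power2_eq_square right_diff_distrib)
  have rpos: "(real r)\<^sup>2 - real r > 0" using assms by (simp add: power2_eq_square)
  have rho: "real (r choose 2) > 0" using assms by simp
  show ?thesis
  proof (rule squeeze_limit[where b = b and C = 168])
    have "(\<lambda>n. 1 - 1 / real n) \<longlonglongrightarrow> 1 - 0" by (intro tendsto_diff tendsto_const lim_const_over_n)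
    hence "(\<lambda>n. (1 - 1 / real n) * (1 / ((real r)\<^sup>2 - real r))) \<longlonglongrightarrow> (1 - 0) * (1 / ((real r)\<^sup>2 - real r))"
      by (rule tendsto_mult_right)
    moreover have "eventually (\<lambda>n. (1 - 1 / real n) * (1 / ((real r)\<^sup>2 - real r)) = b n) sequentially"
      using eventually_gt_at_top[of 0]
    proof eventually_elim
      case (elim n)
      have "b n = real n * (real n - 1) / (real n * real n) * (1 / ((real r)\<^sup>2 - real r))"
        unfolding b_def rc real_choose_2[of n] by (simp add: power2_eq_square)
      also have "real n * (real n - 1) / (real n * real n) = 1 - 1 / real n" using elim by (simp add: field_simps)
      finally show ?case by simp
    qed
    ultimately show "b \<longlonglongrightarrow> 1 / ((real r)\<^sup>2 - real r)" using tendsto_cong by fastforce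
    show "1 / ((real r)\<^sup>2 - real r) > 0" using rpos by simp
  next
    fix n
    obtain V :: "nat set" and E where V: "uniform_hypergraph r V E" "card V = n" "sparse_free (8 * r - 14) 8 E"
      "card E = turan_f r n (8 * r - 14) 8" by (rule turan_f_attained[of 8 r n "8 * r - 14"]) auto
    have "real (card E * (r choose 2)) \<le> real ((n choose 2) + 168 * n * (r choose 2))"
      using sparse_free_card_le[OF V(1,3) assms] V(2) by (intro of_nat_mono) simp
    hence "real (card E) \<le> real (n choose 2) / real (r choose 2) + 168 * real n"
      using rho by (simp add: field_simps)
    hence "real (card E) / (real n)\<^sup>2 \<le> (real (n choose 2) / real (r choose 2) + 168 * real n) / (real n)\<^sup>2"
      by (rule divide_right_mono) simp
    \<comment> \<open>This includes n = 0, where all the quotients are 0.\<close>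
    thus "real (turan_f r n (8 * r - 14) 8) / (real n)\<^sup>2 \<le> b n + 168 / real n"
      unfolding V(4) b_def by (simp add: add_divide_distrib power2_eq_square split: if_splits)
  next
    fix \<delta> :: real assume \<delta>: "0 < \<delta>" "\<delta> < 1"
    have "r \<ge> 3" using assms by simp
    from conflict_free_exists[OF this \<delta>] obtain n0 where
      n0: "\<And>n. n \<ge> n0 \<Longrightarrow> \<exists>S\<subseteq>edges r n. conflict_free r S \<and> real (card S) \<ge> (1-\<delta>) * (real (n choose 2) / real (r choose 2))"
      by blast
    show "eventually (\<lambda>n. (1 - \<delta>) * b n \<le> real (turan_f r n (8 * r - 14) 8) / (real n)\<^sup>2) sequentially"
      using eventually_ge_at_top[of n0]
    proof eventually_elim
      case (elim n)
      from n0[OF this] obtain S where S: "S \<subseteq> edges r n" "conflict_free r S"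
        "real (card S) \<ge> (1-\<delta>) * (real (n choose 2) / real (r choose 2))" by blast
      have "sparse_free (8 * r - 14) 8 S" by (rule cf_sparse_free[OF S(2)]) (use assms in simp)
      from card_le_turan_f[OF S(1) this] have
        "(1-\<delta>) * (real (n choose 2) / real (r choose 2)) \<le> real (turan_f r n (8 * r - 14) 8)" using S(3) by simp
      from divide_right_mono[OF this, of "(real n)\<^sup>2"] show ?case unfolding b_def by simp
    qed
  qed
qed

end
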